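(* Assume that $A_\epsilon\equiv I$ for all $\epsilon>0$ and either $n_{min}>1$ or $n_{max}<1$. For a sequence of $\epsilon\to0$, let $k_\epsilon\in\mathbb{R}_+=(0,\infty)$ be a transmission eigenvalue with corresponding eigenfunctions $(w_\epsilon,v_\epsilon)\in L^2(D)\times L^2(D)$, i.e. $$\Delta w_\epsilon+k_\epsilon^2n(x/\epsilon)w_\epsilon=0,\qquad \Delta v_\epsilon+k_\epsilon^2v_\epsilon=0\ \text{ in } D,\qquad u_\epsilon:=w_\epsilon-v_\epsilon\in H^2_0(D),$$ normalized by $\|u_\epsilon\|_{H^1(D)}=1$. If $k_\epsilon$ is bounded with respect to $\epsilon$, then there is a subsequence of $\{(w_\epsilon,v_\epsilon),k_\epsilon\}\in(L^2(D)\times L^2(D))\times\mathbb{R}_+$ such that $(w_\epsilon,v_\epsilon)\rightharpoonup(w,v)$ weakly in $L^2(D)\times L^2(D)$ and $k_\epsilon\to k$ as $\epsilon\to0$, where $\{(w,v),k\}\in(L^2(D)\times L^2(D))\times\mathbb{R}_+$ is an eigenpair (in particular $(w,v)\neq(0,0)$) corresponding to $$\Delta v+k^2v=0\ \text{ and }\ \Delta w+k^2n_hw=0\ \text{ in } D,\qquad w-v\in H^2_0(D).$$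
   Context: $D\subset\mathbb{R}^d$ ($d=2$ or $3$) is a bounded simply connected open set with piecewise smooth boundary $\partial D$; $Y=(0,1)^d$. $n\in L^\infty$ is a positive real $Y$-periodic function on $\mathbb{R}^d$, $n_\epsilon(x):=n(x/\epsilon)$ for $\epsilon>0$, $n_{min}=\inf_Yn>0$, $n_{max}=\sup_Yn<\infty$, and $n_h=\frac1{|Y|}\int_Yn(y)\,dy$. The matrix coefficient of the medium is $A_\epsilon\equiv I$. All equations are understood in the sense of distributions. A value $k_\epsilon$ is a transmission eigenvalue if there is a nontrivial pair $(w_\epsilon,v_\epsilon)\in L^2(D)\times L^2(D)$ (the eigenfunctions) with $w_\epsilon-v_\epsilon\in H^2_0(D)$ satisfying the displayed equations; an eigenpair of the limit problem is likewise a nontrivial pair $(w,v)$ together with $k$. *)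

theory Defs
  imports "HOL-Analysis.Analysis" "HOL-Probability.Essential_Supremum"
begin

section \<open>Test functions\<close>

definition partial_deriv :: "'n \<Rightarrow> (real^'n \<Rightarrow> complex) \<Rightarrow> real^'n \<Rightarrow> complex" where
  "partial_deriv i f x = frechet_derivative f (at x) (axis i 1)"

fun iter_partial :: "'n list \<Rightarrow> (real^'n \<Rightarrow> complex) \<Rightarrow> real^'n \<Rightarrow> complex" where
  "iter_partial [] f = f"
| "iter_partial (i # is) f = partial_deriv i (iter_partial is f)"

definition smooth :: "(real^'n \<Rightarrow> complex) \<Rightarrow> bool" where
  "smooth f \<longleftrightarrow> (\<forall>is x. iter_partial is f differentiable (at x))"

definition test_functions :: "(real^'n) set \<Rightarrow> (real^'n \<Rightarrow> complex) set" where
  "test_functions D =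
     {\<phi>. smooth \<phi> \<and> compact (closure {x. \<phi> x \<noteq> 0}) \<and> closure {x. \<phi> x \<noteq> 0} \<subseteq> D}"

definition laplacian :: "(real^'n \<Rightarrow> complex) \<Rightarrow> real^'n \<Rightarrow> complex" where
  "laplacian f x = (\<Sum>i\<in>UNIV. iter_partial [i, i] f x)"


section \<open>The spaces $L^2$, $H^m$ and $H^m_0$\<close>

text \<open>Elements of these spaces are represented by functions; two functions represent the same
  element iff they agree almost everywhere on the domain.\<close>

definition L2 :: "(real^'n) set \<Rightarrow> (real^'n \<Rightarrow> complex) set" where
  "L2 D = {f. f \<in> borel_measurable (lebesgue_on D) \<and>
              integrable (lebesgue_on D) (\<lambda>x. (norm (f x))\<^sup>2)}"

definition L2_inner :: "(real^'n) set \<Rightarrow> (real^'n \<Rightarrow> complex) \<Rightarrow> (real^'n \<Rightarrow> complex) \<Rightarrow> complex" where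
  "L2_inner D f g = (LINT x|lebesgue_on D. f x * cnj (g x))"

definition L2_norm :: "(real^'n) set \<Rightarrow> (real^'n \<Rightarrow> complex) \<Rightarrow> real" where
  "L2_norm D f = sqrt (LINT x|lebesgue_on D. (norm (f x))\<^sup>2)"

definition weakly_converges ::
    "(real^'n) set \<Rightarrow> (nat \<Rightarrow> (real^'n \<Rightarrow> complex) \<times> (real^'n \<Rightarrow> complex))
      \<Rightarrow> (real^'n \<Rightarrow> complex) \<times> (real^'n \<Rightarrow> complex) \<Rightarrow> bool" where
  "weakly_converges D p q \<longleftrightarrow>
     (\<forall>f\<in>L2 D. \<forall>g\<in>L2 D.
        (\<lambda>j. L2_inner D (fst (p j)) f + L2_inner D (snd (p j)) g)
          \<longlonglongrightarrow> L2_inner D (fst q) f + L2_inner D (snd q) g)"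

definition has_weak_deriv ::
    "(real^'n) set \<Rightarrow> 'n list \<Rightarrow> (real^'n \<Rightarrow> complex) \<Rightarrow> (real^'n \<Rightarrow> complex) \<Rightarrow> bool" where
  "has_weak_deriv D is u g \<longleftrightarrow>
     (\<forall>\<phi>\<in>test_functions D.
        (LINT x|lebesgue_on D. u x * iter_partial is \<phi> x)
          = (-1) ^ length is * (LINT x|lebesgue_on D. g x * \<phi> x))"

text \<open>The chosen representative is determined almost everywhere on $D$ whenever a weak
  derivative in $L^2(D)$ exists.\<close>

definition weak_deriv ::
    "(real^'n) set \<Rightarrow> 'n list \<Rightarrow> (real^'n \<Rightarrow> complex) \<Rightarrow> real^'n \<Rightarrow> complex" where
  "weak_deriv D is u = (SOME g. g \<in> L2 D \<and> has_weak_deriv D is u g)"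

definition sobolev :: "nat \<Rightarrow> (real^'n) set \<Rightarrow> (real^'n \<Rightarrow> complex) set" where
  "sobolev m D =
     {u \<in> L2 D. \<forall>is. length is \<le> m \<longrightarrow> (\<exists>g\<in>L2 D. has_weak_deriv D is u g)}"

text \<open>Derivatives are indexed by lists of coordinate directions instead of multi-indices. For
  $m = 1$ this is exactly $(\|u\|^2 + \|\nabla u\|^2)^{1/2}$; for $m = 2$ mixed derivatives
  are counted once per order of differentiation, i.e. the Frobenius norm of the Hessian is used.\<close>

definition sobolev_norm :: "nat \<Rightarrow> (real^'n) set \<Rightarrow> (real^'n \<Rightarrow> complex) \<Rightarrow> real" where
  "sobolev_norm m D u = sqrt (\<Sum>is | length is \<le> m. (L2_norm D (weak_deriv D is u))\<^sup>2)"

definition sobolev0 :: "nat \<Rightarrow> (real^'n) set \<Rightarrow> (real^'n \<Rightarrow> complex) set" where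
  "sobolev0 m D =
     {u \<in> sobolev m D. \<exists>\<phi>. (\<forall>j. \<phi> j \<in> test_functions D) \<and>
        (\<lambda>j::nat. sobolev_norm m D (\<lambda>x. u x - \<phi> j x)) \<longlonglongrightarrow> 0}"


section \<open>Transmission eigenpairs\<close>

text \<open>$\Delta w + q w = 0$ in $D$ in the sense of distributions.\<close>

definition helmholtz :: "(real^'n) set \<Rightarrow> (real^'n \<Rightarrow> real) \<Rightarrow> (real^'n \<Rightarrow> complex) \<Rightarrow> bool" where
  "helmholtz D q w \<longleftrightarrow>
     (\<forall>\<phi>\<in>test_functions D.
        (LINT x|lebesgue_on D. w x * laplacian \<phi> x)
          + (LINT x|lebesgue_on D. of_real (q x) * w x * \<phi> x) = 0)"

definition transmission_eigenpair ::
    "(real^'n) set \<Rightarrow> (real^'n \<Rightarrow> real) \<Rightarrow> real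
      \<Rightarrow> (real^'n \<Rightarrow> complex) \<times> (real^'n \<Rightarrow> complex) \<Rightarrow> bool" where
  "transmission_eigenpair D \<nu> k = (\<lambda>(w, v).
     0 < k \<and> w \<in> L2 D \<and> v \<in> L2 D \<and>
     \<not> ((AE x in lebesgue_on D. w x = 0) \<and> (AE x in lebesgue_on D. v x = 0)) \<and>
     helmholtz D (\<lambda>x. k\<^sup>2 * \<nu> x) w \<and>
     helmholtz D (\<lambda>x. k\<^sup>2) v \<and>
     (\<lambda>x. w x - v x) \<in> sobolev0 2 D)"


section \<open>The periodic coefficient\<close>

definition unit_cell :: "(real^'n) set" where
  "unit_cell = {y. \<forall>i. 0 < y $ i \<and> y $ i < 1}"

definition cell_periodic :: "(real^'n \<Rightarrow> real) \<Rightarrow> bool" where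
  "cell_periodic n \<longleftrightarrow> (\<forall>x i. n (x + axis i 1) = n x)"

text \<open>Infimum and supremum of an $L^\infty$ function are the essential ones.\<close>

definition cell_sup :: "(real^'n \<Rightarrow> real) \<Rightarrow> ereal" where
  "cell_sup n = esssup (lebesgue_on unit_cell) (\<lambda>y. ereal (n y))"

definition cell_inf :: "(real^'n \<Rightarrow> real) \<Rightarrow> ereal" where
  "cell_inf n = - esssup (lebesgue_on unit_cell) (\<lambda>y. - ereal (n y))"

definition cell_mean :: "(real^'n \<Rightarrow> real) \<Rightarrow> real" where
  "cell_mean n = (1 / measure lebesgue (unit_cell :: (real^'n) set))
                   * (LINT y|lebesgue_on unit_cell. n y)"


section \<open>Piecewise smooth boundaries\<close>

text \<open>The closed face $x_i = 0$ of the unit cube serves as a $(d-1)$-dimensional parameter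
  domain inside $\mathbb{R}^d$.\<close>

definition face :: "'n \<Rightarrow> (real^'n) set" where
  "face i = {x. x $ i = 0 \<and> (\<forall>j. 0 \<le> x $ j \<and> x $ j \<le> 1)}"

definition rel_open_face :: "'n \<Rightarrow> (real^'n) set" where
  "rel_open_face i = {x. x $ i = 0 \<and> (\<forall>j. j \<noteq> i \<longrightarrow> 0 < x $ j \<and> x $ j < 1)}"

text \<open>\<open>S\<close> is a hypersurface piece with relative interior \<open>S0\<close>: the parametrisation \<open>g\<close> is
  $C^1$ up to the boundary of the parameter domain (as for the smooth paths of the library,
  ``smooth'' means $C^1$), and injective and regular except possibly at that boundary, so that
  e.g. the lateral surface of a cone is admitted. A parametrisation depending only on the
  coordinates other than $x_i$ extends to a neighbourhood of the face in $\mathbb{R}^d$ by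
  making it constant in $x_i$.\<close>

definition smooth_piece :: "(real^'n) set \<Rightarrow> (real^'n) set \<Rightarrow> bool" where
  "smooth_piece S S0 \<longleftrightarrow>
     (\<exists>i U g (g' :: real^'n \<Rightarrow> (real^'n) \<Rightarrow>\<^sub>L (real^'n)).
        open U \<and> face i \<subseteq> U \<and>
        (\<forall>x\<in>U. (g has_derivative blinfun_apply (g' x)) (at x)) \<and> continuous_on U g' \<and>
        (\<forall>x\<in>rel_open_face i. \<forall>y\<in>face i. g x = g y \<longrightarrow> x = y) \<and>
        (\<forall>x\<in>rel_open_face i. \<forall>h. h $ i = 0 \<and> blinfun_apply (g' x) h = 0 \<longrightarrow> h = 0) \<and>
        S = g ` face i \<and> S0 = g ` rel_open_face i)"

definition piecewise_smooth_boundary :: "(real^'n) set \<Rightarrow> bool" where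
  "piecewise_smooth_boundary D \<longleftrightarrow>
     (\<exists>P. finite P \<and> (\<forall>(S, S0)\<in>P. smooth_piece S S0) \<and>
        frontier D = (\<Union>(S, S0)\<in>P. S) \<and>
        (\<forall>p\<in>P. \<forall>q\<in>P. p \<noteq> q \<longrightarrow> fst p \<inter> snd q = {}))"

end

theory Submission
  imports Defs "HOL-Library.Diagonal_Subsequence" "HOL-Computational_Algebra.Polynomial"
begin

text \<open>Write $u = w - v$ for an eigenpair. Subtracting the two equations gives
$\Delta u + k^2 u = - k^2 (n - 1) w$, and testing this and the equation of $w$ with
$u \in H^2_0(D)$ yields the energy identity
$$k^2 \int_D (n - 1) |w|^2 = \|\nabla u\|^2 - k^2 \|u\|^2$$
(\<open>energy_identity\<close>). Since $n - 1$ has a sign and is bounded away from $0$, the left-hand side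
controls $\|w\|^2$, and the equation for $u$ then controls $\Delta u$. Three consequences follow
for a normalized sequence.

The eigenvalues stay away from $0$: the bound for $\|\Delta u\|$ tends to $0$ with $k$, but
$\|\nabla u\|^2 = - \langle u, \Delta u \rangle$ and the Poincare inequality would then force
$\|u\|_{H^1}$ to tend to $0$. Hence $w$ and $v$ are bounded in $L^2(D)$ and $u$ is
bounded in $H^2_0(D)$, the latter because $\|\partial_i \partial_j \phi\| \le \|\Delta \phi\|$ for test
functions. A bounded sequence in a Hilbert space has a weakly convergent subsequence whose weak
limit is also a strong limit of convex combinations (\<open>l2_weak_compactness\<close>); applied to
$w$, $v$ and all derivatives of test functions close to $u$ at once, it produces the limits and
shows that their difference again lies in $H^2_0(D)$ (\<open>H20_weak_compactness\<close>).

The equation for $v$ passes to the weak limit trivially. In the equation for $w$ the product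
$n(x/\epsilon) w_\epsilon$ of two weakly convergent sequences appears. It is handled without strong
convergence of $w_\epsilon$: if $n$ is replaced by a single mode $e^{2 \pi i m \cdot y}$ with
$m \neq 0$, then testing the equation of $w_\epsilon$ with $e^{2 \pi i m \cdot x/\epsilon} \phi$, whose
Laplacian is of order $\epsilon^{-2}$, shows that
$\int_D e^{2 \pi i m \cdot x/\epsilon} w_\epsilon \phi = O(\epsilon)$ (\<open>helmholtz_wave_estimate\<close>). Trigonometric
polynomials are dense in $L^2$ of the cell, so only the mean of $n$ survives
(\<open>homogenization_limit\<close>).

The limit is not trivial: if $w$ and $v$ vanished, $u_\epsilon$ would tend weakly, hence by the
Rellich theorem strongly, to $0$ in $L^2(D)$, and by
$\|\nabla u\|^2 \le \|u\| \|\Delta u\|$ also in $H^1(D)$, contradicting the normalization.\<close>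

section \<open>Square-integrable functions: completeness and weak compactness\<close>

text \<open>Functions are not identified up to null sets, so $L^2$ of a measure is used as a space with a
semi-inner product. Values in a Euclidean space allow several functions to be treated as one
vector-valued function, which is how joint weak limits are obtained later.\<close>

definition square_integrable :: "'a measure \<Rightarrow> ('a \<Rightarrow> 'b::euclidean_space) \<Rightarrow> bool" where
  "square_integrable M f \<longleftrightarrow> f \<in> borel_measurable M \<and> integrable M (\<lambda>x. (norm (f x))\<^sup>2)"

definition l2_ip :: "'a measure \<Rightarrow> ('a \<Rightarrow> 'b::euclidean_space) \<Rightarrow> ('a \<Rightarrow> 'b) \<Rightarrow> real" where
  "l2_ip M f g = (\<integral>x. f x \<bullet> g x \<partial>M)"

definition l2_sq :: "'a measure \<Rightarrow> ('a \<Rightarrow> 'b::euclidean_space) \<Rightarrow> real" where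
  "l2_sq M f = (\<integral>x. (norm (f x))\<^sup>2 \<partial>M)"

lemma square_integrable_measurable [measurable_dest]:
  "square_integrable M f \<Longrightarrow> f \<in> borel_measurable M"
  by (simp add: square_integrable_def)

lemma square_integrable_sq: "square_integrable M f \<Longrightarrow> integrable M (\<lambda>x. (norm (f x))\<^sup>2)"
  by (simp add: square_integrable_def)

lemma square_integrable_bound:
  fixes f :: "'a \<Rightarrow> 'b::euclidean_space" and g :: "'a \<Rightarrow> 'c::euclidean_space"
  assumes "f \<in> borel_measurable M" "square_integrable M g" "AE x in M. norm (f x) \<le> norm (g x)"
  shows "square_integrable M f"
  unfolding square_integrable_def
proof
  show "integrable M (\<lambda>x. (norm (f x))\<^sup>2)"
    by (rule Bochner_Integration.integrable_bound[OF square_integrable_sq[OF assms(2)]])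
      (use assms in \<open>auto elim!: AE_mp intro!: AE_I2 power_mono\<close>)
qed (use assms in auto)

lemma square_integrable_norm_mult:
  fixes f :: "'a \<Rightarrow> 'b::euclidean_space" and g :: "'a \<Rightarrow> 'c::euclidean_space"
  assumes "square_integrable M f" "square_integrable M g"
  shows "integrable M (\<lambda>x. norm (f x) * norm (g x))"
proof (rule Bochner_Integration.integrable_bound)
  show "integrable M (\<lambda>x. (norm (f x))\<^sup>2 + (norm (g x))\<^sup>2)"
    using assms by (intro Bochner_Integration.integrable_add square_integrable_sq)
  show "(\<lambda>x. norm (f x) * norm (g x)) \<in> borel_measurable M"
    using assms by measurable
  have "norm (f x) * norm (g x) \<le> (norm (f x))\<^sup>2 + (norm (g x))\<^sup>2" for x
  proof -
    have "0 \<le> norm (f x) * norm (g x)" by simp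
    moreover have "2 * norm (f x) * norm (g x) \<le> (norm (f x))\<^sup>2 + (norm (g x))\<^sup>2"
      by (rule sum_squares_bound)
    ultimately show ?thesis by linarith
  qed
  then show "AE x in M. norm (norm (f x) * norm (g x)) \<le> norm ((norm (f x))\<^sup>2 + (norm (g x))\<^sup>2)"
    by auto
qed

lemma l2_sq_nonneg [simp]: "0 \<le> l2_sq M f"
  by (simp add: l2_sq_def)

lemma square_integrable_inner:
  assumes "square_integrable M f" "square_integrable M g"
  shows "integrable M (\<lambda>x. f x \<bullet> g x)"
proof (rule Bochner_Integration.integrable_bound[OF square_integrable_norm_mult[OF assms]])
  show "(\<lambda>x. f x \<bullet> g x) \<in> borel_measurable M"
    using assms by measurable
  show "AE x in M. norm (f x \<bullet> g x) \<le> norm (norm (f x) * norm (g x))"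
    by (rule AE_I2) (simp add: abs_mult Cauchy_Schwarz_ineq2)
qed

lemma square_integrable_scaleR:
  "square_integrable M f \<Longrightarrow> square_integrable M (\<lambda>x. c *\<^sub>R f x)"
  unfolding square_integrable_def by (auto simp: power_mult_distrib)

lemma square_integrable_zero: "square_integrable M (\<lambda>x. 0)"
  unfolding square_integrable_def by auto

lemma square_integrable_add:
  assumes "square_integrable M f" "square_integrable M g"
  shows "square_integrable M (\<lambda>x. f x + g x)"
  unfolding square_integrable_def
proof
  have "(norm (f x + g x))\<^sup>2 = (norm (f x))\<^sup>2 + 2 * (f x \<bullet> g x) + (norm (g x))\<^sup>2" for x
    by (simp add: power2_norm_eq_inner inner_add inner_commute)
  then show "integrable M (\<lambda>x. (norm (f x + g x))\<^sup>2)"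
    using square_integrable_inner[OF assms] assms[THEN square_integrable_sq] by simp
qed (use assms in measurable)

lemma square_integrable_diff:
  assumes "square_integrable M f" "square_integrable M g"
  shows "square_integrable M (\<lambda>x. f x - g x)"
  using square_integrable_add[OF assms(1) square_integrable_scaleR[OF assms(2), of "-1"]] by simp

lemma square_integrable_sum:
  assumes "\<And>i. i \<in> I \<Longrightarrow> square_integrable M (f i)"
  shows "square_integrable M (\<lambda>x. \<Sum>i\<in>I. f i x)"
  using assms
  by (induction I rule: infinite_finite_induct)
    (auto intro: square_integrable_add square_integrable_zero)

lemma l2_ip_commute: "l2_ip M f g = l2_ip M g f"
  by (simp add: l2_ip_def inner_commute)

lemma l2_ip_self: "l2_ip M f f = l2_sq M f"
  by (simp add: l2_ip_def l2_sq_def power2_norm_eq_inner)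

lemma l2_ip_add_left:
  assumes "square_integrable M f" "square_integrable M g" "square_integrable M h"
  shows "l2_ip M (\<lambda>x. f x + g x) h = l2_ip M f h + l2_ip M g h"
  unfolding l2_ip_def inner_add_left
  using assms by (intro Bochner_Integration.integral_add square_integrable_inner)

lemma l2_ip_scaleR_left: "l2_ip M (\<lambda>x. c *\<^sub>R f x) h = c * l2_ip M f h"
  unfolding l2_ip_def by simp

lemma l2_ip_zero_left: "l2_ip M (\<lambda>x. 0) h = 0"
  unfolding l2_ip_def by simp

lemma l2_ip_diff_left:
  assumes "square_integrable M f" "square_integrable M g" "square_integrable M h"
  shows "l2_ip M (\<lambda>x. f x - g x) h = l2_ip M f h - l2_ip M g h"
  unfolding l2_ip_def inner_diff_left
  using assms by (intro Bochner_Integration.integral_diff square_integrable_inner)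

lemma l2_ip_sum_left:
  assumes "\<And>i. i \<in> I \<Longrightarrow> square_integrable M (f i)" "square_integrable M h"
  shows "l2_ip M (\<lambda>x. \<Sum>i\<in>I. f i x) h = (\<Sum>i\<in>I. l2_ip M (f i) h)"
  using assms
  by (induction I rule: infinite_finite_induct)
    (auto simp: l2_ip_zero_left l2_ip_add_left square_integrable_sum)

lemma l2_sq_add:
  assumes "square_integrable M f" "square_integrable M g"
  shows "l2_sq M (\<lambda>x. f x + g x) = l2_sq M f + 2 * l2_ip M f g + l2_sq M g"
proof -
  have "(norm (f x + g x))\<^sup>2 = ((norm (f x))\<^sup>2 + 2 * (f x \<bullet> g x)) + (norm (g x))\<^sup>2" for x
    by (simp add: power2_norm_eq_inner inner_add inner_commute)
  then show ?thesis
    unfolding l2_sq_def l2_ip_def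
    using square_integrable_inner[OF assms] assms[THEN square_integrable_sq] by simp
qed

lemma l2_sq_scaleR: "l2_sq M (\<lambda>x. c *\<^sub>R f x) = c\<^sup>2 * l2_sq M f"
  unfolding l2_sq_def by (simp add: power_mult_distrib)

lemma l2_sq_diff:
  assumes "square_integrable M f" "square_integrable M g"
  shows "l2_sq M (\<lambda>x. f x - g x) = l2_sq M f - 2 * l2_ip M f g + l2_sq M g"
proof -
  have "(norm (f x - g x))\<^sup>2 = ((norm (f x))\<^sup>2 - 2 * (f x \<bullet> g x)) + (norm (g x))\<^sup>2" for x
    by (simp add: power2_norm_eq_inner inner_diff inner_commute)
  then show ?thesis
    unfolding l2_sq_def l2_ip_def
    using square_integrable_inner[OF assms] assms[THEN square_integrable_sq] by simp
qed

lemma l2_sq_diff_commute: "l2_sq M (\<lambda>x. f x - g x) = l2_sq M (\<lambda>x. g x - f x)"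
  by (simp add: l2_sq_def norm_minus_commute)

lemma l2_cauchy_schwarz_norm:
  fixes f :: "'a \<Rightarrow> 'b::euclidean_space" and g :: "'a \<Rightarrow> 'c::euclidean_space"
  assumes "square_integrable M f" "square_integrable M g"
  shows "(\<integral>x. norm (f x) * norm (g x) \<partial>M) \<le> sqrt (l2_sq M f) * sqrt (l2_sq M g)"
proof -
  let ?f = "\<lambda>x. norm (f x)" and ?g = "\<lambda>x. norm (g x)"
  let ?p = "\<integral>x. norm (f x) * norm (g x) \<partial>M"
  have si: "square_integrable M ?f" "square_integrable M ?g"
    using assms by (auto simp: square_integrable_def)
  have sq: "l2_sq M ?f = l2_sq M f" "l2_sq M ?g = l2_sq M g"
    by (auto simp: l2_sq_def)
  have ip: "l2_ip M ?f ?g = ?p" "l2_ip M ?g ?f = ?p"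
    by (simp_all add: l2_ip_def mult.commute)
  have p0: "0 \<le> ?p" by simp
  have "0 \<le> l2_sq M f - 2 * a * ?p + a\<^sup>2 * l2_sq M g" for a
  proof -
    have "0 \<le> l2_sq M (\<lambda>x. ?f x - a *\<^sub>R ?g x)" by simp
    also have "\<dots> = l2_sq M f - 2 * a * ?p + a\<^sup>2 * l2_sq M g"
      using l2_sq_diff[OF si(1) square_integrable_scaleR[OF si(2), of a]] l2_sq_scaleR[of M a ?g]
        l2_ip_scaleR_left[of M a ?g ?f]
      by (simp add: sq ip l2_ip_commute[of M ?f])
    finally show ?thesis .
  qed
  note * = this
  have "?p\<^sup>2 \<le> l2_sq M f * l2_sq M g"
  proof (cases "l2_sq M g = 0")
    case True
    have "?p = 0"
    proof (rule ccontr)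
      assume "?p \<noteq> 0"
      then have e: "2 * ((l2_sq M f + 1) / ?p) * ?p = 2 * (l2_sq M f + 1)" by simp
      show False using *[of "(l2_sq M f + 1) / ?p"] l2_sq_nonneg[of M f]
        unfolding e True mult_zero_right by argo
    qed
    then show ?thesis by simp
  next
    case False
    then have g: "l2_sq M g > 0" using l2_sq_nonneg[of M g] by linarith
    then show ?thesis using *[of "?p / l2_sq M g"]
      by (simp add: field_simps power2_eq_square)
  qed
  then have "sqrt (?p\<^sup>2) \<le> sqrt (l2_sq M f * l2_sq M g)" by (rule real_sqrt_le_mono)
  then show ?thesis using p0 by (simp add: real_sqrt_mult)
qed

lemma l2_ip_cauchy_schwarz:
  assumes "square_integrable M f" "square_integrable M g"
  shows "\<bar>l2_ip M f g\<bar> \<le> sqrt (l2_sq M f) * sqrt (l2_sq M g)"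
proof -
  have "\<bar>l2_ip M f g\<bar> \<le> (\<integral>x. \<bar>f x \<bullet> g x\<bar> \<partial>M)"
    unfolding l2_ip_def by (rule integral_abs_bound)
  also have "\<dots> \<le> (\<integral>x. norm (f x) * norm (g x) \<partial>M)"
    using assms
    by (intro integral_mono square_integrable_norm_mult integrable_abs square_integrable_inner
        Cauchy_Schwarz_ineq2) auto
  also note l2_cauchy_schwarz_norm[OF assms]
  finally show ?thesis .
qed

lemma l2_triangle:
  assumes "square_integrable M f" "square_integrable M g"
  shows "sqrt (l2_sq M (\<lambda>x. f x + g x)) \<le> sqrt (l2_sq M f) + sqrt (l2_sq M g)"
proof (rule real_le_lsqrt)
  have "l2_ip M f g \<le> sqrt (l2_sq M f) * sqrt (l2_sq M g)"
    using l2_ip_cauchy_schwarz[OF assms] by simp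
  then show "l2_sq M (\<lambda>x. f x + g x) \<le> (sqrt (l2_sq M f) + sqrt (l2_sq M g))\<^sup>2"
    by (simp add: l2_sq_add[OF assms] power2_sum)
qed auto

lemma l2_ip_tendsto_left:
  assumes "\<And>m. square_integrable M (f m)" "square_integrable M g" "square_integrable M h"
    "(\<lambda>m. l2_sq M (\<lambda>x. f m x - g x)) \<longlonglongrightarrow> 0"
  shows "(\<lambda>m. l2_ip M (f m) h) \<longlonglongrightarrow> l2_ip M g h"
proof -
  have "(\<lambda>m. l2_ip M (f m) h - l2_ip M g h) \<longlonglongrightarrow> 0"
  proof (rule Lim_null_comparison)
    show "\<forall>\<^sub>F m in sequentially. norm (l2_ip M (f m) h - l2_ip M g h)
        \<le> sqrt (l2_sq M (\<lambda>x. f m x - g x)) * sqrt (l2_sq M h)"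
      using l2_ip_cauchy_schwarz[OF square_integrable_diff[OF assms(1,2)] assms(3)]
      by (simp add: l2_ip_diff_left assms)
    show "(\<lambda>m. sqrt (l2_sq M (\<lambda>x. f m x - g x)) * sqrt (l2_sq M h)) \<longlonglongrightarrow> 0"
      using tendsto_mult[OF tendsto_real_sqrt[OF assms(4)] tendsto_const[of "sqrt (l2_sq M h)"]]
      by simp
  qed
  then show ?thesis by (simp add: LIM_zero_iff)
qed

lemma l2_sq_tendsto:
  assumes "\<And>m. square_integrable M (f m)" "square_integrable M g"
    "(\<lambda>m. l2_sq M (\<lambda>x. f m x - g x)) \<longlonglongrightarrow> 0"
  shows "(\<lambda>m. l2_sq M (f m)) \<longlonglongrightarrow> l2_sq M g"
proof -
  have "l2_sq M (f m) = l2_sq M (\<lambda>x. f m x - g x) + 2 * (l2_ip M (f m) g) - l2_sq M g" for m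
    using l2_sq_diff[OF assms(1)[of m] assms(2)] by simp
  moreover have "(\<lambda>m. l2_sq M (\<lambda>x. f m x - g x) + 2 * (l2_ip M (f m) g) - l2_sq M g) \<longlonglongrightarrow>
      0 + 2 * l2_ip M g g - l2_sq M g"
    by (intro tendsto_intros assms l2_ip_tendsto_left)
  ultimately show ?thesis by (simp add: l2_ip_self)
qed

text \<open>Riesz and Fischer: along a subsequence with rapidly decreasing increments the functions converge
almost everywhere, and Fatou's lemma turns the Cauchy condition into convergence in $L^2$.\<close>

lemma l2_complete:
  fixes f :: "nat \<Rightarrow> 'a \<Rightarrow> 'b::euclidean_space"
  assumes f: "\<And>n. square_integrable M (f n)"
    and cauchy: "\<And>e. e > 0 \<Longrightarrow> \<exists>N. \<forall>m\<ge>N. \<forall>n\<ge>N. l2_sq M (\<lambda>x. f m x - f n x) < e"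
  obtains g where "square_integrable M g" "(\<lambda>n. l2_sq M (\<lambda>x. f n x - g x)) \<longlonglongrightarrow> 0"
proof -
  have [measurable]: "f n \<in> borel_measurable M" for n
    using f by (rule square_integrable_measurable)
  have nn: "(\<integral>\<^sup>+x. ennreal ((norm (f m x - f n x))\<^sup>2) \<partial>M) = ennreal (l2_sq M (\<lambda>x. f m x - f n x))" for m n
    unfolding l2_sq_def
    by (rule nn_integral_eq_integral) (auto intro!: square_integrable_sq square_integrable_diff f)
  have "\<exists>r::nat\<Rightarrow>nat. (\<forall>k. \<forall>m\<ge>r k. \<forall>n\<ge>r k. l2_sq M (\<lambda>x. f m x - f n x) < (1/8)^k) \<and> (\<forall>k. r k < r (Suc k))"
  proof -
    have "\<exists>r. \<forall>k. (\<forall>m\<ge>r k. \<forall>n\<ge>r k. l2_sq M (\<lambda>x. f m x - f n x) < (1/8)^k) \<and> r k < r (Suc k)"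
    proof (rule dependent_nat_choice)
      show "\<exists>x. \<forall>m\<ge>x. \<forall>n\<ge>x. l2_sq M (\<lambda>x. f m x - f n x) < (1/8)^0"
        using cauchy[of 1] by simp
      fix x k
      obtain N where "\<forall>m\<ge>N. \<forall>n\<ge>N. l2_sq M (\<lambda>x. f m x - f n x) < (1/8)^Suc k"
        using cauchy[of "(1/8)^Suc k"] by auto
      then show "\<exists>y. (\<forall>m\<ge>y. \<forall>n\<ge>y. l2_sq M (\<lambda>x. f m x - f n x) < (1/8)^Suc k) \<and> x < y"
        by (intro exI[of _ "max N (Suc x)"]) auto
    qed
    then show ?thesis by blast
  qed
  then obtain r :: "nat \<Rightarrow> nat" where
    r: "\<And>k m n. m \<ge> r k \<Longrightarrow> n \<ge> r k \<Longrightarrow> l2_sq M (\<lambda>x. f m x - f n x) < (1/8)^k"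
    and "\<And>k. r k < r (Suc k)" by blast
  then have mono: "strict_mono r" by (simp add: strict_mono_Suc_iff)
  define h where "h k = f (r k)" for k
  have [measurable]: "h k \<in> borel_measurable M" for k by (simp add: h_def)
  have step: "l2_sq M (\<lambda>x. h (Suc k) x - h k x) < (1/8)^k" for k
    unfolding h_def using r[of k "r (Suc k)" "r k"] mono by (simp add: strict_mono_less_eq)
  \<comment> \<open>The weight $4^k$ is summable against the bound $8^{-k}$, and it makes almost every sequence
    of increments $O(2^{-k})$ pointwise, hence summable.\<close>
  have "(\<integral>\<^sup>+x. (\<Sum>k. ennreal (4^k * (norm (h (Suc k) x - h k x))\<^sup>2)) \<partial>M)
      = (\<Sum>k. (\<integral>\<^sup>+x. ennreal (4^k * (norm (h (Suc k) x - h k x))\<^sup>2) \<partial>M))"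
    by (rule nn_integral_suminf) measurable
  also have "\<dots> = (\<Sum>k. ennreal (4^k * l2_sq M (\<lambda>x. h (Suc k) x - h k x)))"
  proof (rule suminf_cong)
    fix k
    have "(\<integral>\<^sup>+x. ennreal (4^k * (norm (h (Suc k) x - h k x))\<^sup>2) \<partial>M)
        = (\<integral>\<^sup>+x. ennreal (4^k) * ennreal ((norm (h (Suc k) x - h k x))\<^sup>2) \<partial>M)"
      by (simp add: ennreal_mult)
    also have "\<dots> = ennreal (4^k) * (\<integral>\<^sup>+x. ennreal ((norm (h (Suc k) x - h k x))\<^sup>2) \<partial>M)"
      by (rule nn_integral_cmult) measurable
    also have "\<dots> = ennreal (4^k * l2_sq M (\<lambda>x. h (Suc k) x - h k x))"
      unfolding h_def nn by (simp add: ennreal_mult)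
    finally show "(\<integral>\<^sup>+x. ennreal (4^k * (norm (h (Suc k) x - h k x))\<^sup>2) \<partial>M)
        = ennreal (4^k * l2_sq M (\<lambda>x. h (Suc k) x - h k x))" .
  qed
  also have "\<dots> \<le> (\<Sum>k. ennreal ((1/2)^k))"
  proof (intro suminf_le ennreal_leI)
    fix k
    have "4^k * l2_sq M (\<lambda>x. h (Suc k) x - h k x) \<le> 4^k * (1/8)^k"
      using step[of k] by simp
    also have "\<dots> = (4 * (1/8))^k" by (simp only: power_mult_distrib)
    finally show "4^k * l2_sq M (\<lambda>x. h (Suc k) x - h k x) \<le> (1/2)^k" by simp
  qed auto
  also have "\<dots> = ennreal (\<Sum>k. (1/2)^k)"
    by (rule suminf_ennreal2) auto
  also have "\<dots> < \<infinity>" by simp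
  finally have "AE x in M. (\<Sum>k. ennreal (4^k * (norm (h (Suc k) x - h k x))\<^sup>2)) \<noteq> \<infinity>"
    by (intro nn_integral_PInf_AE) auto
  then have conv: "AE x in M. convergent (\<lambda>k. h k x)"
  proof (rule AE_mp, intro AE_I2 impI)
    fix x assume fin: "(\<Sum>k. ennreal (4^k * (norm (h (Suc k) x - h k x))\<^sup>2)) \<noteq> \<infinity>"
    have "summable (\<lambda>k. 4^k * (norm (h (Suc k) x - h k x))\<^sup>2)"
      using fin by (intro summable_suminf_not_top) auto
    then have "Bseq (\<lambda>k. 4^k * (norm (h (Suc k) x - h k x))\<^sup>2)"
      by (intro convergent_imp_Bseq convergentI[OF summable_LIMSEQ_zero])
    then obtain B where B: "B > 0" "\<And>k. norm (4^k * (norm (h (Suc k) x - h k x))\<^sup>2) \<le> B"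
      by (auto elim: BseqE)
    have bnd: "norm (h (Suc k) x - h k x) \<le> sqrt B * (1/2)^k" for k
    proof -
      have "(2^k * norm (h (Suc k) x - h k x))\<^sup>2 \<le> B"
      proof -
        have "(4::real)^k = (2^k)\<^sup>2" by (simp add: power2_eq_square flip: power_mult_distrib)
        then show ?thesis using B(2)[of k] by (simp add: power_mult_distrib)
      qed
      then have "2^k * norm (h (Suc k) x - h k x) \<le> sqrt B"
        by (rule real_le_rsqrt)
      then show ?thesis by (simp add: field_simps power_one_over)
    qed
    have "summable (\<lambda>k. h (Suc k) x - h k x)"
      by (rule summable_comparison_test'[where g="\<lambda>k. sqrt B * (1/2)^k" and N=0])
        (use bnd in \<open>auto intro!: summable_mult\<close>)
    then have "convergent (\<lambda>n. \<Sum>k<n. h (Suc k) x - h k x)"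
      by (simp add: summable_iff_convergent)
    then have "convergent (\<lambda>n. (\<Sum>k<n. h (Suc k) x - h k x) + h 0 x)"
      by (intro convergent_add convergent_const)
    then show "convergent (\<lambda>k. h k x)"
      by (simp only: sum_lessThan_telescope[of "\<lambda>k. h k x"] diff_add_cancel)
  qed
  define g where "g x = lim (\<lambda>k. h k x)" for x
  have g_meas [measurable]: "g \<in> borel_measurable M"
    unfolding g_def by (rule borel_measurable_lim_metric) measurable
  have hg: "AE x in M. (\<lambda>k. h k x) \<longlonglongrightarrow> g x"
    using conv by eventually_elim (simp add: g_def convergent_LIMSEQ_iff)
  have fatou: "(\<integral>\<^sup>+x. ennreal ((norm (f n x - g x))\<^sup>2) \<partial>M) \<le> ennreal e"
    if N: "\<And>m n. m \<ge> N \<Longrightarrow> n \<ge> N \<Longrightarrow> l2_sq M (\<lambda>x. f m x - f n x) < e" and "n \<ge> N" for N n e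
  proof -
    have "(\<integral>\<^sup>+x. ennreal ((norm (f n x - g x))\<^sup>2) \<partial>M)
        = (\<integral>\<^sup>+x. liminf (\<lambda>k. ennreal ((norm (f n x - h k x))\<^sup>2)) \<partial>M)"
    proof (rule nn_integral_cong_AE)
      show "AE x in M. ennreal ((norm (f n x - g x))\<^sup>2) = liminf (\<lambda>k. ennreal ((norm (f n x - h k x))\<^sup>2))"
        using hg
      proof eventually_elim
        case (elim x)
        have "(\<lambda>k. ennreal ((norm (f n x - h k x))\<^sup>2)) \<longlonglongrightarrow> ennreal ((norm (f n x - g x))\<^sup>2)"
          by (intro tendsto_intros elim)
        then show ?case by (rule lim_imp_Liminf[OF sequentially_bot, symmetric])
      qed
    qed
    also have "\<dots> \<le> liminf (\<lambda>k. (\<integral>\<^sup>+x. ennreal ((norm (f n x - h k x))\<^sup>2) \<partial>M))"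
      by (rule nn_integral_liminf) measurable
    also have "\<dots> \<le> liminf (\<lambda>k::nat. ennreal e)"
    proof (rule Liminf_mono)
      show "\<forall>\<^sub>F k in sequentially. (\<integral>\<^sup>+x. ennreal ((norm (f n x - h k x))\<^sup>2) \<partial>M) \<le> ennreal e"
        using eventually_ge_at_top[of N]
      proof eventually_elim
        case (elim k)
        then have "r k \<ge> N" using strict_mono_imp_increasing[OF mono, of k] by linarith
        then show ?case unfolding h_def nn using N[OF \<open>n \<ge> N\<close>, of "r k"] by (simp add: ennreal_leI)
      qed
    qed
    also have "\<dots> = ennreal e" by (simp add: Liminf_const)
    finally show ?thesis .
  qed
  have si_diff: "square_integrable M (\<lambda>x. f n x - g x) \<and> l2_sq M (\<lambda>x. f n x - g x) \<le> e"
    if N: "\<And>m n. m \<ge> N \<Longrightarrow> n \<ge> N \<Longrightarrow> l2_sq M (\<lambda>x. f m x - f n x) < e" and "n \<ge> N" and "e > 0" for N n e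
  proof -
    note F = fatou[OF N \<open>n \<ge> N\<close>]
    have int: "integrable M (\<lambda>x. (norm (f n x - g x))\<^sup>2)"
      by (rule integrableI_bounded)
        (use F in \<open>auto intro: le_less_trans\<close>)
    have "ennreal (l2_sq M (\<lambda>x. f n x - g x)) \<le> ennreal e"
      unfolding l2_sq_def using nn_integral_eq_integral[OF int] F by simp
    then have "l2_sq M (\<lambda>x. f n x - g x) \<le> e" using \<open>e > 0\<close>
      by (simp add: ennreal_le_iff)
    with int show ?thesis by (auto simp: square_integrable_def)
  qed
  obtain N1 where "\<And>m n. m \<ge> N1 \<Longrightarrow> n \<ge> N1 \<Longrightarrow> l2_sq M (\<lambda>x. f m x - f n x) < 1"
    using cauchy[of 1] by auto
  then have "square_integrable M (\<lambda>x. f N1 x - g x)" using si_diff[of N1 1 N1] by auto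
  from square_integrable_diff[OF f[of N1] this] have "square_integrable M g" by simp
  moreover have "(\<lambda>n. l2_sq M (\<lambda>x. f n x - g x)) \<longlonglongrightarrow> 0"
  proof (rule LIMSEQ_I)
    fix e :: real assume "e > 0"
    then obtain N where "\<And>m n. m \<ge> N \<Longrightarrow> n \<ge> N \<Longrightarrow> l2_sq M (\<lambda>x. f m x - f n x) < e/2"
      using cauchy[of "e/2"] by auto
    then show "\<exists>N. \<forall>n\<ge>N. norm (l2_sq M (\<lambda>x. f n x - g x) - 0) < e"
      using si_diff[of N "e/2"] \<open>e > 0\<close> by (intro exI[of _ N]) force
  qed
  ultimately show ?thesis using that by blast
qed

text \<open>By the parallelogram law, almost minimal elements of a convex set are close to each other:
their midpoint cannot have much smaller norm. Decreasing families are covered because the minimal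
norms increase and are bounded, so they converge. The constant family gives orthogonal
projections, the tails of a sequence give Mazur's theorem.\<close>

lemma l2_minimizing_sequence:
  fixes C :: "nat \<Rightarrow> ('a \<Rightarrow> 'b::euclidean_space) set"
  assumes si: "\<And>m f. f \<in> C m \<Longrightarrow> square_integrable M f"
    and dec: "\<And>m. C (Suc m) \<subseteq> C m"
    and mid: "\<And>m f g. f \<in> C m \<Longrightarrow> g \<in> C m \<Longrightarrow> (\<lambda>x. (1/2) *\<^sub>R (f x + g x)) \<in> C m"
    and bnd: "\<And>m. \<exists>f\<in>C m. l2_sq M f \<le> B"
  obtains c y where "\<And>m. c m \<in> C m" "\<And>m f. f \<in> C m \<Longrightarrow> l2_sq M (c m) \<le> l2_sq M f + inverse (real (Suc m))"
    "square_integrable M y" "(\<lambda>m. l2_sq M (\<lambda>x. c m x - y x)) \<longlonglongrightarrow> 0"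
proof -
  define d where "d m = Inf (l2_sq M ` C m)" for m
  have ne: "C m \<noteq> {}" for m using bnd by blast
  have bb: "bdd_below (l2_sq M ` C m)" for m by (rule bdd_belowI[of _ 0]) auto
  have d_le: "d m \<le> l2_sq M f" if "f \<in> C m" for m f
    unfolding d_def using that bb by (auto intro: cInf_lower)
  have "\<exists>f. f \<in> C m \<and> l2_sq M f < d m + inverse (real (Suc m))" for m
    using cInf_lessD[of "l2_sq M ` C m" "d m + inverse (real (Suc m))"] ne unfolding d_def by auto
  then obtain c where c: "\<And>m. c m \<in> C m" "\<And>m. l2_sq M (c m) < d m + inverse (real (Suc m))"
    by metis
  have anti: "antimono C" using dec by (rule decseq_SucI)
  have d_mono: "d m \<le> d l" if "m \<le> l" for m l
    unfolding d_def using ne bb antimonoD[OF anti that] by (intro cInf_superset_mono) auto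
  have "d m \<le> B" for m using bnd[of m] d_le by (meson order_trans)
  then have "convergent d"
    using d_mono incseq_convergent[of d B] by (metis (no_types, lifting) convergent_def incseq_def)
  then have "Cauchy d" by (rule convergent_Cauchy)
  have cc: "square_integrable M (c m)" for m using c si by blast
  have diff: "l2_sq M (\<lambda>x. c m x - c l x) \<le> 2 * (d l - d m) + 4 * inverse (real (Suc m))" if "m \<le> l" for m l
  proof -
    let ?h = "\<lambda>x. (1/2) *\<^sub>R (c m x + c l x)"
    have "c l \<in> C m" using c(1)[of l] antimonoD[OF anti that] by blast
    then have "?h \<in> C m" using mid c(1) by blast
    then have "d m \<le> l2_sq M ?h" by (rule d_le)
    also have "\<dots> = (1/4) * l2_sq M (\<lambda>x. c m x + c l x)"
      by (simp only: l2_sq_scaleR) (simp add: power2_eq_square)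
    finally have "4 * d m \<le> l2_sq M (c m) + 2 * l2_ip M (c m) (c l) + l2_sq M (c l)"
      by (simp add: l2_sq_add cc)
    moreover have "l2_sq M (c l) \<le> d l + inverse (real (Suc m))"
    proof -
      have "inverse (real (Suc l)) \<le> inverse (real (Suc m))" using that by simp
      then show ?thesis using c(2)[of l] by linarith
    qed
    ultimately show ?thesis using c(2)[of m]
      by (simp add: l2_sq_diff cc)
  qed
  have cau: "\<exists>N. \<forall>m\<ge>N. \<forall>l\<ge>N. l2_sq M (\<lambda>x. c m x - c l x) < e" if "e > 0" for e
  proof -
    obtain N1 where N1: "\<And>m l. m \<ge> N1 \<Longrightarrow> l \<ge> N1 \<Longrightarrow> dist (d m) (d l) < e/8"
      using \<open>Cauchy d\<close> \<open>e > 0\<close> unfolding Cauchy_def by (meson divide_pos_pos zero_less_numeral)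
    obtain N2 where N2: "inverse (real (Suc N2)) < e/8"
      using reals_Archimedean[of "e/8"] \<open>e > 0\<close> by auto
    have le: "l2_sq M (\<lambda>x. c m x - c l x) < e" if "m \<ge> max N1 N2" "m \<le> l" for m l
    proof -
      have "inverse (real (Suc m)) < e/8"
        by (rule le_less_trans[OF _ N2]) (use that in simp)
      moreover have "d l - d m < e/8" using N1[of m l] that unfolding dist_real_def by linarith
      ultimately show ?thesis using diff[OF that(2)] \<open>e > 0\<close> by argo
    qed
    show ?thesis
    proof (intro exI[of _ "max N1 N2"] allI impI)
      fix m l assume "m \<ge> max N1 N2" "l \<ge> max N1 N2"
      then show "l2_sq M (\<lambda>x. c m x - c l x) < e"
        using le[of m l] le[of l m] l2_sq_diff_commute[of M "c m" "c l"] by (cases "m \<le> l") auto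
    qed
  qed
  obtain y where y: "square_integrable M y" "(\<lambda>m. l2_sq M (\<lambda>x. c m x - y x)) \<longlonglongrightarrow> 0"
    using l2_complete[of M c, OF cc cau] by blast
  show ?thesis
  proof (rule that[OF c(1) _ y])
    fix m f assume "f \<in> C m"
    then show "l2_sq M (c m) \<le> l2_sq M f + inverse (real (Suc m))"
      using d_le[of f m] c(2)[of m] by linarith
  qed
qed

text \<open>The element of $z + S$ of least norm is orthogonal to $S$. As $S$ need not be closed, the
projection itself is only a limit of elements of $S$.\<close>

lemma l2_projection:
  fixes S :: "('a \<Rightarrow> 'b::euclidean_space) set"
  assumes si: "\<And>f. f \<in> S \<Longrightarrow> square_integrable M f"
    and zero: "(\<lambda>x. 0) \<in> S"
    and add: "\<And>f g. f \<in> S \<Longrightarrow> g \<in> S \<Longrightarrow> (\<lambda>x. f x + g x) \<in> S"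
    and scale: "\<And>f c. f \<in> S \<Longrightarrow> (\<lambda>x. c *\<^sub>R f x) \<in> S"
    and z: "square_integrable M z"
  obtains y s where "square_integrable M y" "\<And>m::nat. s m \<in> S"
    "(\<lambda>m. l2_sq M (\<lambda>x. z x - s m x - y x)) \<longlonglongrightarrow> 0" "\<And>t. t \<in> S \<Longrightarrow> l2_ip M y t = 0"
proof -
  define C where "C = (\<lambda>s x. z x - s x) ` S"
  have C_si: "square_integrable M f" if "f \<in> C" for f
    using that si z unfolding C_def by (auto intro: square_integrable_diff)
  obtain c y where c: "\<And>m::nat. c m \<in> C" "\<And>m f. f \<in> C \<Longrightarrow> l2_sq M (c m) \<le> l2_sq M f + inverse (real (Suc m))"
    and y: "square_integrable M y" "(\<lambda>m. l2_sq M (\<lambda>x. c m x - y x)) \<longlonglongrightarrow> 0"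
  proof (rule l2_minimizing_sequence[of "\<lambda>_. C" M "l2_sq M z"])
    fix f g assume "f \<in> C" "g \<in> C"
    then obtain s t where st: "s \<in> S" "t \<in> S" and f: "f = (\<lambda>x. z x - s x)" and g: "g = (\<lambda>x. z x - t x)"
      by (auto simp: C_def)
    have "(\<lambda>x. (1/2) *\<^sub>R (s x + t x)) \<in> S" using st by (intro scale add)
    moreover have "(\<lambda>x. (1/2) *\<^sub>R (f x + g x)) = (\<lambda>x. z x - (1/2) *\<^sub>R (s x + t x))"
    proof
      fix x
      have "f x + g x = (z x + z x) - (s x + t x)" unfolding f g by simp
      then show "(1/2) *\<^sub>R (f x + g x) = z x - (1/2) *\<^sub>R (s x + t x)"
        by (simp only: scaleR_diff_right scaleR_half_double)
    qed
    ultimately show "(\<lambda>x. (1/2) *\<^sub>R (f x + g x)) \<in> C" unfolding C_def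
      by (intro image_eqI[of _ _ "\<lambda>x. (1/2) *\<^sub>R (s x + t x)"])
  next
    show "\<exists>f\<in>C. l2_sq M f \<le> l2_sq M z"
      unfolding C_def using zero by (intro bexI[of _ z] image_eqI[of _ _ "\<lambda>x. 0"]) auto
  qed (use C_si in auto)
  have "\<forall>m. \<exists>s\<in>S. c m = (\<lambda>x. z x - s x)" using c(1) unfolding C_def by blast
  then obtain s where s: "\<And>m. s m \<in> S" "\<And>m. c m = (\<lambda>x. z x - s m x)" by metis
  have csi: "square_integrable M (c m)" for m using c(1) C_si by blast
  have orth: "l2_ip M y t = 0" if "t \<in> S" for t
  proof -
    have tsi: "square_integrable M t" using si that by blast
    have ge: "l2_sq M y \<le> l2_sq M (\<lambda>x. y x + a *\<^sub>R t x)" for a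
    proof (rule LIMSEQ_le)
      show "(\<lambda>m. l2_sq M (c m)) \<longlonglongrightarrow> l2_sq M y"
        by (intro l2_sq_tendsto csi y)
      have lim: "(\<lambda>m. l2_sq M (\<lambda>x. c m x + a *\<^sub>R t x)) \<longlonglongrightarrow> l2_sq M (\<lambda>x. y x + a *\<^sub>R t x)"
        by (intro l2_sq_tendsto square_integrable_add csi y square_integrable_scaleR tsi)
          (use y(2) in simp)
      show "(\<lambda>m. l2_sq M (\<lambda>x. c m x + a *\<^sub>R t x) + inverse (real (Suc m))) \<longlonglongrightarrow> l2_sq M (\<lambda>x. y x + a *\<^sub>R t x)"
        using tendsto_add[OF lim LIMSEQ_inverse_real_of_nat] by simp
      have "(\<lambda>x. c m x + a *\<^sub>R t x) \<in> C" for m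
        unfolding C_def using add[OF s(1)[of m] scale[OF that, of "-a"]]
        by (intro image_eqI[of _ _ "\<lambda>x. s m x + (-a) *\<^sub>R t x"]) (auto simp: s(2))
      then show "\<exists>N. \<forall>m\<ge>N. l2_sq M (c m) \<le> l2_sq M (\<lambda>x. c m x + a *\<^sub>R t x) + inverse (real (Suc m))"
        using c(2) by blast
    qed
    \<comment> \<open>Vary $y$ by $a t$ with $a = - p / (q + 1)$; the $+1$ keeps the denominator positive.\<close>
    let ?p = "l2_ip M y t" and ?q = "l2_sq M t"
    have "0 \<le> 2 * a * ?p + a\<^sup>2 * ?q" for a
      using ge[of a] l2_ip_scaleR_left[of M a t y]
      by (simp add: l2_sq_add y square_integrable_scaleR tsi l2_sq_scaleR l2_ip_commute[of M y])
    from this[of "- ?p / (?q + 1)"] have "0 \<le> - (2 * ?p\<^sup>2 / (?q + 1)) + ?p\<^sup>2 / (?q+1)\<^sup>2 * ?q"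
      by (simp add: power2_eq_square)
    then have "0 \<le> (- (2 * ?p\<^sup>2 / (?q + 1)) + ?p\<^sup>2 / (?q+1)\<^sup>2 * ?q) * (?q+1)\<^sup>2"
      by (intro mult_nonneg_nonneg) auto
    also have "\<dots> = - ?p\<^sup>2 * (?q + 2)"
      using l2_sq_nonneg[of M t] by (simp add: field_simps power2_eq_square add_nonneg_eq_0_iff)
    finally have "?p\<^sup>2 * (?q + 2) \<le> 0" by simp
    then show ?thesis using l2_sq_nonneg[of M t]
      by (simp add: mult_le_0_iff) 
  qed
  show ?thesis
    by (rule that[OF y(1) s(1) _ orth]) (use y(2) s(2) in simp)
qed

lemma bounded_coordinates_subsequence:
  fixes a :: "nat \<Rightarrow> nat \<Rightarrow> real"
  assumes "\<And>i n. \<bar>a n i\<bar> \<le> K i"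
  shows "\<exists>r. strict_mono (r::nat\<Rightarrow>nat) \<and> (\<forall>i. convergent (\<lambda>n. a (r n) i))"
proof -
  let ?P = "\<lambda>i s. convergent (\<lambda>n. a (s n) i)"
  interpret subseqs ?P
  proof
    fix i s assume "strict_mono (s::nat\<Rightarrow>nat)"
    have "Bseq (\<lambda>n. a (s n) i)" using assms by (intro BseqI'[of _ "K i"]) auto
    then have "bounded (range (\<lambda>n. a (s n) i))" by (simp add: Bseq_eq_bounded)
    then obtain l r where "strict_mono r" "((\<lambda>n. a (s n) i) \<circ> r) \<longlonglongrightarrow> l"
      using bounded_imp_convergent_subsequence by blast
    then show "\<exists>r. strict_mono r \<and> convergent (\<lambda>n. a ((s \<circ> r) n) i)"
      by (auto simp: o_def convergent_def)
  qed
  have "convergent (\<lambda>n. a ((diagseq \<circ> ((+) (Suc i))) n) i)" for i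
  proof (rule diagseq_holds)
    fix i s r
    assume "strict_mono (r::nat\<Rightarrow>nat)" "convergent (\<lambda>n. a (s n) i)"
    then show "convergent (\<lambda>n. a ((s \<circ> r) n) i)"
      using convergent_subseq_convergent[of "\<lambda>n. a (s n) i" r] by (simp add: o_def)
  qed
  then have "convergent (\<lambda>n. a (diagseq n) i)" for i
    using convergent_ignore_initial_segment[of "\<lambda>n. a (diagseq n) i" "Suc i"]
    unfolding o_def by (simp add: add.commute[of _ i])
  then show ?thesis using subseq_diagseq by blast
qed

text \<open>A diagonal subsequence makes the inner products with the sequence's own members converge, hence
those with their span, hence, splitting off the orthogonal part, those with every function. This
replaces separability of $L^2$. The limit functional is represented by the limit of almost minimal
elements of the convex hulls of the tails, so the same element is also a strong limit of convex
combinations.\<close>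

theorem l2_weak_compactness:
  fixes x :: "nat \<Rightarrow> 'a \<Rightarrow> 'b::euclidean_space"
  assumes si: "\<And>j. square_integrable M (x j)" and bnd: "\<And>j. l2_sq M (x j) \<le> B"
  obtains r y c N where "strict_mono (r::nat\<Rightarrow>nat)" "square_integrable M y"
    "\<And>g. square_integrable M g \<Longrightarrow> (\<lambda>j. l2_ip M (x (r j)) g) \<longlonglongrightarrow> l2_ip M y g"
    "\<And>m::nat. (\<Sum>j<N m. c m j) = (1::real)"
    "(\<lambda>m. l2_sq M (\<lambda>t. (\<Sum>j<N m. c m j *\<^sub>R x (r j) t) - y t)) \<longlonglongrightarrow> 0"
proof -
  have "\<bar>l2_ip M (x n) (x i)\<bar> \<le> sqrt B * sqrt B" for n i
  proof -
    have "\<bar>l2_ip M (x n) (x i)\<bar> \<le> sqrt (l2_sq M (x n)) * sqrt (l2_sq M (x i))"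
      by (intro l2_ip_cauchy_schwarz si)
    also have "\<dots> \<le> sqrt B * sqrt B"
      using bnd by (intro mult_mono real_sqrt_le_mono) (auto intro: order_trans[OF l2_sq_nonneg])
    finally show ?thesis .
  qed
  then obtain r where r: "strict_mono (r::nat\<Rightarrow>nat)" and conv: "\<And>i. convergent (\<lambda>n. l2_ip M (x (r n)) (x i))"
    using bounded_coordinates_subsequence[of "\<lambda>n i. l2_ip M (x n) (x i)" "\<lambda>_. sqrt B * sqrt B"] by auto
  define S where "S = {f. square_integrable M f \<and> convergent (\<lambda>n. l2_ip M (x (r n)) f)}"
  define V where "V = {f. \<exists>N c. f = (\<lambda>t. \<Sum>i<(N::nat). (c i::real) *\<^sub>R x i t)}"
  have V_D: "\<exists>N c. f = (\<lambda>t. \<Sum>i<(N::nat). (c i::real) *\<^sub>R x i t)" if "f \<in> V" for f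
    using that by (simp add: V_def)
  have VS: "square_integrable M f \<and> convergent (\<lambda>n. l2_ip M (x (r n)) f)" if fV: "f \<in> V" for f
  proof -
    obtain N c where f: "f = (\<lambda>t. \<Sum>i<(N::nat). (c i::real) *\<^sub>R x i t)" using V_D[OF fV] by (elim exE)
    have "square_integrable M f" unfolding f by (intro square_integrable_sum square_integrable_scaleR si)
    moreover have "l2_ip M (x (r n)) f = (\<Sum>i<N. c i * l2_ip M (x (r n)) (x i))" for n
      unfolding l2_ip_commute[of M "x (r n)"] unfolding f
      by (subst l2_ip_sum_left) (auto simp: l2_ip_scaleR_left intro: square_integrable_scaleR si)
    moreover have "convergent (\<lambda>n. \<Sum>i<N. c i * l2_ip M (x (r n)) (x i))"
      by (intro convergent_sum convergent_mult convergent_const conv)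
    ultimately show ?thesis by simp
  qed
  have convz: "convergent (\<lambda>n. l2_ip M (x (r n)) z)" if z: "square_integrable M z" for z
  proof -
    obtain y s where y: "square_integrable M y" and s: "\<And>m::nat. s m \<in> V"
      and lim: "(\<lambda>m. l2_sq M (\<lambda>x. z x - s m x - y x)) \<longlonglongrightarrow> 0"
      and orth: "\<And>t. t \<in> V \<Longrightarrow> l2_ip M y t = 0"
    proof (rule l2_projection[of V M z])
      show "(\<lambda>x. 0) \<in> V" unfolding V_def by (auto intro!: exI[of _ 0])
      fix f g :: "'a \<Rightarrow> 'b" assume fg: "f \<in> V" "g \<in> V"
      obtain N c where f: "f = (\<lambda>t. \<Sum>i<(N::nat). (c i::real) *\<^sub>R x i t)"
        using V_D[OF fg(1)] by (elim exE)
      obtain N' :: nat and c' :: "nat \<Rightarrow> real" where g: "g = (\<lambda>t. \<Sum>i<(N'::nat). (c' i::real) *\<^sub>R x i t)"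
        using V_D[OF fg(2)] by (elim exE)
      have ext: "(\<Sum>i<N. c i *\<^sub>R x i t) = (\<Sum>i<max N N'. (if i < N then c i else 0) *\<^sub>R x i t)" for N N' :: nat and c :: "nat \<Rightarrow> real" and t
        by (rule sum.mono_neutral_cong_left) auto
      have "(\<lambda>t. f t + g t) = (\<lambda>t. \<Sum>i<max N N'. ((if i < N then c i else 0) + (if i < N' then c' i else 0)) *\<^sub>R x i t)"
        unfolding f g ext[where N=N and c=c and N'=N'] ext[where N=N' and c=c' and N'=N] max.commute[of N' N]
        by (simp add: scaleR_left.add sum.distrib)
      then show "(\<lambda>t. f t + g t) \<in> V"
        unfolding V_def by (intro CollectI exI[of _ "max N N'"]) (rule exI)
    next
      fix f a assume fV: "f \<in> V"
      obtain N c where f: "f = (\<lambda>t. \<Sum>i<(N::nat). (c i::real) *\<^sub>R x i t)"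
        using V_D[OF fV] by (elim exE)
      have "(\<lambda>t. a *\<^sub>R f t) = (\<lambda>t. \<Sum>i<N. (a * c i) *\<^sub>R x i t)"
        unfolding f by (simp add: scaleR_sum_right)
      then show "(\<lambda>t. a *\<^sub>R f t) \<in> V" unfolding V_def by (intro CollectI exI[of _ N]) (rule exI)
    qed (use VS z in auto)
    have ssi: "square_integrable M (s m)" for m using VS s by blast
    have xy: "l2_ip M (x j) y = 0" for j
    proof -
      have "x j = (\<lambda>t. \<Sum>i<Suc j. (if i = j then 1 else 0) *\<^sub>R x i t)"
        by (auto simp: if_distrib[of "\<lambda>a. a *\<^sub>R _"] cong: if_cong)
      then have "x j \<in> V" unfolding V_def by (intro CollectI exI)
      then show ?thesis using orth l2_ip_commute[of M "x j" y] by simp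
    qed
    have "Cauchy (\<lambda>n. l2_ip M (x (r n)) z)"
    proof (rule metric_CauchyI)
      fix e :: real assume "e > 0"
      define b where "b = sqrt \<bar>B\<bar> + 1"
      have "sqrt (l2_sq M (x j)) \<le> sqrt \<bar>B\<bar>" for j
        by (rule real_sqrt_le_mono[OF order_trans[OF bnd[of j] abs_ge_self]])
      then have b: "b > 0" "sqrt (l2_sq M (x j)) \<le> b" for j
        unfolding b_def by (auto intro: add_nonneg_pos simp: add_increasing2)
      have "(e / (3*b))\<^sup>2 > 0" using \<open>e > 0\<close> b by simp
      then obtain m where m: "l2_sq M (\<lambda>x. z x - s m x - y x) < (e / (3*b))\<^sup>2"
      proof -
        obtain K where "\<And>n. n \<ge> K \<Longrightarrow> norm (l2_sq M (\<lambda>x. z x - s n x - y x) - 0) < (e / (3*b))\<^sup>2"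
          using LIMSEQ_D[OF lim \<open>(e / (3*b))\<^sup>2 > 0\<close>] by blast
        from that[of K] this[of K] show ?thesis by simp
      qed
      have close: "\<bar>l2_ip M (x j) z - l2_ip M (x j) (s m)\<bar> < e/3" for j
      proof -
        let ?d = "\<lambda>x. z x - s m x - y x"
        have dsi: "square_integrable M ?d" by (intro square_integrable_diff z ssi y)
        have "l2_ip M (x j) z - l2_ip M (x j) (s m) = l2_ip M (x j) ?d"
          using xy[of j] unfolding l2_ip_commute[of M "x j"]
          by (simp add: l2_ip_diff_left square_integrable_diff z ssi y si)
        also have "\<bar>\<dots>\<bar> \<le> sqrt (l2_sq M (x j)) * sqrt (l2_sq M ?d)"
          by (intro l2_ip_cauchy_schwarz si dsi)
        also have "\<dots> \<le> b * sqrt (l2_sq M ?d)"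
          using b by (intro mult_right_mono) auto
        also have "\<dots> < b * (e / (3*b))"
          using m b \<open>e > 0\<close> by (intro mult_strict_left_mono real_less_lsqrt) auto
        finally show ?thesis using b by simp
      qed
      have "Cauchy (\<lambda>n. l2_ip M (x (r n)) (s m))"
        using VS[OF s[of m]] by (intro convergent_Cauchy) auto
      then obtain K where K: "\<And>p q. p \<ge> K \<Longrightarrow> q \<ge> K \<Longrightarrow> dist (l2_ip M (x (r p)) (s m)) (l2_ip M (x (r q)) (s m)) < e/3"
        using \<open>e > 0\<close> unfolding Cauchy_def by (meson divide_pos_pos zero_less_numeral)
      show "\<exists>K. \<forall>p\<ge>K. \<forall>q\<ge>K. dist (l2_ip M (x (r p)) z) (l2_ip M (x (r q)) z) < e"
      proof (intro exI[of _ K] allI impI)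
        fix p q assume "p \<ge> K" "q \<ge> K"
        from K[OF this] close[of "r p"] close[of "r q"]
        show "dist (l2_ip M (x (r p)) z) (l2_ip M (x (r q)) z) < e"
          unfolding dist_real_def by linarith
      qed
    qed
    then show ?thesis by (rule Cauchy_convergent)
  qed
  \<comment> \<open>The convex hulls of the tails $x_{r(m)}, x_{r(m+1)}, \dots$\<close>
  define W where "W m = {f. \<exists>N c. f = (\<lambda>t. \<Sum>j<(N::nat). (c j::real) *\<^sub>R x (r j) t) \<and>
      (\<forall>j. 0 \<le> c j) \<and> (\<forall>j<m. c j = 0) \<and> (\<forall>j\<ge>N. c j = 0) \<and> (\<Sum>j<N. c j) = 1}" for m :: nat
  obtain f y where f: "\<And>m. f m \<in> W m" and y: "square_integrable M y"
    and fy: "(\<lambda>m. l2_sq M (\<lambda>x. f m x - y x)) \<longlonglongrightarrow> 0"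
  proof (rule l2_minimizing_sequence[of W M B])
    show "square_integrable M f" if "f \<in> W m" for m f
      using that unfolding W_def by (auto intro!: square_integrable_sum square_integrable_scaleR si)
    show "W (Suc m) \<subseteq> W m" for m unfolding W_def by (auto simp: less_Suc_eq)
    show "\<exists>f\<in>W m. l2_sq M f \<le> B" for m
    proof (intro bexI)
      show "l2_sq M (x (r m)) \<le> B" by (rule bnd)
      show "x (r m) \<in> W m" unfolding W_def
        by (rule CollectI, rule exI[of _ "Suc m"], rule exI[of _ "\<lambda>j. if j = m then 1 else 0"])
          (auto simp: if_distrib[of "\<lambda>a. a *\<^sub>R _"] cong: if_cong)
    qed
    fix m f g assume "f \<in> W m" "g \<in> W m"
    then obtain N c N' c' where f: "f = (\<lambda>t. \<Sum>j<(N::nat). (c j::real) *\<^sub>R x (r j) t)"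
        and c: "(\<forall>j. 0 \<le> c j)" "(\<forall>j<m. c j = 0)" "(\<forall>j\<ge>N. c j = 0)" "(\<Sum>j<N. c j) = 1"
        and g: "g = (\<lambda>t. \<Sum>j<(N'::nat). (c' j::real) *\<^sub>R x (r j) t)"
        and c': "(\<forall>j. 0 \<le> c' j)" "(\<forall>j<m. c' j = 0)" "(\<forall>j\<ge>N'. c' j = 0)" "(\<Sum>j<N'. c' j) = 1"
      unfolding W_def by blast
    let ?N = "max N N'"
    have f': "f = (\<lambda>t. \<Sum>j<?N. c j *\<^sub>R x (r j) t)" unfolding f
      by (rule ext, rule sum.mono_neutral_left) (use c in auto)
    have g': "g = (\<lambda>t. \<Sum>j<?N. c' j *\<^sub>R x (r j) t)" unfolding g
      by (rule ext, rule sum.mono_neutral_left) (use c' in auto)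
    have s1: "(\<Sum>j<?N. c j) = 1" unfolding c(4)[symmetric]
      by (rule sum.mono_neutral_right) (use c in auto)
    have s2: "(\<Sum>j<?N. c' j) = 1" unfolding c'(4)[symmetric]
      by (rule sum.mono_neutral_right) (use c' in auto)
    show "(\<lambda>x. (1/2) *\<^sub>R (f x + g x)) \<in> W m" unfolding W_def
    proof (rule CollectI, rule exI[of _ ?N], rule exI[of _ "\<lambda>j. (1/2) * (c j + c' j)"], intro conjI)
      show "(\<lambda>t. (1/2) *\<^sub>R (f t + g t)) = (\<lambda>t. \<Sum>j<?N. ((1/2) * (c j + c' j)) *\<^sub>R x (r j) t)"
        unfolding f' g'
        by (rule ext) (simp only: scaleR_sum_right sum.distrib[symmetric] scaleR_left.add[symmetric] scaleR_scaleR)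
      show "(\<Sum>j<?N. (1/2) * (c j + c' j)) = 1"
        using s1 s2 by (simp only: sum_distrib_left[symmetric] sum.distrib) simp
    qed (use c c' in auto)
  qed auto
  have fsi: "square_integrable M (f m)" for m
    using f[of m] unfolding W_def by (auto intro!: square_integrable_sum square_integrable_scaleR si)
  have weak: "(\<lambda>j. l2_ip M (x (r j)) g) \<longlonglongrightarrow> l2_ip M y g" if g: "square_integrable M g" for g
  proof -
    obtain L where L: "(\<lambda>j. l2_ip M (x (r j)) g) \<longlonglongrightarrow> L" using convz[OF g] by (auto simp: convergent_def)
    have "(\<lambda>m. l2_ip M (f m) g) \<longlonglongrightarrow> L"
    proof (rule LIMSEQ_I)
      fix e :: real assume "e > 0"
      then obtain K where K: "\<And>j. j \<ge> K \<Longrightarrow> \<bar>l2_ip M (x (r j)) g - L\<bar> < e/2"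
        using LIMSEQ_D[OF L, of "e/2"] by auto
      show "\<exists>K. \<forall>m\<ge>K. norm (l2_ip M (f m) g - L) < e"
      proof (intro exI[of _ K] allI impI)
        fix m assume "m \<ge> K"
        obtain N c where fm: "f m = (\<lambda>t. \<Sum>j<(N::nat). (c j::real) *\<^sub>R x (r j) t)"
          and c: "(\<forall>j. 0 \<le> c j)" "(\<forall>j<m. c j = 0)" "(\<Sum>j<N. c j) = 1"
          using f[of m] unfolding W_def by blast
        have "l2_ip M (f m) g = (\<Sum>j<N. c j * l2_ip M (x (r j)) g)"
          unfolding fm by (subst l2_ip_sum_left) (auto simp: l2_ip_scaleR_left intro: square_integrable_scaleR si g)
        then have "l2_ip M (f m) g - L = (\<Sum>j<N. c j * (l2_ip M (x (r j)) g - L))"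
          using c(3) by (simp add: algebra_simps sum_subtractf flip: sum_distrib_left sum_distrib_right)
        also have "\<bar>\<dots>\<bar> \<le> (\<Sum>j<N. \<bar>c j * (l2_ip M (x (r j)) g - L)\<bar>)" by (rule sum_abs)
        also have "\<dots> \<le> (\<Sum>j<N. c j * (e/2))"
        proof (rule sum_mono)
          fix j
          show "\<bar>c j * (l2_ip M (x (r j)) g - L)\<bar> \<le> c j * (e/2)"
          proof (cases "j < m")
            case False
            then have "\<bar>l2_ip M (x (r j)) g - L\<bar> \<le> e/2" using K[of j] \<open>m \<ge> K\<close> by simp
            then show ?thesis using c(1) mult_left_mono[of "\<bar>l2_ip M (x (r j)) g - L\<bar>" "e/2" "c j"]
              by (simp add: abs_mult)
          qed (use c in auto)
        qed
        also have "\<dots> = e/2" using c(3) by (simp flip: sum_distrib_right sum_divide_distrib)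
        finally show "norm (l2_ip M (f m) g - L) < e" using \<open>e > 0\<close> by simp
      qed
    qed
    moreover have "(\<lambda>m. l2_ip M (f m) g) \<longlonglongrightarrow> l2_ip M y g"
      by (intro l2_ip_tendsto_left fsi y g fy)
    ultimately show ?thesis using L LIMSEQ_unique by blast
  qed
  have "\<forall>m. \<exists>N c. f m = (\<lambda>t. \<Sum>j<(N::nat). (c j::real) *\<^sub>R x (r j) t) \<and> (\<Sum>j<N. c j) = 1"
    using f unfolding W_def by blast
  then obtain N c where Nc: "\<And>m. f m = (\<lambda>t. \<Sum>j<(N m::nat). (c m j::real) *\<^sub>R x (r j) t)" "\<And>m. (\<Sum>j<N m. c m j) = 1"
    by metis
  show ?thesis
    by (rule that[OF r y weak Nc(2)]) (use fy Nc(1) in auto)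
qed

section \<open>Smooth functions and bump functions\<close>

lemma partial_deriv_eq: "(f has_derivative f') (at x) \<Longrightarrow> partial_deriv i f x = f' (axis i 1)"
  unfolding partial_deriv_def by (metis frechet_derivative_at)

lemma iter_partial_append: "iter_partial (is @ js) f = iter_partial is (iter_partial js f)"
  by (induction "is") auto

text \<open>Smoothness quantifies over all iterated derivatives; it is established coinductively, by
exhibiting a family of differentiable functions that is closed under partial differentiation.\<close>

lemma smooth_if_closed_under_partial_deriv:
  assumes "f \<in> F" "\<And>f x. f \<in> F \<Longrightarrow> f differentiable (at x)" "\<And>f i. f \<in> F \<Longrightarrow> partial_deriv i f \<in> F"
  shows "smooth f"
proof -
  have "iter_partial is f \<in> F" for "is"
    using assms by (induction "is") auto
  then show ?thesis unfolding smooth_def using assms(2) by blast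
qed

lemma smooth_differentiable: "smooth f \<Longrightarrow> f differentiable (at x)"
  unfolding smooth_def by (drule spec[of _ "[]"]) auto

lemma smooth_has_derivative: "smooth f \<Longrightarrow> (f has_derivative frechet_derivative f (at x)) (at x)"
  using smooth_differentiable by (simp add: frechet_derivative_works)

lemma smooth_partial_deriv:
  assumes "smooth f" shows "smooth (partial_deriv i f)"
proof -
  have "iter_partial is (partial_deriv i f) = iter_partial (is @ [i]) f" for "is"
    by (simp add: iter_partial_append)
  then show ?thesis using assms unfolding smooth_def by metis
qed

lemma smooth_iter_partial: "smooth f \<Longrightarrow> smooth (iter_partial is f)"
  by (induction "is") (auto intro: smooth_partial_deriv)

lemma smooth_continuous_on: "smooth f \<Longrightarrow> continuous_on S f"
  by (meson continuous_at_imp_continuous_on differentiable_imp_continuous_within smooth_differentiable)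

lemma partial_deriv_add:
  assumes "f differentiable (at x)" "g differentiable (at x)"
  shows "partial_deriv i (\<lambda>x. f x + g x) x = partial_deriv i f x + partial_deriv i g x"
  using assms unfolding frechet_derivative_works
  by (subst partial_deriv_eq[OF has_derivative_add]) (auto simp: partial_deriv_def)

lemma partial_deriv_mult:
  assumes "f differentiable (at x)" "g differentiable (at x)"
  shows "partial_deriv i (\<lambda>x. f x * g x) x = f x * partial_deriv i g x + partial_deriv i f x * g x"
  using assms unfolding frechet_derivative_works
  by (subst partial_deriv_eq[OF has_derivative_mult]) (auto simp: partial_deriv_def)

lemma partial_deriv_const [simp]: "partial_deriv i (\<lambda>x. c) x = 0"
  by (subst partial_deriv_eq[OF has_derivative_const]) simp

lemma partial_deriv_cnj:
  assumes "f differentiable (at x)"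
  shows "partial_deriv i (\<lambda>x. cnj (f x)) x = cnj (partial_deriv i f x)"
  using assms unfolding frechet_derivative_works
  by (subst partial_deriv_eq[OF has_derivative_cnj]) (auto simp: partial_deriv_def)

text \<open>The partial derivatives of a product are sums of products, so sums and products have to be
closed off simultaneously.\<close>

inductive_set smooth_algebra :: "(real^'n \<Rightarrow> complex) set" where
  base: "smooth f \<Longrightarrow> f \<in> smooth_algebra"
| add: "f \<in> smooth_algebra \<Longrightarrow> g \<in> smooth_algebra \<Longrightarrow> (\<lambda>x. f x + g x) \<in> smooth_algebra"
| mult: "f \<in> smooth_algebra \<Longrightarrow> g \<in> smooth_algebra \<Longrightarrow> (\<lambda>x. f x * g x) \<in> smooth_algebra"

lemma smooth_algebra_smooth:
  assumes "f \<in> smooth_algebra"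
  shows "smooth f"
proof -
  have diff: "f differentiable (at x)" if "f \<in> smooth_algebra" for f :: "real^'n \<Rightarrow> complex" and x
    using that by induction (auto intro: smooth_differentiable)
  have part: "partial_deriv i f \<in> smooth_algebra" if "f \<in> smooth_algebra" for f :: "real^'n \<Rightarrow> complex" and i
    using that
  proof induction
    case (base f)
    then show ?case by (intro smooth_algebra.base smooth_partial_deriv)
  next
    case (add f g)
    then have "partial_deriv i (\<lambda>x. f x + g x) = (\<lambda>x. partial_deriv i f x + partial_deriv i g x)"
      by (auto simp: partial_deriv_add diff)
    then show ?case using add by (auto intro: smooth_algebra.add)
  next
    case (mult f g)
    then have "partial_deriv i (\<lambda>x. f x * g x) = (\<lambda>x. f x * partial_deriv i g x + partial_deriv i f x * g x)"
      by (auto simp: partial_deriv_mult diff)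
    then show ?case using mult by (auto intro!: smooth_algebra.add smooth_algebra.mult)
  qed
  show ?thesis by (rule smooth_if_closed_under_partial_deriv[OF assms diff part])
qed

lemma smooth_add: "smooth f \<Longrightarrow> smooth g \<Longrightarrow> smooth (\<lambda>x. f x + g x)"
  by (rule smooth_algebra_smooth[OF smooth_algebra.add[OF smooth_algebra.base smooth_algebra.base]])

lemma smooth_mult: "smooth f \<Longrightarrow> smooth g \<Longrightarrow> smooth (\<lambda>x. f x * g x)"
  by (rule smooth_algebra_smooth[OF smooth_algebra.mult[OF smooth_algebra.base smooth_algebra.base]])

lemma smooth_const: "smooth (\<lambda>x. c)"
  by (rule smooth_if_closed_under_partial_deriv[where F="range (\<lambda>c x. c)"])
    (auto intro!: image_eqI[of _ _ 0])

lemma smooth_cnj: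
  assumes "smooth f" shows "smooth (\<lambda>x. cnj (f x))"
proof (rule smooth_if_closed_under_partial_deriv[where F="{\<lambda>x. cnj (f x) |f. smooth f}"])
  show "(\<lambda>x. cnj (f x)) \<in> {\<lambda>x. cnj (f x) |f. smooth f}" using assms by blast
  fix g :: "real^'n \<Rightarrow> complex" and x i assume "g \<in> {\<lambda>x. cnj (f x) |f. smooth f}"
  then obtain f where g: "g = (\<lambda>x. cnj (f x))" and f: "smooth f" by blast
  show "g differentiable (at x)"
    unfolding g differentiable_def using has_derivative_cnj[OF smooth_has_derivative[OF f]] by blast
  have "partial_deriv i g = (\<lambda>x. cnj (partial_deriv i f x))"
    unfolding g using f by (auto simp: partial_deriv_cnj smooth_differentiable)
  then show "partial_deriv i g \<in> {\<lambda>x. cnj (f x) |f. smooth f}" using smooth_partial_deriv[OF f] by blast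
qed

lemma smooth_prod:
  assumes "finite I" "\<And>i. i \<in> I \<Longrightarrow> smooth (f i)"
  shows "smooth (\<lambda>x. \<Prod>i\<in>I. f i x)"
  using assms by (induction I) (auto intro: smooth_const smooth_mult)

lemma smooth_sum:
  assumes "\<And>i. i \<in> I \<Longrightarrow> smooth (f i)"
  shows "smooth (\<lambda>x. \<Sum>i\<in>I. f i x)"
  using assms by (induction I rule: infinite_finite_induct) (auto intro: smooth_const smooth_add)

text \<open>The sequence \<open>H\<close> lists the successive derivatives of a function of one variable.\<close>

lemma smooth_ridge:
  fixes b :: "real^'n" and H :: "nat \<Rightarrow> real \<Rightarrow> complex"
  assumes H: "\<And>k t. (H k has_vector_derivative H (Suc k) t) (at t)"
  shows "smooth (\<lambda>x. H 0 (x \<bullet> b))"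
proof (rule smooth_if_closed_under_partial_deriv[where F="{\<lambda>x. c * H k (x \<bullet> b) |c k. True}"])
  show "(\<lambda>x. H 0 (x \<bullet> b)) \<in> {\<lambda>x. c * H k (x \<bullet> b) |c k. True}"
    by (intro CollectI exI[of _ 1] exI[of _ 0]) auto
  fix g :: "real^'n \<Rightarrow> complex" and i assume "g \<in> {\<lambda>x. c * H k (x \<bullet> b) |c k. True}"
  then obtain c k where g: "g = (\<lambda>x. c * H k (x \<bullet> b))" by blast
  have der: "(g has_derivative (\<lambda>h. c * ((h \<bullet> b) *\<^sub>R H (Suc k) (x \<bullet> b)))) (at x)" for x
  proof -
    have "(H k has_derivative (\<lambda>h. h *\<^sub>R H (Suc k) (x \<bullet> b))) (at (x \<bullet> b))"
      using H[of k "x \<bullet> b"] by (simp add: has_vector_derivative_def)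
    then have "((\<lambda>x. H k (x \<bullet> b)) has_derivative (\<lambda>h. (h \<bullet> b) *\<^sub>R H (Suc k) (x \<bullet> b))) (at x)"
      by (rule has_derivative_compose[where f="\<lambda>x. x \<bullet> b" and g="H k", rotated])
        (auto intro!: derivative_eq_intros)
    then show ?thesis unfolding g by (rule has_derivative_mult_right)
  qed
  show "g differentiable (at x)" for x using der unfolding differentiable_def by blast
  have "partial_deriv i g = (\<lambda>x. (c * of_real (axis i 1 \<bullet> b)) * H (Suc k) (x \<bullet> b))"
    by (rule ext) (simp add: partial_deriv_eq[OF der] scaleR_conv_of_real mult.assoc)
  then show "partial_deriv i g \<in> {\<lambda>x. c * H k (x \<bullet> b) |c k. True}" by blast
qed

lemma smooth_real_polynomial_function:
  fixes p :: "real^'n \<Rightarrow> real"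
  shows "real_polynomial_function p \<Longrightarrow> smooth (\<lambda>x. of_real (p x))"
proof (induction rule: real_polynomial_function.induct)
  case (linear f)
  show ?case
  proof (rule smooth_if_closed_under_partial_deriv[where F="insert (\<lambda>x. of_real (f x)) (range (\<lambda>c x. c))"])
    have der: "((\<lambda>x::real^'n. of_real (f x) :: complex) has_derivative (\<lambda>h. of_real (f h))) (at x)" for x
      by (intro has_derivative_of_real bounded_linear_imp_has_derivative linear)
    fix g :: "real^'n \<Rightarrow> complex" and i
    assume g: "g \<in> insert (\<lambda>x. of_real (f x)) (range (\<lambda>c x. c))"
    then show "g differentiable (at x)" for x using der by (auto simp: differentiable_def intro: has_derivative_const)
    have "partial_deriv i (\<lambda>x. of_real (f x) :: complex) = (\<lambda>x. of_real (f (axis i 1)))"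
      by (rule ext) (simp add: partial_deriv_eq[OF der])
    then show "partial_deriv i g \<in> insert (\<lambda>x. of_real (f x)) (range (\<lambda>c x. c))"
    proof -
      have "partial_deriv i (\<lambda>x. c) = (\<lambda>x. 0)" for c :: complex by auto
      with \<open>partial_deriv i (\<lambda>x. complex_of_real (f x)) = _\<close> g show ?thesis by auto
    qed
  qed auto
qed (auto intro: smooth_const smooth_add smooth_mult)

text \<open>The plane wave $e^{i b \cdot x}$.\<close>

definition wave :: "real^'n \<Rightarrow> real^'n \<Rightarrow> complex" where
  "wave b x = exp (\<i> * of_real (x \<bullet> b))"

lemma wave_has_derivative:
  "(wave b has_derivative (\<lambda>h. \<i> * of_real (h \<bullet> b) * wave b x)) (at x)"
proof -
  have "((\<lambda>x. exp (\<i> * of_real (x \<bullet> b))) has_derivative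
      (\<lambda>h. exp (\<i> * of_real (x \<bullet> b)) * (\<i> * of_real (h \<bullet> b)))) (at x)"
    by (rule has_derivative_compose[where f="\<lambda>x. \<i> * of_real (x \<bullet> b)" and g=exp,
          OF _ has_field_derivative_imp_has_derivative[OF DERIV_exp]])
      (auto intro!: derivative_eq_intros)
  then show ?thesis by (simp add: wave_def[abs_def] mult.commute)
qed

lemma partial_deriv_wave: "partial_deriv i (wave b) = (\<lambda>x. \<i> * of_real (b $ i) * wave b x)"
  by (rule ext) (simp add: partial_deriv_eq[OF wave_has_derivative] inner_axis')

lemma smooth_wave: "smooth (wave b)"
proof -
  define H :: "nat \<Rightarrow> real \<Rightarrow> complex" where "H k t = \<i>^k * exp (\<i> * of_real t)" for k t
  have "(H k has_vector_derivative H (Suc k) t) (at t)" for k t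
  proof -
    have "((\<lambda>t. exp (\<i> * of_real t)) has_derivative (\<lambda>h. exp (\<i> * of_real t) * (\<i> * of_real h))) (at t)"
      by (rule has_derivative_compose[where f="\<lambda>t. \<i> * of_real t" and g=exp,
            OF _ has_field_derivative_imp_has_derivative[OF DERIV_exp]])
        (auto intro!: derivative_eq_intros)
    from has_derivative_mult_right[OF this, of "\<i>^k"] show ?thesis
      unfolding H_def has_vector_derivative_def
      by (simp add: scaleR_conv_of_real mult_ac)
  qed
  from smooth_ridge[of H, OF this] show ?thesis
    by (simp add: H_def wave_def[abs_def])
qed

lemma norm_wave [simp]: "norm (wave b x) = 1"
  by (simp add: wave_def)

text \<open>The functions $p(1/t) e^{-1/t}$ for $t > 0$, extended by $0$; they are flat at the origin, and
the family is closed under differentiation because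
$\frac{d}{dt} p(1/t) e^{-1/t} = q(1/t) e^{-1/t}$ with $q(s) = s^2 (p(s) - p'(s))$.\<close>

definition flat :: "real poly \<Rightarrow> real \<Rightarrow> real" where
  "flat p t = (if t \<le> 0 then 0 else poly p (1/t) * exp (- (1/t)))"

lemma poly_over_exp_tendsto_0: "((\<lambda>s. poly q s / exp s) \<longlongrightarrow> (0::real)) at_top"
proof -
  have "((\<lambda>s. \<Sum>i\<le>degree q. coeff q i * (s ^ i / exp s)) \<longlongrightarrow> (\<Sum>i\<le>degree q. coeff q i * 0)) at_top"
    by (intro tendsto_intros tendsto_power_div_exp_0)
  moreover have "poly q s / exp s = (\<Sum>i\<le>degree q. coeff q i * (s ^ i / exp s))" for s
    by (simp add: poly_altdef sum_divide_distrib)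
  ultimately show ?thesis by simp
qed

lemma flat_tendsto_0: "((\<lambda>h. flat p h / h) \<longlongrightarrow> 0) (at 0)"
proof (rule filterlim_split_at)
  show "((\<lambda>h. flat p h / h) \<longlongrightarrow> 0) (at_left 0)"
    by (rule tendsto_eventually) (auto simp: flat_def eventually_at_filter)
  have "((\<lambda>h. poly ([:0,1:] * p) (inverse h) / exp (inverse h)) \<longlongrightarrow> 0) (at_right (0::real))"
    by (rule filterlim_compose[OF poly_over_exp_tendsto_0 filterlim_inverse_at_top_right])
  moreover have "\<forall>\<^sub>F h in at_right 0. poly ([:0,1:] * p) (inverse h) / exp (inverse h) = flat p h / h"
    unfolding eventually_at_filter
    by (rule always_eventually) (auto simp: flat_def exp_minus field_simps)
  ultimately show "((\<lambda>h. flat p h / h) \<longlongrightarrow> 0) (at_right 0)"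
    by (rule Lim_transform_eventually)
qed

lemma flat_has_derivative:
  "(flat p has_real_derivative flat ([:0,0,1:] * (p - pderiv p)) t) (at t)"
proof -
  consider "t < 0" | "t = 0" | "t > 0" by linarith
  then show ?thesis
  proof cases
    case 1
    have "((\<lambda>_. 0) has_real_derivative 0) (at t)" by simp
    then have "(flat p has_real_derivative 0) (at t)"
      by (rule DERIV_cong_ev[THEN iffD1, rotated 3, OF _ refl _ refl])
        (use 1 in \<open>auto simp: flat_def eventually_nhds intro!: exI[of _ "{..<0}"]\<close>)
    then show ?thesis using 1 by (simp add: flat_def)
  next
    case 2
    then show ?thesis using flat_tendsto_0[of p]
      by (simp add: DERIV_def) (simp add: flat_def)
  next
    case 3
    have "((\<lambda>t. poly p (1/t) * exp (- (1/t))) has_real_derivative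
        flat ([:0,0,1:] * (p - pderiv p)) t) (at t)"
      using 3 by (auto intro!: derivative_eq_intros simp: flat_def field_simps power2_eq_square)
    then show ?thesis
      by (rule DERIV_cong_ev[THEN iffD1, rotated 3, OF _ refl _ refl])
        (use 3 in \<open>auto simp: flat_def eventually_nhds intro!: exI[of _ "{0<..}"]\<close>)
  qed
qed

definition box_bump :: "real^'n \<Rightarrow> real^'n \<Rightarrow> real^'n \<Rightarrow> real" where
  "box_bump a b x = (\<Prod>i\<in>UNIV. flat 1 (x $ i - a $ i) * flat 1 (b $ i - x $ i))"

lemma flat_1_nonneg: "flat 1 t \<ge> 0" and flat_1_pos_iff: "flat 1 t > 0 \<longleftrightarrow> t > 0"
  and flat_1_le_1: "flat 1 t \<le> 1"
  by (auto simp: flat_def)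

lemma box_bump_nonneg: "box_bump a b x \<ge> 0"
  unfolding box_bump_def by (intro prod_nonneg) (auto simp: flat_1_nonneg)

lemma box_bump_le_1: "box_bump a b x \<le> 1"
  unfolding box_bump_def
  by (intro prod_le_1) (auto simp: flat_1_nonneg flat_1_le_1 intro!: mult_le_one)

lemma box_bump_pos_iff: "box_bump a b x > 0 \<longleftrightarrow> x \<in> box a b"
proof
  assume "x \<in> box a b"
  then show "box_bump a b x > 0" unfolding box_bump_def
    by (intro prod_pos) (auto simp: mem_box_cart flat_1_pos_iff)
next
  assume pos: "box_bump a b x > 0"
  have "flat 1 (x $ i - a $ i) * flat 1 (b $ i - x $ i) \<noteq> 0" for i
  proof
    assume "flat 1 (x $ i - a $ i) * flat 1 (b $ i - x $ i) = 0"
    then have "box_bump a b x = 0" unfolding box_bump_def by (intro prod_zero) auto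
    then show False using pos by simp
  qed
  then have "flat 1 (x $ i - a $ i) > 0 \<and> flat 1 (b $ i - x $ i) > 0" for i
    using flat_1_nonneg[of "x $ i - a $ i"] flat_1_nonneg[of "b $ i - x $ i"]
    by (auto simp: less_le)
  then show "x \<in> box a b" by (auto simp: mem_box_cart flat_1_pos_iff)
qed

lemma smooth_box_bump: "smooth (\<lambda>x. of_real (box_bump a b x))"
proof -
  define Q where "Q k = ((\<lambda>p. [:0,0,1:] * (p - pderiv p)) ^^ k) (1 :: real poly)" for k
  have H: "((\<lambda>t. of_real (flat (Q k) (t + c)) :: complex) has_vector_derivative of_real (flat (Q (Suc k)) (t + c))) (at t)"
    for k t c
  proof -
    have "(flat (Q k) has_real_derivative flat (Q (Suc k)) (t + c)) (at (t + c))"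
      using flat_has_derivative[of "Q k" "t + c"] by (simp add: Q_def)
    then have "((\<lambda>t. flat (Q k) (t + c)) has_real_derivative flat (Q (Suc k)) (t + c)) (at t)"
      by (simp add: DERIV_shift)
    then show ?thesis by (rule has_vector_derivative_of_real)
  qed
  have "smooth (\<lambda>x. of_real (flat 1 (x $ i - a $ i)) :: complex)"
    "smooth (\<lambda>x. of_real (flat 1 (b $ i - x $ i)) :: complex)" for i
    using smooth_ridge[of "\<lambda>k t. of_real (flat (Q k) (t + - a $ i))", OF H, of "axis i 1"]
      smooth_ridge[of "\<lambda>k t. of_real (flat (Q k) (t + b $ i))", OF H, of "- axis i 1"]
    by (simp_all add: inner_axis Q_def)
  then have "smooth (\<lambda>x. \<Prod>i\<in>UNIV. of_real (flat 1 (x $ i - a $ i)) * of_real (flat 1 (b $ i - x $ i)) :: complex)"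
    by (intro smooth_prod smooth_mult) auto
  then show ?thesis by (simp add: box_bump_def)
qed

lemma compact_closed_subset: "compact K \<Longrightarrow> S \<subseteq> K \<Longrightarrow> closed S \<Longrightarrow> compact S"
  for S :: "'a::t2_space set"
  using compact_Int_closed[of K S] by (simp add: Int_absorb1)

lemma test_functions_smooth: "\<phi> \<in> test_functions D \<Longrightarrow> smooth \<phi>"
  by (simp add: test_functions_def)

lemma test_functions_subset_support:
  assumes "\<phi> \<in> test_functions D" "smooth \<psi>" "{x. \<psi> x \<noteq> 0} \<subseteq> closure {x. \<phi> x \<noteq> 0}"
  shows "\<psi> \<in> test_functions D"
proof -
  have sub: "closure {x. \<psi> x \<noteq> 0} \<subseteq> closure {x. \<phi> x \<noteq> 0}"
    using assms(3) by (simp add: closure_minimal)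
  then have "compact (closure {x. \<psi> x \<noteq> 0})"
    using assms(1) by (intro compact_closed_subset[OF _ sub]) (auto simp: test_functions_def)
  then show ?thesis using assms sub unfolding test_functions_def by auto
qed

lemma test_functions_mult_left:
  assumes "smooth f" "\<phi> \<in> test_functions D"
  shows "(\<lambda>x. f x * \<phi> x) \<in> test_functions D"
  by (rule test_functions_subset_support[OF assms(2)])
    (use assms test_functions_smooth closure_subset in \<open>auto intro!: smooth_mult subsetD[OF closure_subset]\<close>)

lemma test_functions_cnj:
  assumes "\<phi> \<in> test_functions D"
  shows "(\<lambda>x. cnj (\<phi> x)) \<in> test_functions D"
  by (rule test_functions_subset_support[OF assms])
    (use assms test_functions_smooth closure_subset in \<open>auto intro!: smooth_cnj subsetD[OF closure_subset]\<close>)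

lemma test_functions_partial_deriv:
  assumes "\<phi> \<in> test_functions D"
  shows "partial_deriv i \<phi> \<in> test_functions D"
proof (rule test_functions_subset_support[OF assms])
  show "smooth (partial_deriv i \<phi>)" using assms by (intro smooth_partial_deriv test_functions_smooth)
  show "{x. partial_deriv i \<phi> x \<noteq> 0} \<subseteq> closure {x. \<phi> x \<noteq> 0}"
  proof (rule ccontr)
    assume "\<not> ?thesis"
    then obtain x where x: "partial_deriv i \<phi> x \<noteq> 0" "x \<in> - closure {x. \<phi> x \<noteq> 0}" by blast
    have "(\<phi> has_derivative (\<lambda>_. 0)) (at x)"
    proof (rule has_derivative_transform_within_open[of "\<lambda>_. 0" _ _ _ "- closure {x. \<phi> x \<noteq> 0}"])
      fix y assume "y \<in> - closure {x. \<phi> x \<noteq> 0}"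
      then show "0 = \<phi> y" using subsetD[OF closure_subset, of y "{x. \<phi> x \<noteq> 0}"] by auto
    qed (use x in auto)
    then show False using x(1) by (simp add: partial_deriv_eq)
  qed
qed

lemma test_functions_iter_partial: "\<phi> \<in> test_functions D \<Longrightarrow> iter_partial is \<phi> \<in> test_functions D"
  by (induction "is") (auto intro: test_functions_partial_deriv)

lemma test_functions_zero: "(\<lambda>x. 0) \<in> test_functions D"
  by (simp add: test_functions_def smooth_const)

lemma test_functions_add:
  assumes "\<phi> \<in> test_functions D" "\<psi> \<in> test_functions D"
  shows "(\<lambda>x. \<phi> x + \<psi> x) \<in> test_functions D"
proof -
  have sub: "closure {x. \<phi> x + \<psi> x \<noteq> 0} \<subseteq> closure {x. \<phi> x \<noteq> 0} \<union> closure {x. \<psi> x \<noteq> 0}"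
    unfolding closure_Un[symmetric] by (rule closure_mono) auto
  have "compact (closure {x. \<phi> x \<noteq> 0} \<union> closure {x. \<psi> x \<noteq> 0})"
    using assms by (intro compact_Un) (auto simp: test_functions_def)
  then have "compact (closure {x. \<phi> x + \<psi> x \<noteq> 0})"
    using sub by (rule compact_closed_subset) simp
  then show ?thesis using assms sub by (auto simp: test_functions_def intro: smooth_add)
qed

lemma test_functions_sum:
  assumes "\<And>i. i \<in> I \<Longrightarrow> f i \<in> test_functions D"
  shows "(\<lambda>x. \<Sum>i\<in>I. f i x) \<in> test_functions D"
  using assms
  by (induction I rule: infinite_finite_induct) (auto intro: test_functions_zero test_functions_add)

lemma test_functions_scale: "\<phi> \<in> test_functions D \<Longrightarrow> (\<lambda>x. c * \<phi> x) \<in> test_functions D"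
  by (rule test_functions_mult_left[OF smooth_const])

lemma test_functions_diff:
  assumes "\<phi> \<in> test_functions D" "\<psi> \<in> test_functions D"
  shows "(\<lambda>x. \<phi> x - \<psi> x) \<in> test_functions D"
  using test_functions_add[OF assms(1) test_functions_scale[OF assms(2), of "-1"]] by simp

lemma box_bump_test_function:
  assumes "cbox a b \<subseteq> D" "smooth f"
  shows "(\<lambda>x. of_real (box_bump a b x) * f x) \<in> test_functions D"
proof -
  have "{x. (of_real (box_bump a b x) :: complex) \<noteq> 0} \<subseteq> cbox a b"
    using box_bump_pos_iff[of a b] box_bump_nonneg[of a b] box_subset_cbox[of a b]
    by (auto simp: less_le)
  then have sub: "closure {x. (of_real (box_bump a b x) :: complex) \<noteq> 0} \<subseteq> cbox a b"
    by (rule closure_minimal) (rule closed_cbox)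
  then have "compact (closure {x. (of_real (box_bump a b x) :: complex) \<noteq> 0})"
    by (rule compact_closed_subset[OF compact_cbox]) simp
  then have "(\<lambda>x. of_real (box_bump a b x)) \<in> test_functions D"
    using sub assms by (auto simp: test_functions_def smooth_box_bump)
  from test_functions_mult_left[OF assms(2) this] show ?thesis by (simp add: mult.commute)
qed

lemma partial_deriv_sum:
  assumes "\<And>j. j \<in> I \<Longrightarrow> smooth (f j)"
  shows "partial_deriv i (\<lambda>x. \<Sum>j\<in>I. f j x) = (\<lambda>x. \<Sum>j\<in>I. partial_deriv i (f j) x)"
  using assms
proof (induction I rule: infinite_finite_induct)
  case (insert j I)
  have "partial_deriv i (\<lambda>x. f j x + (\<Sum>j\<in>I. f j x)) = (\<lambda>x. partial_deriv i (f j) x + partial_deriv i (\<lambda>x. \<Sum>j\<in>I. f j x) x)"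
    using insert.prems by (auto intro!: partial_deriv_add smooth_differentiable smooth_sum)
  with insert show ?case by simp
qed auto

lemma partial_deriv_scale:
  assumes "smooth f"
  shows "partial_deriv i (\<lambda>x. c * f x) = (\<lambda>x. c * partial_deriv i f x)"
  using smooth_differentiable[OF assms] by (auto simp: partial_deriv_mult)

lemma iter_partial_cnj:
  assumes "smooth f"
  shows "iter_partial is (\<lambda>x. cnj (f x)) = (\<lambda>x. cnj (iter_partial is f x))"
  by (induction "is") (auto simp: partial_deriv_cnj smooth_differentiable smooth_iter_partial assms)

lemma iter_partial_combination:
  assumes "\<And>j. j \<in> I \<Longrightarrow> smooth (f j)"
  shows "iter_partial is (\<lambda>x. \<Sum>j\<in>I. c j * f j x) = (\<lambda>x. \<Sum>j\<in>I. c j * iter_partial is (f j) x)"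
proof (induction "is")
  case (Cons i "is")
  then show ?case
    using assms by (simp add: partial_deriv_sum partial_deriv_scale smooth_iter_partial smooth_mult smooth_const)
qed simp

lemma laplacian_eq: "laplacian f x = (\<Sum>i\<in>UNIV. partial_deriv i (partial_deriv i f) x)"
  by (simp add: laplacian_def)

lemma laplacian_cnj: "smooth f \<Longrightarrow> laplacian (\<lambda>x. cnj (f x)) x = cnj (laplacian f x)"
  unfolding laplacian_def iter_partial_cnj by simp

lemma test_functions_laplacian: "\<phi> \<in> test_functions D \<Longrightarrow> laplacian \<phi> \<in> test_functions D"
  unfolding laplacian_def[abs_def] by (intro test_functions_sum test_functions_iter_partial)

text \<open>The factor $|b|^2$ is what makes oscillating test functions useful: for large $b$ the last term
dominates, and it contains no derivative of $\phi$.\<close>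

lemma laplacian_wave_mult:
  assumes "smooth \<phi>"
  shows "laplacian (\<lambda>x. wave b x * \<phi> x) x =
    wave b x * (laplacian \<phi> x + 2 * \<i> * (\<Sum>i\<in>UNIV. of_real (b $ i) * partial_deriv i \<phi> x)
      - of_real (b \<bullet> b) * \<phi> x)"
proof -
  have 1: "partial_deriv i (\<lambda>x. wave b x * f x) = (\<lambda>x. wave b x * (partial_deriv i f x + \<i> * of_real (b $ i) * f x))"
    if "smooth f" for f i
    using that smooth_wave[of b]
    by (auto simp: partial_deriv_mult smooth_differentiable partial_deriv_wave algebra_simps)
  have 2: "partial_deriv i (\<lambda>x. partial_deriv i \<phi> x + \<i> * of_real (b $ i) * \<phi> x)
      = (\<lambda>x. partial_deriv i (partial_deriv i \<phi>) x + \<i> * of_real (b $ i) * partial_deriv i \<phi> x)" for i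
    using assms
    by (auto simp: partial_deriv_add partial_deriv_scale smooth_differentiable smooth_partial_deriv smooth_mult smooth_const)
  have "partial_deriv i (partial_deriv i (\<lambda>x. wave b x * \<phi> x)) x =
      wave b x * (partial_deriv i (partial_deriv i \<phi>) x + 2 * \<i> * (of_real (b $ i) * partial_deriv i \<phi> x)
        - of_real (b $ i * b $ i) * \<phi> x)" for i
    using assms
    by (simp add: 1 2 smooth_add smooth_mult smooth_const smooth_partial_deriv)
       (simp add: algebra_simps)
  note 3 = this
  show ?thesis unfolding laplacian_eq 3
    by (simp add: inner_vec_def sum.distrib sum_subtractf sum_distrib_left sum_distrib_right algebra_simps)
qed

section \<open>Integral estimates for test functions\<close>

definition compactly_supported :: "(real^'n \<Rightarrow> 'b::euclidean_space) \<Rightarrow> bool" where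
  "compactly_supported f \<longleftrightarrow> continuous_on UNIV f \<and> (\<exists>R. \<forall>x. norm x > R \<longrightarrow> f x = 0)"

lemma compactly_supported_integrable:
  assumes "compactly_supported f" shows "integrable lborel f"
proof -
  obtain R where R: "\<And>x. norm x > R \<Longrightarrow> f x = 0" and c: "continuous_on UNIV f"
    using assms by (auto simp: compactly_supported_def)
  have "integrable lborel (\<lambda>x. indicator (cball 0 R) x *\<^sub>R f x)"
    by (rule borel_integrable_compact) (auto intro: continuous_on_subset[OF c])
  moreover have "(\<lambda>x. indicator (cball 0 R) x *\<^sub>R f x) = f"
    using R by (auto simp: indicator_def not_le)
  ultimately show ?thesis by simp
qed

lemma compactly_supported_bounded:
  assumes "compactly_supported f" obtains B where "\<And>x. norm (f x) \<le> B" "B > 0"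
proof -
  obtain R where R: "\<And>x. norm x > R \<Longrightarrow> f x = 0" and c: "continuous_on UNIV f"
    using assms by (auto simp: compactly_supported_def)
  have "compact (f ` cball 0 R)"
    by (intro compact_continuous_image continuous_on_subset[OF c]) auto
  then obtain B where B: "B > 0" "\<And>x. x \<in> cball 0 R \<Longrightarrow> norm (f x) \<le> B"
    by (auto dest!: compact_imp_bounded simp: bounded_pos)
  have "norm (f x) \<le> B" for x
    using B(1) B(2)[of x] R[of x] by (cases "norm x > R") (auto simp: not_less)
  then show ?thesis using that B by blast
qed

lemma compactly_supported_square_integrable:
  assumes "compactly_supported f" shows "square_integrable lborel f"
proof -
  have "compactly_supported (\<lambda>x. (norm (f x))\<^sup>2)"
    using assms by (auto simp: compactly_supported_def intro!: continuous_intros exI)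
  from compactly_supported_integrable[OF this] compactly_supported_integrable[OF assms]
  show ?thesis by (auto simp: square_integrable_def)
qed

lemma compactly_supported_translate:
  assumes "compactly_supported f" shows "compactly_supported (\<lambda>x. f (x + h))"
proof -
  obtain R where R: "\<And>x. norm x > R \<Longrightarrow> f x = 0" and c: "continuous_on UNIV f"
    using assms by (auto simp: compactly_supported_def)
  have "continuous_on UNIV (\<lambda>x. f (x + h))"
    by (rule continuous_on_compose2[OF c]) (auto intro!: continuous_intros)
  moreover have "f (x + h) = 0" if "norm x > R + norm h" for x
    using R[of "x + h"] that norm_triangle_ineq4[of "x + h" h] by simp
  ultimately show ?thesis unfolding compactly_supported_def by blast
qed

lemma compactly_supported_mult:
  fixes f :: "real^'n \<Rightarrow> complex"
  assumes "compactly_supported f" "continuous_on UNIV g"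
  shows "compactly_supported (\<lambda>x. g x * f x)"
  using assms by (auto simp: compactly_supported_def intro!: continuous_intros)

lemma compactly_supported_diff:
  assumes "compactly_supported f" "compactly_supported g"
  shows "compactly_supported (\<lambda>x. f x - g x)"
proof -
  obtain R where R: "\<And>x. norm x > R \<Longrightarrow> f x = 0" 
    using assms by (auto simp: compactly_supported_def)
  obtain S where S: "\<And>x. norm x > S \<Longrightarrow> g x = 0"
    using assms by (auto simp: compactly_supported_def)
  have "f x - g x = 0" if "norm x > max R S" for x using R S that by simp
  moreover have "continuous_on UNIV (\<lambda>x. f x - g x)"
    using assms by (auto simp: compactly_supported_def intro!: continuous_intros)
  ultimately show ?thesis unfolding compactly_supported_def by blast
qed

lemma compactly_supported_test_function:
  assumes "\<phi> \<in> test_functions D" shows "compactly_supported \<phi>"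
proof -
  have "bounded (closure {x. \<phi> x \<noteq> 0})"
    using assms by (intro compact_imp_bounded) (auto simp: test_functions_def)
  then obtain R where R: "\<And>x. x \<in> closure {x. \<phi> x \<noteq> 0} \<Longrightarrow> norm x \<le> R"
    by (auto simp: bounded_iff)
  have "\<phi> x = 0" if "norm x > R" for x
    using R[of x] that closure_subset[of "{x. \<phi> x \<noteq> 0}"] by force
  then show ?thesis using smooth_continuous_on[OF test_functions_smooth[OF assms]]
    unfolding compactly_supported_def by blast
qed

lemma test_function_outside:
  assumes "\<phi> \<in> test_functions D" "x \<notin> D" shows "\<phi> x = 0"
  using assms closure_subset[of "{x. \<phi> x \<noteq> 0}"] by (auto simp: test_functions_def)

lemma test_function_measurable [measurable]:
  "\<phi> \<in> test_functions D \<Longrightarrow> \<phi> \<in> borel_measurable borel"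
  by (intro borel_measurable_continuous_onI smooth_continuous_on test_functions_smooth)

text \<open>The function spaces live on the completed measure restricted to $D$; test functions vanish
outside $D$ and are Borel, so their integrals can be computed on the whole space, where
translations are available.\<close>

lemma integral_lebesgue_on_eq_lborel:
  fixes f :: "real^'n \<Rightarrow> 'b::euclidean_space"
  assumes "D \<in> sets lebesgue" "f \<in> borel_measurable borel" "\<And>x. x \<notin> D \<Longrightarrow> f x = 0"
  shows "(LINT x|lebesgue_on D. f x) = (LINT x|lborel. f x)"
    and "integrable (lebesgue_on D) f \<longleftrightarrow> integrable lborel f"
proof -
  have ind: "(\<lambda>x. indicator D x *\<^sub>R f x) = f"
    using assms(3) by (auto simp: indicator_def)
  show "(LINT x|lebesgue_on D. f x) = (LINT x|lborel. f x)"
    using assms(1,2) by (subst integral_restrict_space) (auto simp: ind integral_completion)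
  show "integrable (lebesgue_on D) f \<longleftrightarrow> integrable lborel f"
    using assms(1,2) by (subst integrable_restrict_space) (auto simp: ind integrable_completion)
qed

lemma l2_sq_test_function:
  assumes "open D" "\<phi> \<in> test_functions D"
  shows "l2_sq (lebesgue_on D) \<phi> = l2_sq lborel \<phi>"
  unfolding l2_sq_def using assms test_function_outside[OF assms(2)]
  by (intro integral_lebesgue_on_eq_lborel) auto

lemma test_function_square_integrable:
  assumes "open D" "\<phi> \<in> test_functions D"
  shows "square_integrable (lebesgue_on D) \<phi>"
proof -
  have "square_integrable lborel \<phi>"
    by (intro compactly_supported_square_integrable compactly_supported_test_function[OF assms(2)])
  then have "integrable lborel (\<lambda>x. (norm (\<phi> x))\<^sup>2)" by (rule square_integrable_sq)
  then have "integrable (lebesgue_on D) (\<lambda>x. (norm (\<phi> x))\<^sup>2)"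
    using assms test_function_outside[OF assms(2)]
    by (subst integral_lebesgue_on_eq_lborel(2)) auto
  moreover have "\<phi> \<in> borel_measurable (lebesgue_on D)"
    using test_function_measurable[OF assms(2)]
    by (intro measurable_restrict_space1) (simp add: measurable_completion)
  ultimately show ?thesis by (simp add: square_integrable_def)
qed

lemma integral_lborel_translate:
  fixes f :: "real^'n \<Rightarrow> 'b::euclidean_space"
  assumes [measurable]: "f \<in> borel_measurable borel"
  shows "(\<integral>x. f (x + h) \<partial>lborel) = (\<integral>x. f x \<partial>lborel)"
proof -
  have "(\<integral>x. f x \<partial>lborel) = (\<integral>x. f x \<partial>distr lborel borel ((+) h))"
    by (simp add: lborel_distr_plus)
  also have "\<dots> = (\<integral>x. f (h + x) \<partial>lborel)"
    by (rule integral_distr) auto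
  finally show ?thesis by (simp add: add.commute)
qed

lemma l2_sq_translate:
  assumes "compactly_supported (f :: real^'n \<Rightarrow> 'b::euclidean_space)"
  shows "l2_sq lborel (\<lambda>x. f (x + h)) = l2_sq lborel f"
proof -
  have [measurable]: "f \<in> borel_measurable borel"
    using assms by (intro borel_measurable_continuous_onI) (simp add: compactly_supported_def)
  show ?thesis unfolding l2_sq_def
    by (rule integral_lborel_translate[of "\<lambda>x. (norm (f x))\<^sup>2" h]) measurable
qed

lemma frechet_derivative_expand:
  assumes "smooth f"
  shows "frechet_derivative f (at x) h = (\<Sum>i\<in>UNIV. of_real (h $ i) * partial_deriv i f x)"
proof -
  let ?L = "frechet_derivative f (at x)"
  interpret bounded_linear ?L
    using smooth_has_derivative[OF assms] by (rule has_derivative_bounded_linear)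
  have "h = (\<Sum>i\<in>UNIV. h $ i *\<^sub>R axis i 1)"
    using basis_expansion[of h] by (simp add: scalar_mult_eq_scaleR)
  then have "?L h = ?L (\<Sum>i\<in>UNIV. h $ i *\<^sub>R axis i 1)" by (rule arg_cong)
  also have "\<dots> = (\<Sum>i\<in>UNIV. h $ i *\<^sub>R ?L (axis i 1))" by (simp only: sum scaleR)
  finally show ?thesis by (simp add: partial_deriv_def scaleR_conv_of_real[where 'a=complex])
qed

lemma has_derivative_shift:
  fixes s :: "real^'n"
  assumes "smooth f"
  shows "((\<lambda>x. f (x + s)) has_derivative frechet_derivative f (at (x + s))) (at x)"
proof -
  have "((\<lambda>x. x + s) has_derivative (\<lambda>h. h)) (at x)"
    by (auto intro!: derivative_eq_intros)
  from has_derivative_compose[OF this smooth_has_derivative[OF assms]]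
  show ?thesis .
qed

definition dir_deriv :: "real^'n \<Rightarrow> (real^'n \<Rightarrow> complex) \<Rightarrow> real^'n \<Rightarrow> complex" where
  "dir_deriv h f x = (\<Sum>i\<in>UNIV. of_real (h $ i) * partial_deriv i f x)"

lemma dir_deriv_axis: "dir_deriv (axis i s) f = (\<lambda>x. of_real s * partial_deriv i f x)"
proof
  fix x
  have "dir_deriv (axis i s) f x = (\<Sum>j\<in>UNIV. if j = i then of_real s * partial_deriv i f x else 0)"
    unfolding dir_deriv_def by (rule sum.cong) (auto simp: axis_def)
  then show "dir_deriv (axis i s) f x = of_real s * partial_deriv i f x" by simp
qed

lemma dir_deriv_test_function:
  "\<phi> \<in> test_functions D \<Longrightarrow> dir_deriv h \<phi> \<in> test_functions D"
  unfolding dir_deriv_def[abs_def]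
  by (intro test_functions_sum test_functions_scale test_functions_partial_deriv)

lemma norm_dir_deriv_le:
  "(norm (dir_deriv h f x))\<^sup>2 \<le> (norm h)\<^sup>2 * (\<Sum>i\<in>UNIV. (norm (partial_deriv i f x))\<^sup>2)"
proof -
  have "norm (dir_deriv h f x) \<le> (\<Sum>i\<in>UNIV. \<bar>h $ i\<bar> * norm (partial_deriv i f x))"
    unfolding dir_deriv_def by (rule order_trans[OF norm_sum]) (simp add: norm_mult)
  also have "\<dots> = (\<Sum>i\<in>UNIV. \<bar>\<bar>h $ i\<bar>\<bar> * \<bar>norm (partial_deriv i f x)\<bar>)" by simp
  also have "\<dots> \<le> L2_set (\<lambda>i. \<bar>h $ i\<bar>) UNIV * L2_set (\<lambda>i. norm (partial_deriv i f x)) UNIV"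
    by (rule L2_set_mult_ineq)
  finally have "(norm (dir_deriv h f x))\<^sup>2
      \<le> (L2_set (\<lambda>i. \<bar>h $ i\<bar>) UNIV * L2_set (\<lambda>i. norm (partial_deriv i f x)) UNIV)\<^sup>2"
    by (intro power_mono) auto
  also have "\<dots> = (norm h)\<^sup>2 * (\<Sum>i\<in>UNIV. (norm (partial_deriv i f x))\<^sup>2)"
    by (simp add: power_mult_distrib L2_set_def norm_vec_def sum_nonneg)
  finally show ?thesis .
qed

text \<open>The step is $h/(N+1)$, which avoids a division by zero at $N = 0$.\<close>

definition diff_quot :: "nat \<Rightarrow> real^'n \<Rightarrow> (real^'n \<Rightarrow> complex) \<Rightarrow> real^'n \<Rightarrow> complex" where
  "diff_quot N h f x = of_nat (Suc N) * (f (x + (1 / real (Suc N)) *\<^sub>R h) - f x)"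

lemma diff_quot_tendsto:
  assumes "smooth f"
  shows "(\<lambda>N. diff_quot N h f x) \<longlonglongrightarrow> dir_deriv h f x"
proof (cases "h = 0")
  case True
  then show ?thesis by (simp add: diff_quot_def dir_deriv_def)
next
  case False
  let ?L = "frechet_derivative f (at x)" and ?h = "\<lambda>N. (1 / real (Suc N)) *\<^sub>R h"
  have der: "(f has_derivative ?L) (at x)" by (rule smooth_has_derivative[OF assms])
  interpret bounded_linear ?L using der by (rule has_derivative_bounded_linear)
  have lim: "((\<lambda>k. norm (f (x + k) - f x - ?L k) / norm k) \<longlongrightarrow> 0) (at 0)"
    using der by (simp add: has_derivative_at)
  have h0: "?h \<longlonglongrightarrow> 0 *\<^sub>R h"
    by (intro tendsto_intros lim_inverse_n'[THEN LIMSEQ_Suc])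
  then have "filterlim ?h (at 0) sequentially"
    using False by (auto simp: filterlim_at)
  from filterlim_compose[OF lim this]
  have "(\<lambda>N. norm (f (x + ?h N) - f x - ?L (?h N)) / norm (?h N)) \<longlonglongrightarrow> 0" .
  from tendsto_mult[OF this tendsto_const[of "norm h"]]
  have "(\<lambda>N. norm (f (x + ?h N) - f x - ?L (?h N)) / norm (?h N) * norm h) \<longlonglongrightarrow> 0" by simp
  moreover have "norm (f (x + ?h N) - f x - ?L (?h N)) / norm (?h N) * norm h
      = norm (diff_quot N h f x - dir_deriv h f x)" for N
  proof -
    have "norm (diff_quot N h f x - dir_deriv h f x)
        = norm (of_nat (Suc N) * (f (x + ?h N) - f x - ?L (?h N)))"
      unfolding diff_quot_def dir_deriv_def frechet_derivative_expand[OF assms, of x h, symmetric]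
    proof -
      have "of_nat (Suc N) * ?L (?h N) = ?L h"
        by (simp add: scaleR scaleR_conv_of_real[where 'a=complex] del: of_nat_Suc)
      then show "norm (of_nat (Suc N) * (f (x + ?h N) - f x) - ?L h)
          = norm (of_nat (Suc N) * (f (x + ?h N) - f x - ?L (?h N)))"
        by (simp only: right_diff_distrib[of _ _ "?L (?h N)"])
    qed
    also have "\<dots> = real (Suc N) * norm (f (x + ?h N) - f x - ?L (?h N))"
      by (simp only: norm_mult norm_of_nat)
    finally show ?thesis using False by (simp add: field_simps)
  qed
  ultimately have "(\<lambda>N. norm (diff_quot N h f x - dir_deriv h f x)) \<longlonglongrightarrow> 0" by simp
  then show ?thesis by (simp add: tendsto_norm_zero_iff LIM_zero_iff)
qed

lemma test_function_lipschitz: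
  assumes "\<phi> \<in> test_functions D"
  obtains L where "L > 0" "\<And>x h. norm (\<phi> (x + h) - \<phi> x) \<le> L * norm h"
proof -
  have "\<exists>B. \<forall>x. norm (partial_deriv i \<phi> x) \<le> B" for i
    using compactly_supported_bounded[OF compactly_supported_test_function[OF test_functions_partial_deriv[OF assms, of i]]]
    by metis
  then obtain B where B: "\<And>i x. norm (partial_deriv i \<phi> x) \<le> B i" by metis
  define L where "L = (\<Sum>i\<in>UNIV. \<bar>B i\<bar>) + 1"
  have L: "L > 0" unfolding L_def by (intro add_nonneg_pos sum_nonneg) auto
  have on: "onorm (frechet_derivative \<phi> (at x)) \<le> L" for x
  proof (rule onorm_bound)
    show "0 \<le> L" using L by simp
    fix h :: "real^'a"
    have "norm (frechet_derivative \<phi> (at x) h) \<le> (\<Sum>i\<in>UNIV. norm (of_real (h $ i) * partial_deriv i \<phi> x))"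
      unfolding frechet_derivative_expand[OF test_functions_smooth[OF assms]] by (rule norm_sum)
    also have "\<dots> \<le> (\<Sum>i\<in>UNIV. \<bar>B i\<bar> * norm h)"
    proof (rule sum_mono)
      fix i
      have "norm (of_real (h $ i) * partial_deriv i \<phi> x) \<le> norm h * \<bar>B i\<bar>"
        unfolding norm_mult
        by (intro mult_mono) (auto simp: component_le_norm_cart intro: order_trans[OF B])
      then show "norm (of_real (h $ i) * partial_deriv i \<phi> x) \<le> \<bar>B i\<bar> * norm h"
        by (simp add: mult.commute)
    qed
    also have "\<dots> \<le> L * norm h" by (simp add: L_def algebra_simps sum_distrib_left)
    finally show "norm (frechet_derivative \<phi> (at x) h) \<le> L * norm h" .
  qed
  have "norm (\<phi> (x + h) - \<phi> x) \<le> L * norm ((x + h) - x)" for x h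
    by (rule differentiable_bound[of UNIV \<phi> "\<lambda>x. frechet_derivative \<phi> (at x)"])
      (use on smooth_has_derivative[OF test_functions_smooth[OF assms]] in auto)
  then show ?thesis using that L by simp
qed

lemma diff_quot_dominated:
  assumes "\<phi> \<in> test_functions D"
  obtains B R where "B > 0" "\<And>N x. norm (diff_quot N h \<phi> x) \<le> B * indicator (cball 0 R) x"
proof -
  obtain L where L: "L > 0" "\<And>x h. norm (\<phi> (x + h) - \<phi> x) \<le> L * norm h"
    using test_function_lipschitz[OF assms] by blast
  obtain R where R: "\<And>x. norm x > R \<Longrightarrow> \<phi> x = 0"
    using compactly_supported_test_function[OF assms] by (auto simp: compactly_supported_def)
  have "norm (diff_quot N h \<phi> x) \<le> (L * norm h + 1) * indicator (cball 0 (R + norm h)) x" for N x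
  proof (cases "norm x > R + norm h")
    case True
    have "norm ((1 / real (Suc N)) *\<^sub>R h) \<le> norm h"
      by (simp add: divide_le_eq mult_le_cancel_left1)
    then have "norm (x + (1 / real (Suc N)) *\<^sub>R h) > R"
      using True norm_triangle_ineq4[of "x + (1 / real (Suc N)) *\<^sub>R h" "(1 / real (Suc N)) *\<^sub>R h"] by simp
    moreover have "norm x > R" using True norm_ge_zero[of h] by linarith
    ultimately have "diff_quot N h \<phi> x = 0" using R by (simp add: diff_quot_def)
    then show ?thesis using L by simp
  next
    case False
    have "norm (diff_quot N h \<phi> x) = real (Suc N) * norm (\<phi> (x + (1 / real (Suc N)) *\<^sub>R h) - \<phi> x)"
      by (simp only: diff_quot_def norm_mult norm_of_nat)
    also have "\<dots> \<le> real (Suc N) * (L * norm ((1 / real (Suc N)) *\<^sub>R h))"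
      by (intro mult_left_mono L(2)) auto
    also have "\<dots> = L * norm h" by simp
    finally show ?thesis using False by (simp add: not_less)
  qed
  moreover have "L * norm h + 1 > 0" using L(1) by (simp add: add_nonneg_pos)
  ultimately show ?thesis using that by blast
qed

lemma diff_quot_measurable [measurable]:
  assumes "\<phi> \<in> test_functions D" shows "diff_quot N h \<phi> \<in> borel_measurable borel"
proof -
  have [measurable]: "\<phi> \<in> borel_measurable borel" using assms by measurable
  show ?thesis unfolding diff_quot_def[abs_def] by measurable
qed

lemma integral_diff_quot_mult_tendsto:
  assumes \<phi>: "\<phi> \<in> test_functions D" and g: "continuous_on UNIV g"
  shows "(\<lambda>N. \<integral>x. g x * diff_quot N h \<phi> x \<partial>lborel) \<longlonglongrightarrow> (\<integral>x. g x * dir_deriv h \<phi> x \<partial>lborel)"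
proof -
  obtain B R where B: "B > 0" "\<And>N x. norm (diff_quot N h \<phi> x) \<le> B * indicator (cball 0 R) x"
    using diff_quot_dominated[OF \<phi>] by blast
  have [measurable]: "g \<in> borel_measurable borel" using g by (rule borel_measurable_continuous_onI)
  note [measurable] = diff_quot_measurable[OF \<phi>] test_function_measurable[OF dir_deriv_test_function[OF \<phi>]]
  show ?thesis
  proof (rule integral_dominated_convergence[where w="\<lambda>x. indicator (cball 0 R) x *\<^sub>R (B * norm (g x))"])
    show "integrable lborel (\<lambda>x. indicator (cball 0 R) x *\<^sub>R (B * norm (g x)))"
      by (rule borel_integrable_compact) (auto intro!: continuous_intros continuous_on_subset[OF g])
    show "AE x in lborel. (\<lambda>N. g x * diff_quot N h \<phi> x) \<longlonglongrightarrow> g x * dir_deriv h \<phi> x"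
      by (intro AE_I2 tendsto_intros diff_quot_tendsto test_functions_smooth[OF \<phi>])
    fix N
    show "AE x in lborel. norm (g x * diff_quot N h \<phi> x) \<le> indicator (cball 0 R) x *\<^sub>R (B * norm (g x))"
    proof (rule AE_I2)
      fix x
      have "norm (g x) * norm (diff_quot N h \<phi> x) \<le> norm (g x) * (B * indicator (cball 0 R) x)"
        by (intro mult_left_mono B) auto
      then show "norm (g x * diff_quot N h \<phi> x) \<le> indicator (cball 0 R) x *\<^sub>R (B * norm (g x))"
        by (simp add: norm_mult mult_ac)
    qed
  qed measurable
qed

text \<open>Integrals of difference quotients vanish by translation invariance; this gives integration by
parts on the whole space without iterated integrals.\<close>

lemma integral_partial_deriv_zero:
  assumes \<phi>: "\<phi> \<in> test_functions D"
  shows "(\<integral>x. partial_deriv i \<phi> x \<partial>lborel) = 0"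
proof -
  have cs: "compactly_supported \<phi>" by (rule compactly_supported_test_function[OF \<phi>])
  have "(\<integral>x. diff_quot N h \<phi> x \<partial>lborel) = 0" for N h
  proof -
    have "(\<integral>x. \<phi> (x + (1 / real (Suc N)) *\<^sub>R h) - \<phi> x \<partial>lborel)
        = (\<integral>x. \<phi> (x + (1 / real (Suc N)) *\<^sub>R h) \<partial>lborel) - (\<integral>x. \<phi> x \<partial>lborel)"
      by (intro Bochner_Integration.integral_diff compactly_supported_integrable compactly_supported_translate cs)
    also have "\<dots> = 0" using integral_lborel_translate[OF test_function_measurable[OF \<phi>]] by simp
    finally show ?thesis unfolding diff_quot_def by (simp del: of_nat_Suc)
  qed
  with integral_diff_quot_mult_tendsto[OF \<phi>, of "\<lambda>_. 1" "axis i 1"]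
  show ?thesis by (simp add: dir_deriv_axis LIMSEQ_const_iff)
qed

lemma integral_by_parts_lborel:
  assumes f: "smooth f" and \<phi>: "\<phi> \<in> test_functions D"
  shows "(\<integral>x. f x * partial_deriv i \<phi> x \<partial>lborel) = - (\<integral>x. partial_deriv i f x * \<phi> x \<partial>lborel)"
proof -
  have "0 = (\<integral>x. partial_deriv i (\<lambda>x. f x * \<phi> x) x \<partial>lborel)"
    by (rule integral_partial_deriv_zero[symmetric, OF test_functions_mult_left[OF f \<phi>]])
  also have "\<dots> = (\<integral>x. f x * partial_deriv i \<phi> x + partial_deriv i f x * \<phi> x \<partial>lborel)"
    by (simp add: partial_deriv_mult smooth_differentiable f test_functions_smooth[OF \<phi>])
  also have "\<dots> = (\<integral>x. f x * partial_deriv i \<phi> x \<partial>lborel) + (\<integral>x. partial_deriv i f x * \<phi> x \<partial>lborel)"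
    by (intro Bochner_Integration.integral_add compactly_supported_integrable compactly_supported_mult
        compactly_supported_test_function[OF \<phi>] smooth_continuous_on f smooth_partial_deriv
        compactly_supported_test_function[OF test_functions_partial_deriv[OF \<phi>]])
  finally show ?thesis by (simp add: add_eq_0_iff)
qed

lemma diff_quot_partial_deriv:
  assumes "smooth f"
  shows "diff_quot N h (partial_deriv i f) = partial_deriv i (diff_quot N h f)"
proof
  fix x
  let ?s = "(1 / real (Suc N)) *\<^sub>R h"
  have "((\<lambda>x. f (x + ?s)) has_derivative frechet_derivative f (at (x + ?s))) (at x)"
    by (rule has_derivative_shift[OF assms])
  from has_derivative_mult_right[OF has_derivative_diff[OF this smooth_has_derivative[OF assms, of x]], of "of_nat (Suc N)"]
  show "diff_quot N h (partial_deriv i f) x = partial_deriv i (diff_quot N h f) x"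
    unfolding diff_quot_def[abs_def]
    by (subst partial_deriv_eq) (auto simp: partial_deriv_def)
qed

lemma diff_quot_by_parts:
  assumes \<phi>: "\<phi> \<in> test_functions D" and \<psi>: "\<psi> \<in> test_functions D"
  shows "(\<integral>x. \<psi> x * diff_quot N h (partial_deriv j \<phi>) x \<partial>lborel)
    = - (\<integral>x. partial_deriv j \<psi> x * diff_quot N h \<phi> x \<partial>lborel)"
proof -
  let ?s = "(1 / real (Suc N)) *\<^sub>R h"
  have sm: "smooth (\<lambda>x. \<phi> (x + ?s))"
  proof (rule smooth_if_closed_under_partial_deriv[where F="{\<lambda>x. f (x + ?s) |f. smooth f}"])
    show "(\<lambda>x. \<phi> (x + ?s)) \<in> {\<lambda>x. f (x + ?s) |f. smooth f}" using test_functions_smooth[OF \<phi>] by blast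
    fix g i assume "g \<in> {\<lambda>x. f (x + ?s) |f. smooth f}"
    then obtain f where f: "smooth f" and g: "g = (\<lambda>x. f (x + ?s))" by blast
    have der: "(g has_derivative frechet_derivative f (at (x + ?s))) (at x)" for x
      unfolding g by (rule has_derivative_shift[OF f])
    show "g differentiable (at x)" for x using der unfolding differentiable_def by blast
    have "partial_deriv i g = (\<lambda>x. partial_deriv i f (x + ?s))"
      by (rule ext, subst partial_deriv_eq[OF der]) (simp add: partial_deriv_def)
    then show "partial_deriv i g \<in> {\<lambda>x. f (x + ?s) |f. smooth f}" using smooth_partial_deriv[OF f] by blast
  qed
  have smq: "smooth (diff_quot N h \<phi>)"
    using smooth_mult[OF smooth_const[of "of_nat (Suc N)"] smooth_add[OF sm smooth_mult[OF smooth_const[of "-1"] test_functions_smooth[OF \<phi>]]]]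
    by (simp add: diff_quot_def[abs_def])
  have "(\<integral>x. diff_quot N h \<phi> x * partial_deriv j \<psi> x \<partial>lborel)
      = - (\<integral>x. partial_deriv j (diff_quot N h \<phi>) x * \<psi> x \<partial>lborel)"
    by (rule integral_by_parts_lborel[OF smq \<psi>])
  then show ?thesis
    by (simp add: diff_quot_partial_deriv[OF test_functions_smooth[OF \<phi>]] mult.commute)
qed

text \<open>A difference quotient in direction $i$ commutes with $\partial_j$ and may be integrated by
parts in direction $j$ before passing to the limit.\<close>

lemma integral_mixed_partials:
  assumes \<phi>: "\<phi> \<in> test_functions D" and \<psi>: "\<psi> \<in> test_functions D"
  shows "(\<integral>x. \<psi> x * partial_deriv i (partial_deriv j \<phi>) x \<partial>lborel)
       = (\<integral>x. \<psi> x * partial_deriv j (partial_deriv i \<phi>) x \<partial>lborel)"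
proof -
  have "(\<lambda>N. \<integral>x. \<psi> x * diff_quot N (axis i 1) (partial_deriv j \<phi>) x \<partial>lborel)
      \<longlonglongrightarrow> (\<integral>x. \<psi> x * partial_deriv i (partial_deriv j \<phi>) x \<partial>lborel)"
    using integral_diff_quot_mult_tendsto[OF test_functions_partial_deriv[OF \<phi>] smooth_continuous_on[OF test_functions_smooth[OF \<psi>]],
        where h="axis i 1"] by (simp add: dir_deriv_axis)
  moreover have "(\<lambda>N. - (\<integral>x. partial_deriv j \<psi> x * diff_quot N (axis i 1) \<phi> x \<partial>lborel))
      \<longlonglongrightarrow> - (\<integral>x. partial_deriv j \<psi> x * partial_deriv i \<phi> x \<partial>lborel)"
    using integral_diff_quot_mult_tendsto[OF \<phi> smooth_continuous_on[OF test_functions_smooth[OF test_functions_partial_deriv[OF \<psi>]]],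
        where h="axis i 1"] by (intro tendsto_minus) (simp add: dir_deriv_axis)
  ultimately have "(\<integral>x. \<psi> x * partial_deriv i (partial_deriv j \<phi>) x \<partial>lborel)
      = - (\<integral>x. partial_deriv j \<psi> x * partial_deriv i \<phi> x \<partial>lborel)"
    unfolding diff_quot_by_parts[OF \<phi> \<psi>] by (rule LIMSEQ_unique)
  also have "\<dots> = (\<integral>x. \<psi> x * partial_deriv j (partial_deriv i \<phi>) x \<partial>lborel)"
    using integral_by_parts_lborel[OF test_functions_smooth[OF \<psi>] test_functions_partial_deriv[OF \<phi>]] by simp
  finally show ?thesis .
qed

lemma continuous_l2_sq_zero:
  fixes f :: "real^'n \<Rightarrow> complex"
  assumes "compactly_supported f" "l2_sq lborel f = 0"
  shows "f x = 0"
proof -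
  have c: "continuous_on UNIV f" using assms(1) by (simp add: compactly_supported_def)
  have "AE x in lborel. (norm (f x))\<^sup>2 = 0"
    using assms compactly_supported_square_integrable[OF assms(1)]
    unfolding l2_sq_def by (subst (asm) integral_nonneg_eq_0_iff_AE) (auto dest: square_integrable_sq)
  then have ae: "AE x in lborel. x \<notin> {x. f x \<noteq> 0}" by simp
  have op: "open {x. f x \<noteq> 0}" by (intro open_Collect_neq c continuous_on_const)
  then have "emeasure lborel {x. f x \<noteq> 0} = 0"
    using ae by (subst (asm) AE_iff_measurable[of "{x. f x \<noteq> 0}"]) auto
  then have "negligible {x. f x \<noteq> 0}"
    using op by (auto simp: negligible_iff_null_sets null_sets_def emeasure_completion)
  then have "{x. f x \<noteq> 0} = {}" using open_not_negligible[OF op] by blast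
  then show ?thesis by blast
qed

lemma complex_integral_norm_sq:
  "(\<integral>x. f x * cnj (f x) \<partial>M) = complex_of_real (l2_sq M f)"
proof -
  have "f x * cnj (f x) = of_real ((norm (f x))\<^sup>2)" for x by (simp only: complex_norm_square)
  then show ?thesis unfolding l2_sq_def by (simp only: integral_complex_of_real)
qed

text \<open>The difference of the two mixed derivatives is a test function orthogonal to all test functions,
in particular to itself.\<close>

lemma mixed_partials_commute:
  assumes \<phi>: "\<phi> \<in> test_functions D"
  shows "partial_deriv i (partial_deriv j \<phi>) = partial_deriv j (partial_deriv i \<phi>)"
proof
  fix x
  let ?d = "\<lambda>x. partial_deriv i (partial_deriv j \<phi>) x - partial_deriv j (partial_deriv i \<phi>) x"
  have t: "partial_deriv i (partial_deriv j \<phi>) \<in> test_functions D" "partial_deriv j (partial_deriv i \<phi>) \<in> test_functions D"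
    using \<phi> by (intro test_functions_partial_deriv; assumption)+
  have dt: "?d \<in> test_functions D" using t by (rule test_functions_diff)
  note c = test_functions_cnj[OF dt]
  have "complex_of_real (l2_sq lborel ?d) = (\<integral>x. cnj (?d x) * ?d x \<partial>lborel)"
    by (simp add: mult.commute flip: complex_integral_norm_sq)
  also have "\<dots> = (\<integral>x. cnj (?d x) * partial_deriv i (partial_deriv j \<phi>) x \<partial>lborel)
      - (\<integral>x. cnj (?d x) * partial_deriv j (partial_deriv i \<phi>) x \<partial>lborel)"
    unfolding right_diff_distrib[of "cnj (?d _)"]
    by (intro Bochner_Integration.integral_diff compactly_supported_integrable compactly_supported_mult
        compactly_supported_test_function[OF t(1)] compactly_supported_test_function[OF t(2)]
        smooth_continuous_on[OF test_functions_smooth[OF c]])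
  also have "\<dots> = 0" using integral_mixed_partials[OF \<phi> c, of i j] by simp
  finally have "l2_sq lborel ?d = 0" by simp
  then have "?d x = 0" by (rule continuous_l2_sq_zero[OF compactly_supported_test_function[OF dt]])
  then show "partial_deriv i (partial_deriv j \<phi>) x = partial_deriv j (partial_deriv i \<phi>) x" by simp
qed


lemma l2_sq_dir_deriv_le:
  assumes \<phi>: "\<phi> \<in> test_functions D"
  shows "l2_sq lborel (dir_deriv h \<phi>) \<le> (norm h)\<^sup>2 * (\<Sum>i\<in>UNIV. l2_sq lborel (partial_deriv i \<phi>))"
proof -
  have int: "integrable lborel (\<lambda>x. (norm (\<psi> x))\<^sup>2)" if "\<psi> \<in> test_functions D" for \<psi>
    by (intro square_integrable_sq compactly_supported_square_integrable compactly_supported_test_function[OF that])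
  have "l2_sq lborel (dir_deriv h \<phi>) \<le> (\<integral>x. (norm h)\<^sup>2 * (\<Sum>i\<in>UNIV. (norm (partial_deriv i \<phi> x))\<^sup>2) \<partial>lborel)"
    unfolding l2_sq_def
    by (intro integral_mono norm_dir_deriv_le int integrable_mult_right Bochner_Integration.integrable_sum
        dir_deriv_test_function test_functions_partial_deriv \<phi>)
  also have "\<dots> = (norm h)\<^sup>2 * (\<Sum>i\<in>UNIV. l2_sq lborel (partial_deriv i \<phi>))"
    unfolding l2_sq_def
    by (simp add: Bochner_Integration.integral_sum int test_functions_partial_deriv \<phi>)
  finally show ?thesis .
qed

text \<open>Each of the \<open>k\<close> increments is a translate of the first one and has the same norm.\<close>

lemma l2_translation_telescope:
  fixes f :: "real^'n \<Rightarrow> complex"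
  assumes cs: "compactly_supported f"
  shows "sqrt (l2_sq lborel (\<lambda>x. f (x + real k *\<^sub>R s) - f x)) \<le> real k * sqrt (l2_sq lborel (\<lambda>x. f (x + s) - f x))"
proof (induction k)
  case 0
  show ?case by (simp add: l2_sq_def)
next
  case (Suc k)
  let ?d = "\<lambda>x. f (x + s) - f x"
  have d: "compactly_supported ?d" by (intro compactly_supported_diff compactly_supported_translate cs)
  have "(\<lambda>x. f (x + real (Suc k) *\<^sub>R s) - f x) = (\<lambda>x. ?d (x + real k *\<^sub>R s) + (f (x + real k *\<^sub>R s) - f x))"
    by (simp add: scaleR_add_left add_ac)
  then have "sqrt (l2_sq lborel (\<lambda>x. f (x + real (Suc k) *\<^sub>R s) - f x))
      \<le> sqrt (l2_sq lborel (\<lambda>x. ?d (x + real k *\<^sub>R s))) + sqrt (l2_sq lborel (\<lambda>x. f (x + real k *\<^sub>R s) - f x))"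
    by (simp only:) (intro l2_triangle compactly_supported_square_integrable compactly_supported_translate
        compactly_supported_diff cs d)
  also have "l2_sq lborel (\<lambda>x. ?d (x + real k *\<^sub>R s)) = l2_sq lborel ?d" by (rule l2_sq_translate[OF d])
  finally show ?case using Suc by (simp add: algebra_simps)
qed

text \<open>Telescoping over $N+1$ steps of size $h/(N+1)$ bounds the increment by the norm of the difference
quotient, which tends to that of the directional derivative.\<close>

lemma l2_sq_translation_le:
  assumes \<phi>: "\<phi> \<in> test_functions D"
  shows "l2_sq lborel (\<lambda>x. \<phi> (x + h) - \<phi> x) \<le> l2_sq lborel (dir_deriv h \<phi>)"
proof -
  obtain B R where B: "B > 0" "\<And>N x. norm (diff_quot N h \<phi> x) \<le> B * indicator (cball 0 R) x"
    using diff_quot_dominated[OF \<phi>] by blast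
  note [measurable] = diff_quot_measurable[OF \<phi>] test_function_measurable[OF dir_deriv_test_function[OF \<phi>]]
  have lim: "(\<lambda>N. l2_sq lborel (diff_quot N h \<phi>)) \<longlonglongrightarrow> l2_sq lborel (dir_deriv h \<phi>)"
    unfolding l2_sq_def
  proof (rule integral_dominated_convergence[where w="\<lambda>x. indicator (cball 0 R) x *\<^sub>R B\<^sup>2"])
    show "integrable lborel (\<lambda>x. indicator (cball 0 R) x *\<^sub>R B\<^sup>2)"
      by (rule borel_integrable_compact) (auto intro!: continuous_intros)
    show "AE x in lborel. (\<lambda>N. (norm (diff_quot N h \<phi> x))\<^sup>2) \<longlonglongrightarrow> (norm (dir_deriv h \<phi> x))\<^sup>2"
      by (intro AE_I2 tendsto_intros diff_quot_tendsto test_functions_smooth[OF \<phi>])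
    fix N
    show "AE x in lborel. norm ((norm (diff_quot N h \<phi> x))\<^sup>2) \<le> indicator (cball 0 R) x *\<^sub>R B\<^sup>2"
    proof (rule AE_I2)
      fix x
      have "(norm (diff_quot N h \<phi> x))\<^sup>2 \<le> (B * indicator (cball 0 R) x)\<^sup>2"
        by (intro power_mono B) auto
      then show "norm ((norm (diff_quot N h \<phi> x))\<^sup>2) \<le> indicator (cball 0 R) x *\<^sub>R B\<^sup>2"
        by (auto simp: indicator_def)
    qed
  qed measurable
  have le: "l2_sq lborel (\<lambda>x. \<phi> (x + h) - \<phi> x) \<le> l2_sq lborel (diff_quot N h \<phi>)" for N
  proof -
    let ?s = "(1 / real (Suc N)) *\<^sub>R h"
    let ?d = "\<lambda>x. \<phi> (x + ?s) - \<phi> x"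
    have "sqrt (l2_sq lborel (\<lambda>x. \<phi> (x + real (Suc N) *\<^sub>R ?s) - \<phi> x)) \<le> real (Suc N) * sqrt (l2_sq lborel ?d)"
      by (rule l2_translation_telescope[OF compactly_supported_test_function[OF \<phi>]])
    also have "real (Suc N) *\<^sub>R ?s = h" by (simp del: of_nat_Suc)
    finally have "(sqrt (l2_sq lborel (\<lambda>x. \<phi> (x + h) - \<phi> x)))\<^sup>2 \<le> (real (Suc N) * sqrt (l2_sq lborel ?d))\<^sup>2"
      by (rule power_mono) simp
    then have "l2_sq lborel (\<lambda>x. \<phi> (x + h) - \<phi> x) \<le> (real (Suc N))\<^sup>2 * l2_sq lborel ?d"
      by (simp add: power_mult_distrib del: of_nat_Suc)
    also have "\<dots> = l2_sq lborel (\<lambda>x. real (Suc N) *\<^sub>R ?d x)" by (simp only: l2_sq_scaleR)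
    also have "(\<lambda>x. real (Suc N) *\<^sub>R ?d x) = diff_quot N h \<phi>"
      by (auto simp: diff_quot_def[abs_def] scaleR_conv_of_real[where 'a=complex] simp del: of_nat_Suc)
    finally show ?thesis .
  qed
  show ?thesis by (rule LIMSEQ_le_const[OF lim]) (use le in blast)
qed

text \<open>A translation by $3R$ moves $D$ off itself, so $\phi$ and its translate have disjoint supports and
the squared norm of their difference is $2 \|\phi\|^2$.\<close>

lemma poincare_inequality:
  assumes \<phi>: "\<phi> \<in> test_functions D" and D: "D \<subseteq> cball 0 R" and R: "R > 0"
  shows "l2_sq lborel \<phi> \<le> 9 * R\<^sup>2 * l2_sq lborel (partial_deriv i \<phi>)"
proof -
  let ?h = "axis i (3 * R) :: real^'a"
  have cs: "compactly_supported \<phi>" by (rule compactly_supported_test_function[OF \<phi>])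
  have si: "square_integrable lborel \<phi>" "square_integrable lborel (\<lambda>x. \<phi> (x + ?h))"
    by (intro compactly_supported_square_integrable compactly_supported_translate cs)+
  have disj: "\<phi> x = 0 \<or> \<phi> (x + ?h) = 0" for x
  proof (rule ccontr)
    assume "\<not> ?thesis"
    then have "x \<in> D" "x + ?h \<in> D" using test_function_outside[OF \<phi>] by blast+
    then have "norm x \<le> R" "norm (x + ?h) \<le> R" using D by auto
    moreover have "norm ?h \<le> norm (x + ?h) + norm x" using norm_triangle_ineq4[of "x + ?h" x] by simp
    moreover have "norm ?h = 3 * R"
    proof -
      have "?h \<bullet> ?h = (3 * R)\<^sup>2" by (simp add: inner_axis_axis power2_eq_square)
      then show ?thesis using R unfolding norm_eq_sqrt_inner by (simp only: real_sqrt_abs)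
    qed
    ultimately show False using R by linarith
  qed
  have "2 * l2_sq lborel \<phi> = l2_sq lborel (\<lambda>x. \<phi> (x + ?h)) + l2_sq lborel \<phi>"
    by (simp add: l2_sq_translate[OF cs])
  also have "\<dots> = l2_sq lborel (\<lambda>x. \<phi> (x + ?h) - \<phi> x)"
  proof -
    have "\<phi> (x + ?h) \<bullet> \<phi> x = 0" for x using disj[of x] by auto
    then have "l2_ip lborel (\<lambda>x. \<phi> (x + ?h)) \<phi> = 0" by (simp add: l2_ip_def)
    then show ?thesis by (simp add: l2_sq_diff si)
  qed
  also have "\<dots> \<le> l2_sq lborel (dir_deriv ?h \<phi>)" by (rule l2_sq_translation_le[OF \<phi>])
  also have "dir_deriv ?h \<phi> = (\<lambda>x. (3 * R) *\<^sub>R partial_deriv i \<phi> x)"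
    by (simp add: dir_deriv_axis scaleR_conv_of_real[where 'a=complex])
  also have "l2_sq lborel (\<lambda>x. (3 * R) *\<^sub>R partial_deriv i \<phi> x) = 9 * R\<^sup>2 * l2_sq lborel (partial_deriv i \<phi>)"
    by (simp only: l2_sq_scaleR) (simp add: power_mult_distrib)
  finally show ?thesis using l2_sq_nonneg[of lborel \<phi>] by linarith
qed

lemma gradient_energy:
  assumes \<phi>: "\<phi> \<in> test_functions D"
  shows "(\<integral>x. \<phi> x * cnj (laplacian \<phi> x) \<partial>lborel) = - of_real (\<Sum>i\<in>UNIV. l2_sq lborel (partial_deriv i \<phi>))"
proof -
  have sm: "smooth \<phi>" by (rule test_functions_smooth[OF \<phi>])
  have "(\<integral>x. \<phi> x * cnj (partial_deriv i (partial_deriv i \<phi>) x) \<partial>lborel) = - of_real (l2_sq lborel (partial_deriv i \<phi>))" for i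
  proof -
    have c: "cnj (partial_deriv i f x) = partial_deriv i (\<lambda>x. cnj (f x)) x" if "smooth f" for f :: "real^'a \<Rightarrow> complex" and x
      using that by (simp add: partial_deriv_cnj smooth_differentiable)
    have "(\<integral>x. \<phi> x * cnj (partial_deriv i (partial_deriv i \<phi>) x) \<partial>lborel)
        = (\<integral>x. \<phi> x * partial_deriv i (\<lambda>x. cnj (partial_deriv i \<phi> x)) x \<partial>lborel)"
      by (simp add: c smooth_partial_deriv sm)
    also have "\<dots> = - (\<integral>x. partial_deriv i \<phi> x * cnj (partial_deriv i \<phi> x) \<partial>lborel)"
      by (rule integral_by_parts_lborel[OF sm test_functions_cnj[OF test_functions_partial_deriv[OF \<phi>]]])
    finally show ?thesis by (simp add: complex_integral_norm_sq)
  qed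
  note 1 = this
  have "(\<integral>x. \<phi> x * cnj (laplacian \<phi> x) \<partial>lborel) = (\<integral>x. (\<Sum>i\<in>UNIV. \<phi> x * cnj (partial_deriv i (partial_deriv i \<phi>) x)) \<partial>lborel)"
    by (simp add: laplacian_eq sum_distrib_left)
  also have "\<dots> = (\<Sum>i\<in>UNIV. \<integral>x. \<phi> x * cnj (partial_deriv i (partial_deriv i \<phi>) x) \<partial>lborel)"
    by (intro Bochner_Integration.integral_sum compactly_supported_integrable compactly_supported_mult
      compactly_supported_test_function[OF test_functions_cnj[OF test_functions_partial_deriv[OF
        test_functions_partial_deriv[OF \<phi>]]]] smooth_continuous_on sm)
  finally show ?thesis unfolding 1 by (simp add: sum_negf)
qed

text \<open>Integrating by parts twice, $\|\partial_i \partial_j \phi\|^2 = \langle \partial_j \partial_j \phi,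
\partial_i \partial_i \phi \rangle$; the sum over all $i$, $j$ is $\|\Delta \phi\|^2$.\<close>

lemma second_derivative_estimate:
  assumes \<phi>: "\<phi> \<in> test_functions D"
  shows "l2_sq lborel (partial_deriv i (partial_deriv j \<phi>)) \<le> l2_sq lborel (laplacian \<phi>)"
proof -
  let ?d = "partial_deriv"
  have sm: "smooth \<phi>" by (rule test_functions_smooth[OF \<phi>])
  have c: "?d i (\<lambda>x. cnj (f x)) = (\<lambda>x. cnj (?d i f x))" if "smooth f" for f :: "real^'a \<Rightarrow> complex" and i
    using that by (auto simp: partial_deriv_cnj smooth_differentiable)
  have e: "complex_of_real (l2_sq lborel (?d i (?d j \<phi>))) = (\<integral>x. ?d j (?d j \<phi>) x * cnj (?d i (?d i \<phi>) x) \<partial>lborel)" for i j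
  proof -
    have "complex_of_real (l2_sq lborel (?d i (?d j \<phi>))) = (\<integral>x. ?d i (?d j \<phi>) x * cnj (?d i (?d j \<phi>) x) \<partial>lborel)"
      by (rule complex_integral_norm_sq[symmetric])
    also have "\<dots> = - (\<integral>x. ?d j \<phi> x * ?d i (\<lambda>x. cnj (?d i (?d j \<phi>) x)) x \<partial>lborel)"
      by (subst integral_by_parts_lborel)
        (auto intro: test_functions_cnj test_functions_partial_deriv \<phi> smooth_partial_deriv sm)
    also have "?d i (\<lambda>x. cnj (?d i (?d j \<phi>) x)) = ?d j (\<lambda>x. cnj (?d i (?d i \<phi>) x))"
      using mixed_partials_commute[OF \<phi>, of i j]
        mixed_partials_commute[OF test_functions_partial_deriv[OF \<phi>, of i], of i j]
      by (simp add: c smooth_partial_deriv sm)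
    also have "- (\<integral>x. ?d j \<phi> x * ?d j (\<lambda>x. cnj (?d i (?d i \<phi>) x)) x \<partial>lborel)
        = (\<integral>x. ?d j (?d j \<phi>) x * cnj (?d i (?d i \<phi>) x) \<partial>lborel)"
      by (subst integral_by_parts_lborel)
        (auto intro: test_functions_cnj test_functions_partial_deriv \<phi> smooth_partial_deriv sm)
    finally show ?thesis .
  qed
  have int: "integrable lborel (\<lambda>x. ?d j (?d j \<phi>) x * cnj (?d i (?d i \<phi>) x))" for i j
    by (intro compactly_supported_integrable compactly_supported_mult smooth_continuous_on
      compactly_supported_test_function[OF test_functions_cnj[OF test_functions_partial_deriv[OF
        test_functions_partial_deriv[OF \<phi>]]]] smooth_partial_deriv sm)
  have "complex_of_real (l2_sq lborel (laplacian \<phi>)) = (\<integral>x. laplacian \<phi> x * cnj (laplacian \<phi> x) \<partial>lborel)"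
    by (rule complex_integral_norm_sq[symmetric])
  also have "\<dots> = (\<integral>x. (\<Sum>j\<in>UNIV. \<Sum>i\<in>UNIV. ?d j (?d j \<phi>) x * cnj (?d i (?d i \<phi>) x)) \<partial>lborel)"
    by (simp add: laplacian_eq sum_product)
  also have "\<dots> = (\<Sum>j\<in>UNIV. \<Sum>i\<in>UNIV. \<integral>x. ?d j (?d j \<phi>) x * cnj (?d i (?d i \<phi>) x) \<partial>lborel)"
    by (simp add: Bochner_Integration.integral_sum Bochner_Integration.integrable_sum int)
  also have "\<dots> = complex_of_real (\<Sum>j\<in>UNIV. \<Sum>i\<in>UNIV. l2_sq lborel (?d i (?d j \<phi>)))"
    by (simp add: e)
  finally have "l2_sq lborel (laplacian \<phi>) = (\<Sum>j\<in>UNIV. \<Sum>i\<in>UNIV. l2_sq lborel (?d i (?d j \<phi>)))"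
    by (simp only: of_real_eq_iff)
  moreover have "l2_sq lborel (?d i (?d j \<phi>)) \<le> (\<Sum>i\<in>UNIV. l2_sq lborel (?d i (?d j \<phi>)))"
    by (rule member_le_sum) auto
  moreover have "(\<Sum>i\<in>UNIV. l2_sq lborel (?d i (?d j \<phi>))) \<le> (\<Sum>j\<in>UNIV. \<Sum>i\<in>UNIV. l2_sq lborel (?d i (?d j \<phi>)))"
    by (rule member_le_sum[of j UNIV "\<lambda>j. \<Sum>i\<in>UNIV. l2_sq lborel (?d i (?d j \<phi>))"]) (auto intro: sum_nonneg)
  ultimately show ?thesis by linarith
qed


definition set_average :: "(real^'n) set \<Rightarrow> (real^'n \<Rightarrow> complex) \<Rightarrow> real^'n \<Rightarrow> complex" where
  "set_average Q f x = (1 / measure lborel Q) *\<^sub>R (\<integral>h. indicator Q h *\<^sub>R f (x + h) \<partial>lborel)"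

lemma set_average_measurable:
  assumes [measurable]: "f \<in> borel_measurable borel" "Q \<in> sets borel"
  shows "set_average Q f \<in> borel_measurable borel"
  unfolding set_average_def[abs_def] by measurable

lemma indicator_integral_bound:
  fixes u :: "real^'n \<Rightarrow> complex"
  assumes Q: "compact Q" and u: "continuous_on UNIV u"
  shows "(norm (\<integral>h. indicator Q h *\<^sub>R u h \<partial>lborel))\<^sup>2 \<le> measure lborel Q * (\<integral>h. indicator Q h * (norm (u h))\<^sup>2 \<partial>lborel)"
    and "integrable lborel (\<lambda>h. indicator Q h * (norm (u h))\<^sup>2)"
    and "integrable lborel (\<lambda>h. indicator Q h *\<^sub>R u h)"
proof -
  let ?v = "\<lambda>h. indicator Q h *\<^sub>R u h"
  have [measurable]: "Q \<in> sets borel" "u \<in> borel_measurable borel"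
    using Q u by (auto intro: borel_compact borel_measurable_continuous_onI)
  have fin: "emeasure lborel Q < \<infinity>" using Q by (intro emeasure_bounded_finite compact_imp_bounded)
  show i2: "integrable lborel (\<lambda>h. indicator Q h * (norm (u h))\<^sup>2)"
    using borel_integrable_compact[OF Q, of "\<lambda>h. (norm (u h))\<^sup>2"]
    by (simp add: continuous_intros continuous_on_subset[OF u])
  show i1: "integrable lborel (\<lambda>h. indicator Q h *\<^sub>R u h)"
    by (rule borel_integrable_compact[OF Q]) (rule continuous_on_subset[OF u], simp)
  have e: "(norm (?v h))\<^sup>2 = indicator Q h * (norm (u h))\<^sup>2" for h by (simp add: indicator_def)
  have v: "square_integrable lborel ?v"
    unfolding square_integrable_def e using i2 by simp
  have ind: "square_integrable lborel (indicator Q :: _ \<Rightarrow> real)"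
    unfolding square_integrable_def using fin
    by (auto simp: indicator_def power2_eq_square if_distrib cong: if_cong)
      (auto simp flip: indicator_def simp: mult_indicator_cong intro!: integrable_real_indicator)
  have li: "l2_sq lborel (indicator Q :: _ \<Rightarrow> real) = measure lborel Q"
  proof -
    have "(norm (indicator Q h :: real))\<^sup>2 = indicator Q h" for h by (simp add: indicator_def)
    then show ?thesis unfolding l2_sq_def by simp
  qed
  have "norm (\<integral>h. ?v h \<partial>lborel) \<le> (\<integral>h. norm (?v h) \<partial>lborel)" by (rule integral_norm_bound)
  also have "\<dots> = (\<integral>h. norm (?v h) * norm (indicator Q h :: real) \<partial>lborel)"
    by (rule Bochner_Integration.integral_cong) (auto simp: indicator_def)
  also have "\<dots> \<le> sqrt (l2_sq lborel ?v) * sqrt (measure lborel Q)"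
    using l2_cauchy_schwarz_norm[OF v ind] unfolding li .
  finally have "(norm (\<integral>h. ?v h \<partial>lborel))\<^sup>2 \<le> (sqrt (l2_sq lborel ?v) * sqrt (measure lborel Q))\<^sup>2"
    by (rule power_mono) simp
  also have "\<dots> = measure lborel Q * l2_sq lborel ?v" by (simp add: power_mult_distrib)
  finally show "(norm (\<integral>h. ?v h \<partial>lborel))\<^sup>2 \<le> measure lborel Q * (\<integral>h. indicator Q h * (norm (u h))\<^sup>2 \<partial>lborel)"
    unfolding l2_sq_def e .
qed

text \<open>By Jensen's inequality and Tonelli's theorem the error is at most the average over $h \in Q$ of
$\|\phi(\cdot + h) - \phi\|^2$, which the translation estimate controls.\<close>

lemma set_average_error:
  assumes \<phi>: "\<phi> \<in> test_functions D" and Q: "compact Q" "measure lborel Q > 0" and \<rho>: "\<And>h. h \<in> Q \<Longrightarrow> norm h \<le> \<rho>"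
  shows "square_integrable lborel (\<lambda>x. \<phi> x - set_average Q \<phi> x)"
    and "l2_sq lborel (\<lambda>x. \<phi> x - set_average Q \<phi> x) \<le> \<rho>\<^sup>2 * (\<Sum>i\<in>UNIV. l2_sq lborel (partial_deriv i \<phi>))"
proof -
  let ?\<mu> = "measure lborel Q" and ?G = "\<Sum>i\<in>UNIV. l2_sq lborel (partial_deriv i \<phi>)"
  have c: "continuous_on UNIV \<phi>" by (intro smooth_continuous_on test_functions_smooth[OF \<phi>])
  have G: "?G \<ge> 0" by (intro sum_nonneg) auto
  have [measurable]: "Q \<in> sets borel" "\<phi> \<in> borel_measurable borel"
    using Q \<phi> by (auto intro: borel_compact)
  note [measurable] = set_average_measurable[OF \<open>\<phi> \<in> borel_measurable borel\<close> \<open>Q \<in> sets borel\<close>]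
  have fin: "emeasure lborel Q < \<infinity>" using Q by (intro emeasure_bounded_finite compact_imp_bounded)
  have em: "emeasure lborel Q = ennreal ?\<mu>" using fin by (simp add: emeasure_eq_ennreal_measure)
  have pw: "ennreal ((norm (\<phi> x - set_average Q \<phi> x))\<^sup>2)
      \<le> (\<integral>\<^sup>+h. ennreal (1 / ?\<mu>) * (indicator Q h * ennreal ((norm (\<phi> (x + h) - \<phi> x))\<^sup>2)) \<partial>lborel)" for x
  proof -
    let ?u = "\<lambda>h. \<phi> x - \<phi> (x + h)"
    have cs: "continuous_on UNIV (\<lambda>h. \<phi> (x + h))"
      by (rule continuous_on_compose2[OF c]) (auto intro!: continuous_intros)
    have cu: "continuous_on UNIV ?u" by (intro continuous_intros cs)
    note b = indicator_integral_bound[OF Q(1) cu]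
    have "(\<integral>h. indicator Q h *\<^sub>R ?u h \<partial>lborel) = ?\<mu> *\<^sub>R \<phi> x - (\<integral>h. indicator Q h *\<^sub>R \<phi> (x + h) \<partial>lborel)"
    proof -
      have "(\<integral>h. indicator Q h *\<^sub>R ?u h \<partial>lborel) = (\<integral>h. indicator Q h *\<^sub>R \<phi> x - indicator Q h *\<^sub>R \<phi> (x + h) \<partial>lborel)"
        by (simp only: scaleR_diff_right)
      also have "\<dots> = (\<integral>h. indicator Q h *\<^sub>R \<phi> x \<partial>lborel) - (\<integral>h. indicator Q h *\<^sub>R \<phi> (x + h) \<partial>lborel)"
        using fin by (intro Bochner_Integration.integral_diff indicator_integral_bound(3)[OF Q(1) cs]) auto
      finally show ?thesis using fin by simp
    qed
    then have "\<phi> x - set_average Q \<phi> x = (1 / ?\<mu>) *\<^sub>R (\<integral>h. indicator Q h *\<^sub>R ?u h \<partial>lborel)"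
      using Q(2) by (simp add: set_average_def scaleR_diff_right)
    then have "(norm (\<phi> x - set_average Q \<phi> x))\<^sup>2 = (1 / ?\<mu>)\<^sup>2 * (norm (\<integral>h. indicator Q h *\<^sub>R ?u h \<partial>lborel))\<^sup>2"
      by (simp add: power_mult_distrib power_divide)
    also have "\<dots> \<le> (1 / ?\<mu>)\<^sup>2 * (?\<mu> * (\<integral>h. indicator Q h * (norm (?u h))\<^sup>2 \<partial>lborel))"
      by (intro mult_left_mono b(1)) simp
    also have "\<dots> = (1 / ?\<mu>) * (\<integral>h. indicator Q h * (norm (?u h))\<^sup>2 \<partial>lborel)"
      using Q(2) by (simp add: power2_eq_square)
    finally have "ennreal ((norm (\<phi> x - set_average Q \<phi> x))\<^sup>2)
        \<le> ennreal ((1 / ?\<mu>) * (\<integral>h. indicator Q h * (norm (?u h))\<^sup>2 \<partial>lborel))"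
      by (rule ennreal_leI)
    also have "\<dots> = ennreal (1 / ?\<mu>) * ennreal (\<integral>h. indicator Q h * (norm (?u h))\<^sup>2 \<partial>lborel)"
      by (rule ennreal_mult) auto
    also have "ennreal (\<integral>h. indicator Q h * (norm (?u h))\<^sup>2 \<partial>lborel) = (\<integral>\<^sup>+h. ennreal (indicator Q h * (norm (?u h))\<^sup>2) \<partial>lborel)"
      by (rule nn_integral_eq_integral[OF b(2), symmetric]) auto
    also have "ennreal (1 / ?\<mu>) * \<dots> = (\<integral>\<^sup>+h. ennreal (1 / ?\<mu>) * ennreal (indicator Q h * (norm (?u h))\<^sup>2) \<partial>lborel)"
      by (rule nn_integral_cmult[symmetric]) measurable
    also have "\<dots> = (\<integral>\<^sup>+h. ennreal (1 / ?\<mu>) * (indicator Q h * ennreal ((norm (\<phi> (x + h) - \<phi> x))\<^sup>2)) \<partial>lborel)"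
      by (rule nn_integral_cong) (auto simp: indicator_def norm_minus_commute)
    finally show ?thesis .
  qed
  have "(\<integral>\<^sup>+x. ennreal ((norm (\<phi> x - set_average Q \<phi> x))\<^sup>2) \<partial>lborel)
      \<le> (\<integral>\<^sup>+x. (\<integral>\<^sup>+h. ennreal (1 / ?\<mu>) * (indicator Q h * ennreal ((norm (\<phi> (x + h) - \<phi> x))\<^sup>2)) \<partial>lborel) \<partial>lborel)"
    by (rule nn_integral_mono) (rule pw)
  also have "\<dots> = (\<integral>\<^sup>+h. (\<integral>\<^sup>+x. ennreal (1 / ?\<mu>) * (indicator Q h * ennreal ((norm (\<phi> (x + h) - \<phi> x))\<^sup>2)) \<partial>lborel) \<partial>lborel)"
    by (rule lborel_pair.Fubini') measurable
  also have "\<dots> \<le> (\<integral>\<^sup>+h. ennreal (1 / ?\<mu> * (\<rho>\<^sup>2 * ?G)) * indicator Q h \<partial>lborel)"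
  proof (rule nn_integral_mono)
    fix h :: "real^'a"
    have cs: "compactly_supported (\<lambda>x. \<phi> (x + h) - \<phi> x)"
      by (intro compactly_supported_diff compactly_supported_translate compactly_supported_test_function[OF \<phi>])
    show "(\<integral>\<^sup>+x. ennreal (1 / ?\<mu>) * (indicator Q h * ennreal ((norm (\<phi> (x + h) - \<phi> x))\<^sup>2)) \<partial>lborel)
        \<le> ennreal (1 / ?\<mu> * (\<rho>\<^sup>2 * ?G)) * indicator Q h"
    proof (cases "h \<in> Q")
      case True
      have "l2_sq lborel (\<lambda>x. \<phi> (x + h) - \<phi> x) \<le> (norm h)\<^sup>2 * ?G"
        by (rule order_trans[OF l2_sq_translation_le[OF \<phi>] l2_sq_dir_deriv_le[OF \<phi>]])
      also have "\<dots> \<le> \<rho>\<^sup>2 * ?G" using \<rho>[OF True] G by (intro mult_right_mono power_mono) auto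
      finally have le: "l2_sq lborel (\<lambda>x. \<phi> (x + h) - \<phi> x) \<le> \<rho>\<^sup>2 * ?G" .
      have "(\<integral>\<^sup>+x. ennreal ((norm (\<phi> (x + h) - \<phi> x))\<^sup>2) \<partial>lborel) = ennreal (l2_sq lborel (\<lambda>x. \<phi> (x + h) - \<phi> x))"
        unfolding l2_sq_def
        by (rule nn_integral_eq_integral) (auto intro!: square_integrable_sq compactly_supported_square_integrable cs)
      also have "\<dots> \<le> ennreal (\<rho>\<^sup>2 * ?G)" by (rule ennreal_leI[OF le])
      finally have "ennreal (1 / ?\<mu>) * (\<integral>\<^sup>+x. ennreal ((norm (\<phi> (x + h) - \<phi> x))\<^sup>2) \<partial>lborel) \<le> ennreal (1 / ?\<mu>) * ennreal (\<rho>\<^sup>2 * ?G)"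
        by (rule mult_left_mono) simp
      moreover have "ennreal (1 / ?\<mu> * (\<rho>\<^sup>2 * ?G)) = ennreal (1 / ?\<mu>) * ennreal (\<rho>\<^sup>2 * ?G)"
        using G by (intro ennreal_mult) auto
      ultimately show ?thesis using True by (simp only: nn_integral_cmult) (simp add: nn_integral_cmult)
    qed simp
  qed
  also have "\<dots> = ennreal (1 / ?\<mu> * (\<rho>\<^sup>2 * ?G)) * ennreal ?\<mu>"
    by (subst nn_integral_cmult_indicator) (auto simp: em)
  also have "\<dots> = ennreal (\<rho>\<^sup>2 * ?G)" using Q(2) G by (simp flip: ennreal_mult)
  finally have F: "(\<integral>\<^sup>+x. ennreal ((norm (\<phi> x - set_average Q \<phi> x))\<^sup>2) \<partial>lborel) \<le> ennreal (\<rho>\<^sup>2 * ?G)" .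
  have int: "integrable lborel (\<lambda>x. (norm (\<phi> x - set_average Q \<phi> x))\<^sup>2)"
  proof (rule integrableI_bounded)
    show "(\<integral>\<^sup>+x. ennreal (norm ((norm (\<phi> x - set_average Q \<phi> x))\<^sup>2)) \<partial>lborel) < \<infinity>"
      using F by (auto intro: le_less_trans)
  qed measurable
  then show "square_integrable lborel (\<lambda>x. \<phi> x - set_average Q \<phi> x)" by (simp add: square_integrable_def)
  have "(\<integral>\<^sup>+x. ennreal ((norm (\<phi> x - set_average Q \<phi> x))\<^sup>2) \<partial>lborel) = ennreal (l2_sq lborel (\<lambda>x. \<phi> x - set_average Q \<phi> x))"
    unfolding l2_sq_def by (rule nn_integral_eq_integral[OF int]) simp
  with F have "ennreal (l2_sq lborel (\<lambda>x. \<phi> x - set_average Q \<phi> x)) \<le> ennreal (\<rho>\<^sup>2 * ?G)" by simp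
  then show "l2_sq lborel (\<lambda>x. \<phi> x - set_average Q \<phi> x) \<le> \<rho>\<^sup>2 * ?G"
    using G by (simp add: ennreal_le_iff)
qed

lemma norm_sq_le_double:
  fixes a b :: complex
  shows "(norm a)\<^sup>2 \<le> 2 * (norm (a - b))\<^sup>2 + 2 * (norm b)\<^sup>2"
proof -
  have "norm a \<le> norm (a - b) + norm b" using norm_triangle_ineq[of "a - b" b] by simp
  then have "(norm a)\<^sup>2 \<le> (norm (a - b) + norm b)\<^sup>2" by (rule power_mono) simp
  also have "\<dots> \<le> 2 * (norm (a - b))\<^sup>2 + 2 * (norm b)\<^sup>2"
    using sum_squares_bound[of "norm (a - b)" "norm b"] by (simp add: power2_sum)
  finally show ?thesis .
qed

text \<open>Averages over small cubes are uniformly close to the functions by the gradient bound. For a fixed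
cube they are integrals against indicator functions, so they tend to $0$ pointwise and boundedly,
and on the bounded set $D$ also in $L^2$.\<close>

theorem rellich:
  fixes \<phi> :: "nat \<Rightarrow> real^'n \<Rightarrow> complex"
  assumes D: "open D" "bounded D" and \<phi>: "\<And>j. \<phi> j \<in> test_functions D"
    and grad: "\<And>j i. l2_sq lborel (partial_deriv i (\<phi> j)) \<le> B"
    and weak: "\<And>a b. (\<lambda>j. \<integral>x. indicator (cbox a b) x *\<^sub>R \<phi> j x \<partial>lborel) \<longlonglongrightarrow> 0"
  shows "(\<lambda>j. l2_sq lborel (\<phi> j)) \<longlonglongrightarrow> 0"
proof -
  obtain R where R: "R > 0" "D \<subseteq> cball 0 R"
    using D(2) by (auto simp: bounded_pos subset_iff)
  define K where "K = 9 * R\<^sup>2 * B"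
  have K: "l2_sq lborel (\<phi> j) \<le> K" for j
  proof -
    have "l2_sq lborel (\<phi> j) \<le> 9 * R\<^sup>2 * l2_sq lborel (partial_deriv undefined (\<phi> j))"
      by (rule poincare_inequality[OF \<phi> R(2,1)])
    also have "\<dots> \<le> K" unfolding K_def by (intro mult_left_mono grad) simp
    finally show ?thesis .
  qed
  have B0: "B \<ge> 0" by (rule order_trans[OF l2_sq_nonneg grad])
  have [measurable]: "\<phi> j \<in> borel_measurable borel" for j using \<phi> by measurable
  have [measurable]: "D \<in> sets borel" using D by simp
  have finD: "emeasure lborel D < \<infinity>" using D(2) by (rule emeasure_bounded_finite)
  show ?thesis
  proof (rule LIMSEQ_I)
    fix e :: real assume e: "e > 0"
    define d where "d = real CARD('n)"
    have d: "d > 0" by (simp add: d_def)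
    \<comment> \<open>The side of the cube is \<open>\<rho> / d\<close>, so that its points have norm at most \<open>\<rho>\<close>; then the
      averaging error contributes less than \<open>e / 2\<close>.\<close>
    define \<rho> where "\<rho> = sqrt (e / (8 * d * (B + 1)))"
    have \<rho>: "\<rho> > 0" using e d B0 by (simp add: \<rho>_def)
    have small: "2 * (\<rho>\<^sup>2 * (d * B)) < e / 2"
    proof -
      have "\<rho>\<^sup>2 = e / (8 * d * (B + 1))" using e d B0 by (simp add: \<rho>_def)
      then have eq: "\<rho>\<^sup>2 * (8 * d * (B + 1)) = e" using d B0 by simp
      have "2 * (\<rho>\<^sup>2 * (d * B)) \<le> 2 * (\<rho>\<^sup>2 * (d * (B + 1)))"
        using d by (intro mult_left_mono) auto
      also have "\<dots> = e / 4" using eq by (simp add: algebra_simps)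
      finally show ?thesis using e by linarith
    qed
    define c :: "real^'n" where "c = (\<chi> i. \<rho> / d)"
    define Q where "Q = cbox 0 c"
    have ne: "cbox 0 c \<noteq> {}" using \<rho> d by (simp add: interval_ne_empty_cart c_def)
    have Q: "compact Q" "measure lborel Q > 0"
    proof -
      show "compact Q" by (simp add: Q_def)
      have "(\<Prod>i\<in>UNIV. c $ i - (0::real^'n) $ i) > 0"
        using \<rho> d by (intro prod_pos) (auto simp: c_def)
      then show "measure lborel Q > 0" unfolding Q_def content_cbox_cart[OF ne] .
    qed
    have Qn: "norm h \<le> \<rho>" if "h \<in> Q" for h
    proof -
      have "\<bar>h $ i\<bar> \<le> \<rho> / d" for i using that by (auto simp: Q_def mem_box_cart c_def)
      then have "(\<Sum>i\<in>UNIV. \<bar>h $ i\<bar>) \<le> (\<Sum>i\<in>(UNIV::'n set). \<rho> / d)" by (rule sum_mono)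
      then show ?thesis using norm_le_l1_cart[of h] d by (simp add: d_def)
    qed
    let ?A = "\<lambda>j. set_average Q (\<phi> j)"
    have [measurable]: "Q \<in> sets borel" by (simp add: Q_def)
    have [measurable]: "?A j \<in> borel_measurable borel" for j by (rule set_average_measurable) measurable
    have err: "l2_sq lborel (\<lambda>x. \<phi> j x - ?A j x) \<le> \<rho>\<^sup>2 * (d * B)" for j
    proof -
      have "l2_sq lborel (\<lambda>x. \<phi> j x - ?A j x) \<le> \<rho>\<^sup>2 * (\<Sum>i\<in>UNIV. l2_sq lborel (partial_deriv i (\<phi> j)))"
        by (rule set_average_error(2)[OF \<phi> Q Qn])
      also have "(\<Sum>i\<in>UNIV. l2_sq lborel (partial_deriv i (\<phi> j))) \<le> (\<Sum>i\<in>(UNIV::'n set). B)"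
        by (rule sum_mono) (rule grad)
      finally show ?thesis by (simp add: d_def mult_left_mono)
    qed
    have avg0: "(\<lambda>j. ?A j x) \<longlonglongrightarrow> 0" for x
    proof -
      have "(\<integral>h. indicator Q h *\<^sub>R \<phi> j (x + h) \<partial>lborel) = (\<integral>y. indicator (cbox x (x + c)) y *\<^sub>R \<phi> j y \<partial>lborel)" for j
      proof -
        have "(\<integral>y. indicator (cbox x (x + c)) y *\<^sub>R \<phi> j y \<partial>lborel)
            = (\<integral>h. indicator (cbox x (x + c)) (h + x) *\<^sub>R \<phi> j (h + x) \<partial>lborel)"
          by (rule integral_lborel_translate[symmetric]) measurable
        also have "(\<lambda>h. indicator (cbox x (x + c)) (h + x) :: real) = indicator Q"
          by (rule ext) (auto simp: Q_def indicator_def mem_box_cart)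
        finally show ?thesis by (simp add: add.commute)
      qed
      then show ?thesis unfolding set_average_def
        using tendsto_scaleR[OF tendsto_const weak[of x "x + c"]] by simp
    qed
    have avgb: "(norm (?A j x))\<^sup>2 \<le> K / measure lborel Q" for j x
    proof -
      have cs: "continuous_on UNIV (\<lambda>h. \<phi> j (x + h))"
        by (rule continuous_on_compose2[OF smooth_continuous_on[OF test_functions_smooth[OF \<phi>]]])
          (auto intro!: continuous_intros)
      have "(\<integral>h. indicator Q h * (norm (\<phi> j (x + h)))\<^sup>2 \<partial>lborel) \<le> l2_sq lborel (\<lambda>h. \<phi> j (h + x))"
        unfolding l2_sq_def
        by (intro integral_mono indicator_integral_bound(2)[OF Q(1) cs] square_integrable_sq
            compactly_supported_square_integrable compactly_supported_translate compactly_supported_test_function[OF \<phi>])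
          (auto simp: indicator_def add.commute)
      also have "\<dots> \<le> K" by (simp add: l2_sq_translate[OF compactly_supported_test_function[OF \<phi>]] K)
      finally have "(norm (\<integral>h. indicator Q h *\<^sub>R \<phi> j (x + h) \<partial>lborel))\<^sup>2 \<le> measure lborel Q * K"
        using indicator_integral_bound(1)[OF Q(1) cs] Q(2) by (meson mult_left_mono less_imp_le order_trans)
      then show ?thesis using Q(2)
        by (simp add: set_average_def power_divide field_simps power2_eq_square)
    qed
    have "(\<lambda>j. \<integral>x. indicator D x * (norm (?A j x))\<^sup>2 \<partial>lborel) \<longlonglongrightarrow> (\<integral>x. indicator D x * (norm (0::complex))\<^sup>2 \<partial>lborel)"
    proof (rule integral_dominated_convergence[where w="\<lambda>x. indicator D x * (K / measure lborel Q)"])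
      show "integrable lborel (\<lambda>x. indicator D x * (K / measure lborel Q))" using finD by simp
      show "AE x in lborel. (\<lambda>j. indicator D x * (norm (?A j x))\<^sup>2) \<longlonglongrightarrow> indicator D x * (norm (0::complex))\<^sup>2"
        by (intro AE_I2 tendsto_intros avg0)
      show "AE x in lborel. norm (indicator D x * (norm (?A j x))\<^sup>2) \<le> indicator D x * (K / measure lborel Q)" for j
        using avgb[of j] by (intro AE_I2) (simp add: indicator_def)
    qed measurable
    then have "(\<lambda>j. \<integral>x. indicator D x * (norm (?A j x))\<^sup>2 \<partial>lborel) \<longlonglongrightarrow> 0" by simp
    then obtain N where N: "\<And>j. j \<ge> N \<Longrightarrow> \<bar>\<integral>x. indicator D x * (norm (?A j x))\<^sup>2 \<partial>lborel\<bar> < e / 4"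
    proof -
      assume lim: "(\<lambda>j. \<integral>x. indicator D x * (norm (?A j x))\<^sup>2 \<partial>lborel) \<longlonglongrightarrow> 0"
      have "e / 4 > 0" using e by simp
      from LIMSEQ_D[OF lim this] that show thesis by auto
    qed
    show "\<exists>N. \<forall>j\<ge>N. norm (l2_sq lborel (\<phi> j) - 0) < e"
    proof (intro exI[of _ N] allI impI)
      fix j assume "j \<ge> N"
      have ia: "integrable lborel (\<lambda>x. indicator D x * (norm (?A j x))\<^sup>2)"
      proof (rule Bochner_Integration.integrable_bound[where f="\<lambda>x. indicator D x * (K / measure lborel Q)"])
        show "integrable lborel (\<lambda>x. indicator D x * (K / measure lborel Q))" using finD by simp
        show "AE x in lborel. norm (indicator D x * (norm (?A j x))\<^sup>2) \<le> norm (indicator D x * (K / measure lborel Q))"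
          using avgb[of j] order_trans[OF l2_sq_nonneg K] by (intro AE_I2) (auto simp: indicator_def)
      qed measurable
      note id = square_integrable_sq[OF set_average_error(1)[OF \<phi> Q Qn], of j]
      have "l2_sq lborel (\<phi> j) \<le> (\<integral>x. 2 * (norm (\<phi> j x - ?A j x))\<^sup>2 + 2 * (indicator D x * (norm (?A j x))\<^sup>2) \<partial>lborel)"
        unfolding l2_sq_def
      proof (intro integral_mono Bochner_Integration.integrable_add integrable_mult_right ia id)
        show "integrable lborel (\<lambda>x. (norm (\<phi> j x))\<^sup>2)"
          by (intro square_integrable_sq compactly_supported_square_integrable compactly_supported_test_function[OF \<phi>])
        show "(norm (\<phi> j x))\<^sup>2 \<le> 2 * (norm (\<phi> j x - ?A j x))\<^sup>2 + 2 * (indicator D x * (norm (?A j x))\<^sup>2)" for x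
          using norm_sq_le_double[of "\<phi> j x" "?A j x"] test_function_outside[OF \<phi>, of x j]
          by (cases "x \<in> D") auto
      qed
      also have "\<dots> = 2 * l2_sq lborel (\<lambda>x. \<phi> j x - ?A j x) + 2 * (\<integral>x. indicator D x * (norm (?A j x))\<^sup>2 \<partial>lborel)"
        unfolding l2_sq_def using ia id by simp
      also have "\<dots> < e / 2 + e / 2"
        using err[of j] small N[OF \<open>j \<ge> N\<close>] by (intro add_strict_mono) auto
      finally show "norm (l2_sq lborel (\<phi> j) - 0) < e" by simp
    qed
  qed
qed

section \<open>The fundamental lemma and weak derivatives\<close>

lemma square_integrable_mult:
  fixes f g :: "'a \<Rightarrow> complex"
  assumes "square_integrable M f" "square_integrable M g"
  shows "integrable M (\<lambda>x. f x * g x)"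
proof (rule Bochner_Integration.integrable_bound[OF square_integrable_norm_mult[OF assms]])
  show "(\<lambda>x. f x * g x) \<in> borel_measurable M" using assms by measurable
qed (simp add: norm_mult)

lemma borel_measurable_cnj [measurable]: "cnj \<in> borel_measurable borel"
  by (intro borel_measurable_continuous_onI continuous_intros)

lemma square_integrable_cnj: "square_integrable M f \<Longrightarrow> square_integrable M (\<lambda>x. cnj (f x))"
  by (rule square_integrable_bound[of _ M f])
    (auto intro: measurable_compose[OF _ borel_measurable_cnj] square_integrable_measurable)

lemma square_integrable_imp_integrable:
  fixes f :: "'a \<Rightarrow> complex"
  assumes "square_integrable M f" "finite_measure M"
  shows "integrable M f"
proof -
  interpret finite_measure M by fact
  have "square_integrable M (\<lambda>x. 1 :: complex)" by (simp add: square_integrable_def)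
  from square_integrable_mult[OF assms(1) this] show ?thesis by simp
qed

lemma integral_mult_bound:
  fixes f g :: "'a \<Rightarrow> complex"
  assumes "square_integrable M f" "square_integrable M g"
  shows "norm (\<integral>x. f x * g x \<partial>M) \<le> sqrt (l2_sq M f) * sqrt (l2_sq M g)"
proof -
  have "norm (\<integral>x. f x * g x \<partial>M) \<le> (\<integral>x. norm (f x * g x) \<partial>M)" by (rule integral_norm_bound)
  also have "\<dots> \<le> sqrt (l2_sq M f) * sqrt (l2_sq M g)"
    using l2_cauchy_schwarz_norm[OF assms] by (simp add: norm_mult)
  finally show ?thesis .
qed

lemma l2_sq_cnj: "l2_sq M (\<lambda>x. cnj (f x)) = l2_sq M f"
  by (simp add: l2_sq_def)

lemma l2_sq_cmult: "l2_sq M (\<lambda>x. (c::complex) * f x) = (norm c)\<^sup>2 * l2_sq M f"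
  by (simp add: l2_sq_def norm_mult power_mult_distrib)

lemma square_integrable_cmult:
  fixes f :: "'a \<Rightarrow> complex"
  assumes "square_integrable M f" shows "square_integrable M (\<lambda>x. c * f x)"
  using assms unfolding square_integrable_def by (auto simp: norm_mult power_mult_distrib)

lemma integral_mult_tendsto:
  fixes f g :: "nat \<Rightarrow> 'a \<Rightarrow> complex"
  assumes f: "\<And>m. square_integrable M (f m)" "square_integrable M f0" "(\<lambda>m. l2_sq M (\<lambda>x. f m x - f0 x)) \<longlonglongrightarrow> 0"
    and g: "\<And>m. square_integrable M (g m)" "square_integrable M g0" "(\<lambda>m. l2_sq M (\<lambda>x. g m x - g0 x)) \<longlonglongrightarrow> 0"
  shows "(\<lambda>m. \<integral>x. f m x * g m x \<partial>M) \<longlonglongrightarrow> (\<integral>x. f0 x * g0 x \<partial>M)"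
proof -
  let ?b = "\<lambda>m. sqrt (l2_sq M (\<lambda>x. f m x - f0 x)) * sqrt (l2_sq M (g m)) + sqrt (l2_sq M f0) * sqrt (l2_sq M (\<lambda>x. g m x - g0 x))"
  have "(\<lambda>m. (\<integral>x. f m x * g m x \<partial>M) - (\<integral>x. f0 x * g0 x \<partial>M)) \<longlonglongrightarrow> 0"
  proof (rule Lim_null_comparison)
    show "\<forall>\<^sub>F m in sequentially. norm ((\<integral>x. f m x * g m x \<partial>M) - (\<integral>x. f0 x * g0 x \<partial>M)) \<le> ?b m"
    proof (rule always_eventually, rule allI)
      fix m
      note d = square_integrable_diff[OF f(1)[of m] f(2)] square_integrable_diff[OF g(1)[of m] g(2)]
      have "(\<integral>x. f m x * g m x \<partial>M) - (\<integral>x. f0 x * g0 x \<partial>M)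
          = (\<integral>x. (f m x - f0 x) * g m x \<partial>M) + (\<integral>x. f0 x * (g m x - g0 x) \<partial>M)"
        by (simp add: left_diff_distrib right_diff_distrib square_integrable_mult f g)
      also have "norm \<dots> \<le> ?b m"
        by (intro order_trans[OF norm_triangle_ineq] add_mono integral_mult_bound d f g)
      finally show "norm ((\<integral>x. f m x * g m x \<partial>M) - (\<integral>x. f0 x * g0 x \<partial>M)) \<le> ?b m" .
    qed
    have "?b \<longlonglongrightarrow> sqrt 0 * sqrt (l2_sq M g0) + sqrt (l2_sq M f0) * sqrt 0"
      by (intro tendsto_intros f(3) g(3) l2_sq_tendsto g)
    then show "?b \<longlonglongrightarrow> 0" by simp
  qed
  then show ?thesis by (simp add: LIM_zero_iff)
qed

lemma l2_sq_cong_AE: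
  assumes "square_integrable M f" "square_integrable M g" "AE x in M. f x = g x"
  shows "l2_sq M f = l2_sq M g"
  unfolding l2_sq_def
proof (rule integral_cong_AE)
  show "AE x in M. (norm (f x))\<^sup>2 = (norm (g x))\<^sup>2" using assms(3) by auto
qed (use assms in measurable)

text \<open>Multiplying a bump function by polynomials gives test functions. By the Weierstrass theorem the
polynomials may be replaced by continuous functions, and by almost everywhere approximation these by the
bounded function $\bar g / (1 + |g|)$; what remains is the integral of a nonnegative function.\<close>

lemma fundamental_lemma_box:
  fixes g :: "real^'n \<Rightarrow> complex"
  assumes D: "open D" and g: "integrable (lebesgue_on D) g"
    and zero: "\<And>\<phi>. \<phi> \<in> test_functions D \<Longrightarrow> (LINT x|lebesgue_on D. g x * \<phi> x) = 0"
    and ab: "cbox a b \<subseteq> D"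
  shows "AE x in lebesgue_on D. x \<in> box a b \<longrightarrow> g x = 0"
proof -
  let ?M = "lebesgue_on D" and ?\<chi> = "box_bump a b"
  have Dm: "D \<in> sets lebesgue" using D by (simp add: borel_open)
  have meas: "f \<in> borel_measurable ?M" if "f \<in> borel_measurable borel" for f :: "real^'n \<Rightarrow> 'c::euclidean_space"
    using that by (intro measurable_restrict_space1) (simp add: measurable_completion)
  have gm [measurable]: "g \<in> borel_measurable ?M" using g by auto
  have "(\<lambda>x. complex_of_real (?\<chi> x)) \<in> borel_measurable borel"
    by (intro borel_measurable_continuous_onI smooth_continuous_on smooth_box_bump)
  then have "(\<lambda>x. Re (complex_of_real (?\<chi> x))) \<in> borel_measurable borel" by measurable
  then have \<chi>m [measurable]: "?\<chi> \<in> borel_measurable ?M" by (intro meas) simp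
  have \<chi>1: "norm (complex_of_real (?\<chi> x)) \<le> 1" for x
    using box_bump_nonneg[of a b x] box_bump_le_1[of a b x] by simp
  have bint: "integrable ?M (\<lambda>x. g x * of_real (?\<chi> x) * u x)"
    if "u \<in> borel_measurable ?M" "\<And>x. x \<in> box a b \<Longrightarrow> norm (u x) \<le> C" for u C
  proof (rule Bochner_Integration.integrable_bound[OF integrable_mult_right[OF integrable_norm[OF g], of C]])
    show "(\<lambda>x. g x * of_real (?\<chi> x) * u x) \<in> borel_measurable ?M" using that(1) by measurable
    show "AE x in ?M. norm (g x * of_real (?\<chi> x) * u x) \<le> norm (C * norm (g x))"
    proof (rule AE_I2)
      fix x
      show "norm (g x * of_real (?\<chi> x) * u x) \<le> norm (C * norm (g x))"
      proof (cases "x \<in> box a b")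
        case True
        have "norm (g x) * norm (complex_of_real (?\<chi> x)) * norm (u x) \<le> norm (g x) * 1 * C"
          by (intro mult_mono \<chi>1 that(2)[OF True]) auto
        also have "\<dots> \<le> norm (C * norm (g x))" 
          by (simp only: real_norm_def mult_1_right mult.commute[of "norm (g x)"] abs_ge_self)
        finally show ?thesis by (simp only: norm_mult)
      next
        case False
        then have "?\<chi> x = 0" using box_bump_pos_iff[of a b x] box_bump_nonneg[of a b x] by (auto simp: less_le)
        then show ?thesis by simp
      qed
    qed
  qed
  have poly0: "(LINT x|?M. g x * of_real (?\<chi> x) * of_real (p x)) = 0" if "real_polynomial_function p" for p
    using zero[OF box_bump_test_function[OF ab smooth_real_polynomial_function[OF that]]]
    by (simp add: mult.assoc)
  have real0: "(LINT x|?M. g x * of_real (?\<chi> x) * of_real (h x)) = 0" if h: "continuous_on UNIV h" for h :: "real^'n \<Rightarrow> real"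
  proof -
    let ?I = "LINT x|?M. g x * of_real (?\<chi> x) * of_real (h x)"
    have hm: "(\<lambda>x. of_real (h x) :: complex) \<in> borel_measurable ?M"
      using h by (intro meas borel_measurable_continuous_onI continuous_intros)
    obtain C where C: "\<And>x. x \<in> cbox a b \<Longrightarrow> norm (h x) \<le> C"
    proof -
      have "bounded (h ` cbox a b)"
        by (intro compact_imp_bounded compact_continuous_image compact_cbox continuous_on_subset[OF h subset_UNIV])
      then obtain C where "\<forall>x\<in>cbox a b. norm (h x) \<le> C" by (auto simp: bounded_iff)
      then show thesis using that by blast
    qed
    have "norm ?I \<le> e * (LINT x|?M. norm (g x))" if e: "e > 0" for e
    proof -
      obtain p where p: "real_polynomial_function p" "\<And>x. x \<in> cbox a b \<Longrightarrow> \<bar>h x - p x\<bar> < e"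
        using Stone_Weierstrass_real_polynomial_function[OF compact_cbox continuous_on_subset[OF h subset_UNIV] e, of a b]
        by blast
      have pm: "(\<lambda>x. of_real (p x) :: complex) \<in> borel_measurable ?M"
        by (intro meas borel_measurable_continuous_onI smooth_continuous_on smooth_real_polynomial_function p)
      have bx: "x \<in> cbox a b" if "x \<in> box a b" for x using that box_subset_cbox by blast
      have ih: "integrable ?M (\<lambda>x. g x * of_real (?\<chi> x) * of_real (h x))"
        by (rule bint[OF hm, of C]) (use C bx in auto)
      have ip: "integrable ?M (\<lambda>x. g x * of_real (?\<chi> x) * of_real (p x))"
      proof (rule bint[OF pm, of "C + e"])
        fix x assume "x \<in> box a b"
        then show "norm (complex_of_real (p x)) \<le> C + e"
          using C[OF bx, of x] p(2)[OF bx, of x] by (simp add: abs_if split: if_splits)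
      qed
      have "?I = (LINT x|?M. g x * of_real (?\<chi> x) * of_real (h x) - g x * of_real (?\<chi> x) * of_real (p x))"
        using poly0[OF p(1)] ih ip by simp
      also have "norm \<dots> \<le> (LINT x|?M. e * norm (g x))"
      proof (rule order_trans[OF integral_norm_bound], rule integral_mono)
        show "integrable ?M (\<lambda>x. norm (g x * of_real (?\<chi> x) * of_real (h x) - g x * of_real (?\<chi> x) * of_real (p x)))"
          using ih ip by simp
        show "integrable ?M (\<lambda>x. e * norm (g x))" using g by simp
        fix x
        have "norm (g x * of_real (?\<chi> x) * of_real (h x) - g x * of_real (?\<chi> x) * of_real (p x))
            = norm (g x) * norm (complex_of_real (?\<chi> x)) * \<bar>h x - p x\<bar>"
          by (simp add: norm_mult flip: right_diff_distrib of_real_diff)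
        also have "\<dots> \<le> e * norm (g x)"
        proof (cases "x \<in> box a b")
          case True
          have "norm (g x) * norm (complex_of_real (?\<chi> x)) * \<bar>h x - p x\<bar> \<le> norm (g x) * 1 * e"
            using p(2)[OF bx[OF True]] by (intro mult_mono \<chi>1) auto
          then show ?thesis by (simp add: mult.commute)
        next
          case False
          then have "?\<chi> x = 0" using box_bump_pos_iff[of a b x] box_bump_nonneg[of a b x] by (auto simp: less_le)
          then show ?thesis using \<open>e > 0\<close> by simp
        qed
        finally show "norm (g x * of_real (?\<chi> x) * of_real (h x) - g x * of_real (?\<chi> x) * of_real (p x)) \<le> e * norm (g x)" .
      qed
      finally show ?thesis by simp
    qed
    note le = this
    have n0: "0 \<le> (LINT x|?M. norm (g x))" by simp
    have "norm ?I \<le> d" if "d > 0" for d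
    proof -
      let ?n = "LINT x|?M. norm (g x)"
      have np: "?n + 1 > 0" using n0 by linarith
      have "norm ?I \<le> d / (?n + 1) * ?n" by (rule le[OF divide_pos_pos[OF that np]])
      also have "\<dots> = d * (?n / (?n + 1))" by simp
      also have "\<dots> \<le> d * 1"
      proof (rule mult_left_mono)
        show "?n / (?n + 1) \<le> 1" using np by simp
      qed (use that in simp)
      finally show ?thesis by simp
    qed
    then have "norm ?I \<le> 0" using field_le_epsilon[of "norm ?I" 0] by simp
    then show ?thesis by simp
  qed
  have cont0: "(LINT x|?M. g x * of_real (?\<chi> x) * h x) = 0" if h: "continuous_on UNIV h" and hb: "\<And>x. norm (h x) \<le> 1" for h :: "real^'n \<Rightarrow> complex"
  proof -
    have r: "(LINT x|?M. g x * of_real (?\<chi> x) * of_real (Re (h x))) = 0"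
      and i: "(LINT x|?M. g x * of_real (?\<chi> x) * of_real (Im (h x))) = 0"
      by (intro real0 continuous_intros h)+
    have m: "(\<lambda>x. of_real (Re (h x)) :: complex) \<in> borel_measurable ?M" "(\<lambda>x. of_real (Im (h x)) :: complex) \<in> borel_measurable ?M"
      by (intro meas borel_measurable_continuous_onI continuous_intros h)+
    have ir: "integrable ?M (\<lambda>x. g x * of_real (?\<chi> x) * of_real (Re (h x)))"
      by (rule bint[OF m(1), of 1]) (use hb abs_Re_le_cmod order_trans in \<open>fastforce\<close>)
    have ii: "integrable ?M (\<lambda>x. g x * of_real (?\<chi> x) * of_real (Im (h x)))"
      by (rule bint[OF m(2), of 1]) (use hb abs_Im_le_cmod order_trans in \<open>fastforce\<close>)
    have "g x * of_real (?\<chi> x) * h x = g x * of_real (?\<chi> x) * of_real (Re (h x)) + \<i> * (g x * of_real (?\<chi> x) * of_real (Im (h x)))" for x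
      by (subst complex_eq[of "h x"]) (simp add: algebra_simps)
    then show ?thesis using r i ir ii by simp
  qed
  define f where "f x = cnj (g x) / of_real (1 + norm (g x))" for x
  have fm [measurable]: "f \<in> borel_measurable ?M"
    unfolding f_def by measurable
  have fb: "norm (f x) \<le> 1" for x
    unfolding f_def norm_divide norm_of_real by (simp add: divide_le_eq add_pos_nonneg)
  have "f measurable_on D" by (rule measurable_on_iff_borel_measurable[THEN iffD2, OF Dm fm])
  then obtain N F where N: "negligible N" and F: "\<And>k. continuous_on UNIV (F k)"
    and FN: "\<And>x. x \<notin> N \<Longrightarrow> (\<lambda>k::nat. F k x) \<longlonglongrightarrow> (if x \<in> D then f x else 0)"
    unfolding measurable_on_def by blast
  \<comment> \<open>Truncation to the unit disc does not change the limit, which has modulus at most $1$.\<close>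
  define H where "H k x = F k x / of_real (max 1 (norm (F k x)))" for k x
  have Hc: "continuous_on UNIV (H k)" for k
    unfolding H_def by (intro continuous_intros F) auto
  have Hb: "norm (H k x) \<le> 1" for k x
    unfolding H_def norm_divide norm_of_real by (simp add: divide_le_eq)
  have Hm [measurable]: "H k \<in> borel_measurable ?M" for k
    by (intro meas borel_measurable_continuous_onI Hc)
  have "(\<lambda>k. LINT x|?M. g x * of_real (?\<chi> x) * H k x) \<longlonglongrightarrow> (LINT x|?M. g x * of_real (?\<chi> x) * f x)"
  proof (rule integral_dominated_convergence[where w="\<lambda>x. norm (g x)"])
    show "integrable ?M (\<lambda>x. norm (g x))" using g by simp
    show "AE x in ?M. norm (g x * of_real (?\<chi> x) * H k x) \<le> norm (g x)" for k
    proof (rule AE_I2)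
      fix x
      have "norm (g x) * norm (complex_of_real (?\<chi> x)) * norm (H k x) \<le> norm (g x) * 1 * 1"
        by (intro mult_mono \<chi>1 Hb) auto
      then show "norm (g x * of_real (?\<chi> x) * H k x) \<le> norm (g x)" by (simp only: norm_mult mult_1_right)
    qed
    have "AE x in lebesgue. x \<notin> N"
      using N by (intro AE_not_in) (simp add: negligible_iff_null_sets)
    then have "AE x in ?M. x \<notin> N \<and> x \<in> D"
      using Dm by (subst AE_restrict_space_iff) auto
    then show "AE x in ?M. (\<lambda>k. g x * of_real (?\<chi> x) * H k x) \<longlonglongrightarrow> g x * of_real (?\<chi> x) * f x"
    proof eventually_elim
      case (elim x)
      then have "(\<lambda>k. F k x) \<longlonglongrightarrow> f x" using FN[of x] by simp
      then have "(\<lambda>k. H k x) \<longlonglongrightarrow> f x / of_real (max 1 (norm (f x)))"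
        unfolding H_def by (intro tendsto_intros) auto
      then show ?case using fb[of x] by (intro tendsto_intros) (simp add: max_absorb1)
    qed
  qed measurable
  then have "(LINT x|?M. g x * of_real (?\<chi> x) * f x) = 0"
    using cont0[OF Hc Hb] by (simp add: LIMSEQ_const_iff)
  moreover have "g x * of_real (?\<chi> x) * f x = of_real (?\<chi> x * ((norm (g x))\<^sup>2 / (1 + norm (g x))))" for x
  proof -
    have sq: "g x * cnj (g x) = of_real ((norm (g x))\<^sup>2)" by (simp only: complex_norm_square)
    have "g x * of_real (?\<chi> x) * f x = of_real (?\<chi> x) * (g x * cnj (g x) / of_real (1 + norm (g x)))"
      by (simp add: f_def mult_ac)
    then show ?thesis by (simp only: sq of_real_mult of_real_divide)
  qed
  ultimately have "(LINT x|?M. complex_of_real (?\<chi> x * ((norm (g x))\<^sup>2 / (1 + norm (g x))))) = 0"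
    by (simp only:)
  then have z: "(LINT x|?M. ?\<chi> x * ((norm (g x))\<^sup>2 / (1 + norm (g x)))) = 0"
    by (simp only: integral_complex_of_real of_real_eq_0_iff)
  have nn: "0 \<le> ?\<chi> x * ((norm (g x))\<^sup>2 / (1 + norm (g x)))" for x
    by (intro mult_nonneg_nonneg box_bump_nonneg divide_nonneg_nonneg) auto
  have "AE x in ?M. ?\<chi> x * ((norm (g x))\<^sup>2 / (1 + norm (g x))) = 0"
  proof (rule integral_nonneg_eq_0_iff_AE[THEN iffD1, OF _ _ z])
    show "integrable ?M (\<lambda>x. ?\<chi> x * ((norm (g x))\<^sup>2 / (1 + norm (g x))))"
    proof (rule Bochner_Integration.integrable_bound[OF g])
      show "AE x in ?M. norm (?\<chi> x * ((norm (g x))\<^sup>2 / (1 + norm (g x)))) \<le> norm (g x)"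
      proof (rule AE_I2)
        fix x
        have "(norm (g x))\<^sup>2 / (1 + norm (g x)) \<le> norm (g x)"
          by (simp add: divide_le_eq add_pos_nonneg power2_eq_square algebra_simps)
        then have "?\<chi> x * ((norm (g x))\<^sup>2 / (1 + norm (g x))) \<le> 1 * norm (g x)"
          by (intro mult_mono box_bump_le_1) auto
        then show "norm (?\<chi> x * ((norm (g x))\<^sup>2 / (1 + norm (g x)))) \<le> norm (g x)"
          using nn[of x] by (simp only: real_norm_def abs_of_nonneg mult_1)
      qed
    qed measurable
  qed (use nn in auto)
  then show ?thesis
  proof eventually_elim
    case (elim x)
    show ?case
    proof
      assume "x \<in> box a b"
      then have "?\<chi> x > 0" by (simp add: box_bump_pos_iff)
      with elim have "(norm (g x))\<^sup>2 / (1 + norm (g x)) = 0" by simp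
      moreover have "1 + norm (g x) > 0" by (simp add: add_pos_nonneg)
      ultimately show "g x = 0" by (auto simp: divide_eq_0_iff)
    qed
  qed
qed

theorem fundamental_lemma:
  fixes g :: "real^'n \<Rightarrow> complex"
  assumes D: "open D" and g: "integrable (lebesgue_on D) g"
    and zero: "\<And>\<phi>. \<phi> \<in> test_functions D \<Longrightarrow> (LINT x|lebesgue_on D. g x * \<phi> x) = 0"
  shows "AE x in lebesgue_on D. g x = 0"
proof -
  define \<F> where "\<F> = {box a b |a b. cbox a b \<subseteq> D}"
  obtain \<G> where G: "\<G> \<subseteq> \<F>" "countable \<G>" "\<Union>\<G> = \<Union>\<F>"
    using Lindelof[of \<F>] by (auto simp: \<F>_def)
  have cover: "x \<in> \<Union>\<F>" if "x \<in> D" for x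
    using open_contains_cbox[OF D that] unfolding \<F>_def by (metis (mono_tags, lifting) UnionI mem_Collect_eq)
  have "AE x in lebesgue_on D. \<forall>X\<in>\<G>. x \<in> X \<longrightarrow> g x = 0"
  proof (rule AE_ball_countable[THEN iffD2, OF G(2)], rule ballI)
    fix X assume "X \<in> \<G>"
    then obtain a b where "X = box a b" "cbox a b \<subseteq> D" using G(1) by (auto simp: \<F>_def)
    then show "AE x in lebesgue_on D. x \<in> X \<longrightarrow> g x = 0"
      using fundamental_lemma_box[OF D g zero] by simp
  qed
  moreover have "AE x in lebesgue_on D. x \<in> D" by (rule AE_I2) simp
  ultimately show ?thesis
    by eventually_elim (use cover G(3) in blast)
qed

lemma L2_iff: "f \<in> L2 D \<longleftrightarrow> square_integrable (lebesgue_on D) f"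
  by (simp add: L2_def square_integrable_def)

lemma L2_norm_eq: "L2_norm D f = sqrt (l2_sq (lebesgue_on D) f)"
  by (simp add: L2_norm_def l2_sq_def)

lemma finite_measure_lebesgue_on:
  assumes "bounded D" "D \<in> sets lebesgue"
  shows "finite_measure (lebesgue_on D)"
proof
  have "emeasure lebesgue D \<noteq> \<infinity>"
    using fmeasurableD2[OF bounded_set_imp_lmeasurable[OF assms]] by (simp only: infinity_ennreal_def not_False_eq_True)
  then show "emeasure (lebesgue_on D) (space (lebesgue_on D)) \<noteq> \<infinity>"
    using assms(2) emeasure_restrict_space[of D lebesgue D] by simp
qed

lemma weak_deriv_AE_unique:
  assumes D: "open D" "bounded D" and g: "g \<in> L2 D" "has_weak_deriv D is u g" and h: "h \<in> L2 D" "has_weak_deriv D is u h"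
  shows "AE x in lebesgue_on D. g x = h x"
proof -
  have fin: "finite_measure (lebesgue_on D)" using D by (intro finite_measure_lebesgue_on) auto
  have sd: "square_integrable (lebesgue_on D) (\<lambda>x. g x - h x)"
    using g h by (intro square_integrable_diff) (auto simp: L2_iff)
  have "AE x in lebesgue_on D. g x - h x = 0"
  proof (rule fundamental_lemma[OF D(1) square_integrable_imp_integrable[OF sd fin]])
    fix \<phi> assume \<phi>: "\<phi> \<in> test_functions D"
    note t = test_function_square_integrable[OF D(1) \<phi>]
    have "(LINT x|lebesgue_on D. g x * \<phi> x) = (LINT x|lebesgue_on D. h x * \<phi> x)"
      using g(2) h(2) \<phi> unfolding has_weak_deriv_def by auto
    then show "(LINT x|lebesgue_on D. (g x - h x) * \<phi> x) = 0"
      using g(1) h(1) t by (simp add: left_diff_distrib square_integrable_mult L2_iff)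
  qed
  then show ?thesis by simp
qed

lemma weak_deriv_works:
  assumes "u \<in> sobolev m D" "length is \<le> m"
  shows "weak_deriv D is u \<in> L2 D" "has_weak_deriv D is u (weak_deriv D is u)"
proof -
  have "\<exists>g. g \<in> L2 D \<and> has_weak_deriv D is u g" using assms by (auto simp: sobolev_def)
  from someI_ex[OF this] show "weak_deriv D is u \<in> L2 D" "has_weak_deriv D is u (weak_deriv D is u)"
    unfolding weak_deriv_def by auto
qed

lemma l2_sq_weak_deriv:
  assumes D: "open D" "bounded D" and "u \<in> sobolev m D" "length is \<le> m" and g: "g \<in> L2 D" "has_weak_deriv D is u g"
  shows "l2_sq (lebesgue_on D) (weak_deriv D is u) = l2_sq (lebesgue_on D) g"
  by (rule l2_sq_cong_AE)
    (use weak_deriv_works[OF assms(3,4)] weak_deriv_AE_unique[OF D weak_deriv_works[OF assms(3,4)] g] g in \<open>auto simp: L2_iff\<close>)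

lemma integral_by_parts:
  assumes D: "open D" and f: "smooth f" and \<phi>: "\<phi> \<in> test_functions D"
  shows "(LINT x|lebesgue_on D. f x * partial_deriv i \<phi> x) = - (LINT x|lebesgue_on D. partial_deriv i f x * \<phi> x)"
proof -
  have m: "g \<in> borel_measurable borel" if "smooth g" for g :: "real^'a \<Rightarrow> complex"
    using that by (intro borel_measurable_continuous_onI smooth_continuous_on)
  have "(LINT x|lebesgue_on D. f x * partial_deriv i \<phi> x) = (LINT x|lborel. f x * partial_deriv i \<phi> x)"
    using D test_function_outside[OF test_functions_partial_deriv[OF \<phi>]]
    by (intro integral_lebesgue_on_eq_lborel m smooth_mult f test_functions_smooth[OF test_functions_partial_deriv[OF \<phi>]]) auto
  also have "\<dots> = - (LINT x|lborel. partial_deriv i f x * \<phi> x)" by (rule integral_by_parts_lborel[OF f \<phi>])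
  also have "(LINT x|lborel. partial_deriv i f x * \<phi> x) = (LINT x|lebesgue_on D. partial_deriv i f x * \<phi> x)"
    using D test_function_outside[OF \<phi>]
    by (intro integral_lebesgue_on_eq_lborel[symmetric] m smooth_mult smooth_partial_deriv f test_functions_smooth[OF \<phi>]) auto
  finally show ?thesis .
qed

text \<open>Integration by parts peels the directions off in the opposite order, hence the reversal.\<close>

lemma has_weak_deriv_test_function:
  assumes D: "open D" and "\<phi> \<in> test_functions D"
  shows "has_weak_deriv D is \<phi> (iter_partial (rev is) \<phi>)"
  using assms(2)
proof (induction "is" arbitrary: \<phi>)
  case Nil
  then show ?case by (simp add: has_weak_deriv_def)
next
  case (Cons i "is")
  show ?case unfolding has_weak_deriv_def
  proof
    fix \<psi> assume \<psi>: "\<psi> \<in> test_functions D"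
    have "(LINT x|lebesgue_on D. \<phi> x * iter_partial (i # is) \<psi> x)
        = - (LINT x|lebesgue_on D. partial_deriv i \<phi> x * iter_partial is \<psi> x)"
      using integral_by_parts[OF D test_functions_smooth[OF Cons.prems] test_functions_iter_partial[OF \<psi>]] by simp
    also have "(LINT x|lebesgue_on D. partial_deriv i \<phi> x * iter_partial is \<psi> x)
        = (-1) ^ length is * (LINT x|lebesgue_on D. iter_partial (rev is) (partial_deriv i \<phi>) x * \<psi> x)"
      using Cons.IH[OF test_functions_partial_deriv[OF Cons.prems]] \<psi> by (simp add: has_weak_deriv_def)
    finally show "(LINT x|lebesgue_on D. \<phi> x * iter_partial (i # is) \<psi> x)
        = (-1) ^ length (i # is) * (LINT x|lebesgue_on D. iter_partial (rev (i # is)) \<phi> x * \<psi> x)"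
      by (simp add: iter_partial_append)
  qed
qed

lemma has_weak_deriv_diff:
  assumes D: "open D" and u: "u \<in> L2 D" "g \<in> L2 D" "has_weak_deriv D is u g" and v: "v \<in> L2 D" "h \<in> L2 D" "has_weak_deriv D is v h"
  shows "has_weak_deriv D is (\<lambda>x. u x - v x) (\<lambda>x. g x - h x)"
  unfolding has_weak_deriv_def
proof
  fix \<phi> assume \<phi>: "\<phi> \<in> test_functions D"
  note t = test_function_square_integrable[OF D \<phi>] test_function_square_integrable[OF D test_functions_iter_partial[OF \<phi>]]
  show "(LINT x|lebesgue_on D. (u x - v x) * iter_partial is \<phi> x)
      = (-1) ^ length is * (LINT x|lebesgue_on D. (g x - h x) * \<phi> x)"
    using u v t \<phi> unfolding has_weak_deriv_def L2_iff
    by (simp add: left_diff_distrib square_integrable_mult right_diff_distrib)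
qed

lemma finite_multi_indices: "finite {is :: 'n::finite list. length is \<le> m}"
  using finite_lists_length_le[of "UNIV :: 'n set" m] by simp

text \<open>The norm is defined through chosen representatives of the weak derivatives; by uniqueness any other
family of weak derivatives in $L^2$ computes it.\<close>

lemma sobolev_diff_test_function:
  assumes D: "open D" "bounded D" and u: "u \<in> L2 D" and G: "\<And>is. length is \<le> m \<Longrightarrow> G is \<in> L2 D \<and> has_weak_deriv D is u (G is)"
    and \<phi>: "\<phi> \<in> test_functions D"
  shows "sobolev_norm m D (\<lambda>x. u x - \<phi> x)
    = sqrt (\<Sum>is | length is \<le> m. l2_sq (lebesgue_on D) (\<lambda>x. G is x - iter_partial (rev is) \<phi> x))"
proof -
  have tL: "iter_partial is \<phi> \<in> L2 D" for "is"
    using test_function_square_integrable[OF D(1) test_functions_iter_partial[OF \<phi>]] by (simp add: L2_iff)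
  have \<phi>L: "\<phi> \<in> L2 D" using tL[of "[]"] by simp
  have L: "(\<lambda>x. f x - g x) \<in> L2 D" if "f \<in> L2 D" "g \<in> L2 D" for f g
    using that by (simp add: L2_iff square_integrable_diff)
  have w: "has_weak_deriv D is (\<lambda>x. u x - \<phi> x) (\<lambda>x. G is x - iter_partial (rev is) \<phi> x)" if "length is \<le> m" for "is"
    using G[OF that] by (intro has_weak_deriv_diff D u \<phi>L tL has_weak_deriv_test_function \<phi>) auto
  have s: "(\<lambda>x. u x - \<phi> x) \<in> sobolev m D"
    unfolding sobolev_def using w L[OF u \<phi>L] L[OF _ tL] G by blast
  show ?thesis unfolding sobolev_norm_def
  proof (rule arg_cong[of _ _ sqrt], rule sum.cong)
    fix "is" :: "'a list" assume "is \<in> {is. length is \<le> m}"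
    then show "(L2_norm D (weak_deriv D is (\<lambda>x. u x - \<phi> x)))\<^sup>2 = l2_sq (lebesgue_on D) (\<lambda>x. G is x - iter_partial (rev is) \<phi> x)"
    proof -
      have l: "length is \<le> m" using \<open>is \<in> _\<close> by simp
      have "l2_sq (lebesgue_on D) (weak_deriv D is (\<lambda>x. u x - \<phi> x)) = l2_sq (lebesgue_on D) (\<lambda>x. G is x - iter_partial (rev is) \<phi> x)"
        by (rule l2_sq_weak_deriv[OF D s l L[OF _ tL] w[OF l]]) (use G[OF l] in blast)
      then show ?thesis unfolding L2_norm_eq by simp
    qed
  qed simp
qed

lemma sobolev0_approximation:
  assumes D: "open D" "bounded D" and u: "u \<in> sobolev0 m D"
  obtains \<phi> where "\<And>j::nat. \<phi> j \<in> test_functions D"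
    "\<And>is. length is \<le> m \<Longrightarrow> (\<lambda>j. l2_sq (lebesgue_on D) (\<lambda>x. weak_deriv D is u x - iter_partial (rev is) (\<phi> j) x)) \<longlonglongrightarrow> 0"
proof -
  have us: "u \<in> sobolev m D" and uL: "u \<in> L2 D" using u by (auto simp: sobolev0_def sobolev_def)
  obtain \<phi> where \<phi>: "\<And>j::nat. \<phi> j \<in> test_functions D"
    and lim: "(\<lambda>j. sobolev_norm m D (\<lambda>x. u x - \<phi> j x)) \<longlonglongrightarrow> 0"
    using u unfolding sobolev0_def by blast
  let ?d = "\<lambda>is j. l2_sq (lebesgue_on D) (\<lambda>x. weak_deriv D is u x - iter_partial (rev is) (\<phi> j) x)"
  have e: "sobolev_norm m D (\<lambda>x. u x - \<phi> j x) = sqrt (\<Sum>is | length is \<le> m. ?d is j)" for j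
    by (rule sobolev_diff_test_function[OF D uL _ \<phi>]) (use weak_deriv_works[OF us] in blast)
  have "(\<lambda>j. (sqrt (\<Sum>is | length is \<le> m. ?d is j))\<^sup>2) \<longlonglongrightarrow> 0\<^sup>2"
    using lim unfolding e by (rule tendsto_power)
  then have sm: "(\<lambda>j. \<Sum>is | length is \<le> m. ?d is j) \<longlonglongrightarrow> 0" by (simp add: sum_nonneg)
  have "?d is \<longlonglongrightarrow> 0" if "length is \<le> m" for "is"
  proof (rule tendsto_sandwich[OF _ _ tendsto_const sm])
    show "\<forall>\<^sub>F j in sequentially. ?d is j \<le> (\<Sum>is | length is \<le> m. ?d is j)"
      using that by (intro always_eventually allI member_le_sum finite_multi_indices) auto
  qed simp
  then show ?thesis using that \<phi> by blast
qed

lemma sobolev0I: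
  assumes D: "open D" "bounded D" and u: "u \<in> L2 D" and G: "\<And>is. length is \<le> m \<Longrightarrow> G is \<in> L2 D \<and> has_weak_deriv D is u (G is)"
    and \<phi>: "\<And>j::nat. \<phi> j \<in> test_functions D"
    and lim: "\<And>is. length is \<le> m \<Longrightarrow> (\<lambda>j. l2_sq (lebesgue_on D) (\<lambda>x. G is x - iter_partial (rev is) (\<phi> j) x)) \<longlonglongrightarrow> 0"
  shows "u \<in> sobolev0 m D"
proof -
  have "u \<in> sobolev m D" using u G unfolding sobolev_def by blast
  moreover have "(\<lambda>j. sobolev_norm m D (\<lambda>x. u x - \<phi> j x)) \<longlonglongrightarrow> 0"
  proof -
    have "(\<lambda>j. sqrt (\<Sum>is | length is \<le> m. l2_sq (lebesgue_on D) (\<lambda>x. G is x - iter_partial (rev is) (\<phi> j) x)))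
        \<longlonglongrightarrow> sqrt (\<Sum>is\<in>{is::'a list. length is \<le> m}. 0)"
      by (intro tendsto_real_sqrt tendsto_sum lim) auto
    then show ?thesis by (simp add: sobolev_diff_test_function[OF D u G \<phi>])
  qed
  ultimately show ?thesis unfolding sobolev0_def using \<phi> by blast
qed

section \<open>Periodic functions and trigonometric polynomials\<close>

lemma AE_lebesgue_iff_negligible: "(AE x in lebesgue. P x) \<longleftrightarrow> negligible {x. \<not> P x}"
proof
  assume "AE x in lebesgue. P x"
  then obtain N where "N \<in> null_sets lebesgue" "{x. \<not> P x} \<subseteq> N"
    unfolding eventually_ae_filter by auto
  then show "negligible {x. \<not> P x}" by (meson negligible_iff_null_sets negligible_subset)
next
  assume "negligible {x. \<not> P x}"
  then show "AE x in lebesgue. P x" by (intro AE_I'[of "{x. \<not> P x}"]) (auto simp: negligible_iff_null_sets)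
qed

lemma AE_lebesgue_on_iff:
  "D \<in> sets lebesgue \<Longrightarrow> (AE x in lebesgue_on D. P x) \<longleftrightarrow> (AE x in lebesgue. x \<in> D \<longrightarrow> P x)"
  by (subst AE_restrict_space_iff) auto

lemma AE_lebesgue_scale:
  fixes P :: "real^'n \<Rightarrow> bool"
  assumes "AE x in lebesgue. P x" "c \<noteq> 0"
  shows "AE x in lebesgue. P (x /\<^sub>R c)"
proof -
  have "negligible ((\<lambda>x. c *\<^sub>R x) ` {x. \<not> P x})"
  proof (rule negligible_differentiable_image_negligible[OF order_refl])
    show "negligible {x. \<not> P x}" using assms(1) by (simp add: AE_lebesgue_iff_negligible)
    show "(\<lambda>x. c *\<^sub>R x) differentiable_on {x. \<not> P x}"
      by (intro bounded_linear_imp_differentiable_on bounded_linear_scaleR_right)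
  qed
  moreover have "{x. \<not> P (x /\<^sub>R c)} \<subseteq> (\<lambda>x. c *\<^sub>R x) ` {x. \<not> P x}"
    using assms(2) by (auto intro!: image_eqI[of x _ "x /\<^sub>R c" for x])
  ultimately show ?thesis unfolding AE_lebesgue_iff_negligible by (rule negligible_subset)
qed

lemma scaled_measurable:
  assumes "f \<in> borel_measurable lebesgue"
  shows "(\<lambda>x. f (x /\<^sub>R c)) \<in> borel_measurable lebesgue"
  using measurable_compose[OF lebesgue_measurable_scaling assms] by simp

definition lattice_pt :: "('n \<Rightarrow> int) \<Rightarrow> real^'n" where
  "lattice_pt z = (\<chi> i. of_int (z i))"

definition half_cell :: "(real^'n) set" where
  "half_cell = {y. \<forall>i. 0 \<le> y $ i \<and> y $ i < 1}"

definition unit_periodic :: "(real^'n \<Rightarrow> 'b) \<Rightarrow> bool" where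
  "unit_periodic f \<longleftrightarrow> (\<forall>x i. f (x + axis i 1) = f x)"

lemma lattice_pt_nth [simp]: "lattice_pt z $ i = of_int (z i)"
  by (simp add: lattice_pt_def)

lemma unit_periodic_axis:
  fixes f :: "real^'n \<Rightarrow> 'b"
  assumes "unit_periodic f" shows "f (x + axis i (of_int k)) = f x"
proof (induction k arbitrary: x rule: int_induct[where k=0])
  case base
  have "axis i (0::real) = (0::real^'n)" by (simp add: vec_eq_iff axis_def)
  then show ?case by (simp only: of_int_0 add_0_right)
next
  case (step1 k)
  have "x + axis i (of_int (k + 1)) = (x + axis i (of_int k)) + axis i 1"
    by (simp add: vec_eq_iff axis_def)
  then show ?case using assms step1.IH by (simp only: unit_periodic_def)
next
  case (step2 k)
  have "(x + axis i (of_int (k - 1))) + axis i 1 = x + axis i (of_int k)"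
    by (simp add: vec_eq_iff axis_def)
  then show ?case using assms step2.IH by (metis unit_periodic_def)
qed

lemma unit_periodic_lattice:
  assumes "unit_periodic f" shows "f (x + lattice_pt z) = f x"
proof -
  have "f (x + (\<Sum>i\<in>A. axis i (of_int (z i)))) = f x" if "finite A" for A
    using that
  proof (induction A arbitrary: x)
    case (insert i A)
    have "f (x + (\<Sum>i\<in>insert i A. axis i (of_int (z i)))) = f ((x + axis i (of_int (z i))) + (\<Sum>i\<in>A. axis i (of_int (z i))))"
      using insert by (simp add: add.assoc)
    then show ?case using insert.IH unit_periodic_axis[OF assms] by metis
  qed simp
  moreover have "lattice_pt z = (\<Sum>i\<in>UNIV. axis i (of_int (z i)))"
    by (simp add: vec_eq_iff axis_def)
  ultimately show ?thesis by (metis finite)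
qed

lemma half_cell_floor: "x - lattice_pt (\<lambda>i. \<lfloor>x $ i\<rfloor>) \<in> half_cell"
  by (simp add: half_cell_def) linarith

lemma unit_cell_eq_box: "unit_cell = box 0 1"
  by (auto simp: unit_cell_def mem_box_cart)

lemma half_cell_borel [measurable]: "half_cell \<in> sets borel"
  unfolding half_cell_def by measurable

lemma unit_cell_sets [simp]: "unit_cell \<in> sets lebesgue" "unit_cell \<in> sets borel"
  by (simp_all add: unit_cell_eq_box)

lemma negligible_cell_boundary: "negligible (half_cell - unit_cell)"
proof (rule negligible_subset)
  show "negligible (\<Union>i\<in>UNIV. {x::real^'n. x $ i = 0})"
    by (rule negligible_Union) (auto simp: negligible_standard_hyperplane_cart)
  show "half_cell - unit_cell \<subseteq> (\<Union>i\<in>UNIV. {x::real^'n. x $ i = 0})"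
    by (auto simp: half_cell_def unit_cell_def less_le)
qed

lemma unit_cell_subset_half_cell: "unit_cell \<subseteq> half_cell"
  by (auto simp: half_cell_def unit_cell_def less_imp_le)

lemma AE_half_cell_iff: "AE y in lebesgue. y \<in> half_cell \<longleftrightarrow> y \<in> unit_cell"
  unfolding AE_lebesgue_iff_negligible
  by (rule negligible_subset[OF negligible_cell_boundary]) (use unit_cell_subset_half_cell in auto)

lemma periodic_AE:
  fixes P :: "real^'n \<Rightarrow> bool"
  assumes per: "unit_periodic P" and ae: "AE y in lebesgue_on unit_cell. P y"
  shows "AE x in lebesgue. P x"
proof -
  let ?N = "{y \<in> half_cell. \<not> P y}"
  have "AE y in lebesgue. y \<in> half_cell \<longrightarrow> P y"
    using ae AE_half_cell_iff by (subst (asm) AE_lebesgue_on_iff) (auto elim: eventually_elim2)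
  then have N: "negligible ?N" unfolding AE_lebesgue_iff_negligible by (simp add: conj_commute cong: conj_cong)
  have "negligible (\<Union>z. (+) (lattice_pt z) ` ?N)"
    by (intro negligible_countable_Union) (auto intro: negligible_translation[OF N])
  moreover have "{x. \<not> P x} \<subseteq> (\<Union>z. (+) (lattice_pt z) ` ?N)"
  proof
    fix x assume x: "x \<in> {x. \<not> P x}"
    let ?z = "\<lambda>i. \<lfloor>x $ i\<rfloor>"
    have "P (x - lattice_pt ?z) = P x" using unit_periodic_lattice[OF per, of "x - lattice_pt ?z" ?z] by simp
    then have "x - lattice_pt ?z \<in> ?N" using x half_cell_floor[of x] by simp
    then have "x \<in> (+) (lattice_pt ?z) ` ?N" by (intro image_eqI[of _ _ "x - lattice_pt ?z"]) auto
    then show "x \<in> (\<Union>z. (+) (lattice_pt z) ` ?N)" by blast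
  qed
  ultimately show ?thesis unfolding AE_lebesgue_iff_negligible by (rule negligible_subset)
qed

lemma nn_integral_lebesgue_affine:
  fixes f :: "real^'n \<Rightarrow> ennreal"
  assumes f: "f \<in> borel_measurable lebesgue" and c: "c > 0"
  shows "(\<integral>\<^sup>+x. f x \<partial>lebesgue) = ennreal (c ^ CARD('n)) * (\<integral>\<^sup>+x. f (t + c *\<^sub>R x) \<partial>lebesgue)"
proof -
  let ?T = "\<lambda>x::real^'n. t + (\<Sum>j\<in>Basis. (c * (x \<bullet> j)) *\<^sub>R j)"
  have T: "?T = (\<lambda>x. t + c *\<^sub>R x)"
    by (simp only: scaleR_scaleR[symmetric] scaleR_sum_right[symmetric] euclidean_representation)
  have m: "(\<lambda>x. t + c *\<^sub>R x) \<in> lebesgue \<rightarrow>\<^sub>M lebesgue"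
    using lebesgue_affine_measurable[of "\<lambda>_. c" t] c unfolding T by simp
  have "(\<Prod>j\<in>(Basis :: (real^'n) set). \<bar>c\<bar>) = c ^ CARD('n)" using c by simp
  then have e: "lebesgue = density (distr lebesgue lebesgue (\<lambda>x. t + c *\<^sub>R x)) (\<lambda>_. ennreal (c ^ CARD('n)))"
    using lebesgue_affine_euclidean[of "\<lambda>_. c" t] c unfolding T by simp
  have "(\<integral>\<^sup>+x. f x \<partial>lebesgue) = (\<integral>\<^sup>+x. f x \<partial>density (distr lebesgue lebesgue (\<lambda>x. t + c *\<^sub>R x)) (\<lambda>_. ennreal (c ^ CARD('n))))"
    by (subst e) simp
  also have "\<dots> = (\<integral>\<^sup>+x. ennreal (c ^ CARD('n)) * f x \<partial>distr lebesgue lebesgue (\<lambda>x. t + c *\<^sub>R x))"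
    using f by (intro nn_integral_density) auto
  also have "\<dots> = (\<integral>\<^sup>+x. ennreal (c ^ CARD('n)) * f (t + c *\<^sub>R x) \<partial>lebesgue)"
    using f m by (intro nn_integral_distr) auto
  also have "\<dots> = ennreal (c ^ CARD('n)) * (\<integral>\<^sup>+x. f (t + c *\<^sub>R x) \<partial>lebesgue)"
    by (intro nn_integral_cmult measurable_compose[OF m f])
  finally show ?thesis .
qed

text \<open>The set $D$ is covered by at most $(2 \lceil R/e \rceil + 1)^d$ lattice cells of side $e$, and each of
them contributes $e^d$ times the integral over the unit cell.\<close>

lemma nn_integral_periodic_scaled_le:
  fixes r :: "real^'n \<Rightarrow> ennreal"
  assumes r [measurable]: "r \<in> borel_measurable lebesgue" and per: "unit_periodic r"
    and D: "D \<subseteq> cball 0 R" "R \<ge> 0" and e: "0 < e" "e \<le> 1"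
  shows "(\<integral>\<^sup>+x. indicator D x * r (x /\<^sub>R e) \<partial>lebesgue)
    \<le> ennreal ((2 * R + 3) ^ CARD('n)) * (\<integral>\<^sup>+y. indicator unit_cell y * r y \<partial>lebesgue)"
proof -
  define I where "I = (\<integral>\<^sup>+y. indicator half_cell y * r y \<partial>lebesgue)"
  define M where "M = \<lceil>R / e\<rceil>"
  have M: "M \<ge> 0" "R / e \<le> of_int M" "of_int M < R / e + 1"
  proof -
    have "0 \<le> R / e" using D e by simp
    moreover show "R / e \<le> of_int M" "of_int M < R / e + 1"
      using ceiling_correct[of "R / e"] unfolding M_def by linarith+
    ultimately have "(0::real) \<le> of_int M" by linarith
    then show "M \<ge> 0" by simp
  qed
  define Z where "Z = (UNIV :: 'n set) \<rightarrow>\<^sub>E {-M..M}"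
  have Z: "finite Z" "card Z = nat (2 * M + 1) ^ CARD('n)"
    using M by (auto simp: Z_def card_PiE finite_PiE)
  let ?g = "\<lambda>z x. indicator half_cell (x /\<^sub>R e - lattice_pt z) * r (x /\<^sub>R e)"
  have [measurable]: "(\<lambda>x::real^'n. x /\<^sub>R e) \<in> lebesgue \<rightarrow>\<^sub>M lebesgue"
    by (rule lebesgue_measurable_scaling)
  have hm: "(indicator half_cell :: real^'n \<Rightarrow> ennreal) \<in> borel_measurable lebesgue"
    by (intro measurable_completion) measurable
  have gm: "?g z \<in> borel_measurable lebesgue" for z
  proof -
    have "(\<lambda>x::real^'n. x /\<^sub>R e - lattice_pt z) \<in> borel_measurable lborel" by measurable
    then have "(\<lambda>x. indicator half_cell (x /\<^sub>R e - lattice_pt z) :: ennreal) \<in> borel_measurable lborel"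
      by measurable
    then have [measurable]: "(\<lambda>x. indicator half_cell (x /\<^sub>R e - lattice_pt z) :: ennreal) \<in> borel_measurable lebesgue"
      by (rule measurable_completion)
    have [measurable]: "(\<lambda>x. r (x /\<^sub>R e)) \<in> borel_measurable lebesgue"
      by (rule scaled_measurable[OF r])
    show ?thesis by measurable
  qed
  have "(\<integral>\<^sup>+x. indicator D x * r (x /\<^sub>R e) \<partial>lebesgue) \<le> (\<integral>\<^sup>+x. (\<Sum>z\<in>Z. ?g z x) \<partial>lebesgue)"
  proof (rule nn_integral_mono)
    fix x :: "real^'n"
    show "indicator D x * r (x /\<^sub>R e) \<le> (\<Sum>z\<in>Z. ?g z x)"
    proof (cases "x \<in> D")
      case True
      let ?z = "\<lambda>i. \<lfloor>(x /\<^sub>R e) $ i\<rfloor>"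
      have "?z \<in> Z"
      proof -
        have "\<lfloor>(x /\<^sub>R e) $ i\<rfloor> \<in> {-M..M}" for i
        proof -
          have "\<bar>x $ i\<bar> \<le> R" using True D(1) component_le_norm_cart[of x i] by force
          then have "\<bar>(x /\<^sub>R e) $ i\<bar> \<le> R / e" using e by (simp add: divide_inverse mult.commute abs_mult)
          then have "\<bar>(x /\<^sub>R e) $ i\<bar> \<le> of_int M" using M by linarith
          then show ?thesis by (simp add: le_floor_iff floor_le_iff) linarith
        qed
        then show ?thesis by (auto simp: Z_def)
      qed
      then have "?g ?z x \<le> (\<Sum>z\<in>Z. ?g z x)" by (intro member_le_sum Z) auto
      moreover have "?g ?z x = indicator D x * r (x /\<^sub>R e)" using True half_cell_floor[of "x /\<^sub>R e"] by simp
      ultimately show ?thesis by simp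
    qed simp
  qed
  also have "\<dots> = (\<Sum>z\<in>Z. \<integral>\<^sup>+x. ?g z x \<partial>lebesgue)"
    by (rule nn_integral_sum) (rule gm)
  also have "\<dots> = (\<Sum>z\<in>Z. ennreal (e ^ CARD('n)) * I)"
  proof (rule sum.cong[OF refl])
    fix z
    have "?g z (e *\<^sub>R lattice_pt z + e *\<^sub>R y) = indicator half_cell y * r y" for y
    proof -
      have "(e *\<^sub>R lattice_pt z + e *\<^sub>R y) /\<^sub>R e = y + lattice_pt z"
        using e by (simp add: scaleR_add_right)
      then show ?thesis using unit_periodic_lattice[OF per, of y z] by simp
    qed
    then show "(\<integral>\<^sup>+x. ?g z x \<partial>lebesgue) = ennreal (e ^ CARD('n)) * I"
      using nn_integral_lebesgue_affine[OF gm e(1), of z "e *\<^sub>R lattice_pt z"] by (simp add: I_def)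
  qed
  also have "\<dots> = of_nat (card Z) * (ennreal (e ^ CARD('n)) * I)" by simp
  also have "\<dots> = ennreal (real (card Z) * e ^ CARD('n)) * I"
    using e by (simp add: ennreal_mult ennreal_of_nat_eq_real_of_nat mult.assoc)
  also have "\<dots> \<le> ennreal ((2 * R + 3) ^ CARD('n)) * I"
  proof (intro mult_right_mono ennreal_leI)
    have "real (card Z) * e ^ CARD('n) = ((2 * of_int M + 1) * e) ^ CARD('n)"
      using M by (simp add: Z power_mult_distrib)
    also have "\<dots> \<le> (2 * R + 3) ^ CARD('n)"
    proof (rule power_mono)
      have "of_int M * e \<le> R + e" using M(3) e by (simp add: field_simps)
      then show "(2 * of_int M + 1) * e \<le> 2 * R + 3" using e by (simp add: algebra_simps)
      show "0 \<le> (2 * of_int M + 1) * e" using M e by simp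
    qed
    finally show "real (card Z) * e ^ CARD('n) \<le> (2 * R + 3) ^ CARD('n)" .
  qed simp
  also have "I = (\<integral>\<^sup>+y. indicator unit_cell y * r y \<partial>lebesgue)"
    unfolding I_def by (rule nn_integral_cong_AE) (use AE_half_cell_iff in \<open>auto elim!: eventually_mono simp: indicator_def\<close>)
  finally show ?thesis .
qed

lemma periodic_scaled_l2:
  fixes u :: "real^'n \<Rightarrow> complex"
  assumes u [measurable]: "u \<in> borel_measurable lebesgue" and per: "unit_periodic u"
    and si: "square_integrable (lebesgue_on unit_cell) u"
    and D: "D \<in> sets lebesgue" "D \<subseteq> cball 0 R" "R \<ge> 0" and e: "0 < e" "e \<le> 1"
  shows "square_integrable (lebesgue_on D) (\<lambda>x. u (x /\<^sub>R e))"
    and "l2_sq (lebesgue_on D) (\<lambda>x. u (x /\<^sub>R e)) \<le> (2 * R + 3) ^ CARD('n) * l2_sq (lebesgue_on unit_cell) u"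
proof -
  let ?r = "\<lambda>x. ennreal ((norm (u x))\<^sup>2)" and ?K = "(2 * R + 3) ^ CARD('n)"
  have K: "?K \<ge> 0" using D by simp
  have rm: "?r \<in> borel_measurable lebesgue" by measurable
  have rp: "unit_periodic ?r" using per by (simp add: unit_periodic_def)
  have sm: "(\<lambda>x. u (x /\<^sub>R e)) \<in> borel_measurable lebesgue" by (rule scaled_measurable[OF u])
  have "(\<integral>\<^sup>+x. ?r (x /\<^sub>R e) \<partial>lebesgue_on D) = (\<integral>\<^sup>+x. indicator D x * ?r (x /\<^sub>R e) \<partial>lebesgue)"
    using D by (subst nn_integral_restrict_space) (auto simp: mult.commute)
  also have "\<dots> \<le> ennreal ?K * (\<integral>\<^sup>+y. indicator unit_cell y * ?r y \<partial>lebesgue)"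
    by (rule nn_integral_periodic_scaled_le[OF rm rp D(2,3) e])
  also have "(\<integral>\<^sup>+y. indicator unit_cell y * ?r y \<partial>lebesgue) = (\<integral>\<^sup>+y. ?r y \<partial>lebesgue_on unit_cell)"
    by (subst nn_integral_restrict_space) (auto simp: mult.commute)
  also have "\<dots> = ennreal (l2_sq (lebesgue_on unit_cell) u)"
    unfolding l2_sq_def by (rule nn_integral_eq_integral) (auto intro: square_integrable_sq[OF si])
  also have "ennreal ?K * \<dots> = ennreal (?K * l2_sq (lebesgue_on unit_cell) u)"
    using K by (simp add: ennreal_mult)
  finally have F: "(\<integral>\<^sup>+x. ?r (x /\<^sub>R e) \<partial>lebesgue_on D) \<le> ennreal (?K * l2_sq (lebesgue_on unit_cell) u)" .
  have smD: "(\<lambda>x. u (x /\<^sub>R e)) \<in> borel_measurable (lebesgue_on D)"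
    by (rule measurable_restrict_space1[OF sm])
  have int: "integrable (lebesgue_on D) (\<lambda>x. (norm (u (x /\<^sub>R e)))\<^sup>2)"
  proof (rule integrableI_bounded)
    show "(\<integral>\<^sup>+x. ennreal (norm ((norm (u (x /\<^sub>R e)))\<^sup>2)) \<partial>lebesgue_on D) < \<infinity>"
      using le_less_trans[OF F] by simp
  qed (use smD in measurable)
  then show "square_integrable (lebesgue_on D) (\<lambda>x. u (x /\<^sub>R e))" using smD by (simp add: square_integrable_def)
  have "ennreal (l2_sq (lebesgue_on D) (\<lambda>x. u (x /\<^sub>R e))) = (\<integral>\<^sup>+x. ?r (x /\<^sub>R e) \<partial>lebesgue_on D)"
    unfolding l2_sq_def by (rule nn_integral_eq_integral[OF int, symmetric]) auto
  with F have "ennreal (l2_sq (lebesgue_on D) (\<lambda>x. u (x /\<^sub>R e))) \<le> ennreal (?K * l2_sq (lebesgue_on unit_cell) u)" by simp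
  then show "l2_sq (lebesgue_on D) (\<lambda>x. u (x /\<^sub>R e)) \<le> ?K * l2_sq (lebesgue_on unit_cell) u"
    using K by (subst (asm) ennreal_le_iff) auto
qed

text \<open>Trigonometric polynomials; an inductive definition lets all their linear properties be proved mode by
mode.\<close>

inductive_set trig :: "(real^'n \<Rightarrow> complex) set" where
  wave: "(\<lambda>x. c * wave ((2 * pi) *\<^sub>R lattice_pt m) x) \<in> trig"
| add: "P \<in> trig \<Longrightarrow> Q \<in> trig \<Longrightarrow> (\<lambda>x. P x + Q x) \<in> trig"

lemma wave_mult: "wave a x * wave b x = wave (a + b) x"
  by (simp add: wave_def inner_add_right distrib_left exp_add)

lemma trig_mult:
  assumes "P \<in> trig" "Q \<in> trig" shows "(\<lambda>x. P x * Q x) \<in> trig"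
  using assms
proof (induction P)
  case (wave c m)
  from wave show ?case
  proof (induction Q)
    case (wave d l)
    have "(\<lambda>x. c * wave ((2 * pi) *\<^sub>R lattice_pt m) x * (d * wave ((2 * pi) *\<^sub>R lattice_pt l) x))
        = (\<lambda>x. (c * d) * wave ((2 * pi) *\<^sub>R lattice_pt (\<lambda>i. m i + l i)) x)"
    proof
      fix x :: "real^'a"
      have "(2 * pi) *\<^sub>R lattice_pt (\<lambda>i. m i + l i) = (2 * pi) *\<^sub>R lattice_pt m + (2 * pi) *\<^sub>R (lattice_pt l :: real^'a)"
        by (simp add: vec_eq_iff algebra_simps)
      then show "c * wave ((2 * pi) *\<^sub>R lattice_pt m) x * (d * wave ((2 * pi) *\<^sub>R lattice_pt l) x)
          = (c * d) * wave ((2 * pi) *\<^sub>R lattice_pt (\<lambda>i. m i + l i)) x"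
        by (simp add: mult_ac flip: wave_mult)
    qed
    then show ?case by (simp add: trig.wave)
  next
    case (add P Q)
    then show ?case by (simp add: distrib_left trig.add)
  qed
next
  case (add P P')
  then show ?case by (simp add: distrib_right trig.add)
qed

lemma trig_const: "(\<lambda>x::real^'n. c) \<in> trig"
proof -
  have "(2 * pi) *\<^sub>R lattice_pt (\<lambda>_. 0) = (0 :: real^'n)" by (simp add: vec_eq_iff)
  then show ?thesis using trig.wave[of c "(\<lambda>_. 0) :: 'n \<Rightarrow> int"] by (simp add: wave_def[abs_def])
qed

lemma trig_sum:
  assumes "\<And>i. i \<in> I \<Longrightarrow> f i \<in> trig" shows "(\<lambda>x. \<Sum>i\<in>I. f i x) \<in> trig"
  using assms by (induction I rule: infinite_finite_induct) (auto intro: trig_const trig.add)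

lemma trig_continuous: "P \<in> trig \<Longrightarrow> continuous_on UNIV P"
  by (induction rule: trig.induct) (auto intro!: continuous_intros smooth_continuous_on[OF smooth_wave])

lemma trig_bounded: "P \<in> trig \<Longrightarrow> \<exists>B. \<forall>x. norm (P x) \<le> B"
proof (induction rule: trig.induct)
  case (wave c m)
  show ?case by (intro exI[of _ "norm c"]) (simp add: norm_mult)
next
  case (add P Q)
  then obtain A B where "\<forall>x. norm (P x) \<le> A" "\<forall>x. norm (Q x) \<le> B" by blast
  then show ?case by (intro exI[of _ "A + B"]) (auto intro: norm_triangle_le add_mono)
qed

lemma exp_two_pi_int: "exp (\<i> * of_real (2 * pi * of_int k)) = 1"
  using exp_eq_1[of "\<i> * of_real (2 * pi * of_int k)"] by (auto simp: mult.commute)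

lemma wave_shift: "wave b (x + axis i s) = exp (\<i> * of_real (s * b $ i)) * wave b x"
  by (simp add: wave_def inner_add_left inner_axis' distrib_left exp_add mult.commute)

lemma trig_periodic: "P \<in> trig \<Longrightarrow> unit_periodic P"
proof (induction rule: trig.induct)
  case (wave c m)
  show ?case unfolding unit_periodic_def using exp_two_pi_int by (simp add: wave_shift)
next
  case (add P Q)
  then show ?case by (simp add: unit_periodic_def)
qed

lemma trig_cos_sin:
  shows "(\<lambda>x::real^'n. of_real (cos (2 * pi * x $ i))) \<in> trig" "(\<lambda>x::real^'n. of_real (sin (2 * pi * x $ i))) \<in> trig"
proof -
  let ?m = "\<lambda>j. if j = i then 1 else 0 :: int"
  have e: "lattice_pt ?m = axis i 1" "lattice_pt (\<lambda>j. - ?m j) = - axis i (1::real)"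
    by (auto simp: vec_eq_iff axis_def)
  have w: "wave ((2 * pi) *\<^sub>R lattice_pt ?m) x = exp (\<i> * of_real (2 * pi * x $ i))"
    "wave ((2 * pi) *\<^sub>R lattice_pt (\<lambda>j. - ?m j)) x = exp (- (\<i> * of_real (2 * pi * x $ i)))" for x :: "real^'n"
    unfolding e by (simp_all add: wave_def inner_axis)
  have "(\<lambda>x. of_real (cos (2 * pi * x $ i))) = (\<lambda>x::real^'n. (1/2) * wave ((2 * pi) *\<^sub>R lattice_pt ?m) x + (1/2) * wave ((2 * pi) *\<^sub>R lattice_pt (\<lambda>j. - ?m j)) x)"
    unfolding w by (auto simp: cos_of_real[symmetric] cos_exp_eq add_divide_distrib)
  then show "(\<lambda>x::real^'n. of_real (cos (2 * pi * x $ i))) \<in> trig" by (simp only: trig.add trig.wave)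
  have "(\<lambda>x. of_real (sin (2 * pi * x $ i))) = (\<lambda>x::real^'n. (1/(2*\<i>)) * wave ((2 * pi) *\<^sub>R lattice_pt ?m) x + (-1/(2*\<i>)) * wave ((2 * pi) *\<^sub>R lattice_pt (\<lambda>j. - ?m j)) x)"
    unfolding w by (auto simp: sin_of_real[symmetric] sin_exp_eq diff_divide_distrib right_diff_distrib fun_eq_iff)
  then show "(\<lambda>x::real^'n. of_real (sin (2 * pi * x $ i))) \<in> trig" by (simp only: trig.add trig.wave)
qed

text \<open>Continuous functions that vanish on the cell boundary are functions on the torus, embedded here in
$\mathbb{C}^d$; polynomials on $\mathbb{C}^d$ restrict to trigonometric polynomials.\<close>

definition torus_map :: "real^'n \<Rightarrow> complex^'n" where
  "torus_map y = (\<chi> i. cis (2 * pi * y $ i))"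

lemma trig_polynomial_torus:
  fixes p :: "complex^'n \<Rightarrow> real"
  assumes "real_polynomial_function p" shows "(\<lambda>y. of_real (p (torus_map y))) \<in> trig"
  using assms
proof (induction rule: real_polynomial_function.induct)
  case (linear f)
  interpret bounded_linear f by fact
  have "f (torus_map y) = (\<Sum>i\<in>UNIV. cos (2 * pi * y $ i) * f (axis i 1) + sin (2 * pi * y $ i) * f (axis i \<i>))" for y
  proof -
    have "torus_map y = (\<Sum>i\<in>UNIV. cos (2 * pi * y $ i) *\<^sub>R axis i 1 + sin (2 * pi * y $ i) *\<^sub>R axis i \<i>)"
      by (auto simp: vec_eq_iff torus_map_def axis_def complex_eq_iff sum.distrib
          if_distrib cong: if_cong)
    then have "f (torus_map y) = f (\<Sum>i\<in>UNIV. cos (2 * pi * y $ i) *\<^sub>R axis i 1 + sin (2 * pi * y $ i) *\<^sub>R axis i \<i>)"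
      by (rule arg_cong)
    then show ?thesis by (simp only: sum add scaleR real_scaleR_def)
  qed
  then have "(\<lambda>y. of_real (f (torus_map y)) :: complex) = (\<lambda>y. \<Sum>i\<in>UNIV.
      of_real (cos (2 * pi * y $ i)) * of_real (f (axis i 1)) + of_real (sin (2 * pi * y $ i)) * of_real (f (axis i \<i>)))"
    by simp
  then show ?case by (simp only:) (intro trig_sum trig.add trig_mult trig_cos_sin trig_const)
qed (auto intro: trig_const trig.add trig_mult)

lemma torus_map_eq:
  fixes y y' :: "real^'n"
  assumes "y \<in> cbox 0 1" "y' \<in> cbox 0 1" "torus_map y = torus_map y'"
  shows "y = y' \<or> y \<notin> unit_cell \<and> y' \<notin> unit_cell"
proof (rule ccontr)
  assume H: "\<not> ?thesis"
  then obtain i where i: "y $ i \<noteq> y' $ i" by (auto simp: vec_eq_iff)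
  have b: "0 \<le> y $ i" "y $ i \<le> 1" "0 \<le> y' $ i" "y' $ i \<le> 1"
    using assms by (auto simp: mem_box_cart)
  have "cis (2 * pi * y $ i) = cis (2 * pi * y' $ i)" using assms(3) by (simp add: torus_map_def vec_eq_iff)
  then have "cis (2 * pi * (y $ i - y' $ i)) = 1"
    by (simp add: right_diff_distrib flip: cis_divide)
  then have "exp (\<i> * of_real (2 * pi * (y $ i - y' $ i))) = 1" by (simp add: cis_conv_exp)
  then obtain k :: int where "2 * pi * (y $ i - y' $ i) = of_int (2 * k) * pi"
    unfolding exp_eq_1 by auto
  then have k: "y $ i - y' $ i = of_int k" by simp
  with b i have "k = 1 \<or> k = -1"
  proof -
    have "k \<noteq> 0" using k i by auto
    moreover have "of_int k \<le> (1::real)" "of_int k \<ge> (-1::real)" using k b by linarith+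
    ultimately show ?thesis by linarith
  qed
  then have "(y $ i = 1 \<and> y' $ i = 0) \<or> (y $ i = 0 \<and> y' $ i = 1)" using k b by auto
  moreover have "z \<notin> unit_cell" if "z $ i = 0 \<or> z $ i = 1" for z :: "real^'n"
  proof
    assume "z \<in> unit_cell"
    then have "0 < z $ i \<and> z $ i < 1" by (simp add: unit_cell_def)
    with that show False by auto
  qed
  ultimately have "y \<notin> unit_cell \<and> y' \<notin> unit_cell" by blast
  then show False using H by blast
qed

text \<open>The function factors through the torus because points of the closed cell with the same image
are equal or both lie on the boundary, where it vanishes. The factor is continuous as the closed
cell is compact, and the Weierstrass theorem applies on the torus.\<close>

lemma trig_dense_uniform:
  fixes h :: "real^'n \<Rightarrow> real"
  assumes h: "continuous_on UNIV h" "\<And>y. y \<notin> unit_cell \<Longrightarrow> h y = 0" and e: "e > 0"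
  obtains P where "P \<in> trig" "\<And>y. y \<in> unit_cell \<Longrightarrow> norm (of_real (h y) - P y) < e"
proof -
  let ?C = "cbox 0 (1::real^'n)" and ?T = "torus_map ` cbox 0 (1::real^'n)"
  have Ec: "continuous_on UNIV (torus_map :: real^'n \<Rightarrow> _)"
    unfolding torus_map_def by (intro continuous_intros)
  have T: "compact ?T" by (intro compact_continuous_image continuous_on_subset[OF Ec]) auto
  define H where "H z = h (SOME y. y \<in> ?C \<and> torus_map y = z)" for z
  have HE: "H (torus_map y) = h y" if "y \<in> ?C" for y
  proof -
    let ?y = "SOME y'. y' \<in> ?C \<and> torus_map y' = torus_map y"
    have "?y \<in> ?C \<and> torus_map ?y = torus_map y" by (rule someI[of _ y]) (use that in simp)
    then have "?y = y \<or> ?y \<notin> unit_cell \<and> y \<notin> unit_cell" using that by (intro torus_map_eq) auto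
    then show ?thesis unfolding H_def using h(2) by auto
  qed
  have Hc: "continuous_on ?T H"
    unfolding continuous_on_closed_vimage[OF compact_imp_closed[OF T]]
  proof (intro allI impI)
    fix B :: "real set" assume B: "closed B"
    have "H -` B \<inter> ?T = torus_map ` (h -` B \<inter> ?C)" using HE by auto
    moreover have "compact (h -` B \<inter> ?C)"
      using continuous_on_closed_vimage[of ?C h] continuous_on_subset[OF h(1)] B
      by (intro compact_closed_subset[OF compact_cbox[of 0 1]]) auto
    ultimately show "closed (H -` B \<inter> ?T)"
      using compact_continuous_image[OF continuous_on_subset[OF Ec]] by (metis compact_imp_closed subset_UNIV)
  qed
  obtain p where p: "real_polynomial_function p" "\<And>z. z \<in> ?T \<Longrightarrow> \<bar>H z - p z\<bar> < e"
    using Stone_Weierstrass_real_polynomial_function[OF T Hc e] by blast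
  show ?thesis
  proof (rule that[OF trig_polynomial_torus[OF p(1)]])
    fix y :: "real^'n" assume "y \<in> unit_cell"
    then have "y \<in> ?C" unfolding unit_cell_eq_box using box_subset_cbox by blast
    then show "norm (of_real (h y) - complex_of_real (p (torus_map y))) < e"
      using p(2)[of "torus_map y"] HE[of y] by (simp flip: of_real_diff)
  qed
qed

lemma measure_unit_cell: "measure lebesgue (unit_cell :: (real^'n) set) = 1"
proof -
  have "measure lebesgue (box 0 (1::real^'n)) = measure lebesgue (cbox 0 (1::real^'n))"
    by (simp add: measure_lborel_box_eq measure_lborel_cbox_eq measure_completion)
  then show ?thesis unfolding unit_cell_eq_box
    using content_cbox_cart[of 0 "1::real^'n"] by (simp add: interval_ne_empty_cart measure_completion)
qed

lemma finite_measure_unit_cell: "finite_measure (lebesgue_on (unit_cell :: (real^'n) set))"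
  by (rule finite_measure_lebesgue_on) (auto simp: unit_cell_eq_box bounded_box)

lemma integral_unit_cell_const:
  fixes c :: "'b::euclidean_space"
  shows "(LINT y|lebesgue_on (unit_cell :: (real^'n) set). c) = c"
proof -
  have "measure (lebesgue_on (unit_cell :: (real^'n) set)) (space (lebesgue_on (unit_cell :: (real^'n) set)))
      = measure lebesgue (unit_cell :: (real^'n) set)"
    by (subst measure_restrict_space) auto
  then show ?thesis unfolding lebesgue_integral_const measure_unit_cell by simp
qed

lemma integrable_indicator_wave:
  assumes "S \<in> sets borel" "bounded S"
  shows "integrable lborel (\<lambda>y. indicator S y *\<^sub>R wave b y)"
proof (rule Bochner_Integration.integrable_bound[where f="indicator S :: _ \<Rightarrow> real"])
  show "integrable lborel (indicator S :: real^'a \<Rightarrow> real)"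
    using emeasure_bounded_finite[OF assms(2)] assms(1) by (intro integrable_real_indicator) auto
  have [measurable]: "wave b \<in> borel_measurable borel"
    by (intro borel_measurable_continuous_onI smooth_continuous_on smooth_wave)
  show "(\<lambda>y. indicator S y *\<^sub>R wave b y) \<in> borel_measurable lborel"
    using assms(1) by measurable
qed (auto simp: indicator_def)

lemma bounded_half_cell: "bounded (half_cell :: (real^'n) set)"
proof (rule bounded_subset)
  show "bounded (cbox 0 (1::real^'n))" by (rule bounded_cbox)
  show "half_cell \<subseteq> cbox 0 (1::real^'n)" by (auto simp: half_cell_def mem_box_cart less_imp_le)
qed

text \<open>Translation by half a period of the wave in direction $i$ changes its sign, but by periodicity it does
not change the integral over a cell.\<close>

lemma wave_half_cell_integral_zero:
  fixes m :: "'n::finite \<Rightarrow> int"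
  assumes mi: "m i \<noteq> 0"
  shows "(LINT y|lborel. indicator half_cell y *\<^sub>R wave ((2 * pi) *\<^sub>R lattice_pt m) y) = 0"
proof -
  let ?g = "wave ((2 * pi) *\<^sub>R (lattice_pt m :: real^'n))"
  define s where "s = 1 / (2 * \<bar>real_of_int (m i)\<bar>)"
  have s: "0 < s" "s \<le> 1"
  proof -
    have "\<bar>real_of_int (m i)\<bar> \<ge> 1" using mi by linarith
    then show "0 < s" "s \<le> 1" by (auto simp: s_def divide_le_eq)
  qed
  \<comment> \<open>The translated cell consists of \<open>A\<close> and of \<open>B\<close> moved by one period.\<close>
  define A where "A = {y \<in> half_cell. s \<le> (y::real^'n) $ i}"
  define B where "B = {y \<in> half_cell. (y::real^'n) $ i < s}"
  have hc: "half_cell = A \<union> B" "A \<inter> B = {}" by (auto simp: A_def B_def)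
  have [measurable]: "A \<in> sets borel" "B \<in> sets borel" unfolding A_def B_def by measurable
  have bd: "bounded A" "bounded B" using bounded_half_cell by (auto simp: A_def B_def intro: bounded_subset)
  note int = integrable_indicator_wave[OF \<open>A \<in> sets borel\<close> bd(1)] integrable_indicator_wave[OF \<open>B \<in> sets borel\<close> bd(2)]
  have [measurable]: "?g \<in> borel_measurable borel"
    by (intro borel_measurable_continuous_onI smooth_continuous_on smooth_wave)
  let ?I = "LINT y|lborel. indicator half_cell y *\<^sub>R ?g y"
  have split: "?I = (LINT y|lborel. indicator A y *\<^sub>R ?g y) + (LINT y|lborel. indicator B y *\<^sub>R ?g y)"
  proof -
    have "indicator half_cell y *\<^sub>R ?g y = indicator A y *\<^sub>R ?g y + indicator B y *\<^sub>R ?g y" for y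
      using hc by (auto simp: indicator_def)
    then show ?thesis using int by simp
  qed
  have shift: "?g (y + axis i s) = - ?g y" for y
  proof -
    have "s * ((2 * pi) *\<^sub>R (lattice_pt m :: real^'n)) $ i = pi * sgn (of_int (m i))"
      using mi by (simp add: s_def sgn_if)
    then have "exp (\<i> * of_real (s * ((2 * pi) *\<^sub>R (lattice_pt m :: real^'n)) $ i)) = exp (\<i> * of_real (pi * sgn (of_int (m i))))"
      by (simp only:)
    also have "\<dots> = -1"
      using mi by (cases "m i > 0") (auto simp: sgn_if exp_minus)
    finally have "exp (\<i> * of_real (s * ((2 * pi) *\<^sub>R (lattice_pt m :: real^'n)) $ i)) = -1" .
    then show ?thesis unfolding wave_shift by simp
  qed
  have "- ?I = (LINT y|lborel. indicator half_cell y *\<^sub>R ?g (y + axis i s))"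
    by (simp add: shift)
  also have "\<dots> = (LINT y|lborel. indicator half_cell ((y + axis i s) - axis i s) *\<^sub>R ?g (y + axis i s))" by simp
  also have "\<dots> = (LINT y|lborel. indicator half_cell (y - axis i s) *\<^sub>R ?g y)"
    by (rule integral_lborel_translate) measurable
  also have "\<dots> = (LINT y|lborel. indicator A y *\<^sub>R ?g y + indicator B (y - axis i 1) *\<^sub>R ?g y)"
  proof (rule Bochner_Integration.integral_cong[OF refl])
    fix y :: "real^'n"
    have "(y - axis i s \<in> half_cell) \<longleftrightarrow> y \<in> A \<or> y - axis i 1 \<in> B"
    proof -
      have 1: "(y - axis i t) $ j = (if j = i then y $ j - t else y $ j)" for j t by (simp add: axis_def)
      have a: "y \<in> A \<longleftrightarrow> (s \<le> y $ i \<and> y $ i < 1) \<and> (\<forall>j. j \<noteq> i \<longrightarrow> 0 \<le> y $ j \<and> y $ j < 1)"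
        using s by (auto simp: A_def half_cell_def) (metis order_trans less_imp_le)+
      have b: "y - axis i 1 \<in> B \<longleftrightarrow> (1 \<le> y $ i \<and> y $ i < 1 + s) \<and> (\<forall>j. j \<noteq> i \<longrightarrow> 0 \<le> y $ j \<and> y $ j < 1)"
        using s unfolding B_def half_cell_def mem_Collect_eq 1 by (auto split: if_splits)
      have c: "y - axis i s \<in> half_cell \<longleftrightarrow> (s \<le> y $ i \<and> y $ i < 1 + s) \<and> (\<forall>j. j \<noteq> i \<longrightarrow> 0 \<le> y $ j \<and> y $ j < 1)"
        unfolding half_cell_def mem_Collect_eq 1 by (auto split: if_splits)
      show ?thesis unfolding a b c using s by auto
    qed
    moreover have "\<not> (y \<in> A \<and> y - axis i 1 \<in> B)"
    proof
      assume H: "y \<in> A \<and> y - axis i 1 \<in> B"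
      then have "y $ i < 1" by (simp add: A_def half_cell_def)
      moreover from H have "\<forall>j. 0 \<le> (y - axis i 1) $ j" unfolding B_def half_cell_def by blast
      then have "0 \<le> (y - axis i 1) $ i" by (rule spec)
      then have "1 \<le> y $ i" by (simp add: axis_def)
      ultimately show False by simp
    qed
    ultimately show "indicator half_cell (y - axis i s) *\<^sub>R ?g y = indicator A y *\<^sub>R ?g y + indicator B (y - axis i 1) *\<^sub>R ?g y"
      by (auto simp: indicator_def)
  qed
  also have "\<dots> = (LINT y|lborel. indicator A y *\<^sub>R ?g y) + (LINT y|lborel. indicator B (y - axis i 1) *\<^sub>R ?g y)"
  proof (rule Bochner_Integration.integral_add[OF int(1)])
    have pw: "(indicator B (y - axis i 1) :: real) = indicator ((+) (axis i 1) ` B) y" for y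
    proof -
      have "y \<in> (+) (axis i 1) ` B \<longleftrightarrow> y - axis i 1 \<in> B" by (auto intro!: image_eqI[of _ _ "y - axis i 1"])
      then show ?thesis by (simp add: indicator_def)
    qed
    have "(+) (axis i 1) ` B \<in> sets borel"
    proof -
      have "(+) (axis i 1) ` B = (\<lambda>y. y - axis i 1) -` B \<inter> space borel"
        by (auto simp: image_iff) (metis add.commute diff_add_cancel)
      also have "\<dots> \<in> sets borel" by (rule measurable_sets[of _ borel borel]) measurable
      finally show ?thesis .
    qed
    then show "integrable lborel (\<lambda>y. indicator B (y - axis i 1) *\<^sub>R ?g y)"
      unfolding pw using integrable_indicator_wave[of "(+) (axis i 1) ` B"] bounded_translation[OF bd(2)] by simp
  qed
  also have "(LINT y|lborel. indicator B (y - axis i 1) *\<^sub>R ?g y) = (LINT y|lborel. indicator B ((y + axis i 1) - axis i 1) *\<^sub>R ?g (y + axis i 1))"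
    by (rule integral_lborel_translate[symmetric]) measurable
  also have "\<dots> = (LINT y|lborel. indicator B y *\<^sub>R ?g y)"
    using trig_periodic[OF trig.wave[of 1 m]] by (simp add: unit_periodic_def)
  finally have "- ?I = ?I" using split by simp
  then show ?thesis by simp
qed

lemma integral_unit_cell_eq:
  fixes f :: "real^'n \<Rightarrow> complex"
  assumes [measurable]: "f \<in> borel_measurable borel"
  shows "(LINT y|lebesgue_on unit_cell. f y) = (LINT y|lborel. indicator half_cell y *\<^sub>R f y)"
proof -
  have "(LINT y|lebesgue_on unit_cell. f y) = (LINT y|lebesgue. indicator unit_cell y *\<^sub>R f y)"
    by (rule integral_restrict_space) simp
  also have "\<dots> = (LINT y|lebesgue. indicator half_cell y *\<^sub>R f y)"
  proof (rule integral_cong_AE)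
    have [measurable]: "unit_cell \<in> sets borel" by simp
    show "(\<lambda>y. indicator unit_cell y *\<^sub>R f y) \<in> borel_measurable lebesgue"
      "(\<lambda>y. indicator half_cell y *\<^sub>R f y) \<in> borel_measurable lebesgue"
      by (rule measurable_completion, measurable)+
    show "AE y in lebesgue. indicator unit_cell y *\<^sub>R f y = indicator half_cell y *\<^sub>R f y"
      using AE_half_cell_iff by eventually_elim (auto simp: indicator_def)
  qed
  also have "\<dots> = (LINT y|lborel. indicator half_cell y *\<^sub>R f y)"
    by (rule integral_completion) measurable
  finally show ?thesis .
qed

lemma trig_square_integrable:
  fixes P :: "real^'n \<Rightarrow> complex"
  assumes "P \<in> trig" shows "square_integrable (lebesgue_on unit_cell) P"
proof -
  obtain B where B: "\<And>x. norm (P x) \<le> B" using trig_bounded[OF assms] by blast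
  have m: "P \<in> borel_measurable (lebesgue_on unit_cell)"
    by (intro measurable_restrict_space1 measurable_completion) 
      (simp add: borel_measurable_continuous_onI[OF trig_continuous[OF assms]])
  interpret finite_measure "lebesgue_on (unit_cell :: (real^'n) set)" by (rule finite_measure_unit_cell)
  have "square_integrable (lebesgue_on unit_cell) (\<lambda>x::real^'n. B)" by (simp add: square_integrable_def)
  then show ?thesis
    by (rule square_integrable_bound[OF m]) (use B in \<open>auto intro: order_trans[OF _ abs_ge_self]\<close>)
qed

text \<open>Continuous functions approximate $n$ almost everywhere; clipping makes them bounded, and a
cutoff makes them vanish on the cell boundary, so that uniform approximation applies.\<close>

lemma trig_dense_l2:
  fixes n :: "real^'n \<Rightarrow> real"
  assumes n: "n \<in> borel_measurable lebesgue" and C: "AE y in lebesgue_on unit_cell. \<bar>n y\<bar> \<le> C" "C > 0"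
    and \<eta>: "\<eta> > 0"
  obtains P where "P \<in> trig" "square_integrable (lebesgue_on unit_cell) (\<lambda>y. of_real (n y) - P y)"
    "l2_sq (lebesgue_on unit_cell) (\<lambda>y. of_real (n y) - P y) \<le> \<eta>"
proof -
  let ?M = "lebesgue_on (unit_cell :: (real^'n) set)"
  interpret finite_measure ?M by (rule finite_measure_unit_cell)
  have nM [measurable]: "n \<in> borel_measurable ?M" by (rule measurable_restrict_space1[OF n])
  have "n measurable_on unit_cell" by (rule measurable_on_iff_borel_measurable[THEN iffD2, OF unit_cell_sets(1) nM])
  then obtain N F where N: "negligible N" and F: "\<And>k. continuous_on UNIV (F k)"
    and FN: "\<And>x. x \<notin> N \<Longrightarrow> (\<lambda>k::nat. F k x) \<longlonglongrightarrow> (if x \<in> unit_cell then n x else 0)"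
    unfolding measurable_on_def by blast
  define H where "H k y = max (- C) (min C (F k y)) * min 1 (real k * infdist y (- unit_cell))" for k y
  have ne: "- unit_cell \<noteq> ({} :: (real^'n) set)"
  proof -
    have "0 \<in> - (unit_cell :: (real^'n) set)" by (simp add: unit_cell_def)
    then show ?thesis by blast
  qed
  have cl: "closed (- unit_cell :: (real^'n) set)" by (simp add: unit_cell_eq_box open_box closed_Compl)
  have Hc: "continuous_on UNIV (H k)" for k
    unfolding H_def by (intro continuous_intros F)
  have H0: "H k y = 0" if "y \<notin> unit_cell" for k y
    using that by (simp add: H_def infdist_zero)
  have Hb: "\<bar>H k y\<bar> \<le> C" for k y
  proof -
    have "\<bar>H k y\<bar> = \<bar>max (- C) (min C (F k y))\<bar> * \<bar>min 1 (real k * infdist y (- unit_cell))\<bar>"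
      by (simp add: H_def abs_mult)
    also have "\<dots> \<le> C * 1"
      using C(2) by (intro mult_mono) (auto simp: infdist_nonneg abs_le_iff)
    finally show ?thesis by simp
  qed
  have Hm [measurable]: "H k \<in> borel_measurable ?M" for k
    by (intro measurable_restrict_space1 measurable_completion) (simp add: borel_measurable_continuous_onI[OF Hc])
  let ?nc = "\<lambda>y. complex_of_real (n y)" and ?Hc = "\<lambda>k y. complex_of_real (H k y)"
  have "(\<lambda>k. l2_sq ?M (\<lambda>y. ?nc y - ?Hc k y)) \<longlonglongrightarrow> (LINT y|?M. 0)"
    unfolding l2_sq_def
  proof (rule integral_dominated_convergence[where w="\<lambda>_. (2 * C)\<^sup>2"])
    show "integrable ?M (\<lambda>_. (2 * C)\<^sup>2)" by simp
    show "AE y in ?M. norm ((norm (?nc y - ?Hc k y))\<^sup>2) \<le> (2 * C)\<^sup>2" for k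
      using C(1)
    proof eventually_elim
      case (elim y)
      have "norm (?nc y - ?Hc k y) \<le> norm (?nc y) + norm (?Hc k y)" by (rule norm_triangle_ineq4)
      also have "\<dots> \<le> 2 * C" using elim Hb[of k y] by simp
      finally have "(norm (?nc y - ?Hc k y))\<^sup>2 \<le> (2 * C)\<^sup>2" by (rule power_mono) simp
      then show ?case by simp
    qed
    have "AE x in lebesgue. x \<notin> N"
      using N by (intro AE_not_in) (simp add: negligible_iff_null_sets)
    then have "AE x in ?M. x \<notin> N \<and> x \<in> unit_cell"
      by (subst AE_lebesgue_on_iff) auto
    then show "AE y in ?M. (\<lambda>k. (norm (?nc y - ?Hc k y))\<^sup>2) \<longlonglongrightarrow> 0"
      using C(1)
    proof eventually_elim
      case (elim y)
      have d: "infdist y (- unit_cell) > 0"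
        using elim cl ne by (intro infdist_pos_not_in_closed) auto
      have "(\<lambda>k. min 1 (real k * infdist y (- unit_cell))) \<longlonglongrightarrow> 1"
      proof (rule tendsto_eventually)
        obtain k0 :: nat where "1 < real k0 * infdist y (- unit_cell)" using reals_Archimedean3[OF d] by blast
        then show "\<forall>\<^sub>F k in sequentially. min 1 (real k * infdist y (- unit_cell)) = 1"
          using eventually_ge_at_top[of k0]
        proof (elim eventually_mono)
          fix k assume "k0 \<le> k"
          then have "real k0 * infdist y (- unit_cell) \<le> real k * infdist y (- unit_cell)"
            using d by (intro mult_right_mono) auto
          with \<open>1 < real k0 * infdist y (- unit_cell)\<close> show "min 1 (real k * infdist y (- unit_cell)) = 1" by simp
        qed
      qed
      moreover have "(\<lambda>k. F k y) \<longlonglongrightarrow> n y" using FN[of y] elim by simp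
      ultimately have "(\<lambda>k. H k y) \<longlonglongrightarrow> max (- C) (min C (n y)) * 1"
        unfolding H_def by (intro tendsto_intros)
      also have "max (- C) (min C (n y)) * 1 = n y" using elim by (auto simp: abs_le_iff)
      finally have "(\<lambda>k. H k y) \<longlonglongrightarrow> n y" .
      then have "(\<lambda>k. (norm (?nc y - ?Hc k y))\<^sup>2) \<longlonglongrightarrow> (norm (?nc y - ?nc y))\<^sup>2"
        by (intro tendsto_intros)
      then show ?case by simp
    qed
  qed measurable
  then have lim: "(\<lambda>k. l2_sq ?M (\<lambda>y. ?nc y - ?Hc k y)) \<longlonglongrightarrow> 0" by simp
  have "\<eta> / 4 > 0" using \<eta> by simp
  from LIMSEQ_D[OF lim this] obtain k where k: "l2_sq ?M (\<lambda>y. ?nc y - ?Hc k y) < \<eta> / 4" by auto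
  have "sqrt (\<eta> / 4) > 0" using \<eta> by simp
  from trig_dense_uniform[OF Hc H0 this, of k]
  obtain P where P: "P \<in> trig" "\<And>y. y \<in> unit_cell \<Longrightarrow> norm (?Hc k y - P y) < sqrt (\<eta> / 4)" by blast
  have bsi: "square_integrable ?M f" if "f \<in> borel_measurable ?M" "AE y in ?M. norm (f y) \<le> C" for f :: "_ \<Rightarrow> complex"
  proof -
    have "square_integrable ?M (\<lambda>_. C)" by (simp add: square_integrable_def)
    then show ?thesis
      using that by (intro square_integrable_bound[of f ?M "\<lambda>_. C"]) (auto elim!: eventually_mono)
  qed
  have s1: "square_integrable ?M ?nc" using C by (intro bsi) auto
  have s2: "square_integrable ?M (?Hc k)" using Hb by (intro bsi) auto
  note s3 = trig_square_integrable[OF P(1)]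
  have "l2_sq ?M (\<lambda>y. ?Hc k y - P y) \<le> (LINT y|?M. \<eta> / 4)"
    unfolding l2_sq_def
  proof (rule integral_mono)
    show "integrable ?M (\<lambda>y. (norm (?Hc k y - P y))\<^sup>2)"
      by (intro square_integrable_sq square_integrable_diff s2 s3)
    fix y assume "y \<in> space ?M"
    then have "norm (?Hc k y - P y) \<le> sqrt (\<eta> / 4)" using P(2)[of y] by simp
    then have "(norm (?Hc k y - P y))\<^sup>2 \<le> (sqrt (\<eta> / 4))\<^sup>2" by (rule power_mono) simp
    then show "(norm (?Hc k y - P y))\<^sup>2 \<le> \<eta> / 4" using \<eta> by simp
  qed simp
  also have "\<dots> = \<eta> / 4" by (rule integral_unit_cell_const)
  finally have hp: "l2_sq ?M (\<lambda>y. ?Hc k y - P y) \<le> \<eta> / 4" .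
  have si: "square_integrable ?M (\<lambda>y. ?nc y - P y)" by (intro square_integrable_diff s1 s3)
  have "sqrt (l2_sq ?M (\<lambda>y. (?nc y - ?Hc k y) + (?Hc k y - P y)))
      \<le> sqrt (l2_sq ?M (\<lambda>y. ?nc y - ?Hc k y)) + sqrt (l2_sq ?M (\<lambda>y. ?Hc k y - P y))"
    by (intro l2_triangle square_integrable_diff s1 s2 s3)
  also have "\<dots> \<le> sqrt (\<eta> / 4) + sqrt (\<eta> / 4)"
    using k hp by (intro add_mono real_sqrt_le_mono) auto
  also have "\<dots> = sqrt \<eta>" by (simp add: real_sqrt_divide)
  finally have "l2_sq ?M (\<lambda>y. ?nc y - P y) \<le> \<eta>" by simp
  with P(1) si show ?thesis using that by blast
qed

lemma square_integrable_wave_mult: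
  assumes "square_integrable (lebesgue_on D) f"
  shows "square_integrable (lebesgue_on D) (\<lambda>x. wave b x * f x)"
    and "l2_sq (lebesgue_on D) (\<lambda>x. wave b x * f x) = l2_sq (lebesgue_on D) f"
proof -
  have "wave b \<in> borel_measurable (lebesgue_on D)"
    by (intro measurable_restrict_space1 measurable_completion)
      (simp add: borel_measurable_continuous_onI[OF smooth_continuous_on[OF smooth_wave]])
  then have m: "(\<lambda>x. wave b x * f x) \<in> borel_measurable (lebesgue_on D)"
    using square_integrable_measurable[OF assms] by measurable
  show "square_integrable (lebesgue_on D) (\<lambda>x. wave b x * f x)"
    by (rule square_integrable_bound[OF m assms]) (simp add: norm_mult)
  show "l2_sq (lebesgue_on D) (\<lambda>x. wave b x * f x) = l2_sq (lebesgue_on D) f"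
    by (simp add: l2_sq_def norm_mult)
qed

lemma square_integrable_bounded_mult:
  fixes f g :: "'a \<Rightarrow> complex"
  assumes "square_integrable M f" "g \<in> borel_measurable M" "AE x in M. norm (g x) \<le> C"
  shows "square_integrable M (\<lambda>x. g x * f x)" and "l2_sq M (\<lambda>x. g x * f x) \<le> C\<^sup>2 * l2_sq M f"
proof -
  have m: "(\<lambda>x. g x * f x) \<in> borel_measurable M" using assms by measurable
  have le: "AE x in M. norm (g x * f x) \<le> norm (C *\<^sub>R f x)"
    using assms(3)
  proof eventually_elim
    case (elim x)
    then have "norm (g x) * norm (f x) \<le> \<bar>C\<bar> * norm (f x)" by (intro mult_right_mono) auto
    then show ?case by (simp add: norm_mult)
  qed
  show si: "square_integrable M (\<lambda>x. g x * f x)"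
    by (rule square_integrable_bound[OF m square_integrable_scaleR[OF assms(1)] le])
  have "l2_sq M (\<lambda>x. g x * f x) \<le> l2_sq M (\<lambda>x. C *\<^sub>R f x)"
    unfolding l2_sq_def
    by (rule integral_mono_AE)
      (use le in \<open>auto intro: power_mono elim!: eventually_mono simp del: norm_scaleR
        intro!: square_integrable_sq[OF si] square_integrable_sq[OF square_integrable_scaleR[OF assms(1)]]\<close>)
  then show "l2_sq M (\<lambda>x. g x * f x) \<le> C\<^sup>2 * l2_sq M f" by (simp only: l2_sq_scaleR)
qed

text \<open>Tests the equation with $e^{i b \cdot x / e} \phi$. The term in which both derivatives fall on the
wave has the factor $|b|^2/e^2$ and is expressed by the others, which are of order $1/e$ at most.\<close>

lemma helmholtz_wave_estimate:
  fixes D :: "(real^'n) set"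
  assumes D: "open D" and e: "e > 0"
    and w: "square_integrable (lebesgue_on D) w" "l2_sq (lebesgue_on D) w \<le> B"
    and a: "a \<in> borel_measurable (lebesgue_on D)" "AE x in lebesgue_on D. \<bar>a x\<bar> \<le> C"
    and h: "helmholtz D a w" and \<phi>: "\<phi> \<in> test_functions D"
  shows "(b \<bullet> b) * norm (LINT x|lebesgue_on D. wave b (x /\<^sub>R e) * w x * \<phi> x)
    \<le> e\<^sup>2 * (sqrt B * sqrt (l2_sq lborel (laplacian \<phi>)) + \<bar>C\<bar> * sqrt B * sqrt (l2_sq lborel \<phi>))
      + 2 * e * (sqrt B * sqrt (l2_sq lborel (dir_deriv b \<phi>)))"
proof -
  let ?M = "lebesgue_on D" and ?b = "b /\<^sub>R e"
  define W where "W x = wave ?b x * w x" for x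
  have W: "square_integrable ?M W" "l2_sq ?M W \<le> B"
    using square_integrable_wave_mult[OF w(1), of ?b] w(2) by (auto simp: W_def[abs_def])
  have wv: "wave b (x /\<^sub>R e) = wave ?b x" for x by (simp add: wave_def)
  let ?\<psi> = "\<lambda>x. wave ?b x * \<phi> x"
  have \<psi>: "?\<psi> \<in> test_functions D" by (rule test_functions_mult_left[OF smooth_wave \<phi>])
  have H: "(LINT x|?M. w x * laplacian ?\<psi> x) + (LINT x|?M. of_real (a x) * w x * ?\<psi> x) = 0"
    using h \<psi> unfolding helmholtz_def by blast
  have dd: "(\<Sum>i\<in>UNIV. of_real (?b $ i) * partial_deriv i \<phi> x) = of_real (1 / e) * dir_deriv b \<phi> x" for x
    by (simp add: dir_deriv_def sum_distrib_left divide_inverse mult_ac)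
  have bb: "?b \<bullet> ?b = (b \<bullet> b) / e\<^sup>2" by (simp add: power2_eq_square divide_inverse mult_ac)
  have lap: "w x * laplacian ?\<psi> x = W x * laplacian \<phi> x + (2 * \<i> * of_real (1 / e)) * (W x * dir_deriv b \<phi> x)
      - of_real ((b \<bullet> b) / e\<^sup>2) * (W x * \<phi> x)" for x
    unfolding laplacian_wave_mult[OF test_functions_smooth[OF \<phi>]] dd bb W_def
    by (simp add: algebra_simps)
  note tl = test_function_square_integrable[OF D test_functions_laplacian[OF \<phi>]]
    and td = test_function_square_integrable[OF D dir_deriv_test_function[OF \<phi>, of b]]
    and t = test_function_square_integrable[OF D \<phi>]
  have am: "(\<lambda>x. complex_of_real (a x)) \<in> borel_measurable ?M" using a(1) by measurable
  have an: "AE x in ?M. norm (complex_of_real (a x)) \<le> C" using a(2) by simp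
  note aW = square_integrable_bounded_mult[OF W(1) am an]
  let ?J = "LINT x|?M. W x * \<phi> x" and ?L = "LINT x|?M. W x * laplacian \<phi> x"
    and ?E = "LINT x|?M. W x * dir_deriv b \<phi> x" and ?A = "LINT x|?M. (of_real (a x) * W x) * \<phi> x"
  have "(LINT x|?M. w x * laplacian ?\<psi> x) = ?L + (2 * \<i> * of_real (1 / e)) * ?E - of_real ((b \<bullet> b) / e\<^sup>2) * ?J"
    unfolding lap using W(1) tl td t by (simp add: square_integrable_mult)
  moreover have "(LINT x|?M. of_real (a x) * w x * ?\<psi> x) = ?A"
    by (rule Bochner_Integration.integral_cong) (auto simp: W_def)
  ultimately have eq: "of_real ((b \<bullet> b) / e\<^sup>2) * ?J = ?L + ?A + (2 * \<i> * of_real (1 / e)) * ?E"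
  proof -
    assume 1: "(LINT x|?M. w x * laplacian ?\<psi> x) = ?L + (2 * \<i> * of_real (1 / e)) * ?E - of_real ((b \<bullet> b) / e\<^sup>2) * ?J"
      and 2: "(LINT x|?M. of_real (a x) * w x * ?\<psi> x) = ?A"
    have gen: "L + E - K + A = 0 \<Longrightarrow> K = L + A + E" for L E K A :: complex
      by (simp add: algebra_simps)
    show ?thesis by (rule gen) (use H in \<open>simp only: 1 2\<close>)
  qed
  have B0: "0 \<le> B" by (rule order_trans[OF l2_sq_nonneg W(2)])
  have ls: "sqrt (l2_sq ?M W) \<le> sqrt B" using W(2) by (rule real_sqrt_le_mono)
  have nL: "norm ?L \<le> sqrt B * sqrt (l2_sq lborel (laplacian \<phi>))"
    using order_trans[OF integral_mult_bound[OF W(1) tl] mult_right_mono[OF ls]]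
    by (simp add: l2_sq_test_function[OF D test_functions_laplacian[OF \<phi>]])
  have nE: "norm ?E \<le> sqrt B * sqrt (l2_sq lborel (dir_deriv b \<phi>))"
    using order_trans[OF integral_mult_bound[OF W(1) td] mult_right_mono[OF ls]]
    by (simp add: l2_sq_test_function[OF D dir_deriv_test_function[OF \<phi>]])
  have nA: "norm ?A \<le> \<bar>C\<bar> * sqrt B * sqrt (l2_sq lborel \<phi>)"
  proof -
    have "sqrt (l2_sq ?M (\<lambda>x. of_real (a x) * W x)) \<le> sqrt (C\<^sup>2 * B)"
      using aW(2) W(2) by (intro real_sqrt_le_mono) (meson mult_left_mono order_trans zero_le_power2)
    then have "sqrt (l2_sq ?M (\<lambda>x. of_real (a x) * W x)) \<le> \<bar>C\<bar> * sqrt B" by (simp add: real_sqrt_mult)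
    from order_trans[OF integral_mult_bound[OF aW(1) t] mult_right_mono[OF this]]
    show ?thesis by (simp add: l2_sq_test_function[OF D \<phi>])
  qed
  have J: "(LINT x|?M. wave b (x /\<^sub>R e) * w x * \<phi> x) = ?J" by (simp add: wv W_def)
  have "(b \<bullet> b) * norm ?J = e\<^sup>2 * norm (of_real ((b \<bullet> b) / e\<^sup>2) * ?J)"
    using e by (simp add: norm_mult norm_divide norm_power)
  also have "\<dots> \<le> e\<^sup>2 * (norm ?L + norm ?A + 2 / e * norm ?E)"
  proof (rule mult_left_mono)
    have "norm ((2 * \<i> * of_real (1 / e)) * ?E) = 2 / e * norm ?E"
      using e by (simp add: norm_mult norm_divide)
    then show "norm (of_real ((b \<bullet> b) / e\<^sup>2) * ?J) \<le> norm ?L + norm ?A + 2 / e * norm ?E"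
      unfolding eq using norm_triangle_ineq[of "?L + ?A" "(2 * \<i> * of_real (1 / e)) * ?E"] norm_triangle_ineq[of ?L ?A]
      by linarith
  qed simp
  also have "\<dots> = e\<^sup>2 * (norm ?L + norm ?A) + 2 * e * norm ?E"
    using e by (simp add: field_simps power2_eq_square)
  also have "\<dots> \<le> e\<^sup>2 * (sqrt B * sqrt (l2_sq lborel (laplacian \<phi>)) + \<bar>C\<bar> * sqrt B * sqrt (l2_sq lborel \<phi>))
      + 2 * e * (sqrt B * sqrt (l2_sq lborel (dir_deriv b \<phi>)))"
    using e nL nE nA by (intro add_mono mult_left_mono) auto
  finally show ?thesis unfolding J .
qed

text \<open>Modes with $m \neq 0$ have mean zero and disappear by the preceding estimate; the constant mode
is its own mean.\<close>

lemma trig_oscillation_limit: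
  fixes D :: "(real^'n) set"
  assumes D: "open D" and e: "\<And>j. e j > 0" "e \<longlonglongrightarrow> 0"
    and w: "\<And>j. square_integrable (lebesgue_on D) (w j)" "\<And>j. l2_sq (lebesgue_on D) (w j) \<le> B"
    and a: "\<And>j. a j \<in> borel_measurable (lebesgue_on D)" "\<And>j. AE x in lebesgue_on D. \<bar>a j x\<bar> \<le> C"
    and h: "\<And>j. helmholtz D (a j) (w j)" and \<phi>: "\<phi> \<in> test_functions D" and P: "P \<in> trig"
  shows "(\<lambda>j. (LINT x|lebesgue_on D. P (x /\<^sub>R e j) * w j x * \<phi> x)
      - (LINT y|lebesgue_on unit_cell. P y) * (LINT x|lebesgue_on D. w j x * \<phi> x)) \<longlonglongrightarrow> 0"
  using P
proof (induction rule: trig.induct)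
  case (wave c m)
  let ?b = "(2 * pi) *\<^sub>R lattice_pt m :: real^'n"
  show ?case
  proof (cases "m = (\<lambda>_. 0)")
    case True
    then have "?b = 0" by (simp add: vec_eq_iff)
    then have "wave ?b x = 1" for x by (simp add: wave_def)
    then show ?thesis by (simp add: integral_unit_cell_const mult.assoc del: lebesgue_integral_const)
  next
    case False
    then obtain i where i: "m i \<noteq> 0" by auto
    have "?b $ i \<noteq> 0" using i by simp
    then have "?b \<noteq> 0" by (metis zero_index)
    then have b: "?b \<bullet> ?b > 0" by (rule inner_gt_zero_iff[THEN iffD2])
    have wm: "wave ?b \<in> borel_measurable borel"
      by (intro borel_measurable_continuous_onI smooth_continuous_on smooth_wave)
    have "(LINT y|lebesgue_on unit_cell. wave ?b y) = 0"
      using wave_half_cell_integral_zero[of m i, OF i] by (simp add: integral_unit_cell_eq[OF wm])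
    then have z: "(LINT y|lebesgue_on unit_cell. c * wave ?b y) = 0" by simp
    let ?J = "\<lambda>j. LINT x|lebesgue_on D. wave ?b (x /\<^sub>R e j) * w j x * \<phi> x"
    define K1 where "K1 = sqrt B * sqrt (l2_sq lborel (laplacian \<phi>)) + \<bar>C\<bar> * sqrt B * sqrt (l2_sq lborel \<phi>)"
    define K2 where "K2 = sqrt B * sqrt (l2_sq lborel (dir_deriv ?b \<phi>))"
    have "?J \<longlonglongrightarrow> 0"
    proof (rule Lim_null_comparison)
      show "\<forall>\<^sub>F j in sequentially. norm (?J j) \<le> ((e j)\<^sup>2 * K1 + 2 * e j * K2) / (?b \<bullet> ?b)"
      proof (rule always_eventually, rule allI)
        fix j
        have "(?b \<bullet> ?b) * norm (?J j) \<le> (e j)\<^sup>2 * K1 + 2 * e j * K2"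
          unfolding K1_def K2_def by (rule helmholtz_wave_estimate[OF D e(1) w a h \<phi>])
        then show "norm (?J j) \<le> ((e j)\<^sup>2 * K1 + 2 * e j * K2) / (?b \<bullet> ?b)"
          using b by (simp only: pos_le_divide_eq mult.commute)
      qed
      have "(\<lambda>j. ((e j)\<^sup>2 * K1 + 2 * e j * K2) / (?b \<bullet> ?b)) \<longlonglongrightarrow> (0\<^sup>2 * K1 + 2 * 0 * K2) / (?b \<bullet> ?b)"
        using b by (intro tendsto_intros e(2)) (rule less_imp_neq[THEN not_sym])
      then show "(\<lambda>j. ((e j)\<^sup>2 * K1 + 2 * e j * K2) / (?b \<bullet> ?b)) \<longlonglongrightarrow> 0" by simp
    qed
    from tendsto_mult[OF tendsto_const[of c] this]
    have "(\<lambda>j. LINT x|lebesgue_on D. c * wave ?b (x /\<^sub>R e j) * w j x * \<phi> x) \<longlonglongrightarrow> 0"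
      by (simp add: mult.assoc)
    then show ?thesis by (simp only: z) simp
  qed
next
  case (add P Q)
  have si: "square_integrable (lebesgue_on D) (\<lambda>x. P (x /\<^sub>R e j) * w j x)" if PT: "P \<in> trig" for P j
  proof -
    obtain A where A: "\<And>x. norm (P x) \<le> A" using trig_bounded[OF PT] by blast
    have "(\<lambda>x. P (x /\<^sub>R e j)) \<in> borel_measurable (lebesgue_on D)"
      by (intro measurable_restrict_space1 scaled_measurable measurable_completion)
        (simp add: borel_measurable_continuous_onI[OF trig_continuous[OF PT]])
    then show ?thesis using A by (intro square_integrable_bounded_mult(1)[OF w(1), where C=A]) auto
  qed
  note t = test_function_square_integrable[OF D \<phi>]
  have 1: "(LINT x|lebesgue_on D. (P (x /\<^sub>R e j) + Q (x /\<^sub>R e j)) * w j x * \<phi> x)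
      = (LINT x|lebesgue_on D. P (x /\<^sub>R e j) * w j x * \<phi> x) + (LINT x|lebesgue_on D. Q (x /\<^sub>R e j) * w j x * \<phi> x)" for j
    unfolding distrib_right
    by (intro Bochner_Integration.integral_add square_integrable_mult si add.hyps t)
  have 2: "(LINT y|lebesgue_on unit_cell. P y + Q y) = (LINT y|lebesgue_on unit_cell. P y) + (LINT y|lebesgue_on unit_cell. Q y)"
    by (intro Bochner_Integration.integral_add square_integrable_imp_integrable trig_square_integrable add.hyps finite_measure_unit_cell)
  show ?case unfolding 1 2
    using tendsto_add[OF add.IH] by (simp add: algebra_simps)
qed

text \<open>A product of two weakly convergent sequences, which in general does not converge to the product of
the limits. Here it does since \<open>w\<close> solves an equation whose coefficient oscillates together with
$n(x/\epsilon)$: trigonometric approximation of $n$ in $L^2$ of the cell costs a uniformly small error, both in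
the integral and in the mean.\<close>

theorem homogenization_limit:
  fixes D :: "(real^'n) set" and n :: "real^'n \<Rightarrow> real"
  assumes D: "open D" "bounded D" and e: "\<And>j. e j > 0" "e \<longlonglongrightarrow> 0"
    and n: "n \<in> borel_measurable lebesgue" "unit_periodic n" "AE y in lebesgue_on unit_cell. \<bar>n y\<bar> \<le> C" "C > 0"
    and w: "\<And>j. square_integrable (lebesgue_on D) (w j)" "\<And>j. l2_sq (lebesgue_on D) (w j) \<le> B"
    and k: "\<And>j. (k j)\<^sup>2 \<le> K"
    and h: "\<And>j. helmholtz D (\<lambda>x. (k j)\<^sup>2 * n (x /\<^sub>R e j)) (w j)" and \<phi>: "\<phi> \<in> test_functions D"
  shows "(\<lambda>j. (LINT x|lebesgue_on D. of_real (n (x /\<^sub>R e j)) * w j x * \<phi> x)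
      - of_real (cell_mean n) * (LINT x|lebesgue_on D. w j x * \<phi> x)) \<longlonglongrightarrow> 0"
proof -
  let ?M = "lebesgue_on D" and ?Y = "lebesgue_on (unit_cell :: (real^'n) set)"
  have Dm: "D \<in> sets lebesgue" using D by auto
  obtain R where R: "R > 0" "D \<subseteq> cball 0 R"
    using D(2) by (auto simp: bounded_pos subset_iff)
  have nae: "AE x in lebesgue. \<bar>n (x /\<^sub>R e j)\<bar> \<le> C" for j
  proof (rule AE_lebesgue_scale)
    show "AE x in lebesgue. \<bar>n x\<bar> \<le> C"
      using n(2) by (intro periodic_AE[OF _ n(3)]) (simp add: unit_periodic_def)
    show "e j \<noteq> 0" using e(1)[of j] by simp
  qed
  have nm: "(\<lambda>x. n (x /\<^sub>R e j)) \<in> borel_measurable ?M" for j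
    by (intro measurable_restrict_space1 scaled_measurable n)
  have B0: "0 \<le> B" by (rule order_trans[OF l2_sq_nonneg w(2)[of 0]])
  have K0: "0 \<le> K" by (rule order_trans[OF zero_le_power2 k[of 0]])
  have am: "(\<lambda>x. (k j)\<^sup>2 * n (x /\<^sub>R e j)) \<in> borel_measurable ?M" for j using nm[of j] by measurable
  have ab: "AE x in ?M. \<bar>(k j)\<^sup>2 * n (x /\<^sub>R e j)\<bar> \<le> K * C" for j
  proof -
    have "AE x in ?M. \<bar>n (x /\<^sub>R e j)\<bar> \<le> C" using nae[of j] Dm by (subst AE_lebesgue_on_iff) auto
    then show ?thesis
    proof eventually_elim
      case (elim x)
      have "(k j)\<^sup>2 * \<bar>n (x /\<^sub>R e j)\<bar> \<le> K * C" using elim k[of j] K0 by (intro mult_mono) auto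
      then show ?case by (simp add: abs_mult)
    qed
  qed
  note t = test_function_square_integrable[OF D(1) \<phi>]
  obtain F where F: "\<And>x. norm (\<phi> x) \<le> F" "F > 0"
    using compactly_supported_bounded[OF compactly_supported_test_function[OF \<phi>]] by blast
  define T where "T = sqrt (l2_sq ?M \<phi>)"
  define Q where "Q = sqrt ((2 * R + 3) ^ CARD('n))"
  define A where "A = F * Q * sqrt B + sqrt B * T + 1"
  have QT: "Q \<ge> 0" "T \<ge> 0" using R by (auto simp: Q_def T_def)
  have A: "A > 0" unfolding A_def using F QT B0 by (intro add_nonneg_pos add_nonneg_nonneg mult_nonneg_nonneg) auto
  have wphi: "norm (LINT x|?M. w j x * \<phi> x) \<le> sqrt B * T" for j
  proof -
    have "norm (LINT x|?M. w j x * \<phi> x) \<le> sqrt (l2_sq ?M (w j)) * sqrt (l2_sq ?M \<phi>)"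
      by (rule integral_mult_bound[OF w(1) t])
    also have "\<dots> \<le> sqrt B * T" unfolding T_def using w(2) by (intro mult_right_mono real_sqrt_le_mono) auto
    finally show ?thesis .
  qed
  let ?G = "\<lambda>j. (LINT x|?M. of_real (n (x /\<^sub>R e j)) * w j x * \<phi> x) - of_real (cell_mean n) * (LINT x|?M. w j x * \<phi> x)"
  show ?thesis
  proof (rule LIMSEQ_I)
    fix d :: real assume d: "d > 0"
    define \<eta> where "\<eta> = (d / (2 * A))\<^sup>2"
    have \<eta>: "\<eta> > 0" "sqrt \<eta> = d / (2 * A)" using d A by (auto simp: \<eta>_def)
    obtain P where P: "P \<in> trig" and Psi: "square_integrable ?Y (\<lambda>y. of_real (n y) - P y)"
      and Pl: "l2_sq ?Y (\<lambda>y. of_real (n y) - P y) \<le> \<eta>"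
      using trig_dense_l2[OF n(1,3,4) \<eta>(1)] by blast
    let ?u = "\<lambda>y. complex_of_real (n y) - P y"
    have Pm: "P \<in> borel_measurable lebesgue"
      by (intro measurable_completion) (simp add: borel_measurable_continuous_onI[OF trig_continuous[OF P]])
    have um: "?u \<in> borel_measurable lebesgue" using n(1) Pm by measurable
    have up: "unit_periodic ?u" using n(2) trig_periodic[OF P] by (simp add: unit_periodic_def)
    obtain BP where BP: "\<And>x. norm (P x) \<le> BP" using trig_bounded[OF P] by blast
    have mean: "norm (of_real (cell_mean n) - (LINT y|?Y. P y)) \<le> sqrt \<eta>"
    proof -
      interpret Y: finite_measure ?Y by (rule finite_measure_unit_cell)
      have one: "square_integrable ?Y (\<lambda>y. 1 :: complex)" by (simp add: square_integrable_def)
      have l1: "l2_sq ?Y (\<lambda>y. 1 :: complex) = 1"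
        by (simp add: l2_sq_def integral_unit_cell_const del: lebesgue_integral_const)
      have Pi: "integrable ?Y P" by (rule square_integrable_imp_integrable[OF trig_square_integrable[OF P] finite_measure_unit_cell])
      have "integrable ?Y (\<lambda>y. ?u y + P y)"
        by (intro Bochner_Integration.integrable_add Pi square_integrable_imp_integrable[OF Psi finite_measure_unit_cell])
      then have ni: "integrable ?Y (\<lambda>y. complex_of_real (n y))" by simp
      have "complex_of_real (cell_mean n) = (LINT y|?Y. complex_of_real (n y))"
        by (simp add: cell_mean_def measure_unit_cell)
      then have "of_real (cell_mean n) - (LINT y|?Y. P y) = (LINT y|?Y. ?u y * 1)"
        using ni Pi by simp
      also have "norm \<dots> \<le> sqrt (l2_sq ?Y ?u) * sqrt (l2_sq ?Y (\<lambda>y. 1 :: complex))"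
        by (rule integral_mult_bound[OF Psi one])
      also have "\<dots> \<le> sqrt \<eta>" unfolding l1 using Pl by simp
      finally show ?thesis .
    qed
    have osc: "(\<lambda>j. (LINT x|?M. P (x /\<^sub>R e j) * w j x * \<phi> x) - (LINT y|?Y. P y) * (LINT x|?M. w j x * \<phi> x)) \<longlonglongrightarrow> 0"
      by (rule trig_oscillation_limit[OF D(1) e w am ab h \<phi> P])
    have "d / 2 > 0" using d by simp
    from LIMSEQ_D[OF osc this] obtain N1 where N1: "\<And>j. j \<ge> N1 \<Longrightarrow>
        norm ((LINT x|?M. P (x /\<^sub>R e j) * w j x * \<phi> x) - (LINT y|?Y. P y) * (LINT x|?M. w j x * \<phi> x)) < d / 2"
      by auto
    obtain N2 where N2: "\<And>j. j \<ge> N2 \<Longrightarrow> e j \<le> 1"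
      using LIMSEQ_D[OF e(2), of 1] by (metis abs_less_iff diff_zero less_imp_le real_norm_def zero_less_one)
    show "\<exists>N. \<forall>j\<ge>N. norm (?G j - 0) < d"
    proof (intro exI[of _ "max N1 N2"] allI impI)
      fix j assume j: "j \<ge> max N1 N2"
      have e1: "e j \<le> 1" using N2 j by simp
      note us = periodic_scaled_l2[OF um up Psi Dm R(2) less_imp_le[OF R(1)] e(1) e1]
      have Pw: "square_integrable ?M (\<lambda>x. P (x /\<^sub>R e j) * w j x)"
        by (rule square_integrable_bounded_mult(1)[OF w(1), where C=BP])
          (use BP in \<open>auto intro!: measurable_restrict_space1 scaled_measurable Pm\<close>)
      have nw: "square_integrable ?M (\<lambda>x. of_real (n (x /\<^sub>R e j)) * w j x)"
      proof (rule square_integrable_bounded_mult(1)[OF w(1), where C=C])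
        show "(\<lambda>x. complex_of_real (n (x /\<^sub>R e j))) \<in> borel_measurable ?M" using nm[of j] by measurable
        show "AE x in ?M. norm (complex_of_real (n (x /\<^sub>R e j))) \<le> C"
          using nae[of j] Dm by (subst AE_lebesgue_on_iff) auto
      qed
      have wf: "square_integrable ?M (\<lambda>x. \<phi> x * w j x)" "l2_sq ?M (\<lambda>x. \<phi> x * w j x) \<le> F\<^sup>2 * l2_sq ?M (w j)"
        using F(1) by (auto intro!: square_integrable_bounded_mult[OF w(1)] square_integrable_measurable[OF t])
      have d1: "(LINT x|?M. of_real (n (x /\<^sub>R e j)) * w j x * \<phi> x) - (LINT x|?M. P (x /\<^sub>R e j) * w j x * \<phi> x)
          = (LINT x|?M. ?u (x /\<^sub>R e j) * (\<phi> x * w j x))"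
      proof -
        have "(LINT x|?M. of_real (n (x /\<^sub>R e j)) * w j x * \<phi> x) - (LINT x|?M. P (x /\<^sub>R e j) * w j x * \<phi> x)
          = (LINT x|?M. of_real (n (x /\<^sub>R e j)) * w j x * \<phi> x - P (x /\<^sub>R e j) * w j x * \<phi> x)"
          by (intro Bochner_Integration.integral_diff[symmetric] square_integrable_mult nw Pw t)
        then show ?thesis by (simp add: left_diff_distrib right_diff_distrib mult_ac)
      qed
      have "norm (LINT x|?M. ?u (x /\<^sub>R e j) * (\<phi> x * w j x)) \<le> sqrt (l2_sq ?M (\<lambda>x. ?u (x /\<^sub>R e j))) * sqrt (l2_sq ?M (\<lambda>x. \<phi> x * w j x))"
        by (rule integral_mult_bound[OF us(1) wf(1)])
      also have "\<dots> \<le> (Q * sqrt \<eta>) * (F * sqrt B)"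
      proof (rule mult_mono)
        have "l2_sq ?M (\<lambda>x. ?u (x /\<^sub>R e j)) \<le> (2 * R + 3) ^ CARD('n) * \<eta>"
          using us(2) Pl R by (meson mult_left_mono order_trans zero_le_power add_nonneg_nonneg less_imp_le
              mult_nonneg_nonneg zero_le_numeral)
        then show "sqrt (l2_sq ?M (\<lambda>x. ?u (x /\<^sub>R e j))) \<le> Q * sqrt \<eta>"
          unfolding Q_def by (subst real_sqrt_mult[symmetric]) (rule real_sqrt_le_mono)
        have "l2_sq ?M (\<lambda>x. \<phi> x * w j x) \<le> F\<^sup>2 * B"
          using wf(2) w(2)[of j] by (meson mult_left_mono order_trans zero_le_power2)
        then have "sqrt (l2_sq ?M (\<lambda>x. \<phi> x * w j x)) \<le> sqrt (F\<^sup>2 * B)" by (rule real_sqrt_le_mono)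
        then show "sqrt (l2_sq ?M (\<lambda>x. \<phi> x * w j x)) \<le> F * sqrt B" using F(2) by (simp add: real_sqrt_mult)
      qed (use QT \<eta>(1) in auto)
      finally have n1: "norm ((LINT x|?M. of_real (n (x /\<^sub>R e j)) * w j x * \<phi> x) - (LINT x|?M. P (x /\<^sub>R e j) * w j x * \<phi> x))
          \<le> sqrt \<eta> * (F * Q * sqrt B)" unfolding d1 by (simp add: mult_ac)
      have "norm ((LINT y|?Y. P y) * (LINT x|?M. w j x * \<phi> x) - of_real (cell_mean n) * (LINT x|?M. w j x * \<phi> x))
          = norm (of_real (cell_mean n) - (LINT y|?Y. P y)) * norm (LINT x|?M. w j x * \<phi> x)"
        by (simp only: left_diff_distrib[symmetric] norm_mult norm_minus_commute[of "of_real (cell_mean n)"])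
      also have "\<dots> \<le> sqrt \<eta> * (sqrt B * T)"
        using mean wphi[of j] \<eta>(1) by (intro mult_mono) auto
      finally have n2: "norm ((LINT y|?Y. P y) * (LINT x|?M. w j x * \<phi> x) - of_real (cell_mean n) * (LINT x|?M. w j x * \<phi> x))
          \<le> sqrt \<eta> * (sqrt B * T)" .
      have "?G j = ((LINT x|?M. of_real (n (x /\<^sub>R e j)) * w j x * \<phi> x) - (LINT x|?M. P (x /\<^sub>R e j) * w j x * \<phi> x))
          + ((LINT x|?M. P (x /\<^sub>R e j) * w j x * \<phi> x) - (LINT y|?Y. P y) * (LINT x|?M. w j x * \<phi> x))
          + ((LINT y|?Y. P y) * (LINT x|?M. w j x * \<phi> x) - of_real (cell_mean n) * (LINT x|?M. w j x * \<phi> x))" by simp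
      then have "norm (?G j) < sqrt \<eta> * (F * Q * sqrt B) + d / 2 + sqrt \<eta> * (sqrt B * T)"
        using n1 n2 N1[of j] j by (smt (verit) norm_triangle_ineq max.boundedE)
      also have "\<dots> = sqrt \<eta> * (A - 1) + d / 2" by (simp add: A_def algebra_simps)
      also have "\<dots> \<le> sqrt \<eta> * A + d / 2" using \<eta>(1) by (simp add: mult_left_mono)
      also have "\<dots> = d" using A by (simp add: \<eta>(2))
      finally show "norm (?G j - 0) < d" by simp
    qed
  qed
qed

section \<open>Energy estimates for eigenpairs\<close>

lemma l2_sq_le_double:
  fixes f g :: "'a \<Rightarrow> complex"
  assumes "square_integrable M f" "square_integrable M g"
  shows "l2_sq M f \<le> 2 * l2_sq M (\<lambda>x. f x - g x) + 2 * l2_sq M g"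
proof -
  have "l2_sq M f \<le> (\<integral>x. 2 * (norm (f x - g x))\<^sup>2 + 2 * (norm (g x))\<^sup>2 \<partial>M)"
    unfolding l2_sq_def
    by (intro integral_mono square_integrable_sq assms Bochner_Integration.integrable_add integrable_mult_right
        square_integrable_diff norm_sq_le_double)
  also have "\<dots> = 2 * l2_sq M (\<lambda>x. f x - g x) + 2 * l2_sq M g"
    unfolding l2_sq_def using assms
    by (simp add: square_integrable_sq square_integrable_diff)
  finally show ?thesis .
qed

lemma l2_norm_sum_le:
  assumes "finite I" "\<And>i. i \<in> I \<Longrightarrow> square_integrable M (f i)"
  shows "sqrt (l2_sq M (\<lambda>x. \<Sum>i\<in>I. f i x)) \<le> (\<Sum>i\<in>I. sqrt (l2_sq M (f i)))"
  using assms
proof (induction I)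
  case empty
  then show ?case by (simp add: l2_sq_def)
next
  case (insert i I)
  then have "sqrt (l2_sq M (\<lambda>x. f i x + (\<Sum>i\<in>I. f i x))) \<le> sqrt (l2_sq M (f i)) + sqrt (l2_sq M (\<lambda>x. \<Sum>i\<in>I. f i x))"
    by (intro l2_triangle square_integrable_sum) auto
  with insert show ?case by fastforce
qed

lemma l2_sum_tendsto:
  assumes "finite I" "\<And>i m. i \<in> I \<Longrightarrow> square_integrable M (f i m)" "\<And>i. i \<in> I \<Longrightarrow> square_integrable M (g i)"
    "\<And>i. i \<in> I \<Longrightarrow> (\<lambda>m. l2_sq M (\<lambda>x. f i m x - g i x)) \<longlonglongrightarrow> 0"
  shows "(\<lambda>m. l2_sq M (\<lambda>x. (\<Sum>i\<in>I. f i m x) - (\<Sum>i\<in>I. g i x))) \<longlonglongrightarrow> 0"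
proof -
  have "(\<lambda>m. sqrt (l2_sq M (\<lambda>x. (\<Sum>i\<in>I. f i m x) - (\<Sum>i\<in>I. g i x)))) \<longlonglongrightarrow> 0"
  proof (rule tendsto_sandwich[OF _ _ tendsto_const])
    show "\<forall>\<^sub>F m in sequentially. 0 \<le> sqrt (l2_sq M (\<lambda>x. (\<Sum>i\<in>I. f i m x) - (\<Sum>i\<in>I. g i x)))" by simp
    show "\<forall>\<^sub>F m in sequentially. sqrt (l2_sq M (\<lambda>x. (\<Sum>i\<in>I. f i m x) - (\<Sum>i\<in>I. g i x)))
        \<le> (\<Sum>i\<in>I. sqrt (l2_sq M (\<lambda>x. f i m x - g i x)))"
      unfolding sum_subtractf[symmetric]
      by (intro always_eventually allI l2_norm_sum_le square_integrable_diff assms)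
    have "(\<lambda>m. \<Sum>i\<in>I. sqrt (l2_sq M (\<lambda>x. f i m x - g i x))) \<longlonglongrightarrow> (\<Sum>i\<in>I. sqrt 0)"
      by (intro tendsto_sum tendsto_real_sqrt assms)
    then show "(\<lambda>m. \<Sum>i\<in>I. sqrt (l2_sq M (\<lambda>x. f i m x - g i x))) \<longlonglongrightarrow> 0" by simp
  qed
  then have "(\<lambda>m. (sqrt (l2_sq M (\<lambda>x. (\<Sum>i\<in>I. f i m x) - (\<Sum>i\<in>I. g i x))))\<^sup>2) \<longlonglongrightarrow> 0\<^sup>2" by (rule tendsto_power)
  then show ?thesis by simp
qed

lemma weak_deriv_Nil:
  assumes D: "open D" "bounded D" and u: "u \<in> sobolev m D"
  shows "AE x in lebesgue_on D. weak_deriv D [] u x = u x"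
  by (rule weak_deriv_AE_unique[OF D weak_deriv_works[OF u]])
    (use u in \<open>auto simp: sobolev_def has_weak_deriv_def\<close>)

definition weak_laplacian :: "(real^'n) set \<Rightarrow> (real^'n \<Rightarrow> complex) \<Rightarrow> real^'n \<Rightarrow> complex" where
  "weak_laplacian D u x = (\<Sum>i\<in>UNIV. weak_deriv D [i, i] u x)"

definition dirichlet_energy :: "(real^'n) set \<Rightarrow> (real^'n \<Rightarrow> complex) \<Rightarrow> real" where
  "dirichlet_energy D u = (\<Sum>i\<in>UNIV. l2_sq (lebesgue_on D) (weak_deriv D [i] u))"

lemma sobolev_norm_1:
  assumes D: "open D" "bounded D" and u: "u \<in> sobolev 2 D"
  shows "(sobolev_norm 1 D u)\<^sup>2 = l2_sq (lebesgue_on D) u + dirichlet_energy D u"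
proof -
  have e: "{is. length is \<le> 1} = insert [] (range (\<lambda>i. [i]))"
    by (auto simp: le_Suc_eq length_Suc_conv)
  have "(sobolev_norm 1 D u)\<^sup>2 = (\<Sum>is | length is \<le> 1. l2_sq (lebesgue_on D) (weak_deriv D is u))"
    unfolding sobolev_norm_def L2_norm_eq by (simp add: sum_nonneg)
  also have "\<dots> = l2_sq (lebesgue_on D) (weak_deriv D [] u) + (\<Sum>is\<in>range (\<lambda>i. [i]). l2_sq (lebesgue_on D) (weak_deriv D is u))"
    unfolding e by (subst sum.insert) auto
  also have "(\<Sum>is\<in>range (\<lambda>i. [i]). l2_sq (lebesgue_on D) (weak_deriv D is u)) = dirichlet_energy D u"
    unfolding dirichlet_energy_def by (subst sum.reindex) (auto simp: inj_on_def)
  also have "l2_sq (lebesgue_on D) (weak_deriv D [] u) = l2_sq (lebesgue_on D) u"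
    by (rule l2_sq_weak_deriv[OF D u]) (use u in \<open>auto simp: sobolev_def has_weak_deriv_def\<close>)
  finally show ?thesis .
qed

text \<open>Only the derivatives that enter the energy identities are recorded, in terms of the operators
used for test functions.\<close>

lemma H20_approximation:
  assumes D: "open D" "bounded D" and u: "u \<in> sobolev0 2 D"
  obtains \<phi> where "\<And>m::nat. \<phi> m \<in> test_functions D"
    "(\<lambda>m. l2_sq (lebesgue_on D) (\<lambda>x. \<phi> m x - u x)) \<longlonglongrightarrow> 0"
    "\<And>i. (\<lambda>m. l2_sq (lebesgue_on D) (\<lambda>x. partial_deriv i (\<phi> m) x - weak_deriv D [i] u x)) \<longlonglongrightarrow> 0"
    "(\<lambda>m. l2_sq (lebesgue_on D) (\<lambda>x. laplacian (\<phi> m) x - weak_laplacian D u x)) \<longlonglongrightarrow> 0"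
proof -
  let ?M = "lebesgue_on D"
  have us: "u \<in> sobolev 2 D" using u by (simp add: sobolev0_def)
  have uL: "square_integrable ?M u" using us by (simp add: sobolev_def L2_iff)
  have Gsi: "square_integrable ?M (weak_deriv D is u)" if "length is \<le> 2" for "is"
    using weak_deriv_works(1)[OF us that] by (simp add: L2_iff)
  obtain \<phi> where \<phi>: "\<And>j::nat. \<phi> j \<in> test_functions D"
    and lim: "\<And>is. length is \<le> 2 \<Longrightarrow> (\<lambda>j. l2_sq ?M (\<lambda>x. weak_deriv D is u x - iter_partial (rev is) (\<phi> j) x)) \<longlonglongrightarrow> 0"
    using sobolev0_approximation[OF D u] by blast
  have tsi: "square_integrable ?M (iter_partial is (\<phi> j))" for "is" j
    by (rule test_function_square_integrable[OF D(1) test_functions_iter_partial[OF \<phi>]])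
  show ?thesis
  proof (rule that[OF \<phi>])
    have "l2_sq ?M (\<lambda>x. weak_deriv D [] u x - iter_partial (rev []) (\<phi> m) x) = l2_sq ?M (\<lambda>x. \<phi> m x - u x)" for m
    proof -
      have "l2_sq ?M (\<lambda>x. weak_deriv D [] u x - \<phi> m x) = l2_sq ?M (\<lambda>x. u x - \<phi> m x)"
        using weak_deriv_Nil[OF D us] tsi[of "[]" m] Gsi[of "[]"] uL
        by (intro l2_sq_cong_AE square_integrable_diff) auto
      then show ?thesis by (simp add: l2_sq_diff_commute[of ?M u])
    qed
    then show "(\<lambda>m. l2_sq ?M (\<lambda>x. \<phi> m x - u x)) \<longlonglongrightarrow> 0" using lim[of "[]"] by simp
    show "(\<lambda>m. l2_sq ?M (\<lambda>x. partial_deriv i (\<phi> m) x - weak_deriv D [i] u x)) \<longlonglongrightarrow> 0" for i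
      using lim[of "[i]"] by (simp add: l2_sq_diff_commute[of ?M "weak_deriv D [i] u"])
    show "(\<lambda>m. l2_sq ?M (\<lambda>x. laplacian (\<phi> m) x - weak_laplacian D u x)) \<longlonglongrightarrow> 0"
      unfolding laplacian_def weak_laplacian_def
    proof (rule l2_sum_tendsto)
      fix i :: 'a
      show "(\<lambda>m. l2_sq ?M (\<lambda>x. iter_partial [i, i] (\<phi> m) x - weak_deriv D [i, i] u x)) \<longlonglongrightarrow> 0"
        using lim[of "[i, i]"] by (simp add: l2_sq_diff_commute[of ?M "weak_deriv D [i,i] u"])
      show "square_integrable ?M (weak_deriv D [i, i] u)" by (rule Gsi) simp
      show "square_integrable ?M (iter_partial [i, i] (\<phi> m))" for m by (rule tsi)
    qed simp
  qed
qed

lemma weak_laplacian_square_integrable: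
  assumes "u \<in> sobolev 2 D" shows "square_integrable (lebesgue_on D) (weak_laplacian D u)"
  unfolding weak_laplacian_def[abs_def]
  using weak_deriv_works(1)[OF assms] by (intro square_integrable_sum) (simp add: L2_iff)

lemma integral_weak_laplacian:
  assumes D: "open D" and u: "u \<in> sobolev 2 D" and \<phi>: "\<phi> \<in> test_functions D"
  shows "(LINT x|lebesgue_on D. u x * laplacian \<phi> x) = (LINT x|lebesgue_on D. weak_laplacian D u x * \<phi> x)"
proof -
  let ?M = "lebesgue_on D"
  have uL: "square_integrable ?M u" using u by (simp add: sobolev_def L2_iff)
  have G: "square_integrable ?M (weak_deriv D [i,i] u)" "has_weak_deriv D [i,i] u (weak_deriv D [i,i] u)" for i
    using weak_deriv_works[OF u, of "[i,i]"] by (auto simp: L2_iff)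
  note t = test_function_square_integrable[OF D test_functions_iter_partial[OF \<phi>]]
  have "(LINT x|?M. u x * laplacian \<phi> x) = (LINT x|?M. (\<Sum>i\<in>UNIV. u x * iter_partial [i,i] \<phi> x))"
    by (simp add: laplacian_def sum_distrib_left)
  also have "\<dots> = (\<Sum>i\<in>UNIV. LINT x|?M. u x * iter_partial [i,i] \<phi> x)"
    by (intro Bochner_Integration.integral_sum square_integrable_mult uL t)
  also have "\<dots> = (\<Sum>i\<in>UNIV. LINT x|?M. weak_deriv D [i,i] u x * \<phi> x)"
    using G(2) \<phi> by (intro sum.cong) (auto simp: has_weak_deriv_def)
  also have "\<dots> = (LINT x|?M. (\<Sum>i\<in>UNIV. weak_deriv D [i,i] u x * \<phi> x))"
    by (intro Bochner_Integration.integral_sum[symmetric] square_integrable_mult G(1) test_function_square_integrable[OF D \<phi>])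
  finally show ?thesis by (simp add: weak_laplacian_def sum_distrib_right)
qed

text \<open>Both sides are continuous in $H^2$ and agree on test functions.\<close>

lemma dirichlet_energy_identity:
  assumes D: "open D" "bounded D" and u: "u \<in> sobolev0 2 D"
  shows "(LINT x|lebesgue_on D. u x * cnj (weak_laplacian D u x)) = - of_real (dirichlet_energy D u)"
proof -
  let ?M = "lebesgue_on D"
  have us: "u \<in> sobolev 2 D" using u by (simp add: sobolev0_def)
  have uL: "square_integrable ?M u" using us by (simp add: sobolev_def L2_iff)
  obtain \<phi> where \<phi>: "\<And>m::nat. \<phi> m \<in> test_functions D"
    and l0: "(\<lambda>m. l2_sq ?M (\<lambda>x. \<phi> m x - u x)) \<longlonglongrightarrow> 0"
    and l1: "\<And>i. (\<lambda>m. l2_sq ?M (\<lambda>x. partial_deriv i (\<phi> m) x - weak_deriv D [i] u x)) \<longlonglongrightarrow> 0"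
    and l2: "(\<lambda>m. l2_sq ?M (\<lambda>x. laplacian (\<phi> m) x - weak_laplacian D u x)) \<longlonglongrightarrow> 0"
    using H20_approximation[OF D u] by blast
  note t0 = test_function_square_integrable[OF D(1) \<phi>]
    and t1 = test_function_square_integrable[OF D(1) test_functions_partial_deriv[OF \<phi>]]
    and t2 = test_function_square_integrable[OF D(1) test_functions_laplacian[OF \<phi>]]
  have G1: "square_integrable ?M (weak_deriv D [i] u)" for i
    using weak_deriv_works(1)[OF us, of "[i]"] by (simp add: L2_iff)
  have "(\<lambda>m. LINT x|?M. \<phi> m x * cnj (laplacian (\<phi> m) x)) \<longlonglongrightarrow> (LINT x|?M. u x * cnj (weak_laplacian D u x))"
  proof (rule integral_mult_tendsto[OF t0 uL l0])
    show "(\<lambda>m. l2_sq ?M (\<lambda>x. cnj (laplacian (\<phi> m) x) - cnj (weak_laplacian D u x))) \<longlonglongrightarrow> 0"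
      using l2 by (simp add: l2_sq_cnj flip: complex_cnj_diff)
  qed (intro square_integrable_cnj t2 weak_laplacian_square_integrable us)+
  moreover have "(\<lambda>m. - complex_of_real (\<Sum>i\<in>UNIV. l2_sq ?M (partial_deriv i (\<phi> m)))) \<longlonglongrightarrow> - of_real (dirichlet_energy D u)"
    unfolding dirichlet_energy_def
    by (intro tendsto_intros l2_sq_tendsto t1 G1 l1)
  moreover have "(LINT x|?M. \<phi> m x * cnj (laplacian (\<phi> m) x)) = - complex_of_real (\<Sum>i\<in>UNIV. l2_sq ?M (partial_deriv i (\<phi> m)))" for m
  proof -
    have "(LINT x|?M. \<phi> m x * cnj (laplacian (\<phi> m) x)) = (LINT x|lborel. \<phi> m x * cnj (laplacian (\<phi> m) x))"
      using D test_function_outside[OF \<phi>] test_function_measurable[OF \<phi>, of m]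
        test_function_measurable[OF test_functions_laplacian[OF \<phi>, of m]]
      by (intro integral_lebesgue_on_eq_lborel) (auto intro!: borel_measurable_times measurable_compose[OF _ borel_measurable_cnj])
    then show ?thesis
      by (simp add: gradient_energy[OF \<phi>] l2_sq_test_function[OF D(1) test_functions_partial_deriv[OF \<phi>]])
  qed
  ultimately show ?thesis using LIMSEQ_unique by simp
qed

lemma poincare_inequality_H20:
  assumes D: "open D" "D \<subseteq> cball 0 R" "R > 0" and u: "u \<in> sobolev0 2 D"
  shows "l2_sq (lebesgue_on D) u \<le> 9 * R\<^sup>2 * dirichlet_energy D u"
proof -
  let ?M = "lebesgue_on D"
  have bD: "bounded D" using D(2) bounded_cball bounded_subset by blast
  have us: "u \<in> sobolev 2 D" using u by (simp add: sobolev0_def)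
  have uL: "square_integrable ?M u" using us by (simp add: sobolev_def L2_iff)
  obtain \<phi> where \<phi>: "\<And>m::nat. \<phi> m \<in> test_functions D"
    and l0: "(\<lambda>m. l2_sq ?M (\<lambda>x. \<phi> m x - u x)) \<longlonglongrightarrow> 0"
    and l1: "\<And>i. (\<lambda>m. l2_sq ?M (\<lambda>x. partial_deriv i (\<phi> m) x - weak_deriv D [i] u x)) \<longlonglongrightarrow> 0"
    and l2: "(\<lambda>m. l2_sq ?M (\<lambda>x. laplacian (\<phi> m) x - weak_laplacian D u x)) \<longlonglongrightarrow> 0"
    using H20_approximation[OF D(1) bD u] by blast
  note t0 = test_function_square_integrable[OF D(1) \<phi>]
    and t1 = test_function_square_integrable[OF D(1) test_functions_partial_deriv[OF \<phi>]]
  fix i :: 'a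
  have G1: "square_integrable ?M (weak_deriv D [i] u)"
    using weak_deriv_works(1)[OF us, of "[i]"] by (simp add: L2_iff)
  have "l2_sq ?M u \<le> 9 * R\<^sup>2 * l2_sq ?M (weak_deriv D [i] u)"
  proof (rule LIMSEQ_le)
    show "(\<lambda>m. l2_sq ?M (\<phi> m)) \<longlonglongrightarrow> l2_sq ?M u" by (rule l2_sq_tendsto[OF t0 uL l0])
    show "(\<lambda>m. 9 * R\<^sup>2 * l2_sq ?M (partial_deriv i (\<phi> m))) \<longlonglongrightarrow> 9 * R\<^sup>2 * l2_sq ?M (weak_deriv D [i] u)"
      by (intro tendsto_intros l2_sq_tendsto[OF t1 G1 l1])
    show "\<exists>N. \<forall>m\<ge>N. l2_sq ?M (\<phi> m) \<le> 9 * R\<^sup>2 * l2_sq ?M (partial_deriv i (\<phi> m))"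
      using poincare_inequality[OF \<phi> D(2,3)]
      by (simp add: l2_sq_test_function[OF D(1) \<phi>] l2_sq_test_function[OF D(1) test_functions_partial_deriv[OF \<phi>]])
  qed
  also have "\<dots> \<le> 9 * R\<^sup>2 * dirichlet_energy D u"
    unfolding dirichlet_energy_def by (intro mult_left_mono member_le_sum) auto
  finally show ?thesis .
qed

text \<open>A transmission eigenpair for a bounded coefficient, with $u = w - v$ and $q = (\nu - 1) w$.\<close>

locale eigen_setting =
  fixes D :: "(real^'n) set" and \<nu> :: "real^'n \<Rightarrow> real" and k C :: real and w v :: "real^'n \<Rightarrow> complex"
  assumes D: "open D" "bounded D" and ev: "transmission_eigenpair D \<nu> k (w, v)"
    and \<nu>m: "\<nu> \<in> borel_measurable (lebesgue_on D)" and \<nu>b: "AE x in lebesgue_on D. \<bar>\<nu> x\<bar> \<le> C" and C: "C > 0"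
begin

abbreviation "M \<equiv> lebesgue_on D"
definition u where "u x = w x - v x"
definition q where "q x = complex_of_real (\<nu> x - 1) * w x"

lemma k: "k > 0" and w: "square_integrable M w" and v: "square_integrable M v"
  and hw: "helmholtz D (\<lambda>x. k\<^sup>2 * \<nu> x) w" and hv: "helmholtz D (\<lambda>x. k\<^sup>2) v" and u0: "u \<in> sobolev0 2 D"
  using ev by (auto simp: transmission_eigenpair_def L2_iff u_def[abs_def])

lemma u: "square_integrable M u" and us: "u \<in> sobolev 2 D"
  using u0 by (auto simp: sobolev0_def sobolev_def L2_iff)

lemma \<nu>w: "square_integrable M (\<lambda>x. complex_of_real (\<nu> x) * w x)"
  using \<nu>m \<nu>b by (intro square_integrable_bounded_mult(1)[OF w, where C=C]) auto

lemma q_eq: "q x = complex_of_real (\<nu> x) * w x - w x"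
  by (simp add: q_def left_diff_distrib)

lemma q: "square_integrable M q"
  unfolding q_eq[abs_def] by (intro square_integrable_diff \<nu>w w)

text \<open>Both sides are square-integrable, and they agree as distributions by the difference of the two
equations.\<close>

lemma laplacian_eq_q: "AE x in M. weak_laplacian D u x = - (of_real (k\<^sup>2) * (q x + u x))"
proof -
  have fin: "finite_measure M" using D by (intro finite_measure_lebesgue_on) auto
  let ?d = "\<lambda>x. weak_laplacian D u x + of_real (k\<^sup>2) * (q x + u x)"
  have lsi: "square_integrable M (weak_laplacian D u)" by (rule weak_laplacian_square_integrable[OF us])
  have qu: "square_integrable M (\<lambda>x. of_real (k\<^sup>2) * (q x + u x))"
    by (intro square_integrable_cmult square_integrable_add q u)
  have dsi: "square_integrable M ?d" by (rule square_integrable_add[OF lsi qu])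
  have "AE x in M. ?d x = 0"
  proof (rule fundamental_lemma[OF D(1) square_integrable_imp_integrable[OF dsi fin]])
    fix \<phi> assume \<phi>: "\<phi> \<in> test_functions D"
    note t = test_function_square_integrable[OF D(1) \<phi>] and tl = test_function_square_integrable[OF D(1) test_functions_laplacian[OF \<phi>]]
    have "(LINT x|M. weak_laplacian D u x * \<phi> x) = (LINT x|M. u x * laplacian \<phi> x)"
      by (rule integral_weak_laplacian[OF D(1) us \<phi>, symmetric])
    also have "\<dots> = (LINT x|M. w x * laplacian \<phi> x) - (LINT x|M. v x * laplacian \<phi> x)"
      unfolding u_def left_diff_distrib
      by (intro Bochner_Integration.integral_diff square_integrable_mult w v tl)
    also have "\<dots> = (LINT x|M. of_real (k\<^sup>2) * v x * \<phi> x) - (LINT x|M. of_real (k\<^sup>2 * \<nu> x) * w x * \<phi> x)"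
      using hw hv \<phi> unfolding helmholtz_def by (simp add: eq_neg_iff_add_eq_0[symmetric])
    also have "\<dots> = (LINT x|M. of_real (k\<^sup>2) * (v x * \<phi> x)) - (LINT x|M. of_real (k\<^sup>2) * ((of_real (\<nu> x) * w x) * \<phi> x))"
      by (simp only: mult.assoc of_real_mult)
    also have "\<dots> = (LINT x|M. of_real (k\<^sup>2) * (v x * \<phi> x) - of_real (k\<^sup>2) * ((of_real (\<nu> x) * w x) * \<phi> x))"
      by (intro Bochner_Integration.integral_diff[symmetric] integrable_mult_right square_integrable_mult v t \<nu>w)
    also have "\<dots> = (LINT x|M. - ((of_real (k\<^sup>2) * (q x + u x)) * \<phi> x))"
      by (rule Bochner_Integration.integral_cong) (auto simp: q_eq u_def algebra_simps)
    finally have "(LINT x|M. weak_laplacian D u x * \<phi> x) = - (LINT x|M. (of_real (k\<^sup>2) * (q x + u x)) * \<phi> x)" by simp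
    moreover have "(LINT x|M. weak_laplacian D u x * \<phi> x + (of_real (k\<^sup>2) * (q x + u x)) * \<phi> x)
        = (LINT x|M. weak_laplacian D u x * \<phi> x) + (LINT x|M. (of_real (k\<^sup>2) * (q x + u x)) * \<phi> x)"
      by (intro Bochner_Integration.integral_add square_integrable_mult lsi qu t)
    ultimately show "(LINT x|M. ?d x * \<phi> x) = 0"
      unfolding distrib_right[of "weak_laplacian D u _"] by simp
  qed
  then show ?thesis by eventually_elim (simp add: add_eq_0_iff2)
qed

text \<open>The distributional equation for $w$ extends from test functions to $u \in H^2_0(D)$.\<close>

lemma pairing_w: "(LINT x|M. w x * cnj (weak_laplacian D u x)) = - (of_real (k\<^sup>2) * (LINT x|M. (of_real (\<nu> x) * w x) * cnj (u x)))"
proof -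
  obtain \<phi> where \<phi>: "\<And>m::nat. \<phi> m \<in> test_functions D"
    and l0: "(\<lambda>m. l2_sq M (\<lambda>x. \<phi> m x - u x)) \<longlonglongrightarrow> 0"
    and l1: "\<And>i. (\<lambda>m. l2_sq M (\<lambda>x. partial_deriv i (\<phi> m) x - weak_deriv D [i] u x)) \<longlonglongrightarrow> 0"
    and l2: "(\<lambda>m. l2_sq M (\<lambda>x. laplacian (\<phi> m) x - weak_laplacian D u x)) \<longlonglongrightarrow> 0"
    using H20_approximation[OF D u0] by blast
  note t0 = test_function_square_integrable[OF D(1) \<phi>]
    and t2 = test_function_square_integrable[OF D(1) test_functions_laplacian[OF \<phi>]]
  have z: "(\<lambda>m::nat. l2_sq M (\<lambda>x. f x - f x :: complex)) \<longlonglongrightarrow> 0" for f by (simp add: l2_sq_def)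
  have "(\<lambda>m. LINT x|M. w x * cnj (laplacian (\<phi> m) x)) \<longlonglongrightarrow> (LINT x|M. w x * cnj (weak_laplacian D u x))"
    by (rule integral_mult_tendsto[OF w w z])
      (use l2 in \<open>auto intro!: square_integrable_cnj t2 weak_laplacian_square_integrable us simp: l2_sq_cnj simp flip: complex_cnj_diff\<close>)
  moreover have "(\<lambda>m. - (of_real (k\<^sup>2) * (LINT x|M. (of_real (\<nu> x) * w x) * cnj (\<phi> m x))))
      \<longlonglongrightarrow> - (of_real (k\<^sup>2) * (LINT x|M. (of_real (\<nu> x) * w x) * cnj (u x)))"
    by (intro tendsto_intros integral_mult_tendsto[OF \<nu>w \<nu>w z])
      (use l0 in \<open>auto intro!: square_integrable_cnj t0 u simp: l2_sq_cnj simp flip: complex_cnj_diff\<close>)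
  moreover have "(LINT x|M. w x * cnj (laplacian (\<phi> m) x)) = - (of_real (k\<^sup>2) * (LINT x|M. (of_real (\<nu> x) * w x) * cnj (\<phi> m x)))" for m
  proof -
    have "(LINT x|M. w x * laplacian (\<lambda>x. cnj (\<phi> m x)) x) + (LINT x|M. of_real (k\<^sup>2 * \<nu> x) * w x * cnj (\<phi> m x)) = 0"
      using hw test_functions_cnj[OF \<phi>] unfolding helmholtz_def by blast
    moreover have "(LINT x|M. of_real (k\<^sup>2 * \<nu> x) * w x * cnj (\<phi> m x)) = of_real (k\<^sup>2) * (LINT x|M. (of_real (\<nu> x) * w x) * cnj (\<phi> m x))"
      by (subst integral_mult_right_zero[symmetric]) (simp add: mult.assoc)
    ultimately show ?thesis
      by (simp add: laplacian_cnj[OF test_functions_smooth[OF \<phi>]] eq_neg_iff_add_eq_0)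
  qed
  ultimately show ?thesis using LIMSEQ_unique by simp
qed

text \<open>Pairing $\Delta u = - k^2 (q + u)$ with $w$ and using the equation of $w$ gives
$\langle w, q \rangle = \langle q, u \rangle$; pairing it with $u$ gives $\langle u, q \rangle$.\<close>

lemma energy_identity:
  "of_real (k\<^sup>2) * (LINT x|M. w x * cnj (q x)) = complex_of_real (dirichlet_energy D u - k\<^sup>2 * l2_sq M u)"
proof -
  let ?K = "complex_of_real (k\<^sup>2)"
  have K: "?K \<noteq> 0" using k by simp
  have sub: "(LINT x|M. f x * cnj (weak_laplacian D u x)) = - (?K * ((LINT x|M. f x * cnj (q x)) + (LINT x|M. f x * cnj (u x))))"
    if f: "square_integrable M f" for f
  proof -
    have "(LINT x|M. f x * cnj (weak_laplacian D u x)) = (LINT x|M. - (?K * (f x * cnj (q x) + f x * cnj (u x))))"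
    proof (rule integral_cong_AE)
      show "AE x in M. f x * cnj (weak_laplacian D u x) = - (?K * (f x * cnj (q x) + f x * cnj (u x)))"
        using laplacian_eq_q
      proof eventually_elim
        case (elim x)
        show ?case unfolding elim by (simp add: algebra_simps)
      qed
      note [measurable] = square_integrable_measurable[OF f] square_integrable_measurable[OF weak_laplacian_square_integrable[OF us]]
        square_integrable_measurable[OF q] square_integrable_measurable[OF u]
      show "(\<lambda>x. f x * cnj (weak_laplacian D u x)) \<in> borel_measurable M" by measurable
      show "(\<lambda>x. - (?K * (f x * cnj (q x) + f x * cnj (u x)))) \<in> borel_measurable M" by measurable
    qed
    also have "\<dots> = - (?K * ((LINT x|M. f x * cnj (q x)) + (LINT x|M. f x * cnj (u x))))"
      using f q u by (simp add: square_integrable_mult square_integrable_cnj)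
    finally show ?thesis .
  qed
  have nw: "(LINT x|M. (of_real (\<nu> x) * w x) * cnj (u x)) = (LINT x|M. q x * cnj (u x)) + (LINT x|M. w x * cnj (u x))"
  proof -
    have "(LINT x|M. q x * cnj (u x) + w x * cnj (u x)) = (LINT x|M. q x * cnj (u x)) + (LINT x|M. w x * cnj (u x))"
      by (intro Bochner_Integration.integral_add square_integrable_mult square_integrable_cnj q w u)
    then show ?thesis by (simp add: q_eq left_diff_distrib)
  qed
  have "- (?K * ((LINT x|M. w x * cnj (q x)) + (LINT x|M. w x * cnj (u x))))
      = - (?K * ((LINT x|M. q x * cnj (u x)) + (LINT x|M. w x * cnj (u x))))"
    by (rule trans[OF sub[OF w, symmetric] pairing_w[unfolded nw]])
  then have wq: "(LINT x|M. w x * cnj (q x)) = (LINT x|M. q x * cnj (u x))" using K by simp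
  have "(LINT x|M. u x * cnj (q x)) = cnj (LINT x|M. q x * cnj (u x))"
  proof -
    have "u x * cnj (q x) = cnj (q x * cnj (u x))" for x by (simp add: mult.commute)
    then show ?thesis by (simp only: Bochner_Integration.integral_cnj)
  qed
  then have uq: "(LINT x|M. u x * cnj (q x)) = cnj (LINT x|M. w x * cnj (q x))" by (simp only: wq)
  have "- (?K * ((LINT x|M. u x * cnj (q x)) + of_real (l2_sq M u))) = - of_real (dirichlet_energy D u)"
    using sub[OF u] dirichlet_energy_identity[OF D u0] by (simp add: complex_integral_norm_sq)
  then have "?K * cnj (LINT x|M. w x * cnj (q x)) = of_real (dirichlet_energy D u) - ?K * of_real (l2_sq M u)"
  proof -
    assume *: "- (?K * ((LINT x|M. u x * cnj (q x)) + of_real (l2_sq M u))) = - of_real (dirichlet_energy D u)"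
    have gen: "- (K * (A + B)) = - d \<Longrightarrow> K * A = d - K * B" for K A B d :: complex
      by (metis add_diff_cancel_right' distrib_left neg_equal_iff_equal)
    show ?thesis by (rule gen[OF *[unfolded uq]])
  qed
  then have "cnj (?K * cnj (LINT x|M. w x * cnj (q x))) = cnj (of_real (dirichlet_energy D u) - ?K * of_real (l2_sq M u))"
    by (rule arg_cong)
  then show ?thesis by simp
qed

text \<open>The sign \<open>\<sigma>\<close> treats the cases of a coefficient above and below $1$ together.\<close>

context
  fixes \<sigma> c :: real
  assumes sigma: "\<bar>\<sigma>\<bar> = 1" and c: "c > 0" and contrast: "AE x in M. \<sigma> * (\<nu> x - 1) \<ge> c"
    and normalized: "sobolev_norm 1 D u = 1"
begin

lemma norm_split: "l2_sq M u + dirichlet_energy D u = 1"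
  using sobolev_norm_1[OF D us] normalized by simp

lemma dirichlet_energy_nonneg: "dirichlet_energy D u \<ge> 0"
  unfolding dirichlet_energy_def by (intro sum_nonneg) auto

lemma le_1: "l2_sq M u \<le> 1" "dirichlet_energy D u \<le> 1"
  using norm_split dirichlet_energy_nonneg l2_sq_nonneg[of M u] by linarith+

definition weighted where "weighted = (LINT x|M. \<bar>\<nu> x - 1\<bar> * (norm (w x))\<^sup>2)"

lemma weighted_integrable: "integrable M (\<lambda>x. \<bar>\<nu> x - 1\<bar> * (norm (w x))\<^sup>2)"
proof -
  have "integrable M (\<lambda>x. norm (w x) * norm (q x))" by (rule square_integrable_norm_mult[OF w q])
  then show ?thesis by (simp add: q_def norm_mult power2_eq_square mult_ac del: of_real_diff)
qed

lemma weighted_le: "k\<^sup>2 * weighted \<le> 1 + k\<^sup>2"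
proof -
  have "(LINT x|M. w x * cnj (q x)) = (LINT x|M. complex_of_real (\<sigma> * (\<bar>\<nu> x - 1\<bar> * (norm (w x))\<^sup>2)))"
  proof (rule integral_cong_AE)
    note [measurable] = square_integrable_measurable[OF w] square_integrable_measurable[OF q] \<nu>m
    show "(\<lambda>x. w x * cnj (q x)) \<in> borel_measurable M"
      "(\<lambda>x. complex_of_real (\<sigma> * (\<bar>\<nu> x - 1\<bar> * (norm (w x))\<^sup>2))) \<in> borel_measurable M" by measurable
    show "AE x in M. w x * cnj (q x) = complex_of_real (\<sigma> * (\<bar>\<nu> x - 1\<bar> * (norm (w x))\<^sup>2))"
      using contrast
    proof eventually_elim
      case (elim x)
      have s: "\<sigma> * \<bar>\<nu> x - 1\<bar> = \<nu> x - 1"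
        using elim c sigma by (cases "\<sigma> = 1") (auto simp: abs_if split: if_splits)
      have sq: "w x * cnj (w x) = of_real ((norm (w x))\<^sup>2)" by (simp only: complex_norm_square)
      have "w x * cnj (q x) = of_real (\<nu> x - 1) * (w x * cnj (w x))" by (simp add: q_def mult_ac)
      also have "\<dots> = complex_of_real ((\<sigma> * \<bar>\<nu> x - 1\<bar>) * (norm (w x))\<^sup>2)" unfolding sq s by (simp only: of_real_mult)
      finally show ?case by (simp only: mult.assoc)
    qed
  qed
  also have "\<dots> = complex_of_real (\<sigma> * weighted)"
    unfolding weighted_def by (simp only: integral_complex_of_real integral_mult_right_zero)
  finally have "complex_of_real (k\<^sup>2 * (\<sigma> * weighted)) = complex_of_real (dirichlet_energy D u - k\<^sup>2 * l2_sq M u)"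
    using energy_identity by (simp only: of_real_mult)
  then have e: "k\<^sup>2 * (\<sigma> * weighted) = dirichlet_energy D u - k\<^sup>2 * l2_sq M u" by (simp only: of_real_eq_iff)
  have w0: "weighted \<ge> 0" unfolding weighted_def by simp
  have "k\<^sup>2 * weighted = \<bar>k\<^sup>2 * (\<sigma> * weighted)\<bar>" using sigma w0 by (simp add: abs_mult)
  also have "\<dots> \<le> dirichlet_energy D u + k\<^sup>2 * l2_sq M u"
    unfolding e using dirichlet_energy_nonneg by (simp add: abs_le_iff)
  also have "\<dots> \<le> 1 + k\<^sup>2 * 1"
    using le_1 by (intro add_mono mult_left_mono) auto
  finally show ?thesis by simp
qed

lemma w_bound: "c * k\<^sup>2 * l2_sq M w \<le> 1 + k\<^sup>2"
proof -
  have "c * l2_sq M w = (LINT x|M. c * (norm (w x))\<^sup>2)" by (simp add: l2_sq_def)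
  also have "\<dots> \<le> weighted" unfolding weighted_def
  proof (rule integral_mono_AE[OF _ weighted_integrable])
    show "integrable M (\<lambda>x. c * (norm (w x))\<^sup>2)" by (intro integrable_mult_right square_integrable_sq w)
    show "AE x in M. c * (norm (w x))\<^sup>2 \<le> \<bar>\<nu> x - 1\<bar> * (norm (w x))\<^sup>2"
      using contrast
    proof eventually_elim
      case (elim x)
      have "\<sigma> * (\<nu> x - 1) \<le> \<bar>\<sigma> * (\<nu> x - 1)\<bar>" by (rule abs_ge_self)
      then have "c \<le> \<bar>\<nu> x - 1\<bar>" using elim sigma by (simp add: abs_mult)
      then show ?case by (intro mult_right_mono) auto
    qed
  qed
  finally have "k\<^sup>2 * (c * l2_sq M w) \<le> k\<^sup>2 * weighted" by (intro mult_left_mono) auto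
  with weighted_le show ?thesis by (simp add: mult_ac)
qed

text \<open>The right-hand side tends to $0$ with $k$; this is what keeps the eigenvalues away from $0$.\<close>

lemma laplacian_bound: "l2_sq M (weak_laplacian D u) \<le> 2 * k\<^sup>2 * (C + 1) * (1 + k\<^sup>2) + 2 * k ^ 4"
proof -
  have qw: "l2_sq M q \<le> (C + 1) * weighted"
  proof -
    have "l2_sq M q \<le> (LINT x|M. (C + 1) * (\<bar>\<nu> x - 1\<bar> * (norm (w x))\<^sup>2))"
      unfolding l2_sq_def
    proof (rule integral_mono_AE)
      show "integrable M (\<lambda>x. (norm (q x))\<^sup>2)" by (rule square_integrable_sq[OF q])
      show "integrable M (\<lambda>x. (C + 1) * (\<bar>\<nu> x - 1\<bar> * (norm (w x))\<^sup>2))"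
        by (intro integrable_mult_right weighted_integrable)
      show "AE x in M. (norm (q x))\<^sup>2 \<le> (C + 1) * (\<bar>\<nu> x - 1\<bar> * (norm (w x))\<^sup>2)"
        using \<nu>b
      proof eventually_elim
        case (elim x)
        have "norm (q x) = \<bar>\<nu> x - 1\<bar> * norm (w x)" unfolding q_def norm_mult norm_of_real ..
        then have "(norm (q x))\<^sup>2 = \<bar>\<nu> x - 1\<bar> * (\<bar>\<nu> x - 1\<bar> * (norm (w x))\<^sup>2)" by (simp add: power2_eq_square)
        also have "\<dots> \<le> (C + 1) * (\<bar>\<nu> x - 1\<bar> * (norm (w x))\<^sup>2)"
          using elim by (intro mult_right_mono) auto
        finally show ?case .
      qed
    qed
    then show ?thesis by (simp add: weighted_def)
  qed
  have fl: "l2_sq M (weak_laplacian D u) = (k\<^sup>2)\<^sup>2 * l2_sq M (\<lambda>x. q x + u x)"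
  proof -
    have "l2_sq M (weak_laplacian D u) = l2_sq M (\<lambda>x. (- of_real (k\<^sup>2)) * (q x + u x))"
    proof (rule l2_sq_cong_AE[OF weak_laplacian_square_integrable[OF us]])
      show "square_integrable M (\<lambda>x. (- of_real (k\<^sup>2)) * (q x + u x))"
        by (intro square_integrable_cmult square_integrable_add q u)
      show "AE x in M. weak_laplacian D u x = (- of_real (k\<^sup>2)) * (q x + u x)"
        using laplacian_eq_q by eventually_elim simp
    qed
    also have "\<dots> = (k\<^sup>2)\<^sup>2 * l2_sq M (\<lambda>x. q x + u x)"
      by (subst l2_sq_cmult) (simp add: norm_power)
    finally show ?thesis .
  qed
  have "l2_sq M (\<lambda>x. q x + u x) \<le> 2 * l2_sq M q + 2 * l2_sq M u"
    using l2_sq_le_double[OF square_integrable_add[OF q u] u] by simp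
  also have "\<dots> \<le> 2 * ((C + 1) * weighted) + 2 * 1"
    using qw le_1 by (intro add_mono mult_left_mono) auto
  finally have "(k\<^sup>2)\<^sup>2 * l2_sq M (\<lambda>x. q x + u x) \<le> (k\<^sup>2)\<^sup>2 * (2 * ((C + 1) * weighted) + 2 * 1)"
    by (rule mult_left_mono) simp
  also have "\<dots> = 2 * k\<^sup>2 * ((C + 1) * (k\<^sup>2 * weighted)) + 2 * k ^ 4"
    by (simp add: algebra_simps power2_eq_square power4_eq_xxxx)
  also have "\<dots> \<le> 2 * k\<^sup>2 * ((C + 1) * (1 + k\<^sup>2)) + 2 * k ^ 4"
    using C weighted_le by (intro add_mono mult_left_mono) auto
  finally show ?thesis unfolding fl by (simp add: mult.assoc)
qed

lemma energy_le_laplacian: "dirichlet_energy D u \<le> sqrt (l2_sq M (weak_laplacian D u))"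
proof -
  have "dirichlet_energy D u = norm (LINT x|M. u x * cnj (weak_laplacian D u x))"
    using dirichlet_energy_nonneg by (simp add: dirichlet_energy_identity[OF D u0])
  also have "\<dots> \<le> sqrt (l2_sq M u) * sqrt (l2_sq M (\<lambda>x. cnj (weak_laplacian D u x)))"
    by (intro integral_mult_bound u square_integrable_cnj weak_laplacian_square_integrable us)
  also have "\<dots> \<le> 1 * sqrt (l2_sq M (weak_laplacian D u))"
    unfolding l2_sq_cnj using le_1 by (intro mult_right_mono) auto
  finally show ?thesis by simp
qed

text \<open>Later arguments replace $u$ by a test function at this distance, for which second derivatives
and translations are classical.\<close>

lemma test_function_close:
  assumes "\<delta> > 0"
  obtains \<phi> where "\<phi> \<in> test_functions D" "l2_sq M (\<lambda>x. \<phi> x - u x) < \<delta>"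
    "\<And>i. l2_sq M (\<lambda>x. partial_deriv i \<phi> x - weak_deriv D [i] u x) < \<delta>"
    "l2_sq M (\<lambda>x. laplacian \<phi> x - weak_laplacian D u x) < \<delta>"
proof -
  obtain \<phi> where \<phi>: "\<And>m::nat. \<phi> m \<in> test_functions D"
    and l0: "(\<lambda>m. l2_sq M (\<lambda>x. \<phi> m x - u x)) \<longlonglongrightarrow> 0"
    and l1: "\<And>i. (\<lambda>m. l2_sq M (\<lambda>x. partial_deriv i (\<phi> m) x - weak_deriv D [i] u x)) \<longlonglongrightarrow> 0"
    and l2: "(\<lambda>m. l2_sq M (\<lambda>x. laplacian (\<phi> m) x - weak_laplacian D u x)) \<longlonglongrightarrow> 0"
    using H20_approximation[OF D u0] by blast
  have "\<forall>\<^sub>F m in sequentially. l2_sq M (\<lambda>x. \<phi> m x - u x) < \<delta>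
      \<and> (\<forall>i\<in>UNIV. l2_sq M (\<lambda>x. partial_deriv i (\<phi> m) x - weak_deriv D [i] u x) < \<delta>)
      \<and> l2_sq M (\<lambda>x. laplacian (\<phi> m) x - weak_laplacian D u x) < \<delta>"
    by (intro eventually_conj eventually_ball_finite ballI order_tendstoD(2)[OF l0] order_tendstoD(2)[OF l1]
        order_tendstoD(2)[OF l2] assms) auto
  then obtain m where "l2_sq M (\<lambda>x. \<phi> m x - u x) < \<delta>"
      "\<forall>i. l2_sq M (\<lambda>x. partial_deriv i (\<phi> m) x - weak_deriv D [i] u x) < \<delta>"
      "l2_sq M (\<lambda>x. laplacian (\<phi> m) x - weak_laplacian D u x) < \<delta>"
    by (auto simp: eventually_sequentially)
  then show ?thesis using that \<phi> by blast
qed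

end
end

section \<open>Weak limits of eigenpairs\<close>

lemma eigen_setting_u: "eigen_setting.u w v = (\<lambda>x. w x - v x)" if "eigen_setting D \<nu> k C w v"
  using eigen_setting.u_def[OF that] by auto

text \<open>Strict inequalities for the essential bounds leave room for a uniform gap \<open>c\<close>.\<close>

lemma coefficient_bounds:
  fixes n :: "real^'n \<Rightarrow> real"
  assumes pos: "\<forall>x. 0 < n x" and sup: "cell_sup n < \<infinity>" and contrast: "1 < cell_inf n \<or> cell_sup n < 1"
  obtains C \<sigma> c where "C > 0" "\<bar>\<sigma>\<bar> = 1" "c > 0"
    "AE y in lebesgue_on unit_cell. \<bar>n y\<bar> \<le> C" "AE y in lebesgue_on unit_cell. \<sigma> * (n y - 1) \<ge> c"
proof -
  let ?M = "lebesgue_on (unit_cell :: (real^'n) set)"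
  have ae: "AE y in ?M. ereal (n y) \<le> cell_sup n" unfolding cell_sup_def by (rule esssup_AE)
  obtain C0 where C0: "cell_sup n \<le> ereal C0" using sup by (cases "cell_sup n") auto
  have C: "AE y in ?M. \<bar>n y\<bar> \<le> max C0 1"
    using ae
  proof eventually_elim
    case (elim y)
    then have "ereal (n y) \<le> ereal C0" using C0 by (rule order_trans)
    then show ?case using pos[rule_format, of y] by simp
  qed
  from contrast show ?thesis
  proof
    assume "1 < cell_inf n"
    then obtain c' where c': "1 < ereal c'" "ereal c' < cell_inf n" using ereal_dense2 by blast
    have "AE y in ?M. - ereal (n y) \<le> - cell_inf n"
      unfolding cell_inf_def ereal_uminus_uminus by (rule esssup_AE)
    then have "AE y in ?M. 1 * (n y - 1) \<ge> c' - 1"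
    proof eventually_elim
      case (elim y)
      then have "cell_inf n \<le> ereal (n y)" by (simp only: ereal_minus_le_minus)
      with c'(2) have "ereal c' \<le> ereal (n y)" by (meson less_le_trans less_imp_le)
      then show ?case by simp
    qed
    moreover have "c' - 1 > 0" using c'(1) by (simp add: one_ereal_def)
    ultimately show ?thesis using that[of "max C0 1" 1 "c' - 1"] C by simp
  next
    assume "cell_sup n < 1"
    then obtain c' where c': "cell_sup n < ereal c'" "ereal c' < 1" using ereal_dense2 by blast
    have "AE y in ?M. (-1) * (n y - 1) \<ge> 1 - c'"
      using ae
    proof eventually_elim
      case (elim y)
      with c'(1) have "ereal (n y) \<le> ereal c'" by (meson le_less_trans less_imp_le)
      then show ?case by simp
    qed
    moreover have "1 - c' > 0" using c'(2) by (simp add: one_ereal_def)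
    ultimately show ?thesis using that[of "max C0 1" "-1" "1 - c'"] C by simp
  qed
qed

text \<open>The lists of length at most $2$, which index the derivatives in $H^2$, are coded by a finite type so that all
derivatives form one vector-valued function. The code is redundant: a single direction has two
codes.\<close>

definition multi_index :: "'n option \<times> 'n option \<Rightarrow> 'n list" where
  "multi_index p = (case fst p of None \<Rightarrow> [] | Some i \<Rightarrow> [i]) @ (case snd p of None \<Rightarrow> [] | Some i \<Rightarrow> [i])"

definition multi_index_code :: "'n list \<Rightarrow> 'n option \<times> 'n option" where
  "multi_index_code is = (case is of [] \<Rightarrow> (None, None) | i # js \<Rightarrow> (Some i, (case js of [] \<Rightarrow> None | j # _ \<Rightarrow> Some j)))"

lemma multi_index_code: "length is \<le> 2 \<Longrightarrow> multi_index (multi_index_code is) = is"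
  by (auto simp: multi_index_def multi_index_code_def numeral_2_eq_2 split: list.splits)

lemma multi_index_cases:
  "multi_index p = [] \<or> (\<exists>i. multi_index p = [i]) \<or> (\<exists>i j. multi_index p = [i, j])"
  by (auto simp: multi_index_def split: option.splits)

lemma l2_sq_mono:
  fixes f :: "'a \<Rightarrow> 'b::euclidean_space" and g :: "'a \<Rightarrow> 'c::euclidean_space"
  assumes "f \<in> borel_measurable M" "square_integrable M g" "\<And>x. norm (f x) \<le> norm (g x)"
  shows "l2_sq M f \<le> l2_sq M g"
  unfolding l2_sq_def
proof (rule integral_mono)
  have "square_integrable M f" by (rule square_integrable_bound[OF assms(1,2)]) (simp add: assms(3))
  then show "integrable M (\<lambda>x. (norm (f x))\<^sup>2)" by (rule square_integrable_sq)
  show "integrable M (\<lambda>x. (norm (g x))\<^sup>2)" by (rule square_integrable_sq[OF assms(2)])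
  show "(norm (f x))\<^sup>2 \<le> (norm (g x))\<^sup>2" for x by (intro power_mono assms) auto
qed

text \<open>Weak convergence is obtained for the real inner product; it implies the complex statement.\<close>

lemma integral_mult_eq_ip:
  fixes f g :: "'a \<Rightarrow> complex"
  assumes "square_integrable M f" "square_integrable M g"
  shows "(\<integral>x. f x * g x \<partial>M) = of_real (l2_ip M f (\<lambda>x. cnj (g x))) + \<i> * of_real (l2_ip M f (\<lambda>x. \<i> * cnj (g x)))"
proof -
  have "f x * g x = of_real (f x \<bullet> cnj (g x)) + \<i> * of_real (f x \<bullet> (\<i> * cnj (g x)))" for x
    by (simp add: complex_eq_iff inner_complex_def)
  then have "(\<integral>x. f x * g x \<partial>M) = (\<integral>x. of_real (f x \<bullet> cnj (g x)) + \<i> * of_real (f x \<bullet> (\<i> * cnj (g x))) \<partial>M)"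
    by simp
  also have "\<dots> = of_real (l2_ip M f (\<lambda>x. cnj (g x))) + \<i> * of_real (l2_ip M f (\<lambda>x. \<i> * cnj (g x)))"
    unfolding l2_ip_def using assms
    by (subst Bochner_Integration.integral_add)
      (auto intro!: integrable_mult_right integrable_of_real square_integrable_inner square_integrable_cmult square_integrable_cnj)
  finally show ?thesis .
qed

lemma weak_limit_integral:
  fixes f :: "nat \<Rightarrow> 'a \<Rightarrow> complex"
  assumes weak: "\<And>g. square_integrable M g \<Longrightarrow> (\<lambda>j. l2_ip M (f j) g) \<longlonglongrightarrow> l2_ip M f0 g"
    and f: "\<And>j. square_integrable M (f j)" "square_integrable M f0" and g: "square_integrable M g"
  shows "(\<lambda>j. \<integral>x. f j x * g x \<partial>M) \<longlonglongrightarrow> (\<integral>x. f0 x * g x \<partial>M)"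
  unfolding integral_mult_eq_ip[OF f(1) g] integral_mult_eq_ip[OF f(2) g]
  by (intro tendsto_intros weak square_integrable_cmult square_integrable_cnj g)

lemma borel_measurable_axis [measurable]: "(axis p :: complex \<Rightarrow> complex^'m) \<in> borel_measurable borel"
proof (rule borel_measurable_continuous_onI)
  have "axis p = (\<lambda>z::complex. \<chi> q. if q = p then z else 0)" by (auto simp: axis_def fun_eq_iff vec_eq_iff)
  moreover have "continuous_on UNIV (\<lambda>z::complex. (\<chi> q. if q = p then z else 0) :: complex^'m)"
  proof (rule continuous_on_vec_lambda)
    show "continuous_on UNIV (\<lambda>z::complex. if q = p then z else 0)" for q :: 'm
      by (cases "q = p") auto
  qed
  ultimately show "continuous_on UNIV (axis p :: complex \<Rightarrow> complex^'m)" by simp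
qed

lemma norm_axis_complex: "norm (axis p z :: complex^'m) = norm (z :: complex)"
  by (simp add: norm_eq_sqrt_inner inner_axis_axis)

lemma borel_measurable_vec_lambda:
  fixes f :: "'m::finite \<Rightarrow> 'a \<Rightarrow> complex"
  assumes "\<And>p. f p \<in> borel_measurable M"
  shows "(\<lambda>x. \<chi> p. f p x) \<in> borel_measurable M"
  by (subst borel_measurable_euclidean_space) (use assms in \<open>auto simp: Basis_vec_def inner_axis\<close>)

text \<open>Weak compactness is applied to one vector-valued sequence consisting of \<open>w\<close>, \<open>v\<close> and all
derivatives of \<open>\<phi>\<close>. Its components share the subsequence and the convex combinations; the convex
combinations of \<open>\<phi>\<close> converge in $H^2$, and their limit is $w_0 - v_0$ because \<open>\<phi>\<close> approximates
$w - v$.\<close>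

theorem H20_weak_compactness:
  fixes D :: "(real^'n) set" and w v \<phi> :: "nat \<Rightarrow> real^'n \<Rightarrow> complex"
  assumes D: "open D" "bounded D"
    and w: "\<And>j. square_integrable (lebesgue_on D) (w j)" "\<And>j. l2_sq (lebesgue_on D) (w j) \<le> B"
    and v: "\<And>j. square_integrable (lebesgue_on D) (v j)" "\<And>j. l2_sq (lebesgue_on D) (v j) \<le> B"
    and \<phi>: "\<And>j. \<phi> j \<in> test_functions D" "\<And>j p. l2_sq (lebesgue_on D) (iter_partial (multi_index p) (\<phi> j)) \<le> B"
    and close: "(\<lambda>j. l2_sq (lebesgue_on D) (\<lambda>x. \<phi> j x - (w j x - v j x))) \<longlonglongrightarrow> 0"
  obtains r w0 v0 where "strict_mono (r::nat\<Rightarrow>nat)" "square_integrable (lebesgue_on D) w0" "square_integrable (lebesgue_on D) v0"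
    "\<And>g. square_integrable (lebesgue_on D) g \<Longrightarrow> (\<lambda>j. LINT x|lebesgue_on D. w (r j) x * g x) \<longlonglongrightarrow> (LINT x|lebesgue_on D. w0 x * g x)"
    "\<And>g. square_integrable (lebesgue_on D) g \<Longrightarrow> (\<lambda>j. LINT x|lebesgue_on D. v (r j) x * g x) \<longlonglongrightarrow> (LINT x|lebesgue_on D. v0 x * g x)"
    "\<And>g. square_integrable (lebesgue_on D) g \<Longrightarrow> (\<lambda>j. LINT x|lebesgue_on D. \<phi> (r j) x * g x) \<longlonglongrightarrow> (LINT x|lebesgue_on D. (w0 x - v0 x) * g x)"
    "(\<lambda>x. w0 x - v0 x) \<in> sobolev0 2 D"
proof -
  let ?M = "lebesgue_on D"
  define I where "I p j = iter_partial (multi_index p) (\<phi> j)" for p j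
  define X :: "nat \<Rightarrow> real^'n \<Rightarrow> complex \<times> complex \<times> (complex^('n option \<times> 'n option))"
    where "X j x = (w j x, v j x, \<chi> p. I p j x)" for j x
  have Isi: "square_integrable ?M (I p j)" for p j
    unfolding I_def by (rule test_function_square_integrable[OF D(1) test_functions_iter_partial[OF \<phi>(1)]])
  have Ib: "l2_sq ?M (I p j) \<le> B" for p j unfolding I_def by (rule \<phi>(2))
  have nX: "(norm (X j x))\<^sup>2 = (norm (w j x))\<^sup>2 + ((norm (v j x))\<^sup>2 + (\<Sum>p\<in>UNIV. (norm (I p j x))\<^sup>2))" for j x
    by (simp add: X_def norm_Pair norm_vec_def L2_set_def sum_nonneg)
  have iX: "integrable ?M (\<lambda>x. (norm (w j x))\<^sup>2 + ((norm (v j x))\<^sup>2 + (\<Sum>p\<in>UNIV. (norm (I p j x))\<^sup>2)))" for j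
    by (intro Bochner_Integration.integrable_add Bochner_Integration.integrable_sum square_integrable_sq w v Isi)
  have Xsi: "square_integrable ?M (X j)" for j
    unfolding square_integrable_def nX
  proof
    show "X j \<in> borel_measurable ?M" unfolding X_def[abs_def]
      by (intro borel_measurable_Pair borel_measurable_vec_lambda square_integrable_measurable w v Isi)
  qed (rule iX)
  have Xb: "l2_sq ?M (X j) \<le> B + (B + (\<Sum>p\<in>(UNIV::('n option \<times> 'n option) set). B))" for j
  proof -
    have "l2_sq ?M (X j) = l2_sq ?M (w j) + (l2_sq ?M (v j) + (\<Sum>p\<in>UNIV. l2_sq ?M (I p j)))"
      unfolding l2_sq_def nX
      by (simp add: square_integrable_sq w v Isi Bochner_Integration.integral_sum Bochner_Integration.integral_add
          Bochner_Integration.integrable_add Bochner_Integration.integrable_sum)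
    also have "\<dots> \<le> B + (B + (\<Sum>p\<in>(UNIV::('n option \<times> 'n option) set). B))"
      by (intro add_mono sum_mono w v Ib)
    finally show ?thesis .
  qed
  obtain r Y c N where r: "strict_mono (r::nat\<Rightarrow>nat)" and Y: "square_integrable ?M Y"
    and weak: "\<And>g. square_integrable ?M g \<Longrightarrow> (\<lambda>j. l2_ip ?M (X (r j)) g) \<longlonglongrightarrow> l2_ip ?M Y g"
    and c1: "\<And>m::nat. (\<Sum>j<N m. c m j) = (1::real)"
    and strong: "(\<lambda>m. l2_sq ?M (\<lambda>t. (\<Sum>j<N m. c m j *\<^sub>R X (r j) t) - Y t)) \<longlonglongrightarrow> 0"
    using l2_weak_compactness[of ?M X, OF Xsi Xb] by blast
  define w0 where "w0 x = fst (Y x)" for x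
  define v0 where "v0 x = fst (snd (Y x))" for x
  define G where "G p x = snd (snd (Y x)) $ p" for p x
  have Ym [measurable]: "Y \<in> borel_measurable ?M" by (rule square_integrable_measurable[OF Y])
  have comp_m: "(\<lambda>x. fst (f x)) \<in> borel_measurable ?M" "(\<lambda>x. fst (snd (f x))) \<in> borel_measurable ?M"
    "(\<lambda>x. snd (snd (f x)) $ p) \<in> borel_measurable ?M"
    if "f \<in> borel_measurable ?M" for f :: "real^'n \<Rightarrow> complex \<times> complex \<times> (complex^('n option \<times> 'n option))" and p
    by (rule measurable_compose[OF that], intro borel_measurable_continuous_onI continuous_intros)+
  have comp_n: "norm (fst z) \<le> norm z" "norm (fst (snd z)) \<le> norm z" "norm (snd (snd z) $ p) \<le> norm z"
    for z :: "complex \<times> complex \<times> (complex^('n option \<times> 'n option))" and p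
  proof -
    have 1: "norm (fst z) \<le> norm z" "norm (snd z) \<le> norm z"
      using norm_fst_le[of "fst z" "snd z"] norm_snd_le[of "snd z" "fst z"] by simp_all
    have 2: "norm (fst (snd z)) \<le> norm (snd z)" "norm (snd (snd z)) \<le> norm (snd z)"
      using norm_fst_le[of "fst (snd z)" "snd (snd z)"] norm_snd_le[of "snd (snd z)" "fst (snd z)"] by simp_all
    show "norm (fst z) \<le> norm z" by (rule 1)
    show "norm (fst (snd z)) \<le> norm z" by (rule order_trans[OF 2(1) 1(2)])
    show "norm (snd (snd z) $ p) \<le> norm z"
      by (rule order_trans[OF Finite_Cartesian_Product.norm_nth_le order_trans[OF 2(2) 1(2)]])
  qed
  have w0: "square_integrable ?M w0" unfolding w0_def[abs_def]
    by (rule square_integrable_bound[OF comp_m(1)[OF Ym] Y]) (simp add: comp_n)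
  have v0: "square_integrable ?M v0" unfolding v0_def[abs_def]
    by (rule square_integrable_bound[OF comp_m(2)[OF Ym] Y]) (simp add: comp_n)
  have Gsi: "square_integrable ?M (G p)" for p unfolding G_def[abs_def]
    by (rule square_integrable_bound[OF comp_m(3)[OF Ym] Y]) (simp add: comp_n)
  have weak_w: "(\<lambda>j. l2_ip ?M (w (r j)) g) \<longlonglongrightarrow> l2_ip ?M w0 g" if g: "square_integrable ?M g" for g
  proof -
    let ?g = "\<lambda>x. (g x, 0 :: complex, 0 :: complex^('n option \<times> 'n option))"
    have gm: "?g \<in> borel_measurable ?M"
      using square_integrable_measurable[OF g] by (intro borel_measurable_Pair) auto
    have "square_integrable ?M ?g" by (rule square_integrable_bound[OF gm g]) (simp add: norm_Pair)
    from weak[OF this] show ?thesis by (simp add: l2_ip_def X_def w0_def inner_prod_def)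
  qed
  have weak_v: "(\<lambda>j. l2_ip ?M (v (r j)) g) \<longlonglongrightarrow> l2_ip ?M v0 g" if g: "square_integrable ?M g" for g
  proof -
    let ?g = "\<lambda>x. (0 :: complex, g x, 0 :: complex^('n option \<times> 'n option))"
    have gm: "?g \<in> borel_measurable ?M"
      using square_integrable_measurable[OF g] by (intro borel_measurable_Pair) auto
    have "square_integrable ?M ?g" by (rule square_integrable_bound[OF gm g]) (simp add: norm_Pair)
    from weak[OF this] show ?thesis by (simp add: l2_ip_def X_def v0_def inner_prod_def)
  qed
  have weak_I: "(\<lambda>j. l2_ip ?M (I p (r j)) g) \<longlonglongrightarrow> l2_ip ?M (G p) g" if g: "square_integrable ?M g" for g p
  proof -
    let ?g = "\<lambda>x. (0 :: complex, 0 :: complex, axis p (g x) :: complex^('n option \<times> 'n option))"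
    have gm: "?g \<in> borel_measurable ?M"
      using measurable_compose[OF square_integrable_measurable[OF g] borel_measurable_axis[of p]]
      by (intro borel_measurable_Pair) auto
    have "square_integrable ?M ?g"
      by (rule square_integrable_bound[OF gm g]) (simp add: norm_Pair norm_axis_complex)
    from weak[OF this] show ?thesis by (simp add: l2_ip_def X_def G_def inner_prod_def inner_axis)
  qed
  have wi: "(\<lambda>j. LINT x|?M. w (r j) x * g x) \<longlonglongrightarrow> (LINT x|?M. w0 x * g x)" if "square_integrable ?M g" for g
    by (rule weak_limit_integral[OF weak_w w(1) w0 that])
  have vi: "(\<lambda>j. LINT x|?M. v (r j) x * g x) \<longlonglongrightarrow> (LINT x|?M. v0 x * g x)" if "square_integrable ?M g" for g
    by (rule weak_limit_integral[OF weak_v v(1) v0 that])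
  have Ii: "(\<lambda>j. LINT x|?M. I p (r j) x * g x) \<longlonglongrightarrow> (LINT x|?M. G p x * g x)" if "square_integrable ?M g" for g p
    by (rule weak_limit_integral[OF weak_I Isi Gsi that])
  have \<phi>si: "square_integrable ?M (\<phi> j)" for j by (rule test_function_square_integrable[OF D(1) \<phi>(1)])
  have \<phi>i: "(\<lambda>j. LINT x|?M. \<phi> (r j) x * g x) \<longlonglongrightarrow> (LINT x|?M. (w0 x - v0 x) * g x)" if g: "square_integrable ?M g" for g
  proof -
    let ?d = "\<lambda>j x. \<phi> j x - (w j x - v j x)"
    have d: "square_integrable ?M (?d j)" for j by (intro square_integrable_diff \<phi>si w v)
    have d0: "(\<lambda>j. LINT x|?M. ?d j x * g x) \<longlonglongrightarrow> 0"
    proof (rule Lim_null_comparison)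
      show "\<forall>\<^sub>F j in sequentially. norm (LINT x|?M. ?d j x * g x) \<le> sqrt (l2_sq ?M (?d j)) * sqrt (l2_sq ?M g)"
        by (intro always_eventually allI integral_mult_bound d g)
      have "(\<lambda>j. sqrt (l2_sq ?M (?d j)) * sqrt (l2_sq ?M g)) \<longlonglongrightarrow> sqrt 0 * sqrt (l2_sq ?M g)"
        by (intro tendsto_intros close)
      then show "(\<lambda>j. sqrt (l2_sq ?M (?d j)) * sqrt (l2_sq ?M g)) \<longlonglongrightarrow> 0" by simp
    qed
    have "(\<lambda>j. (LINT x|?M. ?d (r j) x * g x) + ((LINT x|?M. w (r j) x * g x) - (LINT x|?M. v (r j) x * g x)))
        \<longlonglongrightarrow> 0 + ((LINT x|?M. w0 x * g x) - (LINT x|?M. v0 x * g x))"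
      by (intro tendsto_intros LIMSEQ_subseq_LIMSEQ[OF d0 r, unfolded o_def] wi vi g)
    moreover have "(LINT x|?M. ?d j x * g x) + ((LINT x|?M. w j x * g x) - (LINT x|?M. v j x * g x)) = (LINT x|?M. \<phi> j x * g x)" for j
      using \<phi>si w v g by (simp add: left_diff_distrib square_integrable_mult)
    moreover have "(LINT x|?M. w0 x * g x) - (LINT x|?M. v0 x * g x) = (LINT x|?M. (w0 x - v0 x) * g x)"
      using w0 v0 g by (simp add: left_diff_distrib square_integrable_mult)
    ultimately show ?thesis by simp
  qed
  define \<Phi> where "\<Phi> m x = (\<Sum>j<N m. of_real (c m j) * \<phi> (r j) x)" for m x
  have \<Phi>: "\<Phi> m \<in> test_functions D" for m
    unfolding \<Phi>_def[abs_def] by (intro test_functions_sum test_functions_scale \<phi>)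
  have G_strong: "(\<lambda>m. l2_sq ?M (\<lambda>x. G p x - iter_partial (multi_index p) (\<Phi> m) x)) \<longlonglongrightarrow> 0" for p
  proof (rule tendsto_sandwich[OF _ _ tendsto_const strong])
    show "\<forall>\<^sub>F m in sequentially. l2_sq ?M (\<lambda>x. G p x - iter_partial (multi_index p) (\<Phi> m) x)
        \<le> l2_sq ?M (\<lambda>t. (\<Sum>j<N m. c m j *\<^sub>R X (r j) t) - Y t)"
    proof (rule always_eventually, rule allI)
      fix m
      let ?S = "\<lambda>t. (\<Sum>j<N m. c m j *\<^sub>R X (r j) t) - Y t"
      have S: "square_integrable ?M ?S"
        by (intro square_integrable_diff square_integrable_sum square_integrable_scaleR Xsi Y)
      have e: "iter_partial (multi_index p) (\<Phi> m) = (\<lambda>x. \<Sum>j<N m. of_real (c m j) * I p (r j) x)"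
        unfolding \<Phi>_def[abs_def] I_def
        by (rule iter_partial_combination) (rule test_functions_smooth[OF \<phi>(1)])
      have "norm (G p x - iter_partial (multi_index p) (\<Phi> m) x) \<le> norm (?S x)" for x
      proof -
        have "snd (snd (?S x)) $ p = - (G p x - iter_partial (multi_index p) (\<Phi> m) x)"
          unfolding e by (simp add: snd_sum X_def G_def scaleR_conv_of_real[where 'a=complex])
        then show ?thesis using comp_n(3)[of "?S x" p] by (simp only: norm_minus_cancel)
      qed
      moreover have "(\<lambda>x. G p x - iter_partial (multi_index p) (\<Phi> m) x) \<in> borel_measurable ?M"
        by (intro square_integrable_measurable square_integrable_diff Gsi
            test_function_square_integrable[OF D(1) test_functions_iter_partial[OF \<Phi>]])
      ultimately show "l2_sq ?M (\<lambda>x. G p x - iter_partial (multi_index p) (\<Phi> m) x) \<le> l2_sq ?M ?S"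
        by (intro l2_sq_mono S)
    qed
  qed simp
  have sob: "(\<lambda>x. w0 x - v0 x) \<in> sobolev0 2 D"
  proof (rule sobolev0I[OF D _ _ \<Phi>, where G="\<lambda>is. G (multi_index_code (rev is))"])
    show "(\<lambda>x. w0 x - v0 x) \<in> L2 D" by (simp add: L2_iff square_integrable_diff w0 v0)
    fix "is" :: "'n list" assume l: "length is \<le> 2"
    then have code: "multi_index (multi_index_code (rev is)) = rev is" by (simp add: multi_index_code)
    show "(\<lambda>j. l2_sq ?M (\<lambda>x. G (multi_index_code (rev is)) x - iter_partial (rev is) (\<Phi> j) x)) \<longlonglongrightarrow> 0"
      using G_strong[of "multi_index_code (rev is)"] by (simp add: code)
    show "G (multi_index_code (rev is)) \<in> L2 D \<and> has_weak_deriv D is (\<lambda>x. w0 x - v0 x) (G (multi_index_code (rev is)))"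
    proof
      show "G (multi_index_code (rev is)) \<in> L2 D" by (simp add: L2_iff Gsi)
      show "has_weak_deriv D is (\<lambda>x. w0 x - v0 x) (G (multi_index_code (rev is)))"
        unfolding has_weak_deriv_def
      proof
        fix \<psi> assume \<psi>: "\<psi> \<in> test_functions D"
        note t = test_function_square_integrable[OF D(1) \<psi>] test_function_square_integrable[OF D(1) test_functions_iter_partial[OF \<psi>, of "is"]]
        have l1: "(\<lambda>j. LINT x|?M. \<phi> (r j) x * iter_partial is \<psi> x) \<longlonglongrightarrow> (LINT x|?M. (w0 x - v0 x) * iter_partial is \<psi> x)"
          by (rule \<phi>i[OF t(2)])
        have l2: "(\<lambda>j. (-1) ^ length is * (LINT x|?M. I (multi_index_code (rev is)) (r j) x * \<psi> x))
            \<longlonglongrightarrow> (-1) ^ length is * (LINT x|?M. G (multi_index_code (rev is)) x * \<psi> x)"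
          by (intro tendsto_intros Ii t)
        have l3: "(LINT x|?M. \<phi> (r j) x * iter_partial is \<psi> x) = (-1) ^ length is * (LINT x|?M. I (multi_index_code (rev is)) (r j) x * \<psi> x)" for j
          using has_weak_deriv_test_function[OF D(1) \<phi>(1), of "is"] \<psi> unfolding has_weak_deriv_def I_def code by blast
        show "(LINT x|?M. (w0 x - v0 x) * iter_partial is \<psi> x)
            = (-1) ^ length is * (LINT x|?M. G (multi_index_code (rev is)) x * \<psi> x)"
          by (rule LIMSEQ_unique[OF l1[unfolded l3] l2])
      qed
    qed
  qed
  show ?thesis by (rule that[OF r w0 v0 wi vi \<phi>i sob])
qed

theorem theorem3p2:
  fixes D :: "(real^'n) set"
    and n :: "real^'n \<Rightarrow> real"
    and \<epsilon> k :: "nat \<Rightarrow> real"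
    and w v :: "nat \<Rightarrow> real^'n \<Rightarrow> complex"
  assumes dim: "CARD('n) = 2 \<or> CARD('n) = 3"
    and D: "open D" "bounded D" "simply_connected D" "piecewise_smooth_boundary D"
    and n: "n \<in> borel_measurable lebesgue" "\<forall>x. 0 < n x" "cell_periodic n"
    and n_bounds: "0 < cell_inf n" "cell_sup n < \<infinity>"
    and contrast: "1 < cell_inf n \<or> cell_sup n < 1"
    and eps: "\<forall>j. 0 < \<epsilon> j" "\<epsilon> \<longlonglongrightarrow> 0"
    and eigen: "\<forall>j. transmission_eigenpair D (\<lambda>x. n (x /\<^sub>R \<epsilon> j)) (k j) (w j, v j)"
    and normalized: "\<forall>j. sobolev_norm 1 D (\<lambda>x. w j x - v j x) = 1"
    and k_bounded: "bounded (range k)"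
  shows "\<exists>r w0 v0 k0. strict_mono (r :: nat \<Rightarrow> nat) \<and>
           weakly_converges D (\<lambda>j. (w (r j), v (r j))) (w0, v0) \<and>
           (\<lambda>j. k (r j)) \<longlonglongrightarrow> k0 \<and>
           transmission_eigenpair D (\<lambda>x. cell_mean n) k0 (w0, v0)"
proof -
  let ?M = "lebesgue_on D"
  have Dm: "D \<in> sets lebesgue" using D(1) by auto
  note DD = D(1) D(2)
  obtain R where R: "D \<subseteq> cball 0 R" "R > 0" using D(2) by (auto simp: bounded_pos subset_iff)
  obtain C \<sigma> c where C: "C > 0" and sigma: "\<bar>\<sigma>\<bar> = 1" and c: "c > 0"
    and nC: "AE y in lebesgue_on unit_cell. \<bar>n y\<bar> \<le> C" and nc: "AE y in lebesgue_on unit_cell. \<sigma> * (n y - 1) \<ge> c"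
    using coefficient_bounds[OF n(2) n_bounds(2) contrast] by blast
  have per: "unit_periodic n" using n(3) by (simp add: unit_periodic_def cell_periodic_def)
  have scaled_AE: "AE x in ?M. Q (n (x /\<^sub>R \<epsilon> j))" if "AE y in lebesgue_on unit_cell. Q (n y)" for Q j
  proof -
    have "AE x in lebesgue. Q (n x)"
      using per by (intro periodic_AE[OF _ that]) (simp add: unit_periodic_def)
    then have "AE x in lebesgue. Q (n (x /\<^sub>R \<epsilon> j))"
      using eps(1)[rule_format, of j] by (intro AE_lebesgue_scale) auto
    then show ?thesis using Dm by (subst AE_lebesgue_on_iff) auto
  qed
  define u where "u j x = w j x - v j x" for j x
  have E: "eigen_setting D (\<lambda>x. n (x /\<^sub>R \<epsilon> j)) (k j) C (w j) (v j)" for j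
    by unfold_locales
      (use DD eigen C scaled_AE[OF nC] in \<open>auto intro!: measurable_restrict_space1 scaled_measurable n\<close>)
  have U: "eigen_setting.u (w j) (v j) = u j" for j
    using eigen_setting_u[OF E] by (auto simp: u_def)
  have con: "AE x in ?M. \<sigma> * (n (x /\<^sub>R \<epsilon> j) - 1) \<ge> c" for j by (rule scaled_AE[OF nc])
  have nrm: "sobolev_norm 1 D (eigen_setting.u (w j) (v j)) = 1" for j
    using normalized unfolding U by (simp add: u_def[abs_def])
  note w_bound = eigen_setting.w_bound[OF E sigma c con nrm, unfolded U]
    and laplacian_bound = eigen_setting.laplacian_bound[OF E sigma c con nrm, unfolded U]
    and energy_le = eigen_setting.energy_le_laplacian[OF E sigma c con nrm, unfolded U]
    and norm_split = eigen_setting.norm_split[OF E sigma c con nrm, unfolded U]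
    and le_1 = eigen_setting.le_1[OF E sigma c con nrm, unfolded U]
    and u_H20 = eigen_setting.u0[OF E, unfolded U]
    and u_si = eigen_setting.u[OF E, unfolded U]
    and w_si = eigen_setting.w[OF E] and v_si = eigen_setting.v[OF E]
    and k_pos = eigen_setting.k[OF E]
  have G_si: "square_integrable ?M (weak_deriv D [i] (u j))" for i j
    using weak_deriv_works(1)[of "u j" 2 D "[i]"] u_H20[of j] by (simp add: sobolev0_def L2_iff)
  have L_si: "square_integrable ?M (weak_laplacian D (u j))" for j
    using u_H20[of j] by (intro weak_laplacian_square_integrable) (simp add: sobolev0_def)
  obtain K where K: "\<And>j. \<bar>k j\<bar> \<le> K" using k_bounded by (auto simp: bounded_iff)
  have K2: "(k j)\<^sup>2 \<le> K\<^sup>2" "(k j) ^ 4 \<le> K ^ 4" for j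
    using K[of j] power_mono[of "\<bar>k j\<bar>" K 2] power_mono[of "\<bar>k j\<bar>" K 4] by auto
  obtain k0 r1 where r1: "strict_mono (r1 :: nat \<Rightarrow> nat)" and k0: "(\<lambda>j. k (r1 j)) \<longlonglongrightarrow> k0"
    using bounded_imp_convergent_subsequence[OF k_bounded] by (auto simp: o_def)
  have k0_nonneg: "k0 \<ge> 0"
    by (rule LIMSEQ_le_const[OF k0]) (use k_pos in \<open>auto intro: less_imp_le\<close>)
  \<comment> \<open>As $k \to 0$ the bound for $\Delta u$ tends to $0$, and with it the energy and, by the
    Poincare inequality, the whole $H^1$ norm.\<close>
  have "k0 \<noteq> 0"
  proof
    assume "k0 = 0"
    let ?b = "\<lambda>j. 2 * (k (r1 j))\<^sup>2 * (C + 1) * (1 + (k (r1 j))\<^sup>2) + 2 * (k (r1 j)) ^ 4"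
    have "?b \<longlonglongrightarrow> 2 * k0\<^sup>2 * (C + 1) * (1 + k0\<^sup>2) + 2 * k0 ^ 4"
      by (intro tendsto_intros k0)
    then have b0: "?b \<longlonglongrightarrow> 0" using \<open>k0 = 0\<close> by simp
    have "(\<lambda>j. 9 * R\<^sup>2 * sqrt (?b j) + sqrt (?b j)) \<longlonglongrightarrow> 9 * R\<^sup>2 * sqrt 0 + sqrt 0"
      by (intro tendsto_intros b0)
    then have lim: "(\<lambda>j. 9 * R\<^sup>2 * sqrt (?b j) + sqrt (?b j)) \<longlonglongrightarrow> 0" by simp
    have "1 \<le> 9 * R\<^sup>2 * sqrt (?b j) + sqrt (?b j)" for j
    proof -
      have e: "dirichlet_energy D (u (r1 j)) \<le> sqrt (?b j)"
        by (rule order_trans[OF energy_le real_sqrt_le_mono[OF laplacian_bound]])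
      have "l2_sq ?M (u (r1 j)) \<le> 9 * R\<^sup>2 * dirichlet_energy D (u (r1 j))"
        by (rule poincare_inequality_H20[OF D(1) R u_H20])
      also have "\<dots> \<le> 9 * R\<^sup>2 * sqrt (?b j)" by (rule mult_left_mono[OF e]) simp
      finally show ?thesis using e norm_split[of "r1 j"] by linarith
    qed
    then have "(1::real) \<le> 0" by (intro LIMSEQ_le_const[OF lim]) blast
    then show False by simp
  qed
  with k0_nonneg have k0_pos: "k0 > 0" by simp
  then have "k0 / 2 < k0" by simp
  from order_tendstoD(1)[OF k0 this] obtain N where N: "\<And>j. j \<ge> N \<Longrightarrow> k0 / 2 < k (r1 j)"
    by (auto simp: eventually_sequentially)
  \<comment> \<open>A tail of the subsequence, on which the eigenvalues are bounded below.\<close>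
  define r2 where "r2 j = r1 (j + N)" for j
  have r2: "strict_mono r2" using r1 by (auto simp: r2_def strict_mono_def)
  have k_r2: "(\<lambda>j. k (r2 j)) \<longlonglongrightarrow> k0" unfolding r2_def by (rule LIMSEQ_ignore_initial_segment[OF k0])
  define B1 where "B1 = (1 + K\<^sup>2) / (c * (k0/2)\<^sup>2)"
  have wB: "l2_sq ?M (w (r2 j)) \<le> B1" for j
  proof -
    have "(k0/2)\<^sup>2 \<le> (k (r2 j))\<^sup>2" using N[of "j + N"] k0_pos by (intro power_mono) (auto simp: r2_def)
    then have "c * (k0/2)\<^sup>2 * l2_sq ?M (w (r2 j)) \<le> c * (k (r2 j))\<^sup>2 * l2_sq ?M (w (r2 j))"
      using c by (intro mult_right_mono mult_left_mono) auto
    also have "\<dots> \<le> 1 + (k (r2 j))\<^sup>2" by (rule w_bound)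
    also have "\<dots> \<le> 1 + K\<^sup>2" using K2 by simp
    finally have "l2_sq ?M (w (r2 j)) * (c * (k0/2)\<^sup>2) \<le> 1 + K\<^sup>2" by (simp only: mult.commute)
    moreover have "c * (k0/2)\<^sup>2 > 0" using c k0_pos by simp
    ultimately show ?thesis unfolding B1_def by (simp only: pos_le_divide_eq)
  qed
  have B1_nonneg: "B1 \<ge> 0" by (rule order_trans[OF l2_sq_nonneg wB[of 0]])
  have vB: "l2_sq ?M (v (r2 j)) \<le> 2 + 2 * B1" for j
  proof -
    have "l2_sq ?M (v (r2 j)) \<le> 2 * l2_sq ?M (\<lambda>x. v (r2 j) x - w (r2 j) x) + 2 * l2_sq ?M (w (r2 j))"
      by (rule l2_sq_le_double[OF v_si w_si])
    also have "l2_sq ?M (\<lambda>x. v (r2 j) x - w (r2 j) x) = l2_sq ?M (u (r2 j))"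
      unfolding u_def[abs_def] by (rule l2_sq_diff_commute)
    also have "2 * l2_sq ?M (u (r2 j)) + 2 * l2_sq ?M (w (r2 j)) \<le> 2 * 1 + 2 * B1"
      by (intro add_mono mult_left_mono le_1 wB) auto
    finally show ?thesis by simp
  qed
  define L where "L = 2 * K\<^sup>2 * (C + 1) * (1 + K\<^sup>2) + 2 * K ^ 4"
  have L: "l2_sq ?M (weak_laplacian D (u j)) \<le> L" for j
    unfolding L_def
    by (rule order_trans[OF laplacian_bound]) (use C K2 in \<open>intro add_mono mult_mono; simp\<close>)
  have L_nonneg: "L \<ge> 0" by (rule order_trans[OF l2_sq_nonneg L[of 0]])
  define \<delta> where "\<delta> j = inverse (real (Suc j))" for j
  have \<delta>: "\<delta> j > 0" "\<delta> j \<le> 1" "\<delta> \<longlonglongrightarrow> 0" for j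
    using LIMSEQ_inverse_real_of_nat by (auto simp: \<delta>_def[abs_def] field_simps)
  have ex: "\<exists>\<phi>. \<phi> \<in> test_functions D \<and> l2_sq ?M (\<lambda>x. \<phi> x - u (r2 j) x) < \<delta> j \<and>
    (\<forall>i. l2_sq ?M (\<lambda>x. partial_deriv i \<phi> x - weak_deriv D [i] (u (r2 j)) x) < \<delta> j) \<and>
    l2_sq ?M (\<lambda>x. laplacian \<phi> x - weak_laplacian D (u (r2 j)) x) < \<delta> j" for j
  proof (rule eigen_setting.test_function_close[OF E[of "r2 j"] sigma c con[of "r2 j"] nrm[of "r2 j"] \<delta>(1)[of j], unfolded U])
    fix \<phi> assume "\<phi> \<in> test_functions D" "l2_sq ?M (\<lambda>x. \<phi> x - u (r2 j) x) < \<delta> j"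
      "\<And>i. l2_sq ?M (\<lambda>x. partial_deriv i \<phi> x - weak_deriv D [i] (u (r2 j)) x) < \<delta> j"
      "l2_sq ?M (\<lambda>x. laplacian \<phi> x - weak_laplacian D (u (r2 j)) x) < \<delta> j"
    then show ?thesis by (intro exI[of _ \<phi>] conjI allI)
  qed
  have ex': "\<forall>j. \<exists>\<phi>. \<phi> \<in> test_functions D \<and> l2_sq ?M (\<lambda>x. \<phi> x - u (r2 j) x) < \<delta> j \<and>
    (\<forall>i. l2_sq ?M (\<lambda>x. partial_deriv i \<phi> x - weak_deriv D [i] (u (r2 j)) x) < \<delta> j) \<and>
    l2_sq ?M (\<lambda>x. laplacian \<phi> x - weak_laplacian D (u (r2 j)) x) < \<delta> j"
    by (intro allI ex)
  obtain \<phi> where \<phi>_all: "\<forall>j. \<phi> j \<in> test_functions D \<and> l2_sq ?M (\<lambda>x. \<phi> j x - u (r2 j) x) < \<delta> j \<and>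
    (\<forall>i. l2_sq ?M (\<lambda>x. partial_deriv i (\<phi> j) x - weak_deriv D [i] (u (r2 j)) x) < \<delta> j) \<and>
    l2_sq ?M (\<lambda>x. laplacian (\<phi> j) x - weak_laplacian D (u (r2 j)) x) < \<delta> j"
    using choice[OF ex'] by (elim exE)
  have \<phi>: "\<phi> j \<in> test_functions D"
    and \<phi>0: "l2_sq ?M (\<lambda>x. \<phi> j x - u (r2 j) x) < \<delta> j"
    and \<phi>1: "l2_sq ?M (\<lambda>x. partial_deriv i (\<phi> j) x - weak_deriv D [i] (u (r2 j)) x) < \<delta> j"
    and \<phi>2: "l2_sq ?M (\<lambda>x. laplacian (\<phi> j) x - weak_laplacian D (u (r2 j)) x) < \<delta> j" for i j
    using \<phi>_all by blast+
  note t0 = test_function_square_integrable[OF D(1) \<phi>]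
    and t1 = test_function_square_integrable[OF D(1) test_functions_partial_deriv[OF \<phi>]]
    and t2 = test_function_square_integrable[OF D(1) test_functions_laplacian[OF \<phi>]]
  have G_le: "l2_sq ?M (weak_deriv D [i] (u j)) \<le> 1" for i j
  proof -
    have "l2_sq ?M (weak_deriv D [i] (u j)) \<le> dirichlet_energy D (u j)"
      unfolding dirichlet_energy_def by (rule member_le_sum) auto
    then show ?thesis using le_1(2)[of j] by linarith
  qed
  have \<phi>0B: "l2_sq ?M (\<phi> j) \<le> 4" for j
    using l2_sq_le_double[OF t0[of j] u_si[of "r2 j"]] \<phi>0[of j] \<delta>(2)[of j] le_1(1)[of "r2 j"] by linarith
  have \<phi>1B: "l2_sq ?M (partial_deriv i (\<phi> j)) \<le> 4" for i j
    using l2_sq_le_double[OF t1[of i j] G_si[of i "r2 j"]] \<phi>1[of i j] \<delta>(2)[of j] G_le[of i "r2 j"] by linarith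
  have \<phi>2B: "l2_sq ?M (laplacian (\<phi> j)) \<le> 2 + 2 * L" for j
    using l2_sq_le_double[OF t2[of j] L_si[of "r2 j"]] \<phi>2[of j] \<delta>(2)[of j] L[of "r2 j"] by linarith
  have \<phi>ijB: "l2_sq ?M (partial_deriv i (partial_deriv i' (\<phi> j))) \<le> 2 + 2 * L" for i i' j
    using second_derivative_estimate[OF \<phi>, of i i' j] \<phi>2B[of j]
    by (simp add: l2_sq_test_function[OF D(1) test_functions_laplacian[OF \<phi>]]
        l2_sq_test_function[OF D(1) test_functions_partial_deriv[OF test_functions_partial_deriv[OF \<phi>]]])
  define B where "B = 6 + 2 * B1 + 2 * L"
  have multi: "l2_sq ?M (iter_partial (multi_index p) (\<phi> j)) \<le> B" for p j
    using multi_index_cases[of p]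
  proof (elim disjE exE)
    assume "multi_index p = []"
    then show ?thesis using \<phi>0B[of j] B1_nonneg L_nonneg by (simp add: B_def)
  next
    fix i assume "multi_index p = [i]"
    then show ?thesis using \<phi>1B[of i j] B1_nonneg L_nonneg by (simp add: B_def)
  next
    fix i i' assume "multi_index p = [i, i']"
    then show ?thesis using \<phi>ijB[of i i' j] B1_nonneg L_nonneg by (simp add: B_def)
  qed
  have wB': "l2_sq ?M (w (r2 j)) \<le> B" and vB': "l2_sq ?M (v (r2 j)) \<le> B" for j
    using wB[of j] vB[of j] B1_nonneg L_nonneg unfolding B_def by linarith+
  have cl: "(\<lambda>j. l2_sq ?M (\<lambda>x. \<phi> j x - (w (r2 j) x - v (r2 j) x))) \<longlonglongrightarrow> 0"
  proof (rule tendsto_sandwich[OF _ _ tendsto_const \<delta>(3)])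
    show "\<forall>\<^sub>F j in sequentially. l2_sq ?M (\<lambda>x. \<phi> j x - (w (r2 j) x - v (r2 j) x)) \<le> \<delta> j"
      using \<phi>0 by (intro always_eventually allI less_imp_le) (simp add: u_def)
  qed simp
  obtain r w0 v0 where r: "strict_mono (r::nat\<Rightarrow>nat)" and w0: "square_integrable ?M w0" and v0: "square_integrable ?M v0"
    and wi: "\<And>g. square_integrable ?M g \<Longrightarrow> (\<lambda>j. LINT x|?M. w (r2 (r j)) x * g x) \<longlonglongrightarrow> (LINT x|?M. w0 x * g x)"
    and vi: "\<And>g. square_integrable ?M g \<Longrightarrow> (\<lambda>j. LINT x|?M. v (r2 (r j)) x * g x) \<longlonglongrightarrow> (LINT x|?M. v0 x * g x)"
    and \<phi>i: "\<And>g. square_integrable ?M g \<Longrightarrow> (\<lambda>j. LINT x|?M. \<phi> (r j) x * g x) \<longlonglongrightarrow> (LINT x|?M. (w0 x - v0 x) * g x)"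
    and sob: "(\<lambda>x. w0 x - v0 x) \<in> sobolev0 2 D"
    by (rule H20_weak_compactness[of D "\<lambda>j. w (r2 j)" B "\<lambda>j. v (r2 j)" \<phi>, OF DD w_si wB' v_si vB' \<phi> multi cl])
      (rule that)
  define \<rho> where "\<rho> j = r2 (r j)" for j
  have \<rho>: "strict_mono \<rho>" using r r2 by (auto simp: \<rho>_def strict_mono_def)
  have k_\<rho>: "(\<lambda>j. k (\<rho> j)) \<longlonglongrightarrow> k0"
    using LIMSEQ_subseq_LIMSEQ[OF k_r2 r] by (simp add: o_def \<rho>_def)
  have eps_\<rho>: "(\<lambda>j. \<epsilon> (\<rho> j)) \<longlonglongrightarrow> 0"
    using LIMSEQ_subseq_LIMSEQ[OF eps(2) \<rho>] by (simp add: o_def)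
  have weak: "weakly_converges D (\<lambda>j. (w (\<rho> j), v (\<rho> j))) (w0, v0)"
    unfolding weakly_converges_def L2_inner_def fst_conv snd_conv \<rho>_def
    by (intro ballI tendsto_add wi vi square_integrable_cnj) (simp_all add: L2_iff)
  have hv0: "helmholtz D (\<lambda>x. k0\<^sup>2) v0"
    unfolding helmholtz_def
  proof
    fix \<psi> assume \<psi>: "\<psi> \<in> test_functions D"
    note t = test_function_square_integrable[OF D(1) \<psi>] test_function_square_integrable[OF D(1) test_functions_laplacian[OF \<psi>]]
    have "(\<lambda>j. (LINT x|?M. v (\<rho> j) x * laplacian \<psi> x) + of_real ((k (\<rho> j))\<^sup>2) * (LINT x|?M. v (\<rho> j) x * \<psi> x))
        \<longlonglongrightarrow> (LINT x|?M. v0 x * laplacian \<psi> x) + of_real (k0\<^sup>2) * (LINT x|?M. v0 x * \<psi> x)"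
      unfolding \<rho>_def by (intro tendsto_intros vi t k_\<rho>[unfolded \<rho>_def])
    moreover have "(LINT x|?M. v (\<rho> j) x * laplacian \<psi> x) + of_real ((k (\<rho> j))\<^sup>2) * (LINT x|?M. v (\<rho> j) x * \<psi> x) = 0" for j
      using eigen_setting.hv[OF E, of "\<rho> j"] \<psi> unfolding helmholtz_def by (simp add: mult.assoc)
    ultimately have "(LINT x|?M. v0 x * laplacian \<psi> x) + of_real (k0\<^sup>2) * (LINT x|?M. v0 x * \<psi> x) = 0"
      by (simp add: LIMSEQ_const_iff)
    then show "(LINT x|?M. v0 x * laplacian \<psi> x) + (LINT x|?M. of_real (k0\<^sup>2) * v0 x * \<psi> x) = 0"
      by (simp add: mult.assoc)
  qed
  \<comment> \<open>The oscillating coefficient is replaced by its mean in the limit.\<close>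
  have hw0: "helmholtz D (\<lambda>x. k0\<^sup>2 * cell_mean n) w0"
    unfolding helmholtz_def
  proof
    fix \<psi> assume \<psi>: "\<psi> \<in> test_functions D"
    note t = test_function_square_integrable[OF D(1) \<psi>] test_function_square_integrable[OF D(1) test_functions_laplacian[OF \<psi>]]
    let ?A = "\<lambda>j. LINT x|?M. of_real (n (x /\<^sub>R \<epsilon> (\<rho> j))) * w (\<rho> j) x * \<psi> x"
    let ?m = "complex_of_real (cell_mean n)"
    have hom: "(\<lambda>j. ?A j - ?m * (LINT x|?M. w (\<rho> j) x * \<psi> x)) \<longlonglongrightarrow> 0"
      by (rule homogenization_limit[OF DD _ eps_\<rho> n(1) per nC C, where k="\<lambda>j. k (\<rho> j)" and K="K\<^sup>2" and B=B])
        (use eps(1) w_si wB' K2 eigen_setting.hw[OF E] \<psi> in \<open>auto simp: \<rho>_def\<close>)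
    have "(\<lambda>j. (?A j - ?m * (LINT x|?M. w (\<rho> j) x * \<psi> x)) + ?m * (LINT x|?M. w (\<rho> j) x * \<psi> x)) \<longlonglongrightarrow> 0 + ?m * (LINT x|?M. w0 x * \<psi> x)"
      using hom by (intro tendsto_intros) (auto simp: \<rho>_def intro: wi t)
    then have A: "?A \<longlonglongrightarrow> ?m * (LINT x|?M. w0 x * \<psi> x)" by simp
    have "(\<lambda>j. (LINT x|?M. w (\<rho> j) x * laplacian \<psi> x) + of_real ((k (\<rho> j))\<^sup>2) * ?A j)
        \<longlonglongrightarrow> (LINT x|?M. w0 x * laplacian \<psi> x) + of_real (k0\<^sup>2) * (?m * (LINT x|?M. w0 x * \<psi> x))"
      by (intro tendsto_add tendsto_mult A tendsto_of_real tendsto_power k_\<rho>) (simp add: \<rho>_def wi t)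
    moreover have "(LINT x|?M. w (\<rho> j) x * laplacian \<psi> x) + of_real ((k (\<rho> j))\<^sup>2) * ?A j = 0" for j
      using eigen_setting.hw[OF E, of "\<rho> j"] \<psi> unfolding helmholtz_def by (simp add: mult.assoc)
    ultimately have "(LINT x|?M. w0 x * laplacian \<psi> x) + of_real (k0\<^sup>2) * (?m * (LINT x|?M. w0 x * \<psi> x)) = 0"
      by (simp add: LIMSEQ_const_iff)
    then show "(LINT x|?M. w0 x * laplacian \<psi> x) + (LINT x|?M. of_real (k0\<^sup>2 * cell_mean n) * w0 x * \<psi> x) = 0"
      by (simp add: mult.assoc)
  qed
  \<comment> \<open>Otherwise the approximating test functions tend to $0$ weakly, hence strongly, and so do their
    gradients; this is incompatible with the normalization.\<close>
  have nontrivial: "\<not> ((AE x in ?M. w0 x = 0) \<and> (AE x in ?M. v0 x = 0))"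
  proof
    assume z: "(AE x in ?M. w0 x = 0) \<and> (AE x in ?M. v0 x = 0)"
    have zero: "(LINT x|?M. (w0 x - v0 x) * g x) = 0" if g: "square_integrable ?M g" for g
    proof -
      note [measurable] = square_integrable_measurable[OF g] square_integrable_measurable[OF w0] square_integrable_measurable[OF v0]
      have "(LINT x|?M. (w0 x - v0 x) * g x) = (LINT x|?M. 0)"
        by (rule integral_cong_AE) (use z in \<open>auto elim: eventually_elim2\<close>)
      then show ?thesis by simp
    qed
    have "(\<lambda>j. l2_sq lborel (\<phi> (r j))) \<longlonglongrightarrow> 0"
    proof (rule rellich[OF DD \<phi>])
      show "l2_sq lborel (partial_deriv i (\<phi> (r j))) \<le> 4" for i j
        using \<phi>1B[of i "r j"] by (simp add: l2_sq_test_function[OF D(1) test_functions_partial_deriv[OF \<phi>]])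
      fix a b :: "real^'n"
      let ?g = "\<lambda>x. complex_of_real (indicator (cbox a b) x)"
      interpret fm: finite_measure ?M by (rule finite_measure_lebesgue_on[OF D(2) Dm])
      have gm: "?g \<in> borel_measurable ?M"
      proof (rule measurable_restrict_space1, rule measurable_completion)
        show "?g \<in> borel_measurable lborel" by measurable
      qed
      have one: "square_integrable ?M (\<lambda>x. 1 :: complex)" by (simp add: square_integrable_def)
      have g: "square_integrable ?M ?g"
        by (rule square_integrable_bound[OF gm one]) (simp add: indicator_def)
      have e: "(\<integral>x. indicator (cbox a b) x *\<^sub>R \<phi> j x \<partial>lborel) = (LINT x|?M. \<phi> j x * ?g x)" for j
      proof -
        have [measurable]: "\<phi> j \<in> borel_measurable borel" by (rule test_function_measurable[OF \<phi>])
        have "(LINT x|?M. \<phi> j x * ?g x) = (LINT x|lborel. \<phi> j x * ?g x)"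
          by (rule integral_lebesgue_on_eq_lborel(1)[OF Dm]) (use test_function_outside[OF \<phi>] in auto)
        then show ?thesis by (simp add: scaleR_conv_of_real mult.commute)
      qed
      show "(\<lambda>j. \<integral>x. indicator (cbox a b) x *\<^sub>R \<phi> (r j) x \<partial>lborel) \<longlonglongrightarrow> 0"
        unfolding e using \<phi>i[OF g] zero[OF g] by simp
    qed
    then have s0: "(\<lambda>j. l2_sq ?M (\<phi> (r j))) \<longlonglongrightarrow> 0" by (simp add: l2_sq_test_function[OF D(1) \<phi>])
    have \<delta>r: "(\<lambda>j. \<delta> (r j)) \<longlonglongrightarrow> 0" using LIMSEQ_subseq_LIMSEQ[OF \<delta>(3) r] by (simp add: o_def)
    define d where "d = real CARD('n)"
    let ?S = "\<lambda>j. \<Sum>i\<in>UNIV. l2_sq ?M (partial_deriv i (\<phi> j))"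
    have S: "?S j \<le> sqrt (l2_sq ?M (\<phi> j)) * sqrt (2 + 2 * L)" for j
    proof -
      have "complex_of_real (?S j) = - (LINT x|lborel. \<phi> j x * cnj (laplacian (\<phi> j) x))"
        by (simp add: gradient_energy[OF \<phi>] l2_sq_test_function[OF D(1) test_functions_partial_deriv[OF \<phi>]])
      then have "norm (complex_of_real (?S j)) = norm (LINT x|lborel. \<phi> j x * cnj (laplacian (\<phi> j) x))"
        by (simp only: norm_minus_cancel)
      moreover have "0 \<le> ?S j" by (intro sum_nonneg) auto
      ultimately have "?S j = norm (LINT x|lborel. \<phi> j x * cnj (laplacian (\<phi> j) x))"
        by (simp only: norm_of_real abs_of_nonneg)
      also have "\<dots> \<le> sqrt (l2_sq lborel (\<phi> j)) * sqrt (l2_sq lborel (\<lambda>x. cnj (laplacian (\<phi> j) x)))"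
        by (intro integral_mult_bound compactly_supported_square_integrable compactly_supported_test_function[OF \<phi>]
            compactly_supported_test_function[OF test_functions_cnj[OF test_functions_laplacian[OF \<phi>]]])
      also have "\<dots> \<le> sqrt (l2_sq ?M (\<phi> j)) * sqrt (2 + 2 * L)"
        unfolding l2_sq_cnj l2_sq_test_function[OF D(1) \<phi>, symmetric]
          l2_sq_test_function[OF D(1) test_functions_laplacian[OF \<phi>], symmetric]
        by (intro mult_left_mono real_sqrt_le_mono \<phi>2B) simp
      finally show ?thesis .
    qed
    let ?T = "\<lambda>j. 2 * \<delta> j + 2 * l2_sq ?M (\<phi> j) + (2 * d * \<delta> j + 2 * (sqrt (l2_sq ?M (\<phi> j)) * sqrt (2 + 2 * L)))"
    have one: "1 \<le> ?T j" for j
    proof -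
      have 1: "l2_sq ?M (u (r2 j)) \<le> 2 * \<delta> j + 2 * l2_sq ?M (\<phi> j)"
        using l2_sq_le_double[OF u_si[of "r2 j"] t0[of j]] \<phi>0[of j] l2_sq_diff_commute[of ?M "u (r2 j)" "\<phi> j"] by linarith
      have "dirichlet_energy D (u (r2 j)) \<le> (\<Sum>i\<in>UNIV. 2 * \<delta> j + 2 * l2_sq ?M (partial_deriv i (\<phi> j)))"
        unfolding dirichlet_energy_def
      proof (rule sum_mono)
        fix i
        show "l2_sq ?M (weak_deriv D [i] (u (r2 j))) \<le> 2 * \<delta> j + 2 * l2_sq ?M (partial_deriv i (\<phi> j))"
          using l2_sq_le_double[OF G_si[of i "r2 j"] t1[of i j]] \<phi>1[of i j]
            l2_sq_diff_commute[of ?M "weak_deriv D [i] (u (r2 j))" "partial_deriv i (\<phi> j)"] by linarith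
      qed
      also have "\<dots> = 2 * d * \<delta> j + 2 * ?S j"
        by (simp add: sum.distrib d_def sum_distrib_left mult_ac)
      finally show ?thesis using 1 S[of j] norm_split[of "r2 j"] by linarith
    qed
    have "(\<lambda>j. ?T (r j)) \<longlonglongrightarrow> 2 * 0 + 2 * 0 + (2 * d * 0 + 2 * (sqrt 0 * sqrt (2 + 2 * L)))"
      by (intro tendsto_intros \<delta>r s0)
    then have "(\<lambda>j. ?T (r j)) \<longlonglongrightarrow> 0" by simp
    from LIMSEQ_le_const[OF this, of 1] one have "(1::real) \<le> 0" by blast
    then show False by simp
  qed
  have "transmission_eigenpair D (\<lambda>x. cell_mean n) k0 (w0, v0)"
    unfolding transmission_eigenpair_def using k0_pos w0 v0 hv0 hw0 nontrivial sob by (simp add: L2_iff)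
  with \<rho> weak k_\<rho> show ?thesis by blast
qed

end
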